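(* $K_0(\mathbf{\Pi},\vee)$, endowed with the product $M\cdot N:=\mathrm{Ind}_{n,m}\,M\otimes N$ (for $M\in K_0(\Bbbk\Pi_n,\vee)$, $N\in K_0(\Bbbk\Pi_m,\vee)$) and the coproduct $\Delta^{\odot}(W_A)=\sum_{B\wedge C=A}W_B\otimes W_C$ (for $A\in\Pi_n$, sum over pairs $(B,C)\in\Pi_n\times\Pi_n$), is a bialgebra. Moreover, the linear map $F\colon K_0(\mathbf{\Pi},\vee)\to\mathsf{NCSym}$ given by $F(W_A)=\mathbf{m}_A$ for all $A\in\Pi_n$, $n\ge0$, is an isomorphism of bialgebras, where $\mathsf{NCSym}$ carries its product and its internal comultiplication $\Delta^{\odot}$.
   Context: $\Bbbk$ is a field of characteristic zero. $\Pi_n$ is the set of set partitions of $[n]=\{1,\dots,n\}$ ($\Pi_0$ consists only of the empty set partition), ordered by $A\le B$ iff every part of $A$ is contained in a part of $B$. It is a lattice with meet $\wedge$, join $\vee$, minimal element $\mathbf{0}_n=\{\{1\},\dots,\{n\}\}$, maximal element $\mathbf{1}_n=\{[n]\}$, and Möbius function $\mu$. For $A\in\Pi_n$, $B\in\Pi_m$, the set partition $A|B\in\Pi_{n+m}$ consists of the parts of $A$ together with the parts of $B$ with every element shifted by $n$. $(\Bbbk\Pi_n,\vee)$ is the $\Bbbk$-algebra with basis $\Pi_n$ and product extending $\vee$ bilinearly (unit $\mathbf{0}_n$); it is commutative and semisimple, with primitive orthogonal idempotents $f_A=\sum_{B\ge A}\mu(A,B)B$, $A\in\Pi_n$, and simple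 modules $W_A=\Bbbk\Pi_n\vee f_A$ (left multiplication). $K_0(\Bbbk\Pi_n,\vee)$ is the Grothendieck group of finite dimensional projective modules, regarded as the $\Bbbk$-vector space with basis the isomorphism classes of the modules $W_A$, $A\in\Pi_n$; $K_0(\mathbf{\Pi},\vee)=\bigoplus_{n\ge0}K_0(\Bbbk\Pi_n,\vee)$. For a $(\Bbbk\Pi_n,\vee)$-module $M$ and a $(\Bbbk\Pi_m,\vee)$-module $N$, $\mathrm{Ind}_{n,m}\,M\otimes N=\Bbbk\Pi_{n+m}\otimes_{\Bbbk\Pi_n\otimes\Bbbk\Pi_m}(M\otimes N)$, where $\Bbbk\Pi_n\otimes\Bbbk\Pi_m$ is identified with a subalgebra of $(\Bbbk\Pi_{n+m},\vee)$ via the injective algebra homomorphism $\rho_{n,m}(C\otimes D)=C|D$; this is extended bilinearly to $K_0(\mathbf{\Pi},\vee)$. $\mathsf{NCSym}=\bigoplus_{d\ge0}\mathsf{NCSym}_d$ is the $\Bbbk$-algebra of symmetric functions in noncommutative variables $x_1,x_2,\dots$. The space $\mathsf{NCSym}_d$ has basis $\{\mathbf{m}_A\}_{A\in\Pi_d}$, where $\mathbf{m}_A=\sum x_{i_1}\cdots x_{i_d}$ is the formal sum over all sequences of positive integers such that $i_a=i_b$ iff $a,b$ are in the same part of $A$ (and $\mathbf{m}_\emptyset=1$). The product is, for $A\in\Pi_d$, $B\in\Pi_m$, $\mathbf{m}_A\mathbf{m}_B=\sum_{C\in\Pi_{d+m},\,C\wedge(\mathbf{1}_d|\mathbf{1}_m)=A|B}\mathbf{m}_C$,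 and the internal comultiplication is $\Delta^{\odot}(\mathbf{m}_A)=\sum_{B\wedge C=A}\mathbf{m}_B\otimes\mathbf{m}_C$. With these, $\mathsf{NCSym}$ is a bialgebra. *)

theory Defs
  imports "HOL-Algebra.Algebraic_Closure_Type" "HOL-Algebra.Free_Abelian_Groups"
    "HOL-Algebra.Module" "HOL-Library.Disjoint_Sets"
begin

section \<open>Modules\<close>

text \<open>
  A field of characteristic zero is a type of class \<^class>\<open>field_char_0\<close>, turned into a ring record
  by \<^const>\<open>ring_of_type_algebra\<close>. The record type of modules extends that of rings. For a plain
  module the fields \<open>mult\<close> and \<open>one\<close> carry no information; for an algebra they are its product and
  unit.
\<close>

abbreviation kk :: "'k::field_char_0 ring" where
  "kk \<equiv> ring_of_type_algebra"

definition mod_hom ::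
    "('r, 'm) ring_scheme \<Rightarrow> ('r, 'a, 'x) module_scheme \<Rightarrow> ('r, 'b, 'y) module_scheme \<Rightarrow> ('a \<Rightarrow> 'b) set"
  where "mod_hom R M N = {f \<in> carrier M \<rightarrow> carrier N.
    (\<forall>x\<in>carrier M. \<forall>y\<in>carrier M. f (x \<oplus>\<^bsub>M\<^esub> y) = f x \<oplus>\<^bsub>N\<^esub> f y) \<and>
    (\<forall>r\<in>carrier R. \<forall>x\<in>carrier M. f (r \<odot>\<^bsub>M\<^esub> x) = r \<odot>\<^bsub>N\<^esub> f x)}"

definition mod_iso ::
    "('r, 'm) ring_scheme \<Rightarrow> ('r, 'a, 'x) module_scheme \<Rightarrow> ('r, 'b, 'y) module_scheme \<Rightarrow> bool"
  where "mod_iso R M N \<longleftrightarrow> (\<exists>f\<in>mod_hom R M N. bij_betw f (carrier M) (carrier N))"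

definition ring_as_module :: "('r, 'm) ring_scheme \<Rightarrow> ('r, 'r) module" where
  "ring_as_module R = \<lparr>carrier = carrier R, monoid.mult = monoid.mult R, monoid.one = monoid.one R,
     ring.zero = ring.zero R, ring.add = ring.add R, module.smult = monoid.mult R\<rparr>"

definition with_smult :: "('r, 'a, 'x) module_scheme \<Rightarrow> ('s \<Rightarrow> 'a \<Rightarrow> 'a) \<Rightarrow> ('s, 'a) module" where
  "with_smult M f = \<lparr>carrier = carrier M, monoid.mult = monoid.mult M, monoid.one = monoid.one M,
     ring.zero = ring.zero M, ring.add = ring.add M, module.smult = f\<rparr>"

definition restrict_scalars :: "('s \<Rightarrow> 'r) \<Rightarrow> ('r, 'a, 'x) module_scheme \<Rightarrow> ('s, 'a) module" where
  "restrict_scalars \<phi> M = with_smult M (\<lambda>s x. \<phi> s \<odot>\<^bsub>M\<^esub> x)"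

definition free_module :: "('r, 'm) ring_scheme \<Rightarrow> nat \<Rightarrow> ('r, nat \<Rightarrow> 'r) module" where
  "free_module R d = \<lparr>carrier = {..<d} \<rightarrow>\<^sub>E carrier R,
     monoid.mult = (\<lambda>f g. \<lambda>i\<in>{..<d}. f i \<otimes>\<^bsub>R\<^esub> g i), monoid.one = (\<lambda>i\<in>{..<d}. \<one>\<^bsub>R\<^esub>),
     ring.zero = (\<lambda>i\<in>{..<d}. \<zero>\<^bsub>R\<^esub>), ring.add = (\<lambda>f g. \<lambda>i\<in>{..<d}. f i \<oplus>\<^bsub>R\<^esub> g i),
     module.smult = (\<lambda>r f. \<lambda>i\<in>{..<d}. r \<otimes>\<^bsub>R\<^esub> f i)\<rparr>"

definition fin_gen :: "('r, 'm) ring_scheme \<Rightarrow> ('r, 'a, 'x) module_scheme \<Rightarrow> bool" where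
  "fin_gen R M \<longleftrightarrow> (\<exists>S. finite S \<and> S \<subseteq> carrier M \<and>
     (\<forall>x\<in>carrier M. \<exists>c\<in>S \<rightarrow> carrier R. x = (\<Oplus>\<^bsub>M\<^esub>s\<in>S. c s \<odot>\<^bsub>M\<^esub> s)))"

text \<open>Finitely generated projective: a direct summand, that is a retract, of some \<open>R\<^sup>d\<close>.\<close>

definition fg_projective :: "('r, 'm) ring_scheme \<Rightarrow> ('r, 'a, 'x) module_scheme \<Rightarrow> bool" where
  "fg_projective R P \<longleftrightarrow> module R P \<and>
     (\<exists>d. \<exists>i\<in>mod_hom R P (free_module R d). \<exists>p\<in>mod_hom R (free_module R d) P.
        \<forall>x\<in>carrier P. p (i x) = x)"

definition short_exact :: "('r, 'm) ring_scheme \<Rightarrow> ('r, 'a, 'x) module_scheme \<Rightarrow>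
    ('r, 'b, 'y) module_scheme \<Rightarrow> ('r, 'c, 'z) module_scheme \<Rightarrow> bool" where
  "short_exact R P' P P'' \<longleftrightarrow> (\<exists>f\<in>mod_hom R P' P. \<exists>g\<in>mod_hom R P P''.
     inj_on f (carrier P') \<and> g ` carrier P = carrier P'' \<and>
     f ` carrier P' = {x \<in> carrier P. g x = \<zero>\<^bsub>P''\<^esub>})"

definition is_basis ::
    "('k::field_char_0, 'v, 'x) module_scheme \<Rightarrow> 'i set \<Rightarrow> ('i \<Rightarrow> 'v) \<Rightarrow> bool" where
  "is_basis V I b \<longleftrightarrow> b \<in> I \<rightarrow> carrier V \<and>
     (\<forall>x\<in>carrier V. \<exists>!c. Poly_Mapping.keys c \<subseteq> I \<and>
        x = (\<Oplus>\<^bsub>V\<^esub>i\<in>Poly_Mapping.keys c. Poly_Mapping.lookup c i \<odot>\<^bsub>V\<^esub> b i))"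

text \<open>The linear map with \<open>b i \<mapsto> f i\<close> for \<open>i \<in> I\<close>; meaningful if \<^term>\<open>is_basis V I b\<close>.\<close>

definition linear_extension :: "('k::field_char_0, 'v, 'x) module_scheme \<Rightarrow> 'i set \<Rightarrow> ('i \<Rightarrow> 'v) \<Rightarrow>
    ('k, 'w, 'y) module_scheme \<Rightarrow> ('i \<Rightarrow> 'w) \<Rightarrow> 'v \<Rightarrow> 'w" where
  "linear_extension V I b W f x =
     (let c = (THE c. Poly_Mapping.keys c \<subseteq> I \<and>
                 x = (\<Oplus>\<^bsub>V\<^esub>i\<in>Poly_Mapping.keys c. Poly_Mapping.lookup c i \<odot>\<^bsub>V\<^esub> b i))
      in \<Oplus>\<^bsub>W\<^esub>i\<in>Poly_Mapping.keys c. Poly_Mapping.lookup c i \<odot>\<^bsub>W\<^esub> f i)"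


section \<open>Tensor products\<close>

text \<open>
  For a commutative ring \<open>R\<close>, the group underlying \<open>M \<otimes>\<^sub>R N\<close> is the free abelian group on
  \<open>M \<times> N\<close> modulo the subgroup generated by the bilinearity relations.
\<close>

type_synonym ('a, 'b) tensor = "('a \<times> 'b \<Rightarrow>\<^sub>0 int) set"

definition tensor_rel :: "('r, 'm) ring_scheme \<Rightarrow> ('r, 'a, 'x) module_scheme \<Rightarrow>
    ('r, 'b, 'y) module_scheme \<Rightarrow> ('a, 'b) tensor" where
  "tensor_rel R M N = generate (free_Abelian_group (carrier M \<times> carrier N))
     ({frag_of (x \<oplus>\<^bsub>M\<^esub> x', y) - frag_of (x, y) - frag_of (x', y) | x x' y.
         x \<in> carrier M \<and> x' \<in> carrier M \<and> y \<in> carrier N} \<union>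
      {frag_of (x, y \<oplus>\<^bsub>N\<^esub> y') - frag_of (x, y) - frag_of (x, y') | x y y'.
         x \<in> carrier M \<and> y \<in> carrier N \<and> y' \<in> carrier N} \<union>
      {frag_of (r \<odot>\<^bsub>M\<^esub> x, y) - frag_of (x, r \<odot>\<^bsub>N\<^esub> y) | r x y.
         r \<in> carrier R \<and> x \<in> carrier M \<and> y \<in> carrier N})"

definition tensor_group :: "('r, 'm) ring_scheme \<Rightarrow> ('r, 'a, 'x) module_scheme \<Rightarrow>
    ('r, 'b, 'y) module_scheme \<Rightarrow> ('a, 'b) tensor monoid" where
  "tensor_group R M N = free_Abelian_group (carrier M \<times> carrier N) Mod tensor_rel R M N"

definition pure_tensor :: "('r, 'm) ring_scheme \<Rightarrow> ('r, 'a, 'x) module_scheme \<Rightarrow>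
    ('r, 'b, 'y) module_scheme \<Rightarrow> 'a \<Rightarrow> 'b \<Rightarrow> ('a, 'b) tensor" where
  "pure_tensor R M N a b =
     tensor_rel R M N #>\<^bsub>free_Abelian_group (carrier M \<times> carrier N)\<^esub> frag_of (a, b)"

text \<open>
  The additive map on a tensor product with \<open>a \<otimes> b \<mapsto> f a b\<close>, evaluated on representatives;
  meaningful if \<open>f\<close> is biadditive and balanced, for then the image below is a singleton.
\<close>

definition tensor_lift ::
    "('c, 'm) ring_scheme \<Rightarrow> ('a \<Rightarrow> 'b \<Rightarrow> 'c) \<Rightarrow> ('a, 'b) tensor \<Rightarrow> 'c" where
  "tensor_lift P f T = the_elem
     ((\<lambda>x. finsum P (\<lambda>(a, b). [Poly_Mapping.lookup x (a, b)] \<cdot>\<^bsub>P\<^esub> f a b) (Poly_Mapping.keys x)) ` T)"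

text \<open>
  The additive structure alone comes first, since the remaining operations are lifted into it. If
  \<open>M\<close> and \<open>N\<close> are algebras, \<open>mult\<close> and \<open>one\<close> are those of the tensor product algebra.
\<close>

definition tensor_add :: "('r, 'm) ring_scheme \<Rightarrow> ('r, 'a, 'x) module_scheme \<Rightarrow>
    ('r, 'b, 'y) module_scheme \<Rightarrow> ('a, 'b) tensor ring" where
  "tensor_add R M N = \<lparr>carrier = carrier (tensor_group R M N),
     monoid.mult = undefined, monoid.one = undefined,
     ring.zero = monoid.one (tensor_group R M N), ring.add = monoid.mult (tensor_group R M N)\<rparr>"

definition tensor :: "('r, 'm) ring_scheme \<Rightarrow> ('r, 'a, 'x) module_scheme \<Rightarrow>
    ('r, 'b, 'y) module_scheme \<Rightarrow> ('r, ('a, 'b) tensor) module" where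
  "tensor R M N = \<lparr>carrier = carrier (tensor_add R M N),
     monoid.mult = (\<lambda>S T. tensor_lift (tensor_add R M N)
       (\<lambda>a b. tensor_lift (tensor_add R M N)
          (\<lambda>c d. pure_tensor R M N (a \<otimes>\<^bsub>M\<^esub> c) (b \<otimes>\<^bsub>N\<^esub> d)) T) S),
     monoid.one = pure_tensor R M N \<one>\<^bsub>M\<^esub> \<one>\<^bsub>N\<^esub>,
     ring.zero = ring.zero (tensor_add R M N), ring.add = ring.add (tensor_add R M N),
     module.smult = (\<lambda>r. tensor_lift (tensor_add R M N) (\<lambda>a b. pure_tensor R M N (r \<odot>\<^bsub>M\<^esub> a) b))\<rparr>"

definition tensor_map :: "('r, 'm) ring_scheme \<Rightarrow> ('r, 'c, 'x) module_scheme \<Rightarrow>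
    ('r, 'd, 'y) module_scheme \<Rightarrow> ('a \<Rightarrow> 'c) \<Rightarrow> ('b \<Rightarrow> 'd) \<Rightarrow> ('a, 'b) tensor \<Rightarrow> ('c, 'd) tensor" where
  "tensor_map R M N f g = tensor_lift (tensor R M N) (\<lambda>a b. pure_tensor R M N (f a) (g b))"

text \<open>The canonical map \<open>(L \<otimes> M) \<otimes> N \<rightarrow> L \<otimes> (M \<otimes> N)\<close>.\<close>

definition tensor_assoc :: "('r, 'm) ring_scheme \<Rightarrow> ('r, 'a, 'x) module_scheme \<Rightarrow>
    ('r, 'b, 'y) module_scheme \<Rightarrow> ('r, 'c, 'z) module_scheme \<Rightarrow>
    (('a, 'b) tensor, 'c) tensor \<Rightarrow> ('a, ('b, 'c) tensor) tensor" where
  "tensor_assoc R L M N = tensor_lift (tensor R L (tensor R M N))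
     (\<lambda>t c. tensor_lift (tensor R L (tensor R M N))
        (\<lambda>a b. pure_tensor R L (tensor R M N) a (pure_tensor R M N b c)) t)"


section \<open>Bialgebras\<close>

locale bialgebra = module R A + A?: ring A
    for R :: "('r, 'm) ring_scheme" (structure) and A :: "('r, 'a, 'x) module_scheme" (structure) +
  fixes \<Delta> :: "'a \<Rightarrow> ('a, 'a) tensor" and \<epsilon> :: "'a \<Rightarrow> 'r"
  assumes smult_mult_left:
      "\<lbrakk>r \<in> carrier R; x \<in> carrier A; y \<in> carrier A\<rbrakk> \<Longrightarrow> (r \<odot>\<^bsub>A\<^esub> x) \<otimes>\<^bsub>A\<^esub> y = r \<odot>\<^bsub>A\<^esub> (x \<otimes>\<^bsub>A\<^esub> y)"
    and smult_mult_right: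
      "\<lbrakk>r \<in> carrier R; x \<in> carrier A; y \<in> carrier A\<rbrakk> \<Longrightarrow> x \<otimes>\<^bsub>A\<^esub> (r \<odot>\<^bsub>A\<^esub> y) = r \<odot>\<^bsub>A\<^esub> (x \<otimes>\<^bsub>A\<^esub> y)"
    and comult_linear: "\<Delta> \<in> mod_hom R A (tensor R A A)"
    and counit_linear: "\<epsilon> \<in> mod_hom R A (ring_as_module R)"
    and coassoc: "x \<in> carrier A \<Longrightarrow>
      tensor_assoc R A A A (tensor_map R (tensor R A A) A \<Delta> (\<lambda>a. a) (\<Delta> x)) =
      tensor_map R A (tensor R A A) (\<lambda>a. a) \<Delta> (\<Delta> x)"
    and counit_left: "x \<in> carrier A \<Longrightarrow> tensor_lift A (\<lambda>a b. \<epsilon> a \<odot>\<^bsub>A\<^esub> b) (\<Delta> x) = x"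
    and counit_right: "x \<in> carrier A \<Longrightarrow> tensor_lift A (\<lambda>a b. \<epsilon> b \<odot>\<^bsub>A\<^esub> a) (\<Delta> x) = x"
    and comult_mult: "\<lbrakk>x \<in> carrier A; y \<in> carrier A\<rbrakk> \<Longrightarrow>
      \<Delta> (x \<otimes>\<^bsub>A\<^esub> y) = \<Delta> x \<otimes>\<^bsub>tensor R A A\<^esub> \<Delta> y"
    and comult_one: "\<Delta> \<one>\<^bsub>A\<^esub> = \<one>\<^bsub>tensor R A A\<^esub>"
    and counit_mult: "\<lbrakk>x \<in> carrier A; y \<in> carrier A\<rbrakk> \<Longrightarrow> \<epsilon> (x \<otimes>\<^bsub>A\<^esub> y) = \<epsilon> x \<otimes>\<^bsub>R\<^esub> \<epsilon> y"
    and counit_one: "\<epsilon> \<one>\<^bsub>A\<^esub> = \<one>\<^bsub>R\<^esub>"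

definition bialgebra_iso :: "('r, 'm) ring_scheme \<Rightarrow>
    ('r, 'a, 'x) module_scheme \<Rightarrow> ('a \<Rightarrow> ('a, 'a) tensor) \<Rightarrow> ('a \<Rightarrow> 'r) \<Rightarrow>
    ('r, 'b, 'y) module_scheme \<Rightarrow> ('b \<Rightarrow> ('b, 'b) tensor) \<Rightarrow> ('b \<Rightarrow> 'r) \<Rightarrow> ('a \<Rightarrow> 'b) \<Rightarrow> bool" where
  "bialgebra_iso R A \<Delta> \<epsilon> B \<Delta>' \<epsilon>' F \<longleftrightarrow>
     bialgebra R A \<Delta> \<epsilon> \<and> bialgebra R B \<Delta>' \<epsilon>' \<and>
     F \<in> mod_hom R A B \<and> bij_betw F (carrier A) (carrier B) \<and>
     (\<forall>x\<in>carrier A. \<forall>y\<in>carrier A. F (x \<otimes>\<^bsub>A\<^esub> y) = F x \<otimes>\<^bsub>B\<^esub> F y) \<and> F \<one>\<^bsub>A\<^esub> = \<one>\<^bsub>B\<^esub> \<and>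
     (\<forall>x\<in>carrier A. \<Delta>' (F x) = tensor_map R B B F F (\<Delta> x)) \<and>
     (\<forall>x\<in>carrier A. \<epsilon>' (F x) = \<epsilon> x)"


section \<open>The lattice of set partitions\<close>

definition set_partitions :: "nat \<Rightarrow> nat set set set" where
  "set_partitions n = {A. partition_on {1..n} A}"

definition partition_lattice :: "nat \<Rightarrow> nat set set gorder" where
  "partition_lattice n = \<lparr>carrier = set_partitions n, eq = (=), le = refines {1..n}\<rparr>"

definition bot_partition :: "nat \<Rightarrow> nat set set" where
  "bot_partition n = (\<lambda>i. {i}) ` {1..n}"

text \<open>The empty block is removed for \<open>n = 0\<close>.\<close>

definition top_partition :: "nat \<Rightarrow> nat set set" where
  "top_partition n = {{1..n}} - {{}}"

text \<open>\<open>A|B\<close>, where \<open>A\<close> is a partition of \<open>{1..n}\<close>\<close>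

definition concat_partition :: "nat \<Rightarrow> nat set set \<Rightarrow> nat set set \<Rightarrow> nat set set" where
  "concat_partition n A B = A \<union> (\<lambda>p. (\<lambda>i. n + i) ` p) ` B"

lemma finite_set_partitions: "finite (set_partitions n)"
  unfolding set_partitions_def by (rule finitely_many_partition_on) simp

function mobius :: "nat \<Rightarrow> nat set set \<Rightarrow> nat set set \<Rightarrow> int" where
  "mobius n A B = (if A = B then 1
     else if refines {1..n} A B
       then - (\<Sum>C\<in>{C. refines {1..n} A C \<and> refines {1..n} C B \<and> C \<noteq> B}. mobius n A C)
     else 0)"
  by pat_completeness auto
termination
proof (relation "measure (\<lambda>(n, A, B). card {C. refines {1..n} A C \<and> refines {1..n} C B})", simp)
  fix n :: nat and A B C :: "nat set set"
  assume *: "refines {1..n} A B" "C \<in> {C. refines {1..n} A C \<and> refines {1..n} C B \<and> C \<noteq> B}"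
  have fin: "finite {C. refines {1..n} A C \<and> refines {1..n} C B}"
    by (rule finite_subset[OF _ finite_set_partitions[of n]])
      (auto simp: set_partitions_def refines_def)
  have "\<not> refines {1..n} B C"
    using * refines_asym by blast
  moreover have "refines {1..n} B B"
    using * by (auto simp: refines_def)
  ultimately have "{D. refines {1..n} A D \<and> refines {1..n} D C}
      \<subset> {D. refines {1..n} A D \<and> refines {1..n} D B}"
    using * by (auto intro: refines_trans)
  from psubset_card_mono[OF fin this]
  show "((n, A, C), (n, A, B)) \<in> measure (\<lambda>(n, A, B). card {C. refines {1..n} A C \<and> refines {1..n} C B})"
    by simp
qed

declare mobius.simps [simp del]

text \<open>\<open>\<Union>n. \<Pi>\<^sub>n\<close> as a disjoint union, the index set of the bases \<open>W\<^sub>A\<close> and \<open>m\<^sub>A\<close>\<close>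

definition graded_partitions :: "(nat \<times> nat set set) set" where
  "graded_partitions = (SIGMA n:UNIV. set_partitions n)"


section \<open>The join algebra and its modules\<close>

type_synonym 'k part_vec = "nat set set \<Rightarrow>\<^sub>0 'k"

definition join_algebra :: "nat \<Rightarrow> 'k::field_char_0 part_vec ring" where
  "join_algebra n = \<lparr>carrier = {x. Poly_Mapping.keys x \<subseteq> set_partitions n},
     monoid.mult = (\<lambda>x y. \<Sum>A\<in>Poly_Mapping.keys x. \<Sum>B\<in>Poly_Mapping.keys y.
       Poly_Mapping.single (A \<squnion>\<^bsub>partition_lattice n\<^esub> B)
         (Poly_Mapping.lookup x A * Poly_Mapping.lookup y B)),
     monoid.one = Poly_Mapping.single (bot_partition n) 1, ring.zero = 0, ring.add = (+)\<rparr>"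

text \<open>The structure map \<open>\<k> \<rightarrow> \<k>\<Pi>\<^sub>n\<close>\<close>

definition scalar :: "nat \<Rightarrow> 'k::field_char_0 \<Rightarrow> 'k part_vec" where
  "scalar n c = Poly_Mapping.single (bot_partition n) c"

abbreviation over_field ::
    "nat \<Rightarrow> ('k::field_char_0 part_vec, 'a, 'x) module_scheme \<Rightarrow> ('k, 'a) module" where
  "over_field n M \<equiv> restrict_scalars (scalar n) M"

definition primitive_idem :: "nat \<Rightarrow> nat set set \<Rightarrow> 'k::field_char_0 part_vec" where
  "primitive_idem n A = (\<Sum>B\<in>{B. refines {1..n} A B}. Poly_Mapping.single B (of_int (mobius n A B)))"

definition W_module :: "nat \<Rightarrow> nat set set \<Rightarrow> ('k::field_char_0 part_vec, 'k part_vec) module" where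
  "W_module n A = (ring_as_module (join_algebra n))
     \<lparr>carrier := (\<lambda>x. x \<otimes>\<^bsub>join_algebra n\<^esub> primitive_idem n A) ` carrier (join_algebra n)\<rparr>"

definition fd_projective :: "nat \<Rightarrow> ('k::field_char_0 part_vec, 'a, 'x) module_scheme \<Rightarrow> bool" where
  "fd_projective n P \<longleftrightarrow> fg_projective (join_algebra n) P \<and> fin_gen kk (over_field n P)"


section \<open>Induction\<close>

text \<open>The algebra \<open>\<k>\<Pi>\<^sub>n \<otimes> \<k>\<Pi>\<^sub>m\<close>\<close>

definition join_algebra2 :: "nat \<Rightarrow> nat \<Rightarrow>
    ('k::field_char_0, ('k part_vec, 'k part_vec) tensor) module" where
  "join_algebra2 n m = tensor kk (over_field n (ring_as_module (join_algebra n)))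
     (over_field m (ring_as_module (join_algebra m)))"

definition rho :: "nat \<Rightarrow> nat \<Rightarrow> ('k::field_char_0 part_vec, 'k part_vec) tensor \<Rightarrow> 'k part_vec" where
  "rho n m = tensor_lift (join_algebra (n + m))
     (\<lambda>x y. \<Sum>C\<in>Poly_Mapping.keys x. \<Sum>D\<in>Poly_Mapping.keys y.
        Poly_Mapping.single (concat_partition n C D)
          (Poly_Mapping.lookup x C * Poly_Mapping.lookup y D))"

text \<open>\<open>M \<otimes> N\<close> as a \<open>\<k>\<Pi>\<^sub>n \<otimes> \<k>\<Pi>\<^sub>m\<close>-module, \<open>(x \<otimes> y)(a \<otimes> b) = xa \<otimes> yb\<close>\<close>

definition outer_tensor :: "nat \<Rightarrow> nat \<Rightarrow>
    ('k::field_char_0 part_vec, 'a, 'x) module_scheme \<Rightarrow> ('k part_vec, 'b, 'y) module_scheme \<Rightarrow>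
    (('k part_vec, 'k part_vec) tensor, ('a, 'b) tensor) module" where
  "outer_tensor n m M N =
     (let M' = over_field n M; N' = over_field m N; T = tensor kk M' N' in
      with_smult T (\<lambda>s t. tensor_lift T (\<lambda>x y. tensor_lift T
        (\<lambda>a b. pure_tensor kk M' N' (x \<odot>\<^bsub>M\<^esub> a) (y \<odot>\<^bsub>N\<^esub> b)) t) s))"

text \<open>
  \<open>\<k>\<Pi>\<^sub>n\<^sub>+\<^sub>m \<otimes> (M \<otimes> N)\<close> over \<open>S = \<k>\<Pi>\<^sub>n \<otimes> \<k>\<Pi>\<^sub>m\<close>, where \<open>S\<close> acts on \<open>\<k>\<Pi>\<^sub>n\<^sub>+\<^sub>m\<close> through \<^const>\<open>rho\<close>
  and \<open>\<k>\<Pi>\<^sub>n\<^sub>+\<^sub>m\<close> acts on the left factor.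
\<close>

definition Ind :: "nat \<Rightarrow> nat \<Rightarrow>
    ('k::field_char_0 part_vec, 'a, 'x) module_scheme \<Rightarrow> ('k part_vec, 'b, 'y) module_scheme \<Rightarrow>
    ('k part_vec, ('k part_vec, ('a, 'b) tensor) tensor) module" where
  "Ind n m M N =
     (let S = join_algebra2 n m;
          Q = restrict_scalars (rho n m) (ring_as_module (join_algebra (n + m)));
          Y = outer_tensor n m M N;
          T = tensor S Q Y
      in with_smult T (\<lambda>r. tensor_lift T
           (\<lambda>q x. pure_tensor S Q Y (r \<otimes>\<^bsub>join_algebra (n + m)\<^esub> q) x)))"


section \<open>The Grothendieck group\<close>

text \<open>
  Every finite dimensional module has an isomorphic copy whose elements are of type \<open>nat \<Rightarrow> 'k\<close>,
  so modules on this type suffice as generators. The direct sum over \<open>n\<close> of the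
  \<open>\<k>\<close>-linear Grothendieck groups is the vector space on all pairs \<open>(n, P)\<close>, with \<open>P\<close> a finite
  dimensional projective \<open>\<k>\<Pi>\<^sub>n\<close>-module, modulo the relations given by short exact sequences.
\<close>

type_synonym 'k std_module = "('k part_vec, nat \<Rightarrow> 'k) module"
type_synonym 'k K0_free = "nat \<times> 'k std_module \<Rightarrow>\<^sub>0 'k"

definition K0_gens :: "(nat \<times> 'k::field_char_0 std_module) set" where
  "K0_gens = {(n, P). fd_projective n P}"

definition K0_rel :: "'k::field_char_0 K0_free set" where
  "K0_rel = Modules.module.span (\<lambda>c. Poly_Mapping.map ((*) c))
     {Poly_Mapping.single (n, P) 1 - Poly_Mapping.single (n, P') 1 - Poly_Mapping.single (n, P'') 1
       | n P P' P''. (n, P) \<in> K0_gens \<and> (n, P') \<in> K0_gens \<and> (n, P'') \<in> K0_gens \<and>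
           short_exact (join_algebra n) P' P P''}"

definition K0_coset :: "'k::field_char_0 K0_free \<Rightarrow> 'k K0_free set" where
  "K0_coset x = (\<lambda>r. r + x) ` K0_rel"

definition std_copy ::
    "nat \<Rightarrow> ('k::field_char_0 part_vec, 'a, 'x) module_scheme \<Rightarrow> 'k std_module" where
  "std_copy n M = (SOME P. (n, P) \<in> K0_gens \<and> mod_iso (join_algebra n) P M)"

definition K0_class ::
    "nat \<Rightarrow> ('k::field_char_0 part_vec, 'a, 'x) module_scheme \<Rightarrow> 'k K0_free set" where
  "K0_class n M = K0_coset (Poly_Mapping.single (n, std_copy n M) 1)"

definition K0_free_mult :: "'k::field_char_0 K0_free \<Rightarrow> 'k K0_free \<Rightarrow> 'k K0_free" where
  "K0_free_mult x y = (\<Sum>(n, M)\<in>Poly_Mapping.keys x. \<Sum>(m, N)\<in>Poly_Mapping.keys y.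
     Poly_Mapping.single (n + m, std_copy (n + m) (Ind n m M N))
       (Poly_Mapping.lookup x (n, M) * Poly_Mapping.lookup y (m, N)))"

text \<open>
  The operations are evaluated on representatives; \<^const>\<open>the_elem\<close> is meaningful because the
  resulting coset does not depend on them.
\<close>

definition K0 :: "('k::field_char_0, 'k K0_free set) module" where
  "K0 = \<lparr>carrier = K0_coset ` {x. Poly_Mapping.keys x \<subseteq> K0_gens},
     monoid.mult = (\<lambda>U V. the_elem ((\<lambda>(x, y). K0_coset (K0_free_mult x y)) ` (U \<times> V))),
     monoid.one = K0_class 0 (W_module 0 {}),
     ring.zero = K0_coset 0,
     ring.add = (\<lambda>U V. the_elem ((\<lambda>(x, y). K0_coset (x + y)) ` (U \<times> V))),
     module.smult = (\<lambda>c U. the_elem ((\<lambda>x. K0_coset (Poly_Mapping.map ((*) c) x)) ` U))\<rparr>"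

definition K0_W :: "nat \<times> nat set set \<Rightarrow> 'k::field_char_0 K0_free set" where
  "K0_W = (\<lambda>(n, A). K0_class n (W_module n A))"


section \<open>Symmetric functions in noncommuting variables\<close>

text \<open>
  A formal series in noncommuting variables \<open>x\<^sub>1, x\<^sub>2, \<dots>\<close> is the function sending a word, that is
  the list of its indices, to its coefficient.
\<close>

type_synonym 'k nc_series = "nat list \<Rightarrow> 'k"

definition monomial_fun :: "nat \<times> nat set set \<Rightarrow> 'k::field_char_0 nc_series" where
  "monomial_fun = (\<lambda>(d, A) w. of_bool (length w = d \<and> 0 \<notin> set w \<and>
     (\<forall>a\<in>{1..d}. \<forall>b\<in>{1..d}. w ! (a - 1) = w ! (b - 1) \<longleftrightarrow> (\<exists>p\<in>A. a \<in> p \<and> b \<in> p))))"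

definition NCSym :: "('k::field_char_0, 'k nc_series) module" where
  "NCSym = \<lparr>carrier = {\<lambda>w. \<Sum>i\<in>Poly_Mapping.keys c. Poly_Mapping.lookup c i * monomial_fun i w | c.
       Poly_Mapping.keys c \<subseteq> graded_partitions},
     monoid.mult = (\<lambda>f g w. \<Sum>i\<le>length w. f (take i w) * g (drop i w)),
     monoid.one = monomial_fun (0, {}),
     ring.zero = (\<lambda>w. 0), ring.add = (\<lambda>f g w. f w + g w), module.smult = (\<lambda>c f w. c * f w)\<rparr>"

text \<open>
  The product of \<^const>\<open>NCSym\<close> is that of formal series. On monomial functions it is given by
  lemma \<open>monomial_fun_mult\<close> below, whose proof describes a partition by the relation of lying in a common
  block.
\<close>

definition same_block :: "nat set set \<Rightarrow> nat \<Rightarrow> nat \<Rightarrow> bool" where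
  "same_block A a b \<longleftrightarrow> (\<exists>p\<in>A. a \<in> p \<and> b \<in> p)"

lemma same_block_in: "\<lbrakk>A \<in> set_partitions n; same_block A a b\<rbrakk> \<Longrightarrow> a \<in> {1..n} \<and> b \<in> {1..n}"
  unfolding set_partitions_def same_block_def partition_on_def by blast

lemma refines_iff_same_block:
  assumes "A \<in> set_partitions n" "B \<in> set_partitions n"
  shows "refines {1..n} A B \<longleftrightarrow> (\<forall>a b. same_block A a b \<longrightarrow> same_block B a b)"
proof
  assume "refines {1..n} A B"
  then show "\<forall>a b. same_block A a b \<longrightarrow> same_block B a b"
    unfolding refines_def same_block_def by blast
next
  assume *: "\<forall>a b. same_block A a b \<longrightarrow> same_block B a b"
  have A: "partition_on {1..n} A" and B: "partition_on {1..n} B"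
    using assms by (auto simp: set_partitions_def)
  have "\<exists>q\<in>B. p \<subseteq> q" if p: "p \<in> A" for p
  proof -
    obtain a where a: "a \<in> p"
      using A p unfolding partition_on_def by (metis ex_in_conv)
    obtain q where q: "q \<in> B" "a \<in> q"
      using *[rule_format, of a a] a p unfolding same_block_def by auto
    have "b \<in> q" if b: "b \<in> p" for b
    proof -
      obtain q' where q': "q' \<in> B" "a \<in> q'" "b \<in> q'"
        using *[rule_format, of a b] a p b unfolding same_block_def by auto
      then have "q' = q"
        using q B partition_onD2[OF B] by (auto simp: disjoint_def)
      then show ?thesis using q' by simp
    qed
    then show ?thesis using q by blast
  qed
  then show "refines {1..n} A B"
    using A B unfolding refines_def by blast
qed

lemma partition_eqI:
  assumes "A \<in> set_partitions n" "B \<in> set_partitions n"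
    and "\<And>a b. same_block A a b \<longleftrightarrow> same_block B a b"
  shows "A = B"
  using assms refines_iff_same_block refines_asym by metis

lemma partition_meet:
  assumes A: "A \<in> set_partitions n" and B: "B \<in> set_partitions n"
  shows "A \<sqinter>\<^bsub>partition_lattice n\<^esub> B \<in> set_partitions n"
    and "same_block (A \<sqinter>\<^bsub>partition_lattice n\<^esub> B) a b \<longleftrightarrow> same_block A a b \<and> same_block B a b"
proof -
  let ?L = "partition_lattice n"
  let ?C = "common_refinement {A, B}"
  have parts: "partition_on {1..n} A" "partition_on {1..n} B"
    using assms by (auto simp: set_partitions_def)
  have low: "Lower ?L {A, B} = {D. refines {1..n} D A \<and> refines {1..n} D B}"
    using A B by (auto simp: Lower_def partition_lattice_def set_partitions_def refines_def)
  have C: "?C \<in> set_partitions n"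
    unfolding set_partitions_def using parts by (auto intro: partition_on_common_refinement)
  have CA: "refines {1..n} ?C A" and CB: "refines {1..n} ?C B"
    using parts by (auto intro: refines_common_refinement)
  have max: "refines {1..n} D ?C" if "refines {1..n} D A" "refines {1..n} D B" for D
    by (rule common_refinement_coarsest) (use that parts in \<open>auto simp: refines_def\<close>)
  have "greatest ?L D (Lower ?L {A, B}) \<longleftrightarrow> D = ?C" for D
  proof
    assume "greatest ?L D (Lower ?L {A, B})"
    then have "refines {1..n} D A" "refines {1..n} D B" "refines {1..n} ?C D"
      using CA CB unfolding greatest_def low by (auto simp: partition_lattice_def)
    then show "D = ?C" using max refines_asym by blast
  next
    assume "D = ?C"
    then show "greatest ?L D (Lower ?L {A, B})"
      unfolding greatest_def low using CA CB max C
      by (auto simp: partition_lattice_def set_partitions_def refines_def[of _ _ A])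
  qed
  then have eq: "A \<sqinter>\<^bsub>?L\<^esub> B = ?C"
    unfolding meet_def inf_def by simp
  show "A \<sqinter>\<^bsub>?L\<^esub> B \<in> set_partitions n"
    using C eq by simp
  have "same_block ?C a b" if ab: "same_block A a b" "same_block B a b"
  proof -
    obtain p q where pq: "p \<in> A" "a \<in> p" "b \<in> p" "q \<in> B" "a \<in> q" "b \<in> q"
      using ab unfolding same_block_def by blast
    let ?f = "\<lambda>P. if P = A then p else q"
    have "?f \<in> (\<Pi> P\<in>{A, B}. P)" using pq by simp
    then have "\<Inter> (?f ` {A, B}) \<in> (\<Union>f\<in>(\<Pi> P\<in>{A, B}. P). {\<Inter> (f ` {A, B})})" by blast
    moreover have ab: "a \<in> \<Inter> (?f ` {A, B})" "b \<in> \<Inter> (?f ` {A, B})" using pq by simp_all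
    ultimately have "\<Inter> (?f ` {A, B}) \<in> ?C" unfolding common_refinement by blast
    then show ?thesis unfolding same_block_def using ab by blast
  qed
  moreover have "same_block A a b \<and> same_block B a b" if "same_block ?C a b"
    using that refines_iff_same_block[OF C A] refines_iff_same_block[OF C B] CA CB by blast
  ultimately show "same_block (A \<sqinter>\<^bsub>?L\<^esub> B) a b \<longleftrightarrow> same_block A a b \<and> same_block B a b"
    unfolding eq by blast
qed

lemma concat_partition:
  assumes A: "A \<in> set_partitions d" and B: "B \<in> set_partitions e"
  shows "concat_partition d A B \<in> set_partitions (d + e)"
    and "same_block (concat_partition d A B) a b \<longleftrightarrow>
      same_block A a b \<or> d < a \<and> d < b \<and> same_block B (a - d) (b - d)"
proof -
  let ?s = "(`) (\<lambda>i. d + i)"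
  have pA: "partition_on {1..d} A" and pB: "partition_on {1..e} B"
    using assms by (auto simp: set_partitions_def)
  have "?s ` B - {{}} = ?s ` B"
    using partition_onD3[OF pB] by auto
  then have "partition_on (?s {1..e}) (?s ` B)"
    using partition_on_inj_image[OF pB, of "\<lambda>i. d + i"] by simp
  moreover have "?s {1..e} = {d + 1..d + e}"
    using image_add_atLeastAtMost[of d 1 e] by (simp add: add.commute[of e])
  ultimately have sB: "partition_on {d + 1..d + e} (?s ` B)" by metis
  have "{1..d + e} = {1..d} \<union> {d + 1..d + e}" by auto
  moreover have "\<Union>A \<inter> \<Union>(?s ` B) = {}"
    unfolding partition_onD1[OF pA, symmetric] partition_onD1[OF sB, symmetric] by auto
  then have "disjoint (A \<union> ?s ` B)"
    using partition_onD2[OF pA] partition_onD2[OF sB] by (intro disjoint_union)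
  ultimately show "concat_partition d A B \<in> set_partitions (d + e)"
    using partition_onD1[OF pA] partition_onD1[OF sB] partition_onD3[OF pA] partition_onD3[OF sB]
    unfolding concat_partition_def set_partitions_def partition_on_def by auto
  have "(\<exists>p\<in>?s ` B. a \<in> p \<and> b \<in> p) \<longleftrightarrow> d < a \<and> d < b \<and> same_block B (a - d) (b - d)"
  proof
    assume "\<exists>p\<in>?s ` B. a \<in> p \<and> b \<in> p"
    then obtain q i j where q: "q \<in> B" "i \<in> q" "j \<in> q" "a = d + i" "b = d + j" by blast
    moreover have "i \<in> {1..e}" "j \<in> {1..e}"
      using q partition_onD1[OF pB] by auto
    ultimately show "d < a \<and> d < b \<and> same_block B (a - d) (b - d)"
      unfolding same_block_def by auto
  next
    assume *: "d < a \<and> d < b \<and> same_block B (a - d) (b - d)"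
    then obtain q where "q \<in> B" "a - d \<in> q" "b - d \<in> q" unfolding same_block_def by blast
    moreover have "a = d + (a - d)" "b = d + (b - d)" using * by auto
    ultimately show "\<exists>p\<in>?s ` B. a \<in> p \<and> b \<in> p" by blast
  qed
  then show "same_block (concat_partition d A B) a b \<longleftrightarrow>
      same_block A a b \<or> d < a \<and> d < b \<and> same_block B (a - d) (b - d)"
    unfolding concat_partition_def same_block_def[of "A \<union> _"] same_block_def[of A] bex_Un by simp
qed

lemma top_partition:
  shows "top_partition d \<in> set_partitions d"
    and "same_block (top_partition d) a b \<longleftrightarrow> a \<in> {1..d} \<and> b \<in> {1..d}"
  by (auto simp: top_partition_def set_partitions_def partition_on_def same_block_def
      pairwise_def)

definition kernel_partition :: "nat list \<Rightarrow> nat set set" where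
  "kernel_partition w =
     (\<lambda>a. {b \<in> {1..length w}. w ! (a - 1) = w ! (b - 1)}) ` {1..length w}"

lemma kernel_partition:
  shows "kernel_partition w \<in> set_partitions (length w)"
    and "same_block (kernel_partition w) a b \<longleftrightarrow>
      a \<in> {1..length w} \<and> b \<in> {1..length w} \<and> w ! (a - 1) = w ! (b - 1)"
proof -
  show "kernel_partition w \<in> set_partitions (length w)"
    unfolding kernel_partition_def set_partitions_def
    by (auto simp: partition_on_def disjoint_def)
  show "same_block (kernel_partition w) a b \<longleftrightarrow>
      a \<in> {1..length w} \<and> b \<in> {1..length w} \<and> w ! (a - 1) = w ! (b - 1)"
    unfolding kernel_partition_def same_block_def by auto
qed

lemma monomial_fun_eq:
  assumes "A \<in> set_partitions d"
  shows "monomial_fun (d, A) w = of_bool (length w = d \<and> 0 \<notin> set w \<and> A = kernel_partition w)"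
proof -
  have "(\<forall>a\<in>{1..d}. \<forall>b\<in>{1..d}. w ! (a - 1) = w ! (b - 1) \<longleftrightarrow> same_block A a b)
      \<longleftrightarrow> A = kernel_partition w" (is "?l \<longleftrightarrow> ?r") if len: "length w = d"
  proof
    assume ?l
    show ?r
    proof (rule partition_eqI[of _ d])
      show "kernel_partition w \<in> set_partitions d"
        using kernel_partition(1)[of w] len by simp
      show "same_block A a b \<longleftrightarrow> same_block (kernel_partition w) a b" for a b
        using \<open>?l\<close> same_block_in[OF assms, of a b] len by (auto simp: kernel_partition(2))
    qed (fact assms)
  next
    assume ?r
    then show ?l using len by (auto simp: kernel_partition(2))
  qed
  then show ?thesis
    unfolding monomial_fun_def same_block_def prod.case by (intro arg_cong[of _ _ of_bool]) blast
qed

lemma monomial_fun_mult: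
  assumes A: "A \<in> set_partitions d" and B: "B \<in> set_partitions e"
  shows "monomial_fun (d, A) \<otimes>\<^bsub>NCSym\<^esub> monomial_fun (e, B) = (\<lambda>w. \<Sum>C\<in>{C \<in> set_partitions (d + e).
      C \<sqinter>\<^bsub>partition_lattice (d + e)\<^esub> concat_partition d (top_partition d) (top_partition e)
        = concat_partition d A B}. (monomial_fun (d + e, C) w :: 'k::field_char_0))"
proof
  fix w
  let ?T = "concat_partition d (top_partition d) (top_partition e)"
  let ?I = "{C \<in> set_partitions (d + e). C \<sqinter>\<^bsub>partition_lattice (d + e)\<^esub> ?T = concat_partition d A B}"
  let ?K = "kernel_partition w"
  let ?P = "length w = d + e \<and> 0 \<notin> set w \<and> A = kernel_partition (take d w)
      \<and> B = kernel_partition (drop d w)"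
  have split: "monomial_fun (d, A) (take i w) * monomial_fun (e, B) (drop i w)
      = (if i = d then of_bool ?P else 0 :: 'k)" if i: "i \<le> length w" for i
  proof (cases "i = d")
    case True
    have "set w = set (take d w) \<union> set (drop d w)"
      by (metis append_take_drop_id set_append)
    then have "(length (take d w) = d \<and> 0 \<notin> set (take d w) \<and> A = kernel_partition (take d w)) \<and>
        (length (drop d w) = e \<and> 0 \<notin> set (drop d w) \<and> B = kernel_partition (drop d w)) \<longleftrightarrow> ?P"
      using i True by (metis UnE UnI1 UnI2 append_take_drop_id length_append length_drop
        diff_add_inverse length_take min.absorb2)
    then show ?thesis
      unfolding True monomial_fun_eq[OF A] monomial_fun_eq[OF B] of_bool_conj[symmetric] by simp
  next
    case False
    then have "length (take i w) \<noteq> d" using i by simp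
    then show ?thesis
      unfolding monomial_fun_eq[OF A] using False by simp
  qed
  have "(monomial_fun (d, A) \<otimes>\<^bsub>NCSym\<^esub> monomial_fun (e, B)) w
      = (\<Sum>i\<le>length w. if i = d then of_bool ?P else 0 :: 'k)"
    unfolding NCSym_def monoid.simps by (intro sum.cong refl split) simp
  also have "\<dots> = of_bool ?P"
  proof -
    have "(\<Sum>i\<le>length w. if i = d then of_bool ?P else 0 :: 'k)
        = (if d \<le> length w then of_bool ?P else 0)"
      by (subst sum.delta) auto
    also have "\<dots> = of_bool ?P" by auto
    finally show ?thesis .
  qed
  also have "?P \<longleftrightarrow> length w = d + e \<and> 0 \<notin> set w \<and> ?K \<in> ?I"
  proof (cases "length w = d + e")
    case True
    note T = concat_partition[OF top_partition(1)[of d] top_partition(1)[of e]]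
    have K: "?K \<in> set_partitions (d + e)"
      using kernel_partition(1)[of w] True by simp
    have Kd: "kernel_partition (take d w) \<in> set_partitions d"
      and Ke: "kernel_partition (drop d w) \<in> set_partitions e"
      using kernel_partition(1)[of "take d w"] kernel_partition(1)[of "drop d w"] True by simp_all
    have eq: "?K \<sqinter>\<^bsub>partition_lattice (d + e)\<^esub> ?T
        = concat_partition d (kernel_partition (take d w)) (kernel_partition (drop d w))"
    proof (rule partition_eqI)
      fix a b
      show "same_block (?K \<sqinter>\<^bsub>partition_lattice (d + e)\<^esub> ?T) a b =
          same_block (concat_partition d (kernel_partition (take d w)) (kernel_partition (drop d w))) a b"
        unfolding partition_meet(2)[OF K T(1)] T(2) concat_partition(2)[OF Kd Ke]
        using True by (auto simp: top_partition(2) kernel_partition(2))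
    qed (use partition_meet(1)[OF K T(1)] concat_partition(1)[OF Kd Ke] in auto)
    have "concat_partition d A B = concat_partition d A' B' \<longleftrightarrow> A = A' \<and> B = B'"
      if A': "A' \<in> set_partitions d" and B': "B' \<in> set_partitions e" for A' B'
    proof
      assume *: "concat_partition d A B = concat_partition d A' B'"
      have **: "same_block A a b \<or> d < a \<and> d < b \<and> same_block B (a - d) (b - d) \<longleftrightarrow>
          same_block A' a b \<or> d < a \<and> d < b \<and> same_block B' (a - d) (b - d)" for a b
        using concat_partition(2)[OF A B, of a b] concat_partition(2)[OF A' B', of a b] * by simp
      have "same_block A a b \<longleftrightarrow> same_block A' a b" for a b
        using **[of a b] same_block_in[OF A, of a b] same_block_in[OF A', of a b] by auto
      moreover have "same_block B a b \<longleftrightarrow> same_block B' a b" for a b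
        using **[of "d + a" "d + b"] same_block_in[OF A, of "d + a" "d + b"]
          same_block_in[OF A', of "d + a" "d + b"] same_block_in[OF B, of a b]
          same_block_in[OF B', of a b] by auto
      ultimately show "A = A' \<and> B = B'"
        using A B A' B' partition_eqI by blast
    qed simp
    from this[OF Kd Ke] show ?thesis
      using True K unfolding mem_Collect_eq eq by metis
  qed simp
  also have "of_bool (length w = d + e \<and> 0 \<notin> set w \<and> ?K \<in> ?I) = (\<Sum>C\<in>?I. monomial_fun (d + e, C) w :: 'k)"
  proof -
    have "(\<Sum>C\<in>?I. monomial_fun (d + e, C) w :: 'k)
        = (\<Sum>C\<in>?I. if C = ?K then of_bool (length w = d + e \<and> 0 \<notin> set w) else 0)"
      by (intro sum.cong) (auto simp: monomial_fun_eq)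
    moreover have "finite ?I" by (simp add: finite_set_partitions)
    ultimately show ?thesis by (simp only: sum.delta') auto
  qed
  finally show "(monomial_fun (d, A) \<otimes>\<^bsub>NCSym\<^esub> monomial_fun (e, B)) w = (\<Sum>C\<in>?I. monomial_fun (d + e, C) w :: 'k)" .
qed


section \<open>The internal coproduct\<close>

text \<open>
  \<open>b\<^sub>A \<mapsto> \<Sum> b\<^sub>B \<otimes> b\<^sub>C\<close> over \<open>B \<and> C = A\<close>, for a space \<open>V\<close> with a basis \<open>b\<close> indexed by
  all set partitions
\<close>

definition internal_coproduct :: "('k::field_char_0, 'v, 'x) module_scheme \<Rightarrow>
    (nat \<times> nat set set \<Rightarrow> 'v) \<Rightarrow> 'v \<Rightarrow> ('v, 'v) tensor" where
  "internal_coproduct V b = linear_extension V graded_partitions b (tensor kk V V)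
     (\<lambda>(n, A). finsum (tensor kk V V) (\<lambda>(B, C). pure_tensor kk V V (b (n, B)) (b (n, C)))
        {(B, C) \<in> set_partitions n \<times> set_partitions n. B \<sqinter>\<^bsub>partition_lattice n\<^esub> C = A})"

definition F_map :: "'k::field_char_0 K0_free set \<Rightarrow> 'k nc_series" where
  "F_map = linear_extension K0 graded_partitions K0_W NCSym monomial_fun"

end

theory Submission
  imports Defs
begin

text \<open>
  Every finite dimensional projective \<open>\<k>\<Pi>\<^sub>n\<close>-module has a basis of simultaneous eigenvectors for the
  characters \<open>\<chi>\<^sub>A(B) = [B \<le> A]\<close>, and \<open>\<k>\<Pi>\<^sub>n \<or> f\<^sub>A\<close> is a line with character \<open>\<chi>\<^sub>A\<close>. Sending a module to the
  sum of \<open>m\<^sub>A\<close> over the characters of such a basis does not depend on the basis and is additive on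
  short exact sequences. Two modules with the same characters are isomorphic, so this map identifies
  \<open>K\<^sub>0\<close> with \<open>NCSym\<close>. It is multiplicative because in an induced module \<open>f\<^sub>C\<close> annihilates \<open>v \<otimes> w\<close>, for
  \<open>v\<close> of character \<open>\<chi>\<^sub>A\<close> and \<open>w\<close> of character \<open>\<chi>\<^sub>B\<close>, unless \<open>C \<and> (1|1) = A|B\<close>, and the remaining
  \<open>f\<^sub>C \<otimes> (v \<otimes> w)\<close> form an eigenbasis. Compatibility of product and coproduct is checked on the basis:
  restricting set partitions to an initial segment and to its complement commutes with meets.
\<close>

section \<open>Modules, sums and bases\<close>

text \<open>Where the condition C \<and> (1|1) = A|B comes from: a partition D|E refines C iff D and
  E refine the two restrictions of C, so along \<open>rho\<close> the character of C becomes the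
  product of the characters of \<open>lo n C\<close> and \<open>hi n C\<close>. By Frobenius
  reciprocity the constituents induced from A and B are the C with these restrictions, and meeting
  with 1|1 does nothing but cut C between n and n + 1.

  That the other f_C annihilate v \<otimes> w is a matter of moving an idempotent across the tensor
  sign. The obstacle is the independence of the survivors, in a tensor product given by generators
  and relations; it is overcome by constructing functionals dual to them with the universal
  property.

  Modules live on many types and the operations of \<open>K0\<close> pass through chosen copies, so
  laws are not checked on representatives. Once the kernel of the characteristic is known to be
  exactly \<open>K0_rel\<close>, each coset is a fibre of it, and every law of \<open>K0\<close> is
  pulled back from \<open>NCSym\<close>.\<close>

lemma kk_simps [simp]:
  "carrier (kk :: 'k::field_char_0 ring) = UNIV" "\<zero>\<^bsub>kk :: 'k ring\<^esub> = 0" "\<one>\<^bsub>kk :: 'k ring\<^esub> = 1"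
  "(x :: 'k) \<oplus>\<^bsub>kk\<^esub> y = x + y" "x \<otimes>\<^bsub>kk\<^esub> y = x * y"
  by (simp_all add: ring_of_type_algebra_def)

lemma cring_kk [simp, intro]: "cring (kk :: 'k::field_char_0 ring)"
  by (rule cring_from_type_algebra)

lemma abelian_group_kk [simp, intro]: "abelian_group (kk :: 'k::field_char_0 ring)"
  using cring.axioms(1)[OF cring_kk] ring.axioms(1) by blast

lemma a_inv_kk [simp]: "\<ominus>\<^bsub>kk :: 'k::field_char_0 ring\<^esub> x = - x"
proof -
  interpret abelian_group "kk :: 'k ring" ..
  show ?thesis by (rule minus_equality) simp_all
qed

context abelian_monoid
begin

text \<open>The set Y may exceed the image of \<pi>: empty fibres contribute zero, so a sum can be
  sorted by values of which only an upper bound is known.\<close>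

lemma finsum_fibres:
  assumes "finite S" "finite Y" "\<pi> ` S \<subseteq> Y" "\<And>x. x \<in> S \<Longrightarrow> g x \<in> carrier G"
  shows "(\<Oplus>y\<in>Y. \<Oplus>x\<in>{x \<in> S. \<pi> x = y}. g x) = finsum G g S"
proof -
  have "(\<Union>y\<in>Y. {x \<in> S. \<pi> x = y}) = S" using assms(3) by auto
  moreover have "finsum G g (\<Union>y\<in>Y. {x \<in> S. \<pi> x = y}) = (\<Oplus>y\<in>Y. \<Oplus>x\<in>{x \<in> S. \<pi> x = y}. g x)"
    using assms by (intro add.finprod_UN_disjoint) (auto simp: pairwise_def disjnt_def)
  ultimately show ?thesis by simp
qed

lemma finsum_Sigma:
  assumes "finite I" "\<And>i. i \<in> I \<Longrightarrow> finite (S i)"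
    and "\<And>i x. i \<in> I \<Longrightarrow> x \<in> S i \<Longrightarrow> f i x \<in> carrier G"
  shows "(\<Oplus>i\<in>I. \<Oplus>x\<in>S i. f i x) = (\<Oplus>p\<in>Sigma I S. f (fst p) (snd p))"
proof -
  have "(\<Oplus>i\<in>I. \<Oplus>x\<in>S i. f i x) = (\<Oplus>i\<in>I. \<Oplus>p\<in>{p \<in> Sigma I S. fst p = i}. f (fst p) (snd p))"
  proof (rule finsum_cong')
    show "(\<lambda>i. \<Oplus>p\<in>{p \<in> Sigma I S. fst p = i}. f (fst p) (snd p)) \<in> I \<rightarrow> carrier G"
      using assms(3) by (auto intro!: finsum_closed)
    fix i assume i: "i \<in> I"
    then have "{p \<in> Sigma I S. fst p = i} = Pair i ` S i" by auto
    then show "(\<Oplus>x\<in>S i. f i x) = (\<Oplus>p\<in>{p \<in> Sigma I S. fst p = i}. f (fst p) (snd p))"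
      unfolding \<open>_ = Pair i ` S i\<close> using assms i by (subst finsum_reindex) (auto simp: inj_on_def)
  qed simp
  also have "\<dots> = (\<Oplus>p\<in>Sigma I S. f (fst p) (snd p))"
    using assms by (intro finsum_fibres) auto
  finally show ?thesis .
qed

end

section \<open>Additive and linear maps\<close>

definition add_hom :: "('a, 'm) ring_scheme \<Rightarrow> ('b, 'n) ring_scheme \<Rightarrow> ('a \<Rightarrow> 'b) set" where
  "add_hom A B = {f \<in> carrier A \<rightarrow> carrier B.
     \<forall>x\<in>carrier A. \<forall>y\<in>carrier A. f (x \<oplus>\<^bsub>A\<^esub> y) = f x \<oplus>\<^bsub>B\<^esub> f y}"

lemma add_homI:
  assumes "\<And>x. x \<in> carrier A \<Longrightarrow> f x \<in> carrier B"
    and "\<And>x y. x \<in> carrier A \<Longrightarrow> y \<in> carrier A \<Longrightarrow> f (x \<oplus>\<^bsub>A\<^esub> y) = f x \<oplus>\<^bsub>B\<^esub> f y"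
  shows "f \<in> add_hom A B"
  using assms by (auto simp: add_hom_def)

lemma add_hom_closed: "f \<in> add_hom A B \<Longrightarrow> x \<in> carrier A \<Longrightarrow> f x \<in> carrier B"
  by (auto simp: add_hom_def)

lemma add_hom_add:
  "f \<in> add_hom A B \<Longrightarrow> x \<in> carrier A \<Longrightarrow> y \<in> carrier A \<Longrightarrow> f (x \<oplus>\<^bsub>A\<^esub> y) = f x \<oplus>\<^bsub>B\<^esub> f y"
  by (auto simp: add_hom_def)

lemma add_hom_zero:
  assumes "f \<in> add_hom A B" "abelian_group A" "abelian_group B"
  shows "f \<zero>\<^bsub>A\<^esub> = \<zero>\<^bsub>B\<^esub>"
proof -
  interpret A: abelian_group A by fact
  interpret B: abelian_group B by fact
  have "f \<zero>\<^bsub>A\<^esub> \<oplus>\<^bsub>B\<^esub> f \<zero>\<^bsub>A\<^esub> = f \<zero>\<^bsub>A\<^esub>"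
    using add_hom_add[OF assms(1), of "\<zero>\<^bsub>A\<^esub>" "\<zero>\<^bsub>A\<^esub>"] by simp
  then show ?thesis using add_hom_closed[OF assms(1) A.zero_closed] by simp
qed

lemma add_hom_neg:
  assumes "f \<in> add_hom A B" "abelian_group A" "abelian_group B" "x \<in> carrier A"
  shows "f (\<ominus>\<^bsub>A\<^esub> x) = \<ominus>\<^bsub>B\<^esub> f x"
proof -
  interpret A: abelian_group A by fact
  interpret B: abelian_group B by fact
  have "f (\<ominus>\<^bsub>A\<^esub> x) \<oplus>\<^bsub>B\<^esub> f x = \<zero>\<^bsub>B\<^esub>"
    using add_hom_add[OF assms(1), of "\<ominus>\<^bsub>A\<^esub> x" x] add_hom_zero[OF assms(1-3)] assms(4)
    by (simp add: A.l_neg)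
  from B.minus_equality[OF this] show ?thesis
    using add_hom_closed[OF assms(1)] assms(4) by simp
qed

lemma add_hom_finsum:
  assumes "f \<in> add_hom A B" "abelian_group A" "abelian_group B"
    and "\<And>i. i \<in> I \<Longrightarrow> g i \<in> carrier A"
  shows "f (\<Oplus>\<^bsub>A\<^esub>i\<in>I. g i) = (\<Oplus>\<^bsub>B\<^esub>i\<in>I. f (g i))"
proof -
  interpret A: abelian_group A by fact
  interpret B: abelian_group B by fact
  show ?thesis using assms(4)
  proof (induction I rule: infinite_finite_induct)
    case (insert i I)
    then show ?case
      using add_hom_add[OF assms(1)] add_hom_closed[OF assms(1)] by (simp add: Pi_def)
  qed (simp_all add: add_hom_zero[OF assms(1-3)])
qed

lemma add_hom_comp: "f \<in> add_hom A B \<Longrightarrow> g \<in> add_hom B C \<Longrightarrow> (\<lambda>x. g (f x)) \<in> add_hom A C"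
  by (simp add: add_hom_def Pi_iff)

lemma mod_hom_add_hom: "f \<in> mod_hom R M N \<Longrightarrow> f \<in> add_hom M N"
  by (simp add: mod_hom_def add_hom_def)

lemma mod_homI:
  assumes "f \<in> add_hom M N"
    and "\<And>r x. r \<in> carrier R \<Longrightarrow> x \<in> carrier M \<Longrightarrow> f (r \<odot>\<^bsub>M\<^esub> x) = r \<odot>\<^bsub>N\<^esub> f x"
  shows "f \<in> mod_hom R M N"
  using assms by (auto simp: mod_hom_def add_hom_def)

lemma mod_hom_smult:
  "f \<in> mod_hom R M N \<Longrightarrow> r \<in> carrier R \<Longrightarrow> x \<in> carrier M \<Longrightarrow> f (r \<odot>\<^bsub>M\<^esub> x) = r \<odot>\<^bsub>N\<^esub> f x"
  by (simp add: mod_hom_def)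

lemma mod_hom_comp: "f \<in> mod_hom R L M \<Longrightarrow> g \<in> mod_hom R M N \<Longrightarrow> (\<lambda>x. g (f x)) \<in> mod_hom R L N"
  by (simp add: mod_hom_def Pi_iff)


section \<open>Tensor products\<close>

definition balanced_map :: "('r, 'm) ring_scheme \<Rightarrow> ('r, 'a, 'x) module_scheme \<Rightarrow>
    ('r, 'b, 'y) module_scheme \<Rightarrow> ('c, 'n) ring_scheme \<Rightarrow> ('a \<Rightarrow> 'b \<Rightarrow> 'c) \<Rightarrow> bool" where
  "balanced_map R M N P f \<longleftrightarrow>
     (\<forall>x\<in>carrier M. \<forall>y\<in>carrier N. f x y \<in> carrier P) \<and>
     (\<forall>x\<in>carrier M. \<forall>x'\<in>carrier M. \<forall>y\<in>carrier N. f (x \<oplus>\<^bsub>M\<^esub> x') y = f x y \<oplus>\<^bsub>P\<^esub> f x' y) \<and>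
     (\<forall>x\<in>carrier M. \<forall>y\<in>carrier N. \<forall>y'\<in>carrier N. f x (y \<oplus>\<^bsub>N\<^esub> y') = f x y \<oplus>\<^bsub>P\<^esub> f x y') \<and>
     (\<forall>r\<in>carrier R. \<forall>x\<in>carrier M. \<forall>y\<in>carrier N. f (r \<odot>\<^bsub>M\<^esub> x) y = f x (r \<odot>\<^bsub>N\<^esub> y))"

lemma balanced_mapI:
  assumes "\<And>x y. x \<in> carrier M \<Longrightarrow> y \<in> carrier N \<Longrightarrow> f x y \<in> carrier P"
    and "\<And>x x' y. \<lbrakk>x \<in> carrier M; x' \<in> carrier M; y \<in> carrier N\<rbrakk> \<Longrightarrow> f (x \<oplus>\<^bsub>M\<^esub> x') y = f x y \<oplus>\<^bsub>P\<^esub> f x' y"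
    and "\<And>x y y'. \<lbrakk>x \<in> carrier M; y \<in> carrier N; y' \<in> carrier N\<rbrakk> \<Longrightarrow> f x (y \<oplus>\<^bsub>N\<^esub> y') = f x y \<oplus>\<^bsub>P\<^esub> f x y'"
    and "\<And>r x y. \<lbrakk>r \<in> carrier R; x \<in> carrier M; y \<in> carrier N\<rbrakk> \<Longrightarrow> f (r \<odot>\<^bsub>M\<^esub> x) y = f x (r \<odot>\<^bsub>N\<^esub> y)"
  shows "balanced_map R M N P f"
  using assms by (simp add: balanced_map_def)

text \<open>A common ground for the two kinds of tensor product in use: over the field, where both
  sides are modules, and over \<open>join_algebra2 n m\<close> in \<open>Ind\<close>, where closure
  under the scalar action is what is at hand. That closure keeps the relations inside the free
  abelian group.\<close>

locale tensor_pair = M: abelian_group M + N: abelian_group N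
  for R :: "('r, 'm) ring_scheme" and M :: "('r, 'a, 'x) module_scheme" and N :: "('r, 'b, 'y) module_scheme" +
  assumes smult_closed_left: "\<lbrakk>r \<in> carrier R; x \<in> carrier M\<rbrakk> \<Longrightarrow> r \<odot>\<^bsub>M\<^esub> x \<in> carrier M"
    and smult_closed_right: "\<lbrakk>r \<in> carrier R; y \<in> carrier N\<rbrakk> \<Longrightarrow> r \<odot>\<^bsub>N\<^esub> y \<in> carrier N"
begin

abbreviation "T \<equiv> tensor R M N"
abbreviation "pure \<equiv> pure_tensor R M N"
abbreviation "FG \<equiv> free_Abelian_group (carrier M \<times> carrier N)"
abbreviation "rel \<equiv> tensor_rel R M N"

lemma carrier_T: "carrier T = (\<lambda>x. rel #>\<^bsub>FG\<^esub> x) ` carrier FG"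
  and add_T: "add T = set_mult FG" and zero_T: "ring.zero T = rel"
  by (simp_all add: tensor_def tensor_add_def tensor_group_def carrier_FactGroup)

lemma carrier_tensor_add: "carrier (tensor_add R M N) = carrier T"
  and add_tensor_add: "add (tensor_add R M N) = add T"
  and zero_tensor_add: "ring.zero (tensor_add R M N) = ring.zero T"
  by (simp_all add: tensor_def)

lemma subgroup_rel: "subgroup rel FG"
  unfolding tensor_rel_def
  by (intro group.generate_is_subgroup group_free_Abelian_group)
    (auto simp: smult_closed_left smult_closed_right keys_frag_of
      dest!: subsetD[OF keys_diff])

lemma comm_group_T: "comm_group (tensor_group R M N)"
  unfolding tensor_group_def
  by (intro comm_group.abelian_FactGroup abelian_free_Abelian_group subgroup_rel)

lemma abelian_group_tensor_add [simp, intro]: "abelian_group (tensor_add R M N)"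
  and abelian_group_T [simp, intro]: "abelian_group T"
proof -
  interpret C: comm_group "tensor_group R M N" by (rule comm_group_T)
  show "abelian_group (tensor_add R M N)" "abelian_group T"
    by (rule abelian_groupI; simp add: tensor_def tensor_add_def C.m_ac C.l_inv_ex)+
qed

sublocale T: abelian_group T by (rule abelian_group_T)

lemma rel_subset: "x \<in> rel \<Longrightarrow> Poly_Mapping.keys x \<subseteq> carrier M \<times> carrier N"
  using subgroup.mem_carrier[OF subgroup_rel] by simp

lemma coset_add:
  assumes "x \<in> carrier FG" "y \<in> carrier FG"
  shows "(rel #>\<^bsub>FG\<^esub> x) \<oplus>\<^bsub>T\<^esub> (rel #>\<^bsub>FG\<^esub> y) = rel #>\<^bsub>FG\<^esub> (x + y)"
proof -
  have "rel \<lhd> FG"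
    using comm_group.normal_iff_subgroup[OF abelian_free_Abelian_group] subgroup_rel by blast
  from normal.rcos_sum[OF this assms] show ?thesis by (simp add: add_T)
qed

lemma coset_eq:
  assumes "x \<in> carrier FG" "y \<in> carrier FG" "x - y \<in> rel"
  shows "rel #>\<^bsub>FG\<^esub> x = rel #>\<^bsub>FG\<^esub> y"
proof -
  have "(x - y) + y \<in> rel #>\<^bsub>FG\<^esub> y"
    using assms(3) unfolding r_coset_def mult_free_Abelian_group by blast
  then show ?thesis
    using group.repr_independence[OF group_free_Abelian_group _ assms(2) subgroup_rel] by simp
qed

lemma pure_closed [simp, intro]: "\<lbrakk>a \<in> carrier M; b \<in> carrier N\<rbrakk> \<Longrightarrow> pure a b \<in> carrier T"
  unfolding pure_tensor_def carrier_T by (intro imageI) simp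

lemma pure_eqI:
  assumes "a \<in> carrier M" "b \<in> carrier N" "x \<in> carrier FG" "frag_of (a, b) - x \<in> rel"
  shows "pure a b = rel #>\<^bsub>FG\<^esub> x"
  unfolding pure_tensor_def using assms by (intro coset_eq) simp_all

lemma pure_add_left:
  assumes "a \<in> carrier M" "a' \<in> carrier M" "b \<in> carrier N"
  shows "pure (a \<oplus>\<^bsub>M\<^esub> a') b = pure a b \<oplus>\<^bsub>T\<^esub> pure a' b"
proof -
  have "frag_of (a \<oplus>\<^bsub>M\<^esub> a', b) - frag_of (a, b) - frag_of (a', b) \<in> rel"
    unfolding tensor_rel_def using assms by (intro generate.incl) blast
  then have "pure (a \<oplus>\<^bsub>M\<^esub> a') b = rel #>\<^bsub>FG\<^esub> (frag_of (a, b) + frag_of (a', b))"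
    using assms by (intro pure_eqI) (auto simp: algebra_simps keys_frag_of intro!: order_trans[OF keys_add])
  then show ?thesis
    using assms by (simp add: pure_tensor_def[of R M N a b] pure_tensor_def[of R M N a' b] coset_add)
qed

lemma pure_add_right:
  assumes "a \<in> carrier M" "b \<in> carrier N" "b' \<in> carrier N"
  shows "pure a (b \<oplus>\<^bsub>N\<^esub> b') = pure a b \<oplus>\<^bsub>T\<^esub> pure a b'"
proof -
  have "frag_of (a, b \<oplus>\<^bsub>N\<^esub> b') - frag_of (a, b) - frag_of (a, b') \<in> rel"
    unfolding tensor_rel_def using assms by (intro generate.incl) blast
  then have "pure a (b \<oplus>\<^bsub>N\<^esub> b') = rel #>\<^bsub>FG\<^esub> (frag_of (a, b) + frag_of (a, b'))"
    using assms by (intro pure_eqI) (auto simp: algebra_simps keys_frag_of intro!: order_trans[OF keys_add])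
  then show ?thesis
    using assms by (simp add: pure_tensor_def[of R M N a b] pure_tensor_def[of R M N a b'] coset_add)
qed

lemma pure_balanced:
  assumes "r \<in> carrier R" "a \<in> carrier M" "b \<in> carrier N"
  shows "pure (r \<odot>\<^bsub>M\<^esub> a) b = pure a (r \<odot>\<^bsub>N\<^esub> b)"
proof -
  have "frag_of (r \<odot>\<^bsub>M\<^esub> a, b) - frag_of (a, r \<odot>\<^bsub>N\<^esub> b) \<in> rel"
    unfolding tensor_rel_def using assms by (intro generate.incl) blast
  then show ?thesis
    unfolding pure_tensor_def[of R M N a "r \<odot>\<^bsub>N\<^esub> b"]
    using assms smult_closed_left smult_closed_right by (intro pure_eqI) auto
qed

lemma pure_hom_left: "b \<in> carrier N \<Longrightarrow> (\<lambda>a. pure a b) \<in> add_hom M T"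
  by (intro add_homI) (simp_all add: pure_add_left)

lemma pure_hom_right: "a \<in> carrier M \<Longrightarrow> (\<lambda>b. pure a b) \<in> add_hom N T"
  by (intro add_homI) (simp_all add: pure_add_right)

lemma pure_zero_left [simp]: "b \<in> carrier N \<Longrightarrow> pure \<zero>\<^bsub>M\<^esub> b = \<zero>\<^bsub>T\<^esub>"
  using add_hom_zero[OF pure_hom_left] M.abelian_group_axioms by blast

lemma pure_zero_right [simp]: "a \<in> carrier M \<Longrightarrow> pure a \<zero>\<^bsub>N\<^esub> = \<zero>\<^bsub>T\<^esub>"
  using add_hom_zero[OF pure_hom_right] N.abelian_group_axioms by blast

lemma pure_finsum_left:
  "(\<And>i. i \<in> I \<Longrightarrow> g i \<in> carrier M) \<Longrightarrow> b \<in> carrier N \<Longrightarrow>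
    pure (\<Oplus>\<^bsub>M\<^esub>i\<in>I. g i) b = (\<Oplus>\<^bsub>T\<^esub>i\<in>I. pure (g i) b)"
  using add_hom_finsum[OF pure_hom_left] M.abelian_group_axioms by blast

lemma pure_finsum_right:
  "(\<And>i. i \<in> I \<Longrightarrow> g i \<in> carrier N) \<Longrightarrow> a \<in> carrier M \<Longrightarrow>
    pure a (\<Oplus>\<^bsub>N\<^esub>i\<in>I. g i) = (\<Oplus>\<^bsub>T\<^esub>i\<in>I. pure a (g i))"
  using add_hom_finsum[OF pure_hom_right] N.abelian_group_axioms by blast

text \<open>Tensors arise from pure ones by sums alone, without a case for negatives, because -(a
  \<otimes> b) = (-a) \<otimes> b.\<close>

lemma tensor_induct [consumes 1, case_names zero pure add]:
  assumes t: "t \<in> carrier T"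
    and zero: "P \<zero>\<^bsub>T\<^esub>"
    and pure: "\<And>a b. a \<in> carrier M \<Longrightarrow> b \<in> carrier N \<Longrightarrow> P (pure a b)"
    and add: "\<And>s t. \<lbrakk>s \<in> carrier T; t \<in> carrier T; P s; P t\<rbrakk> \<Longrightarrow> P (s \<oplus>\<^bsub>T\<^esub> t)"
  shows "P t"
proof -
  obtain x where x: "Poly_Mapping.keys x \<subseteq> carrier M \<times> carrier N" and tx: "t = rel #>\<^bsub>FG\<^esub> x"
    using t unfolding carrier_T by auto
  have clos: "rel #>\<^bsub>FG\<^esub> y \<in> carrier T" if "Poly_Mapping.keys y \<subseteq> carrier M \<times> carrier N" for y
    unfolding carrier_T using that by (intro imageI) simp
  have z: "rel #>\<^bsub>FG\<^esub> 0 = \<zero>\<^bsub>T\<^esub>"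
    using group.coset_join2[OF group_free_Abelian_group _ subgroup_rel, of 0]
      subgroup.one_closed[OF subgroup_rel] by (simp add: zero_T)
  \<comment> \<open>Induction over a free abelian group passes through differences, while P is only
    known to survive sums; the claim is therefore carried for x and -x together.\<close>
  have "P (rel #>\<^bsub>FG\<^esub> x) \<and> P (rel #>\<^bsub>FG\<^esub> (- x))"
    using x
  proof (induction x rule: free_Abelian_group_induct[consumes 1, case_names Zero Diff Frag])
    case Zero
    then show ?case using zero z by simp
  next
    case (Diff x y)
    then have "rel #>\<^bsub>FG\<^esub> (x + (- y)) = (rel #>\<^bsub>FG\<^esub> x) \<oplus>\<^bsub>T\<^esub> (rel #>\<^bsub>FG\<^esub> (- y))"
      "rel #>\<^bsub>FG\<^esub> ((- x) + y) = (rel #>\<^bsub>FG\<^esub> (- x)) \<oplus>\<^bsub>T\<^esub> (rel #>\<^bsub>FG\<^esub> y)"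
      by (intro coset_add[symmetric]; simp)+
    then show ?case using Diff clos by (auto intro!: add)
  next
    case (Frag p)
    obtain a b where p: "p = (a, b)" "a \<in> carrier M" "b \<in> carrier N" using Frag by auto
    have "(rel #>\<^bsub>FG\<^esub> (- frag_of p)) \<oplus>\<^bsub>T\<^esub> (rel #>\<^bsub>FG\<^esub> frag_of p) = \<zero>\<^bsub>T\<^esub>"
      using Frag z by (subst coset_add) simp_all
    then have "rel #>\<^bsub>FG\<^esub> (- frag_of p) = \<ominus>\<^bsub>T\<^esub> pure a b"
      using p clos by (intro T.minus_equality[symmetric]) (simp_all add: pure_tensor_def)
    also have "\<dots> = pure (\<ominus>\<^bsub>M\<^esub> a) b"
      using add_hom_neg[OF pure_hom_left M.abelian_group_axioms abelian_group_T] p by simp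
    finally show ?case using p pure by (simp add: pure_tensor_def)
  qed
  then show ?thesis by (simp add: tx)
qed

text \<open>The sum \<open>h\<close> over a representative is additive on the free abelian group and
  kills each defining relation, hence the whole of \<open>rel\<close>. It is thus constant on
  cosets, which is what makes \<open>the_elem\<close> in \<open>tensor_lift\<close> return its
  value.\<close>

lemma
  assumes P: "abelian_group P" and f: "balanced_map R M N P f"
  shows tensor_lift_hom: "tensor_lift P f \<in> add_hom T P"
    and tensor_lift_pure: "\<And>a b. a \<in> carrier M \<Longrightarrow> b \<in> carrier N \<Longrightarrow> tensor_lift P f (pure a b) = f a b"
proof -
  interpret P: abelian_group P by fact
  let ?g = "\<lambda>p. case p of (a, b) \<Rightarrow> f a b"
  define h where "h x = finsum P (\<lambda>(a, b). [Poly_Mapping.lookup x (a, b)] \<cdot>\<^bsub>P\<^esub> f a b) (Poly_Mapping.keys x)"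
    for x :: "'a \<times> 'b \<Rightarrow>\<^sub>0 int"
  have fc: "?g p \<in> carrier P" if "p \<in> carrier M \<times> carrier N" for p
    using that f by (auto simp: balanced_map_def)
  have fpow: "[k] \<cdot>\<^bsub>P\<^esub> ?g p \<in> carrier P" if "p \<in> carrier M \<times> carrier N" for p and k :: int
    using P.add.int_pow_closed fc[OF that] by blast
  have h_eq: "h x = (\<Oplus>\<^bsub>P\<^esub>p\<in>Poly_Mapping.keys x. [Poly_Mapping.lookup x p] \<cdot>\<^bsub>P\<^esub> ?g p)" for x
    by (simp add: h_def case_prod_unfold)
  \<comment> \<open>Padding with zero coefficients lets two representatives be summed over one
    common support, as additivity requires.\<close>
  have h_sup: "h x = (\<Oplus>\<^bsub>P\<^esub>p\<in>K. [Poly_Mapping.lookup x p] \<cdot>\<^bsub>P\<^esub> ?g p)"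
    if "finite K" "Poly_Mapping.keys x \<subseteq> K" "K \<subseteq> carrier M \<times> carrier N" for x K
    unfolding h_eq
  proof (rule P.add.finprod_mono_neutral_cong_left)
    fix p assume "p \<in> K - Poly_Mapping.keys x"
    then show "[Poly_Mapping.lookup x p] \<cdot>\<^bsub>P\<^esub> ?g p = \<zero>\<^bsub>P\<^esub>"
      by (simp add: in_keys_iff add_pow_def)
  next
    show "(\<lambda>p. [Poly_Mapping.lookup x p] \<cdot>\<^bsub>P\<^esub> ?g p) \<in> K \<rightarrow> carrier P"
      using that(3) fpow by blast
  qed (use that in auto)
  have h_add: "h (x + y) = h x \<oplus>\<^bsub>P\<^esub> h y"
    if "Poly_Mapping.keys x \<subseteq> carrier M \<times> carrier N" "Poly_Mapping.keys y \<subseteq> carrier M \<times> carrier N" for x y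
  proof -
    let ?K = "Poly_Mapping.keys x \<union> Poly_Mapping.keys y"
    have K: "finite ?K" "?K \<subseteq> carrier M \<times> carrier N" using that by auto
    have fK: "[k] \<cdot>\<^bsub>P\<^esub> ?g p \<in> carrier P" if "p \<in> ?K" for p and k :: int using fpow K that by blast
    have "h (x + y) = (\<Oplus>\<^bsub>P\<^esub>p\<in>?K. [Poly_Mapping.lookup x p] \<cdot>\<^bsub>P\<^esub> ?g p \<oplus>\<^bsub>P\<^esub> [Poly_Mapping.lookup y p] \<cdot>\<^bsub>P\<^esub> ?g p)"
      unfolding h_sup[OF K(1) keys_add K(2)]
    proof (rule P.finsum_cong')
      fix p assume "p \<in> ?K"
      then have "?g p \<in> carrier P" using fc K by blast
      then show "[Poly_Mapping.lookup (x + y) p] \<cdot>\<^bsub>P\<^esub> ?g p =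
          [Poly_Mapping.lookup x p] \<cdot>\<^bsub>P\<^esub> ?g p \<oplus>\<^bsub>P\<^esub> [Poly_Mapping.lookup y p] \<cdot>\<^bsub>P\<^esub> ?g p"
        by (simp only: lookup_add P.add.int_pow_mult)
    qed (use fK in blast)+
    also have "\<dots> = h x \<oplus>\<^bsub>P\<^esub> h y"
      unfolding h_sup[OF K(1) Un_upper1 K(2)] h_sup[OF K(1) Un_upper2 K(2)]
      using fK by (intro P.finsum_addf) blast+
    finally show ?thesis .
  qed
  have h_closed: "h x \<in> carrier P" if "Poly_Mapping.keys x \<subseteq> carrier M \<times> carrier N" for x
    unfolding h_eq using fpow that by (intro P.finsum_closed) blast
  have h_frag: "h (frag_of p) = ?g p" if "p \<in> carrier M \<times> carrier N" for p
    using fc[OF that] P.add.int_pow_1[of "?g p"] by (simp add: h_eq keys_frag_of Pi_def)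
  have h_zero: "h 0 = \<zero>\<^bsub>P\<^esub>" by (simp add: h_def)
  \<comment> \<open>Stated for differences so that it serves both the relations, which have the form
    p - q, and the inverses 0 - x in the generated subgroup.\<close>
  have h_diff: "h (x - y) = \<zero>\<^bsub>P\<^esub> \<longleftrightarrow> h x = h y"
    if "Poly_Mapping.keys x \<subseteq> carrier M \<times> carrier N" "Poly_Mapping.keys y \<subseteq> carrier M \<times> carrier N" for x y
  proof -
    have k: "Poly_Mapping.keys (x - y) \<subseteq> carrier M \<times> carrier N"
      using that keys_diff[of x y] by blast
    have "h x = h (x - y) \<oplus>\<^bsub>P\<^esub> h y" using h_add[OF k that(2)] by simp
    then show ?thesis using h_closed[OF k] h_closed[OF that(2)] by simp
  qed
  let ?gens = "{frag_of (x \<oplus>\<^bsub>M\<^esub> x', y) - frag_of (x, y) - frag_of (x', y) | x x' y.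
         x \<in> carrier M \<and> x' \<in> carrier M \<and> y \<in> carrier N} \<union>
      {frag_of (x, y \<oplus>\<^bsub>N\<^esub> y') - frag_of (x, y) - frag_of (x, y') | x y y'.
         x \<in> carrier M \<and> y \<in> carrier N \<and> y' \<in> carrier N} \<union>
      {frag_of (r \<odot>\<^bsub>M\<^esub> x, y) - frag_of (x, r \<odot>\<^bsub>N\<^esub> y) | r x y.
         r \<in> carrier R \<and> x \<in> carrier M \<and> y \<in> carrier N}"
  have rel_gens: "rel = generate FG ?gens" by (simp add: tensor_rel_def)
  have three: "h (frag_of p - frag_of q - frag_of r) = \<zero>\<^bsub>P\<^esub>"
    if "p \<in> carrier M \<times> carrier N" "q \<in> carrier M \<times> carrier N" "r \<in> carrier M \<times> carrier N"
      "?g p = ?g q \<oplus>\<^bsub>P\<^esub> ?g r" for p q r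
  proof -
    have "h (frag_of q + frag_of r) = h (frag_of p)"
      using that by (subst h_add) (auto simp: h_frag keys_frag_of)
    moreover have "Poly_Mapping.keys (frag_of q + frag_of r) \<subseteq> carrier M \<times> carrier N"
      using that keys_add[of "frag_of q" "frag_of r"] by (auto simp: keys_frag_of)
    ultimately show ?thesis
      unfolding diff_diff_add using that by (subst h_diff) (auto simp: keys_frag_of)
  qed
  have h_gens: "h x = \<zero>\<^bsub>P\<^esub>" if "x \<in> ?gens" for x
    using that
  proof (elim UnE CollectE exE conjE)
    fix x' x'' y assume "x = frag_of (x' \<oplus>\<^bsub>M\<^esub> x'', y) - frag_of (x', y) - frag_of (x'', y)"
      "x' \<in> carrier M" "x'' \<in> carrier M" "y \<in> carrier N"
    then show ?thesis using f by (auto simp: balanced_map_def intro!: three)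
  next
    fix x' y y' assume "x = frag_of (x', y \<oplus>\<^bsub>N\<^esub> y') - frag_of (x', y) - frag_of (x', y')"
      "x' \<in> carrier M" "y \<in> carrier N" "y' \<in> carrier N"
    then show ?thesis using f by (auto simp: balanced_map_def intro!: three)
  next
    fix r x' y assume *: "x = frag_of (r \<odot>\<^bsub>M\<^esub> x', y) - frag_of (x', r \<odot>\<^bsub>N\<^esub> y)"
      "r \<in> carrier R" "x' \<in> carrier M" "y \<in> carrier N"
    then have c: "(r \<odot>\<^bsub>M\<^esub> x', y) \<in> carrier M \<times> carrier N" "(x', r \<odot>\<^bsub>N\<^esub> y) \<in> carrier M \<times> carrier N"
      by (auto simp: smult_closed_left smult_closed_right)
    then have "h (frag_of (r \<odot>\<^bsub>M\<^esub> x', y)) = h (frag_of (x', r \<odot>\<^bsub>N\<^esub> y))"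
      using * f by (simp add: h_frag balanced_map_def)
    then show ?thesis using c * by (subst *(1), subst h_diff) (auto simp: keys_frag_of)
  qed
  have h_rel: "h x = \<zero>\<^bsub>P\<^esub>" if "x \<in> rel" for x
    using that unfolding rel_gens
  proof (induction x rule: generate.induct)
    case one
    then show ?case by (simp add: h_zero)
  next
    case (incl x)
    then show ?case by (rule h_gens)
  next
    case (inv x)
    then have k: "Poly_Mapping.keys x \<subseteq> carrier M \<times> carrier N"
      by (intro rel_subset) (simp only: rel_gens generate.incl)
    have "h (0 - x) = \<zero>\<^bsub>P\<^esub> \<longleftrightarrow> h 0 = h x" using k by (intro h_diff) simp_all
    then show ?case using k h_zero h_gens[OF inv] by simp
  next
    case (eng x y)
    then have "x \<in> rel" "y \<in> rel" unfolding rel_gens by simp_all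
    then show ?case using eng by (simp add: h_add rel_subset)
  qed
  have lift: "tensor_lift P f (rel #>\<^bsub>FG\<^esub> x) = h x" if "x \<in> carrier FG" for x
  proof -
    have "h ` (rel #>\<^bsub>FG\<^esub> x) = {h x}"
    proof
      show "h ` (rel #>\<^bsub>FG\<^esub> x) \<subseteq> {h x}"
        using that h_rel h_closed by (auto simp: r_coset_def h_add rel_subset)
      show "{h x} \<subseteq> h ` (rel #>\<^bsub>FG\<^esub> x)"
        using group.rcos_self[OF group_free_Abelian_group that subgroup_rel] by blast
    qed
    then show ?thesis
      unfolding tensor_lift_def h_def[symmetric, abs_def] by simp
  qed
  show "tensor_lift P f \<in> add_hom T P"
  proof (rule add_homI)
    fix s assume "s \<in> carrier T"
    then show "tensor_lift P f s \<in> carrier P"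
      unfolding carrier_T using lift h_closed by auto
  next
    fix s t assume "s \<in> carrier T" "t \<in> carrier T"
    then obtain x y where xy: "s = rel #>\<^bsub>FG\<^esub> x" "t = rel #>\<^bsub>FG\<^esub> y" "x \<in> carrier FG" "y \<in> carrier FG"
      unfolding carrier_T by blast
    then have "x + y \<in> carrier FG" using keys_add[of x y] by auto
    then show "tensor_lift P f (s \<oplus>\<^bsub>T\<^esub> t) = tensor_lift P f s \<oplus>\<^bsub>P\<^esub> tensor_lift P f t"
      using xy h_add by (simp add: coset_add lift)
  qed
  show "tensor_lift P f (pure a b) = f a b" if "a \<in> carrier M" "b \<in> carrier N" for a b
    using that by (simp add: pure_tensor_def lift h_frag)
qed

end

context tensor_pair
begin

text \<open>Identities on tensor products are reduced by this to pure tensors; the price is to show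
  that both sides are additive. In the uses, \<open>rotated -2\<close> brings the membership of t to
  the front, where it meets the chained fact.\<close>

lemma tensor_ext:
  assumes "f \<in> add_hom T P" "g \<in> add_hom T P" "abelian_group P" "t \<in> carrier T"
    and "\<And>a b. a \<in> carrier M \<Longrightarrow> b \<in> carrier N \<Longrightarrow> f (pure a b) = g (pure a b)"
  shows "f t = g t"
  using assms(4)
proof (induction t rule: tensor_induct)
  case zero
  then show ?case using add_hom_zero[OF assms(1)] add_hom_zero[OF assms(2)] assms(3) by simp
next
  case (add s t)
  then show ?case using add_hom_add[OF assms(1)] add_hom_add[OF assms(2)] by simp
qed (use assms(5) in auto)

end

section \<open>Tensor products of modules over a commutative ring\<close>

locale tensor_modules = M: module R M + N: module R N
  for R :: "('r, 'm) ring_scheme" and M :: "('r, 'a, 'x) module_scheme" and N :: "('r, 'b, 'y) module_scheme"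
begin

sublocale tensor_pair R M N
  by unfold_locales (rule M.smult_closed N.smult_closed; assumption)+

text \<open>The target is \<open>tensor_add\<close>, since the scalar action of
  \<open>tensor\<close> is itself defined as a lift into its additive part. Balance uses that R is
  commutative: moving s across the tensor sign exchanges it with r.\<close>

lemma balanced_smult: "r \<in> carrier R \<Longrightarrow> balanced_map R M N (tensor_add R M N) (\<lambda>a b. pure (r \<odot>\<^bsub>M\<^esub> a) b)"
  by (rule balanced_mapI)
    (simp_all add: carrier_tensor_add add_tensor_add M.smult_r_distr pure_add_left pure_add_right
      pure_balanced[symmetric] M.smult_assoc1[symmetric] M.m_comm)

lemma smult_T: "r \<odot>\<^bsub>T\<^esub> t = tensor_lift (tensor_add R M N) (\<lambda>a b. pure (r \<odot>\<^bsub>M\<^esub> a) b) t"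
  by (simp add: tensor_def)

lemma smult_T_hom: "r \<in> carrier R \<Longrightarrow> (\<lambda>t. r \<odot>\<^bsub>T\<^esub> t) \<in> add_hom T T"
  unfolding smult_T using tensor_lift_hom[OF abelian_group_tensor_add balanced_smult, of r]
  by (simp add: add_hom_def carrier_tensor_add add_tensor_add)

lemma smult_pure: "\<lbrakk>r \<in> carrier R; a \<in> carrier M; b \<in> carrier N\<rbrakk> \<Longrightarrow> r \<odot>\<^bsub>T\<^esub> pure a b = pure (r \<odot>\<^bsub>M\<^esub> a) b"
  unfolding smult_T by (rule tensor_lift_pure[OF abelian_group_tensor_add balanced_smult])

lemma smult_pure_right: "\<lbrakk>r \<in> carrier R; a \<in> carrier M; b \<in> carrier N\<rbrakk> \<Longrightarrow> r \<odot>\<^bsub>T\<^esub> pure a b = pure a (r \<odot>\<^bsub>N\<^esub> b)"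
  by (simp add: smult_pure pure_balanced)

lemma module_T: "module R T"
proof (rule moduleI)
  show "cring R" by (rule M.R.is_cring)
  show "abelian_group T" ..
  note closed = add_hom_closed[OF smult_T_hom]
  show "r \<odot>\<^bsub>T\<^esub> t \<in> carrier T" if "r \<in> carrier R" "t \<in> carrier T" for r t
    using closed that .
  show "r \<odot>\<^bsub>T\<^esub> (s \<oplus>\<^bsub>T\<^esub> t) = r \<odot>\<^bsub>T\<^esub> s \<oplus>\<^bsub>T\<^esub> r \<odot>\<^bsub>T\<^esub> t" if "r \<in> carrier R" "s \<in> carrier T" "t \<in> carrier T" for r s t
    using add_hom_add[OF smult_T_hom] that by blast
  show "(r \<oplus>\<^bsub>R\<^esub> s) \<odot>\<^bsub>T\<^esub> t = r \<odot>\<^bsub>T\<^esub> t \<oplus>\<^bsub>T\<^esub> s \<odot>\<^bsub>T\<^esub> t" if rs: "r \<in> carrier R" "s \<in> carrier R" and "t \<in> carrier T" for r s t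
    using that(3)
  proof (rule tensor_ext[of _ T, rotated -2])
    show "(\<lambda>t. (r \<oplus>\<^bsub>R\<^esub> s) \<odot>\<^bsub>T\<^esub> t) \<in> add_hom T T" using rs by (intro smult_T_hom) simp
    show "(\<lambda>t. r \<odot>\<^bsub>T\<^esub> t \<oplus>\<^bsub>T\<^esub> s \<odot>\<^bsub>T\<^esub> t) \<in> add_hom T T"
      by (rule add_homI) (simp_all add: rs closed add_hom_add[OF smult_T_hom] T.a_ac)
  qed (simp_all add: rs smult_pure M.smult_l_distr pure_add_left)
  show "(r \<otimes>\<^bsub>R\<^esub> s) \<odot>\<^bsub>T\<^esub> t = r \<odot>\<^bsub>T\<^esub> (s \<odot>\<^bsub>T\<^esub> t)" if rs: "r \<in> carrier R" "s \<in> carrier R" and "t \<in> carrier T" for r s t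
    using that(3)
  proof (rule tensor_ext[of _ T, rotated -2])
    show "(\<lambda>t. (r \<otimes>\<^bsub>R\<^esub> s) \<odot>\<^bsub>T\<^esub> t) \<in> add_hom T T" using rs by (intro smult_T_hom) simp
    show "(\<lambda>t. r \<odot>\<^bsub>T\<^esub> (s \<odot>\<^bsub>T\<^esub> t)) \<in> add_hom T T"
      using add_hom_comp[OF smult_T_hom smult_T_hom] rs by blast
  qed (simp_all add: rs smult_pure M.smult_assoc1)
  show "\<one>\<^bsub>R\<^esub> \<odot>\<^bsub>T\<^esub> t = t" if "t \<in> carrier T" for t
    using that
  proof (rule tensor_ext[of _ T, rotated -2])
    show "(\<lambda>t. \<one>\<^bsub>R\<^esub> \<odot>\<^bsub>T\<^esub> t) \<in> add_hom T T" by (intro smult_T_hom) simp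
    show "(\<lambda>t. t) \<in> add_hom T T" by (rule add_homI) simp_all
  qed (simp_all add: smult_pure)
qed

sublocale T: module R T by (rule module_T)

lemma tensor_lift_mod_hom:
  assumes P: "module R P" and f: "balanced_map R M N P f"
    and sm: "\<And>r a b. \<lbrakk>r \<in> carrier R; a \<in> carrier M; b \<in> carrier N\<rbrakk> \<Longrightarrow> f (r \<odot>\<^bsub>M\<^esub> a) b = r \<odot>\<^bsub>P\<^esub> f a b"
  shows "tensor_lift P f \<in> mod_hom R T P"
proof (rule mod_homI)
  interpret P: module R P by fact
  note h = tensor_lift_hom[OF P.abelian_group_axioms f]
  show "tensor_lift P f \<in> add_hom T P" by (rule h)
  fix r t assume r: "r \<in> carrier R" and "t \<in> carrier T"
  from this(2) show "tensor_lift P f (r \<odot>\<^bsub>T\<^esub> t) = r \<odot>\<^bsub>P\<^esub> tensor_lift P f t"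
  proof (rule tensor_ext[of _ P, rotated -2])
    show "(\<lambda>t. tensor_lift P f (r \<odot>\<^bsub>T\<^esub> t)) \<in> add_hom T P"
      using add_hom_comp[OF smult_T_hom h] r by blast
    show "(\<lambda>t. r \<odot>\<^bsub>P\<^esub> tensor_lift P f t) \<in> add_hom T P"
      by (rule add_homI) (simp_all add: r add_hom_closed[OF h] add_hom_add[OF h] P.smult_r_distr)
  qed (simp_all add: r smult_pure tensor_lift_pure[OF P.abelian_group_axioms f] sm P.abelian_group_axioms)
qed

lemma balanced_mapI_linear:
  assumes P: "module R P"
    and left: "\<And>y. y \<in> carrier N \<Longrightarrow> (\<lambda>x. f x y) \<in> mod_hom R M P"
    and right: "\<And>x. x \<in> carrier M \<Longrightarrow> f x \<in> mod_hom R N P"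
  shows "balanced_map R M N P f"
  using add_hom_closed[OF mod_hom_add_hom[OF right]] add_hom_add[OF mod_hom_add_hom[OF right]]
    add_hom_add[OF mod_hom_add_hom[OF left]] mod_hom_smult[OF left] mod_hom_smult[OF right]
  by (intro balanced_mapI) auto

lemma
  assumes P: "module R P"
    and left: "\<And>y. y \<in> carrier N \<Longrightarrow> (\<lambda>x. f x y) \<in> mod_hom R M P"
    and right: "\<And>x. x \<in> carrier M \<Longrightarrow> f x \<in> mod_hom R N P"
  shows bilinear_lift_hom: "tensor_lift P f \<in> mod_hom R T P"
    and bilinear_lift_pure: "\<And>a b. a \<in> carrier M \<Longrightarrow> b \<in> carrier N \<Longrightarrow> tensor_lift P f (pure a b) = f a b"
proof -
  interpret P: module R P by fact
  note bal = balanced_mapI_linear[OF P left right]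
  show "tensor_lift P f \<in> mod_hom R T P"
    by (rule tensor_lift_mod_hom[OF P bal]) (use mod_hom_smult[OF left] in auto)
  show "tensor_lift P f (pure a b) = f a b" if "a \<in> carrier M" "b \<in> carrier N" for a b
    using tensor_lift_pure[OF P.abelian_group_axioms bal that] .
qed

lemma pure_mod_hom_left: "b \<in> carrier N \<Longrightarrow> (\<lambda>a. pure a b) \<in> mod_hom R M T"
  by (rule mod_homI) (simp_all add: pure_hom_left smult_pure)

lemma pure_mod_hom_right: "a \<in> carrier M \<Longrightarrow> (\<lambda>b. pure a b) \<in> mod_hom R N T"
  by (rule mod_homI) (simp_all add: pure_hom_right smult_pure_right)

lemma
  assumes M': "module R M'" and N': "module R N'" and f: "f \<in> mod_hom R M M'" and g: "g \<in> mod_hom R N N'"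
  shows tensor_map_hom: "tensor_map R M' N' f g \<in> mod_hom R T (tensor R M' N')"
    and tensor_map_pure: "\<And>a b. a \<in> carrier M \<Longrightarrow> b \<in> carrier N \<Longrightarrow>
      tensor_map R M' N' f g (pure a b) = pure_tensor R M' N' (f a) (g b)"
proof -
  interpret T': tensor_modules R M' N' using M' N' by (simp add: tensor_modules_def)
  note l = mod_hom_comp[OF f T'.pure_mod_hom_left[OF add_hom_closed[OF mod_hom_add_hom[OF g]]]]
  note r = mod_hom_comp[OF g T'.pure_mod_hom_right[OF add_hom_closed[OF mod_hom_add_hom[OF f]]]]
  show "tensor_map R M' N' f g \<in> mod_hom R T (tensor R M' N')"
    unfolding tensor_map_def by (rule bilinear_lift_hom[OF T'.module_T l r])
  show "tensor_map R M' N' f g (pure a b) = pure_tensor R M' N' (f a) (g b)"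
    if "a \<in> carrier M" "b \<in> carrier N" for a b
    unfolding tensor_map_def by (rule bilinear_lift_pure[OF T'.module_T l r that])
qed

end

text \<open>Two nested lifts. For fixed c the inner one is linear in t by the universal property;
  its linearity in c, which the outer lift requires, is of another kind and is checked for all t by
  comparison on pure tensors.\<close>

lemma
  assumes L: "module R L" and M: "module R M" and N: "module R N"
  shows tensor_assoc_hom: "tensor_assoc R L M N \<in>
      mod_hom R (tensor R (tensor R L M) N) (tensor R L (tensor R M N))" (is ?hom)
    and tensor_assoc_pure: "\<And>a b c. \<lbrakk>a \<in> carrier L; b \<in> carrier M; c \<in> carrier N\<rbrakk> \<Longrightarrow>
      tensor_assoc R L M N (pure_tensor R (tensor R L M) N (pure_tensor R L M a b) c) =
      pure_tensor R L (tensor R M N) a (pure_tensor R M N b c)"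
proof -
  interpret LM: tensor_modules R L M using L M by (simp add: tensor_modules_def)
  interpret MN: tensor_modules R M N using M N by (simp add: tensor_modules_def)
  interpret LM_N: tensor_modules R "tensor R L M" N using LM.module_T N by (simp add: tensor_modules_def)
  interpret L_MN: tensor_modules R L "tensor R M N" using MN.module_T L by (simp add: tensor_modules_def)
  let ?g = "\<lambda>c a b. L_MN.pure a (MN.pure b c)"
  let ?P = "tensor R L (tensor R M N)"
  have gl: "(\<lambda>a. ?g c a b) \<in> mod_hom R L ?P" if "c \<in> carrier N" "b \<in> carrier M" for c b
    using that by (intro L_MN.pure_mod_hom_left) simp
  have gr: "?g c a \<in> mod_hom R M ?P" if "c \<in> carrier N" "a \<in> carrier L" for c a
    using mod_hom_comp[OF MN.pure_mod_hom_left L_MN.pure_mod_hom_right] that by blast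
  let ?f = "\<lambda>t c. tensor_lift ?P (?g c) t"
  have fl: "(\<lambda>t. ?f t c) \<in> mod_hom R (tensor R L M) ?P" if "c \<in> carrier N" for c
    by (rule LM.bilinear_lift_hom[OF L_MN.module_T gl[OF that] gr[OF that]])
  have fp: "?f (LM.pure a b) c = ?g c a b" if "c \<in> carrier N" "a \<in> carrier L" "b \<in> carrier M" for a b c
    by (rule LM.bilinear_lift_pure[OF L_MN.module_T gl[OF that(1)] gr[OF that(1)] that(2,3)])
  note fclosed = add_hom_closed[OF mod_hom_add_hom[OF fl]]
  note fadd = add_hom_add[OF mod_hom_add_hom[OF fl]]
  have fr: "?f t \<in> mod_hom R N ?P" if t: "t \<in> carrier (tensor R L M)" for t
  proof (rule mod_homI[OF add_homI])
    show "?f t c \<in> carrier ?P" if "c \<in> carrier N" for c using fclosed that t .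
    show "?f t (c \<oplus>\<^bsub>N\<^esub> d) = ?f t c \<oplus>\<^bsub>?P\<^esub> ?f t d" if cd: "c \<in> carrier N" "d \<in> carrier N" for c d
      using t
    proof (rule LM.tensor_ext[of _ ?P, rotated -2])
      show "(\<lambda>t. ?f t (c \<oplus>\<^bsub>N\<^esub> d)) \<in> add_hom LM.T ?P" using cd by (intro mod_hom_add_hom[OF fl]) simp
      show "(\<lambda>t. ?f t c \<oplus>\<^bsub>?P\<^esub> ?f t d) \<in> add_hom LM.T ?P"
        using cd by (intro add_homI) (simp_all add: fclosed fadd L_MN.T.a_ac)
    qed (use cd in \<open>simp_all add: fp MN.pure_add_right L_MN.pure_add_right\<close>)
    show "?f t (r \<odot>\<^bsub>N\<^esub> c) = r \<odot>\<^bsub>?P\<^esub> ?f t c" if rc: "r \<in> carrier R" "c \<in> carrier N" for r c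
      using t
    proof (rule LM.tensor_ext[of _ ?P, rotated -2])
      show "(\<lambda>t. ?f t (r \<odot>\<^bsub>N\<^esub> c)) \<in> add_hom LM.T ?P" using rc by (intro mod_hom_add_hom[OF fl]) simp
      show "(\<lambda>t. r \<odot>\<^bsub>?P\<^esub> ?f t c) \<in> add_hom LM.T ?P"
        using add_hom_comp[OF mod_hom_add_hom[OF fl] L_MN.smult_T_hom] rc by blast
    qed (use rc in \<open>simp_all add: fp L_MN.smult_pure_right MN.smult_pure_right\<close>)
  qed
  show ?hom
    unfolding tensor_assoc_def by (rule LM_N.bilinear_lift_hom[OF L_MN.module_T fl fr])
  show "tensor_assoc R L M N (LM_N.pure (LM.pure a b) c) = L_MN.pure a (MN.pure b c)"
    if "a \<in> carrier L" "b \<in> carrier M" "c \<in> carrier N" for a b c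
    unfolding tensor_assoc_def
    using LM_N.bilinear_lift_pure[OF L_MN.module_T fl fr, of "LM.pure a b" c] fp that by simp
qed

section \<open>The tensor square of an algebra\<close>

locale assoc_algebra = module R A + A?: ring A
  for R :: "('r, 'm) ring_scheme" (structure) and A :: "('r, 'a, 'x) module_scheme" (structure) +
  assumes smult_mult_left:
      "\<lbrakk>r \<in> carrier R; x \<in> carrier A; y \<in> carrier A\<rbrakk> \<Longrightarrow> (r \<odot>\<^bsub>A\<^esub> x) \<otimes>\<^bsub>A\<^esub> y = r \<odot>\<^bsub>A\<^esub> (x \<otimes>\<^bsub>A\<^esub> y)"
    and smult_mult_right:
      "\<lbrakk>r \<in> carrier R; x \<in> carrier A; y \<in> carrier A\<rbrakk> \<Longrightarrow> x \<otimes>\<^bsub>A\<^esub> (r \<odot>\<^bsub>A\<^esub> y) = r \<odot>\<^bsub>A\<^esub> (x \<otimes>\<^bsub>A\<^esub> y)"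
begin

lemma mult_mod_hom_left: "y \<in> carrier A \<Longrightarrow> (\<lambda>x. x \<otimes>\<^bsub>A\<^esub> y) \<in> mod_hom R A A"
  by (rule mod_homI[OF add_homI]) (simp_all add: A.l_distr smult_mult_left)

lemma mult_mod_hom_right: "x \<in> carrier A \<Longrightarrow> (\<lambda>y. x \<otimes>\<^bsub>A\<^esub> y) \<in> mod_hom R A A"
  by (rule mod_homI[OF add_homI]) (simp_all add: A.r_distr smult_mult_right)

sublocale T: tensor_modules R A A by unfold_locales

text \<open>The product is a lift in s of a lift in t. Additivity in s is therefore immediate,
  whereas additivity in t is tested on pure s.\<close>

lemma
  shows tensor_mult_hom_left: "t \<in> carrier T.T \<Longrightarrow> (\<lambda>s. s \<otimes>\<^bsub>T.T\<^esub> t) \<in> add_hom T.T T.T"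
    and tensor_mult_hom_right: "s \<in> carrier T.T \<Longrightarrow> (\<lambda>t. s \<otimes>\<^bsub>T.T\<^esub> t) \<in> add_hom T.T T.T"
    and tensor_mult_pure: "\<lbrakk>a \<in> carrier A; b \<in> carrier A; c \<in> carrier A; d \<in> carrier A\<rbrakk> \<Longrightarrow>
      T.pure a b \<otimes>\<^bsub>T.T\<^esub> T.pure c d = T.pure (a \<otimes>\<^bsub>A\<^esub> c) (b \<otimes>\<^bsub>A\<^esub> d)"
proof -
  let ?P = "tensor_add R A A"
  let ?g = "\<lambda>a b c d. T.pure (a \<otimes>\<^bsub>A\<^esub> c) (b \<otimes>\<^bsub>A\<^esub> d)"
  note simps = T.carrier_tensor_add T.add_tensor_add T.pure_add_left T.pure_add_right
    A.l_distr A.r_distr smult_mult_left smult_mult_right T.pure_balanced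
  have g: "balanced_map R A A ?P (?g a b)" if "a \<in> carrier A" "b \<in> carrier A" for a b
    by (rule balanced_mapI) (simp_all add: that simps)
  let ?f = "\<lambda>t a b. tensor_lift ?P (?g a b) t"
  note fh = T.tensor_lift_hom[OF T.abelian_group_tensor_add g]
  have fc: "?f t a b \<in> carrier T.T" if "a \<in> carrier A" "b \<in> carrier A" "t \<in> carrier T.T" for a b t
    using add_hom_closed[OF fh[OF that(1,2)] that(3)] by (simp add: simps)
  have fp: "?f (T.pure c d) a b = ?g a b c d" if "a \<in> carrier A" "b \<in> carrier A" "c \<in> carrier A" "d \<in> carrier A" for a b c d
    using that by (intro T.tensor_lift_pure[OF T.abelian_group_tensor_add g])
  have fa: "?f (t \<oplus>\<^bsub>T.T\<^esub> t') a b = ?f t a b \<oplus>\<^bsub>T.T\<^esub> ?f t' a b"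
    if "a \<in> carrier A" "b \<in> carrier A" "t \<in> carrier T.T" "t' \<in> carrier T.T" for a b t t'
    using add_hom_add[OF fh[OF that(1,2)] that(3,4)] by (simp add: simps)
  have fz: "?f \<zero>\<^bsub>T.T\<^esub> a b = \<zero>\<^bsub>T.T\<^esub>" if "a \<in> carrier A" "b \<in> carrier A" for a b
    using add_hom_zero[OF fh[OF that]] by (simp add: T.zero_tensor_add)
  \<comment> \<open>Being balanced is preserved by sums in t, so induction over t leaves pure
    tensors, where it follows from the laws of the algebra A.\<close>
  have f: "balanced_map R A A ?P (?f t)" if t: "t \<in> carrier T.T" for t
    using t
  proof (induction t rule: T.tensor_induct)
    case zero
    show ?case by (rule balanced_mapI) (simp_all add: fz simps)
  next
    case (pure c d)
    then show ?case by (intro balanced_mapI) (simp_all add: fp simps)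
  next
    case (add s t)
    then show ?case
      by (intro balanced_mapI) (simp_all add: fa fc T.carrier_tensor_add T.add_tensor_add balanced_map_def T.T.a_ac)
  qed
  have mult: "s \<otimes>\<^bsub>T.T\<^esub> t = tensor_lift ?P (?f t) s" for s t
    by (simp add: tensor_def)
  note mh = T.tensor_lift_hom[OF T.abelian_group_tensor_add f]
  have mp: "T.pure a b \<otimes>\<^bsub>T.T\<^esub> t = ?f t a b" if "a \<in> carrier A" "b \<in> carrier A" "t \<in> carrier T.T" for a b t
    unfolding mult using that by (intro T.tensor_lift_pure[OF T.abelian_group_tensor_add f])
  show left: "(\<lambda>s. s \<otimes>\<^bsub>T.T\<^esub> t) \<in> add_hom T.T T.T" if "t \<in> carrier T.T" for t
    using mh[OF that] by (simp add: mult add_hom_def T.carrier_tensor_add T.add_tensor_add)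
  show "T.pure a b \<otimes>\<^bsub>T.T\<^esub> T.pure c d = ?g a b c d"
    if "a \<in> carrier A" "b \<in> carrier A" "c \<in> carrier A" "d \<in> carrier A"
    using that by (simp add: mp fp)
  show "(\<lambda>t. s \<otimes>\<^bsub>T.T\<^esub> t) \<in> add_hom T.T T.T" if s: "s \<in> carrier T.T"
  proof (rule add_homI)
    show "s \<otimes>\<^bsub>T.T\<^esub> t \<in> carrier T.T" if "t \<in> carrier T.T" for t
      using add_hom_closed[OF left[OF that] s] .
    show "s \<otimes>\<^bsub>T.T\<^esub> (t \<oplus>\<^bsub>T.T\<^esub> t') = s \<otimes>\<^bsub>T.T\<^esub> t \<oplus>\<^bsub>T.T\<^esub> s \<otimes>\<^bsub>T.T\<^esub> t'" if t: "t \<in> carrier T.T" "t' \<in> carrier T.T" for t t'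
      using s
    proof (rule T.tensor_ext[of _ T.T, rotated -2])
      show "(\<lambda>s. s \<otimes>\<^bsub>T.T\<^esub> (t \<oplus>\<^bsub>T.T\<^esub> t')) \<in> add_hom T.T T.T" using t by (intro left) simp
      show "(\<lambda>s. s \<otimes>\<^bsub>T.T\<^esub> t \<oplus>\<^bsub>T.T\<^esub> s \<otimes>\<^bsub>T.T\<^esub> t') \<in> add_hom T.T T.T"
        using t by (intro add_homI) (simp_all add: add_hom_closed[OF left] add_hom_add[OF left] T.T.a_ac)
    qed (use t in \<open>simp_all add: mp fa\<close>)
  qed
qed

end

text \<open>The lifts only provide additivity of the product. Compatibility with scalars is verified
  on pure tensors, in one argument after the other.\<close>

lemma (in assoc_algebra) tensor_mult_smult:
  assumes r: "r \<in> carrier R" and s: "s \<in> carrier T.T" and t: "t \<in> carrier T.T"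
  shows "(r \<odot>\<^bsub>T.T\<^esub> s) \<otimes>\<^bsub>T.T\<^esub> t = r \<odot>\<^bsub>T.T\<^esub> (s \<otimes>\<^bsub>T.T\<^esub> t)"
    and "s \<otimes>\<^bsub>T.T\<^esub> (r \<odot>\<^bsub>T.T\<^esub> t) = r \<odot>\<^bsub>T.T\<^esub> (s \<otimes>\<^bsub>T.T\<^esub> t)"
proof -
  note sm = T.smult_T_hom[OF r]
  have 1: "(r \<odot>\<^bsub>T.T\<^esub> T.pure a b) \<otimes>\<^bsub>T.T\<^esub> t = r \<odot>\<^bsub>T.T\<^esub> (T.pure a b \<otimes>\<^bsub>T.T\<^esub> t)"
    if ab: "a \<in> carrier A" "b \<in> carrier A" for a b
    using t
  proof (rule T.tensor_ext[of _ T.T, rotated -2])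
    show "(\<lambda>t. (r \<odot>\<^bsub>T.T\<^esub> T.pure a b) \<otimes>\<^bsub>T.T\<^esub> t) \<in> add_hom T.T T.T"
      using r ab by (intro tensor_mult_hom_right) simp
    show "(\<lambda>t. r \<odot>\<^bsub>T.T\<^esub> (T.pure a b \<otimes>\<^bsub>T.T\<^esub> t)) \<in> add_hom T.T T.T"
      using add_hom_comp[OF tensor_mult_hom_right sm] ab by simp
  qed (use r ab in \<open>simp_all add: tensor_mult_pure T.smult_pure smult_mult_left\<close>)
  show "(r \<odot>\<^bsub>T.T\<^esub> s) \<otimes>\<^bsub>T.T\<^esub> t = r \<odot>\<^bsub>T.T\<^esub> (s \<otimes>\<^bsub>T.T\<^esub> t)"
    using s
  proof (rule T.tensor_ext[of _ T.T, rotated -2])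
    show "(\<lambda>s. (r \<odot>\<^bsub>T.T\<^esub> s) \<otimes>\<^bsub>T.T\<^esub> t) \<in> add_hom T.T T.T"
      using add_hom_comp[OF sm tensor_mult_hom_left[OF t]] .
    show "(\<lambda>s. r \<odot>\<^bsub>T.T\<^esub> (s \<otimes>\<^bsub>T.T\<^esub> t)) \<in> add_hom T.T T.T"
      using add_hom_comp[OF tensor_mult_hom_left[OF t] sm] .
  qed (use 1 in simp_all)
  have 2: "T.pure a b \<otimes>\<^bsub>T.T\<^esub> (r \<odot>\<^bsub>T.T\<^esub> t) = r \<odot>\<^bsub>T.T\<^esub> (T.pure a b \<otimes>\<^bsub>T.T\<^esub> t)"
    if ab: "a \<in> carrier A" "b \<in> carrier A" for a b
    using t
  proof (rule T.tensor_ext[of _ T.T, rotated -2])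
    show "(\<lambda>t. T.pure a b \<otimes>\<^bsub>T.T\<^esub> (r \<odot>\<^bsub>T.T\<^esub> t)) \<in> add_hom T.T T.T"
      using add_hom_comp[OF sm tensor_mult_hom_right] ab by simp
    show "(\<lambda>t. r \<odot>\<^bsub>T.T\<^esub> (T.pure a b \<otimes>\<^bsub>T.T\<^esub> t)) \<in> add_hom T.T T.T"
      using add_hom_comp[OF tensor_mult_hom_right sm] ab by simp
  qed (use r ab in \<open>simp_all add: tensor_mult_pure T.smult_pure smult_mult_right\<close>)
  show "s \<otimes>\<^bsub>T.T\<^esub> (r \<odot>\<^bsub>T.T\<^esub> t) = r \<odot>\<^bsub>T.T\<^esub> (s \<otimes>\<^bsub>T.T\<^esub> t)"
    using s
  proof (rule T.tensor_ext[of _ T.T, rotated -2])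
    show "(\<lambda>s. s \<otimes>\<^bsub>T.T\<^esub> (r \<odot>\<^bsub>T.T\<^esub> t)) \<in> add_hom T.T T.T"
      using r t by (intro tensor_mult_hom_left) simp
    show "(\<lambda>s. r \<odot>\<^bsub>T.T\<^esub> (s \<otimes>\<^bsub>T.T\<^esub> t)) \<in> add_hom T.T T.T"
      using add_hom_comp[OF tensor_mult_hom_left[OF t] sm] .
  qed (use 2 in simp_all)
qed


section \<open>Bases\<close>

definition lincomb :: "('k::field_char_0, 'v, 'x) module_scheme \<Rightarrow> ('i \<Rightarrow> 'v) \<Rightarrow> ('i \<Rightarrow>\<^sub>0 'k) \<Rightarrow> 'v" where
  "lincomb V b c = (\<Oplus>\<^bsub>V\<^esub>i\<in>Poly_Mapping.keys c. Poly_Mapping.lookup c i \<odot>\<^bsub>V\<^esub> b i)"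

definition vspan :: "('k::field_char_0, 'v, 'x) module_scheme \<Rightarrow> 'i set \<Rightarrow> ('i \<Rightarrow> 'v) \<Rightarrow> 'v set" where
  "vspan V I b = lincomb V b ` {c. Poly_Mapping.keys c \<subseteq> I}"

lemma lookup_scale [simp]:
  "Poly_Mapping.lookup (Poly_Mapping.map ((*) r) c) i = (r :: 'k::field_char_0) * Poly_Mapping.lookup c i"
  by (simp add: Poly_Mapping.map.rep_eq when_def)

lemma keys_scale: "Poly_Mapping.keys (Poly_Mapping.map ((*) (r :: 'k::field_char_0)) c) \<subseteq> Poly_Mapping.keys c"
  by (auto simp: in_keys_iff)

lemma module_kk_self: "module (kk :: 'k::field_char_0 ring) (ring_as_module kk)"
proof (rule moduleI)
  show "abelian_group (ring_as_module (kk :: 'k ring))"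
    by (rule abelian_groupI) (auto simp: ring_as_module_def algebra_simps intro: exI[of _ "- x" for x])
qed (auto simp: ring_as_module_def algebra_simps)

lemma ring_as_module_kk_simps [simp]:
  "carrier (ring_as_module (kk :: 'k::field_char_0 ring)) = UNIV"
  "\<zero>\<^bsub>ring_as_module (kk :: 'k ring)\<^esub> = 0"
  "x \<oplus>\<^bsub>ring_as_module kk\<^esub> y = x + (y :: 'k)" "x \<odot>\<^bsub>ring_as_module kk\<^esub> y = x * (y :: 'k)"
  by (simp_all add: ring_as_module_def)

lemma finsum_kk_self [simp]:
  "finite I \<Longrightarrow> finsum (ring_as_module (kk :: 'k::field_char_0 ring)) f I = sum f I"
proof (induction I rule: finite_induct)
  case empty
  interpret module kk "ring_as_module (kk :: 'k ring)" by (rule module_kk_self)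
  show ?case by simp
next
  case (insert i I)
  interpret module kk "ring_as_module (kk :: 'k ring)" by (rule module_kk_self)
  show ?case using insert by simp
qed

lemma functional_iff: "f \<in> mod_hom kk V (ring_as_module (kk :: 'k::field_char_0 ring)) \<longleftrightarrow>
    (\<forall>x\<in>carrier V. \<forall>y\<in>carrier V. f (x \<oplus>\<^bsub>V\<^esub> y) = f x + f y) \<and> (\<forall>r. \<forall>x\<in>carrier V. f (r \<odot>\<^bsub>V\<^esub> x) = r * f x)"
  by (simp add: mod_hom_def ring_as_module_def)

locale kk_space = module "kk :: 'k ring" V for V :: "('k::field_char_0, 'v, 'x) module_scheme"
begin

lemma kk_smult_closed [simp]: "x \<in> carrier V \<Longrightarrow> r \<odot>\<^bsub>V\<^esub> x \<in> carrier V"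
  by (rule smult_closed) simp_all

lemma kk_smult_add: "x \<in> carrier V \<Longrightarrow> (r + s) \<odot>\<^bsub>V\<^esub> x = r \<odot>\<^bsub>V\<^esub> x \<oplus>\<^bsub>V\<^esub> s \<odot>\<^bsub>V\<^esub> x"
  using smult_l_distr[of r s x] by simp

lemma kk_smult_mult: "x \<in> carrier V \<Longrightarrow> (r * s) \<odot>\<^bsub>V\<^esub> x = r \<odot>\<^bsub>V\<^esub> (s \<odot>\<^bsub>V\<^esub> x)"
  using smult_assoc1[of r s x] by simp

lemma kk_smult_zero [simp]: "x \<in> carrier V \<Longrightarrow> 0 \<odot>\<^bsub>V\<^esub> x = \<zero>\<^bsub>V\<^esub>"
  using smult_l_null[of x] by simp

lemma kk_smult_one [simp]: "x \<in> carrier V \<Longrightarrow> 1 \<odot>\<^bsub>V\<^esub> x = x"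
  using smult_one[of x] by simp

lemma kk_smult_minus: "x \<in> carrier V \<Longrightarrow> (- r) \<odot>\<^bsub>V\<^esub> x = \<ominus>\<^bsub>V\<^esub> (r \<odot>\<^bsub>V\<^esub> x)"
  using smult_l_minus[of r x] by simp

end

section \<open>Linear combinations, spans and bases\<close>

locale vector_family = kk_space V
  for V :: "('k::field_char_0, 'v, 'x) module_scheme" +
  fixes I :: "'i set" and b :: "'i \<Rightarrow> 'v"
  assumes family: "b \<in> I \<rightarrow> carrier V"
begin

lemma b_closed [simp]: "i \<in> I \<Longrightarrow> b i \<in> carrier V"
  using family by blast

lemma lincomb_superset:
  assumes "finite J" "Poly_Mapping.keys c \<subseteq> J" "J \<subseteq> I"
  shows "lincomb V b c = (\<Oplus>\<^bsub>V\<^esub>i\<in>J. Poly_Mapping.lookup c i \<odot>\<^bsub>V\<^esub> b i)"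
  unfolding lincomb_def
proof (rule M.add.finprod_mono_neutral_cong_left)
  fix i assume "i \<in> J - Poly_Mapping.keys c"
  then have "Poly_Mapping.lookup c i = 0" "i \<in> I" using assms by (auto simp: in_keys_iff)
  then show "Poly_Mapping.lookup c i \<odot>\<^bsub>V\<^esub> b i = \<zero>\<^bsub>V\<^esub>" by simp
qed (use assms in auto)

lemma lincomb_closed [simp]: "Poly_Mapping.keys c \<subseteq> I \<Longrightarrow> lincomb V b c \<in> carrier V"
  unfolding lincomb_def by (rule M.finsum_closed) auto

lemma lincomb_zero [simp]: "lincomb V b 0 = \<zero>\<^bsub>V\<^esub>"
  by (simp add: lincomb_def)

lemma lincomb_add:
  assumes "Poly_Mapping.keys c \<subseteq> I" "Poly_Mapping.keys d \<subseteq> I"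
  shows "lincomb V b (c + d) = lincomb V b c \<oplus>\<^bsub>V\<^esub> lincomb V b d"
proof -
  let ?J = "Poly_Mapping.keys c \<union> Poly_Mapping.keys d"
  have J: "finite ?J" "?J \<subseteq> I" using assms by auto
  have "lincomb V b (c + d) = (\<Oplus>\<^bsub>V\<^esub>i\<in>?J. Poly_Mapping.lookup c i \<odot>\<^bsub>V\<^esub> b i \<oplus>\<^bsub>V\<^esub> Poly_Mapping.lookup d i \<odot>\<^bsub>V\<^esub> b i)"
    unfolding lincomb_superset[OF J(1) keys_add J(2)]
    using J by (intro M.finsum_cong') (auto simp: lookup_add subset_iff kk_smult_add)
  also have "\<dots> = lincomb V b c \<oplus>\<^bsub>V\<^esub> lincomb V b d"
    unfolding lincomb_superset[OF J(1) Un_upper1 J(2)] lincomb_superset[OF J(1) Un_upper2 J(2)]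
    using J by (intro M.finsum_addf) auto
  finally show ?thesis .
qed

lemma lincomb_scale:
  assumes c: "Poly_Mapping.keys c \<subseteq> I"
  shows "lincomb V b (Poly_Mapping.map ((*) r) c) = r \<odot>\<^bsub>V\<^esub> lincomb V b c"
proof -
  have "r \<odot>\<^bsub>V\<^esub> lincomb V b c = (\<Oplus>\<^bsub>V\<^esub>i\<in>Poly_Mapping.keys c. r \<odot>\<^bsub>V\<^esub> (Poly_Mapping.lookup c i \<odot>\<^bsub>V\<^esub> b i))"
    unfolding lincomb_def using c by (intro finsum_smult_ldistr) auto
  also have "\<dots> = lincomb V b (Poly_Mapping.map ((*) r) c)"
    unfolding lincomb_superset[OF finite_keys keys_scale c]
    using c by (intro M.finsum_cong') (auto simp: subset_iff kk_smult_mult)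
  finally show ?thesis ..
qed

lemma lincomb_single [simp]: "i \<in> I \<Longrightarrow> lincomb V b (Poly_Mapping.single i r) = r \<odot>\<^bsub>V\<^esub> b i"
  by (cases "r = 0") (simp_all add: lincomb_def Pi_def)

lemma vspan_zero: "\<zero>\<^bsub>V\<^esub> \<in> vspan V I b"
  unfolding vspan_def by (rule image_eqI[of _ _ 0]) simp_all

lemma vspan_base: "i \<in> I \<Longrightarrow> b i \<in> vspan V I b"
  unfolding vspan_def by (rule image_eqI[of _ _ "Poly_Mapping.single i 1"]) simp_all

lemma vspan_add: "\<lbrakk>x \<in> vspan V I b; y \<in> vspan V I b\<rbrakk> \<Longrightarrow> x \<oplus>\<^bsub>V\<^esub> y \<in> vspan V I b"
  unfolding vspan_def
proof (elim imageE CollectE)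
  fix c d assume "x = lincomb V b c" "Poly_Mapping.keys c \<subseteq> I" "y = lincomb V b d" "Poly_Mapping.keys d \<subseteq> I"
  then show "x \<oplus>\<^bsub>V\<^esub> y \<in> lincomb V b ` {c. Poly_Mapping.keys c \<subseteq> I}"
    using keys_add[of c d] by (intro image_eqI[of _ _ "c + d"]) (auto simp: lincomb_add)
qed

lemma vspan_smult: "x \<in> vspan V I b \<Longrightarrow> r \<odot>\<^bsub>V\<^esub> x \<in> vspan V I b"
  unfolding vspan_def
proof (elim imageE CollectE)
  fix c assume "x = lincomb V b c" "Poly_Mapping.keys c \<subseteq> I"
  then show "r \<odot>\<^bsub>V\<^esub> x \<in> lincomb V b ` {c. Poly_Mapping.keys c \<subseteq> I}"
    using keys_scale[of r c] by (intro image_eqI[of _ _ "Poly_Mapping.map ((*) r) c"]) (auto simp: lincomb_scale)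
qed

lemma vspan_finsum: "(\<And>j. j \<in> J \<Longrightarrow> g j \<in> vspan V I b) \<Longrightarrow> (\<Oplus>\<^bsub>V\<^esub>j\<in>J. g j) \<in> vspan V I b"
proof (induction J rule: infinite_finite_induct)
  case (insert j J)
  have "vspan V I b \<subseteq> carrier V" by (auto simp: vspan_def)
  then show ?case using insert by (subst M.finsum_insert) (auto intro!: vspan_add)
qed (simp_all add: vspan_zero)

lemma is_basisI:
  assumes "carrier V \<subseteq> vspan V I b"
    and indep: "\<And>c. Poly_Mapping.keys c \<subseteq> I \<Longrightarrow> lincomb V b c = \<zero>\<^bsub>V\<^esub> \<Longrightarrow> c = 0"
  shows "is_basis V I b"
  unfolding is_basis_def lincomb_def[symmetric]
proof (intro conjI ballI)
  fix x assume "x \<in> carrier V"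
  then obtain c where c: "Poly_Mapping.keys c \<subseteq> I" "x = lincomb V b c" using assms(1) unfolding vspan_def by blast
  show "\<exists>!c. Poly_Mapping.keys c \<subseteq> I \<and> x = lincomb V b c"
  proof (rule ex1I[of _ c])
    fix d assume d: "Poly_Mapping.keys d \<subseteq> I \<and> x = lincomb V b d"
    \<comment> \<open>The negative of c, written as a scalar multiple because \<open>lincomb\<close>
      is known to respect sums and scalars.\<close>
    let ?m = "Poly_Mapping.map ((*) (-1)) c"
    have k: "Poly_Mapping.keys ?m \<subseteq> I" by (rule order_trans[OF keys_scale c(1)])
    have "lincomb V b (d + ?m) = x \<oplus>\<^bsub>V\<^esub> (- 1) \<odot>\<^bsub>V\<^esub> x"
      using lincomb_add[OF conjunct1[OF d] k] lincomb_scale[OF c(1), of "- 1"]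
      by (simp only: c(2)[symmetric] conjunct2[OF d, symmetric])
    also have "\<dots> = \<zero>\<^bsub>V\<^esub>"
      using \<open>x \<in> carrier V\<close> by (simp add: kk_smult_minus M.r_neg)
    finally have "d + ?m = 0"
      using d k keys_add[of d ?m] by (intro indep) auto
    then have "Poly_Mapping.lookup (d + ?m) i = 0" for i by simp
    then show "d = c" by (intro poly_mapping_eqI) (simp add: lookup_add)
  qed (use c in simp)
qed (fact family)

lemma lincomb_hom:
  assumes W: "module kk W" and f: "f \<in> mod_hom kk V W" and c: "Poly_Mapping.keys c \<subseteq> I"
  shows "f (lincomb V b c) = lincomb W (\<lambda>i. f (b i)) c"
proof -
  interpret W: module kk W by fact
  have "f (lincomb V b c) = (\<Oplus>\<^bsub>W\<^esub>i\<in>Poly_Mapping.keys c. f (Poly_Mapping.lookup c i \<odot>\<^bsub>V\<^esub> b i))"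
    unfolding lincomb_def using c
    by (intro add_hom_finsum[OF mod_hom_add_hom[OF f]]) (auto intro: M.abelian_group_axioms W.abelian_group_axioms)
  also have "\<dots> = lincomb W (\<lambda>i. f (b i)) c"
    unfolding lincomb_def using c add_hom_closed[OF mod_hom_add_hom[OF f]]
    by (intro W.finsum_cong') (auto simp: mod_hom_smult[OF f] subset_iff)
  finally show ?thesis .
qed

text \<open>Applying \<delta> i to a vanishing combination isolates its coefficient at i.
  Independence is obtained this way for idempotents, lines, extensions and, above all, induced
  modules, where coefficients cannot be read off a coset.\<close>

lemma is_basis_dualI:
  assumes "carrier V \<subseteq> vspan V I b"
    and hom: "\<And>i. i \<in> I \<Longrightarrow> \<delta> i \<in> mod_hom kk V (ring_as_module kk)"
    and dual: "\<And>i j. i \<in> I \<Longrightarrow> j \<in> I \<Longrightarrow> \<delta> i (b j) = of_bool (i = j)"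
  shows "is_basis V I b"
proof (rule is_basisI)
  fix c assume c: "Poly_Mapping.keys c \<subseteq> I" and 0: "lincomb V b c = \<zero>\<^bsub>V\<^esub>"
  show "c = 0"
  proof (rule poly_mapping_eqI)
    fix i
    show "Poly_Mapping.lookup c i = Poly_Mapping.lookup 0 i"
    proof (cases "i \<in> I")
      case True
      have *: "lincomb (ring_as_module kk) (\<lambda>j. \<delta> i (b j)) c = (\<Sum>j\<in>Poly_Mapping.keys c. Poly_Mapping.lookup c j * \<delta> i (b j))"
        by (simp add: lincomb_def)
      have "\<delta> i \<zero>\<^bsub>V\<^esub> = 0"
        using hom[OF True] smult_r_null[of 0] by (metis M.zero_closed functional_iff mult_zero_left UNIV_I kk_simps(1))
      then have "0 = (\<Sum>j\<in>Poly_Mapping.keys c. Poly_Mapping.lookup c j * \<delta> i (b j))"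
        using lincomb_hom[OF module_kk_self hom[OF True] c] 0 * by simp
      also have "\<dots> = (\<Sum>j\<in>Poly_Mapping.keys c. if j = i then Poly_Mapping.lookup c j else 0)"
        using dual[OF True] c by (intro sum.cong) (auto simp: subset_iff)
      also have "\<dots> = Poly_Mapping.lookup c i"
        by (simp add: in_keys_iff)
      finally show ?thesis by simp
    qed (use c in \<open>auto simp: in_keys_iff\<close>)
  qed
qed (fact assms(1))

end

section \<open>Coordinates and linear extension\<close>

locale basis_module = kk_space V
  for V :: "('k::field_char_0, 'v, 'x) module_scheme" +
  fixes I :: "'i set" and b :: "'i \<Rightarrow> 'v"
  assumes basis: "is_basis V I b"
begin

sublocale vector_family V I b
  using basis by unfold_locales (simp add: is_basis_def)

definition coord :: "'v \<Rightarrow> 'i \<Rightarrow>\<^sub>0 'k" where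
  "coord x = (THE c. Poly_Mapping.keys c \<subseteq> I \<and> x = lincomb V b c)"

lemma ex1_coord: "x \<in> carrier V \<Longrightarrow> \<exists>!c. Poly_Mapping.keys c \<subseteq> I \<and> x = lincomb V b c"
  using basis by (simp add: is_basis_def lincomb_def)

lemma coord:
  assumes "x \<in> carrier V"
  shows keys_coord: "Poly_Mapping.keys (coord x) \<subseteq> I" and lincomb_coord: "lincomb V b (coord x) = x"
  using theI'[OF ex1_coord[OF assms]] by (auto simp: coord_def)

lemma coord_lincomb: "Poly_Mapping.keys c \<subseteq> I \<Longrightarrow> coord (lincomb V b c) = c"
  unfolding coord_def using ex1_coord[of "lincomb V b c"] by (intro the1_equality) auto

lemma coord_add: "\<lbrakk>x \<in> carrier V; y \<in> carrier V\<rbrakk> \<Longrightarrow> coord (x \<oplus>\<^bsub>V\<^esub> y) = coord x + coord y"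
  using coord_lincomb[of "coord x + coord y"] keys_add[of "coord x" "coord y"] keys_coord
  by (simp add: lincomb_add lincomb_coord subset_iff) blast

lemma coord_smult: "x \<in> carrier V \<Longrightarrow> coord (r \<odot>\<^bsub>V\<^esub> x) = Poly_Mapping.map ((*) r) (coord x)"
  using coord_lincomb[of "Poly_Mapping.map ((*) r) (coord x)"] keys_scale[of r "coord x"] keys_coord[of x]
  by (simp add: lincomb_scale lincomb_coord)

lemma coord_base: "i \<in> I \<Longrightarrow> coord (b i) = Poly_Mapping.single i 1"
  using coord_lincomb[of "Poly_Mapping.single i 1"] smult_one[of "b i"] by simp

lemma coord_functional: "(\<lambda>x. Poly_Mapping.lookup (coord x) i) \<in> mod_hom kk V (ring_as_module kk)"
  by (simp add: functional_iff coord_add coord_smult lookup_add)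

lemma mod_hom_ext:
  assumes W: "module kk W" and f: "f \<in> mod_hom kk V W" and g: "g \<in> mod_hom kk V W"
    and x: "x \<in> carrier V" and eq: "\<And>i. i \<in> I \<Longrightarrow> f (b i) = g (b i)"
  shows "f x = g x"
proof -
  interpret W: module kk W by fact
  note k = keys_coord[OF x]
  have "lincomb W (\<lambda>i. f (b i)) (coord x) = lincomb W (\<lambda>i. g (b i)) (coord x)"
    unfolding lincomb_def using k eq add_hom_closed[OF mod_hom_add_hom[OF g]]
    by (intro W.finsum_cong') (auto simp: subset_iff)
  then show ?thesis
    using lincomb_hom[OF W f k] lincomb_hom[OF W g k] by (simp add: lincomb_coord x)
qed

lemma linear_extension_eq: "linear_extension V I b W f x = lincomb W f (coord x)"
  by (simp add: linear_extension_def lincomb_def coord_def Let_def)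

lemma
  assumes W: "module kk W" and f: "\<And>i. i \<in> I \<Longrightarrow> f i \<in> carrier W"
  shows linear_extension_hom: "linear_extension V I b W f \<in> mod_hom kk V W"
    and linear_extension_base: "\<And>i. i \<in> I \<Longrightarrow> linear_extension V I b W f (b i) = f i"
proof -
  interpret W: module kk W by fact
  interpret W: vector_family W I f by unfold_locales (use f in blast)
  show "linear_extension V I b W f \<in> mod_hom kk V W"
    unfolding linear_extension_eq[abs_def]
    by (rule mod_homI[OF add_homI])
      (simp_all add: keys_coord coord_add coord_smult W.lincomb_add W.lincomb_scale)
  show "linear_extension V I b W f (b i) = f i" if "i \<in> I" for i
    using that W.smult_one[of "f i"] f by (simp add: linear_extension_eq coord_base)
qed

end

lemma (in assoc_algebra) tensor_mult_closed:
  "\<lbrakk>s \<in> carrier T.T; t \<in> carrier T.T\<rbrakk> \<Longrightarrow> s \<otimes>\<^bsub>T.T\<^esub> t \<in> carrier T.T"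
  using add_hom_closed[OF tensor_mult_hom_left] by blast

section \<open>Restricting set partitions\<close>

abbreviation meet_n :: "nat set set \<Rightarrow> nat \<Rightarrow> nat set set \<Rightarrow> nat set set" where
  "meet_n A n B \<equiv> A \<sqinter>\<^bsub>partition_lattice n\<^esub> B"

text \<open>\<open>lo\<close> and \<open>hi\<close> are the restrictions of C to the points up to n
  and, shifted down, to the points after n. Blocks may leave an empty trace, which is removed; the
  half-line in \<open>hi\<close> spares the total size as a parameter.\<close>

definition lo :: "nat \<Rightarrow> nat set set \<Rightarrow> nat set set" where
  "lo n C = (\<inter>) {1..n} ` C - {{}}"

definition hi :: "nat \<Rightarrow> nat set set \<Rightarrow> nat set set" where
  "hi n C = (-`) (\<lambda>i. n + i) ` ((\<inter>) {n + 1..} ` C - {{}}) - {{}}"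

lemma lo:
  assumes "C \<in> set_partitions (n + m)"
  shows lo_partition: "lo n C \<in> set_partitions n"
    and same_block_lo: "same_block (lo n C) a b \<longleftrightarrow> a \<in> {1..n} \<and> b \<in> {1..n} \<and> same_block C a b"
proof -
  have "{1..n} \<inter> {1..n + m} = {1..n}" by auto
  then show "lo n C \<in> set_partitions n"
    using partition_on_restrict[of "{1..n + m}" C "{1..n}"] assms by (simp add: set_partitions_def lo_def)
  show "same_block (lo n C) a b \<longleftrightarrow> a \<in> {1..n} \<and> b \<in> {1..n} \<and> same_block C a b"
    unfolding same_block_def lo_def by blast
qed

lemma hi:
  assumes "C \<in> set_partitions (n + m)"
  shows hi_partition: "hi n C \<in> set_partitions m"
    and same_block_hi: "same_block (hi n C) a b \<longleftrightarrow> 0 < a \<and> 0 < b \<and> same_block C (n + a) (n + b)"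
proof -
  have *: "partition_on ({n + 1..} \<inter> {1..n + m}) ((\<inter>) {n + 1..} ` C - {{}})"
    using partition_on_restrict assms unfolding set_partitions_def by blast
  have "(+) n -` ({n + 1..} \<inter> {1..n + m}) = {1..m}" by auto
  then show "hi n C \<in> set_partitions m"
    using partition_on_vimage[OF *, of "(+) n"] by (simp add: set_partitions_def hi_def)
  show "same_block (hi n C) a b \<longleftrightarrow> 0 < a \<and> 0 < b \<and> same_block C (n + a) (n + b)"
  proof
    assume "same_block (hi n C) a b"
    then obtain q where q: "q \<in> hi n C" "a \<in> q" "b \<in> q" unfolding same_block_def by blast
    then obtain p where "p \<in> C" "q = (+) n -` ({n + 1..} \<inter> p)" unfolding hi_def by blast
    then show "0 < a \<and> 0 < b \<and> same_block C (n + a) (n + b)"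
      using q by (auto simp: same_block_def)
  next
    assume "0 < a \<and> 0 < b \<and> same_block C (n + a) (n + b)"
    then obtain p where p: "0 < a" "0 < b" "p \<in> C" "n + a \<in> p" "n + b \<in> p"
      unfolding same_block_def by blast
    then have "n + a \<in> {n + 1..} \<inter> p" "n + b \<in> {n + 1..} \<inter> p" by auto
    moreover from this p have "(+) n -` ({n + 1..} \<inter> p) \<in> hi n C"
      unfolding hi_def by (intro DiffI imageI) blast+
    ultimately show "same_block (hi n C) a b"
      unfolding same_block_def by (meson vimageI2)
  qed
qed

text \<open>Meeting with 1|1 separates the points up to n from those after n and changes nothing
  else. The index set of the product of two monomial functions is therefore a fibre of the pair of
  restrictions, the form in which it returns as the set of constituents of an induced
  module.\<close>

lemma meet_concat_top_iff:
  assumes A: "A \<in> set_partitions n" and B: "B \<in> set_partitions m" and C: "C \<in> set_partitions (n + m)"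
  shows "meet_n C (n + m) (concat_partition n (top_partition n) (top_partition m)) = concat_partition n A B
    \<longleftrightarrow> lo n C = A \<and> hi n C = B"
proof -
  note T = concat_partition[OF top_partition(1)[of n] top_partition(1)[of m]]
  note AB = concat_partition[OF A B]
  note K = partition_meet[OF C T(1)]
  show ?thesis
  proof
    assume "meet_n C (n + m) (concat_partition n (top_partition n) (top_partition m)) = concat_partition n A B"
    then have *: "same_block C a b \<and> (a \<in> {1..n} \<and> b \<in> {1..n} \<or> n < a \<and> n < b \<and> a - n \<in> {1..m} \<and> b - n \<in> {1..m}) \<longleftrightarrow>
        same_block A a b \<or> n < a \<and> n < b \<and> same_block B (a - n) (b - n)" for a b
      using K(2)[of a b] AB(2)[of a b] T(2)[of a b] by (simp add: top_partition(2))
    have "same_block (lo n C) a b \<longleftrightarrow> same_block A a b" for a b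
      using *[of a b] same_block_in[OF A, of a b] by (auto simp: same_block_lo[OF C])
    moreover have "same_block (hi n C) a b \<longleftrightarrow> same_block B a b" for a b
      using *[of "n + a" "n + b"] same_block_in[OF A, of "n + a" "n + b"] same_block_in[OF B, of a b]
        same_block_in[OF C, of "n + a" "n + b"]
      by (auto simp: same_block_hi[OF C])
    ultimately show "lo n C = A \<and> hi n C = B"
      using partition_eqI lo_partition[OF C] hi_partition[OF C] A B by blast
  next
    assume "lo n C = A \<and> hi n C = B"
    then have A': "same_block A a b \<longleftrightarrow> a \<in> {1..n} \<and> b \<in> {1..n} \<and> same_block C a b"
      and B': "same_block B a b \<longleftrightarrow> 0 < a \<and> 0 < b \<and> same_block C (n + a) (n + b)" for a b
      using same_block_lo[OF C] same_block_hi[OF C] by auto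
    show "meet_n C (n + m) (concat_partition n (top_partition n) (top_partition m)) = concat_partition n A B"
    proof (rule partition_eqI[OF K(1) AB(1)])
      fix a b
      show "same_block (meet_n C (n + m) (concat_partition n (top_partition n) (top_partition m))) a b
          \<longleftrightarrow> same_block (concat_partition n A B) a b"
        unfolding K(2) AB(2) T(2) top_partition(2) A' B'
        using same_block_in[OF C, of a b] by auto
    qed
  qed
qed

text \<open>A meet relates two points iff both partitions do, and restriction only limits the points
  considered.\<close>

lemma lo_meet:
  assumes "C \<in> set_partitions (n + m)" "D \<in> set_partitions (n + m)"
  shows "lo n (meet_n C (n + m) D) = meet_n (lo n C) n (lo n D)"
  using assms
  by (intro partition_eqI[of _ n]) (auto simp: lo_partition[of _ n m] same_block_lo[of _ n m] partition_meet)

lemma hi_meet: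
  assumes "C \<in> set_partitions (n + m)" "D \<in> set_partitions (n + m)"
  shows "hi n (meet_n C (n + m) D) = meet_n (hi n C) m (hi n D)"
  using assms
  by (intro partition_eqI[of _ m])
    (auto simp: hi_partition[of _ n m] same_block_hi[of _ n m] partition_meet)

lemma lo_top: "lo n (top_partition (n + m)) = top_partition n"
  by (rule partition_eqI[OF lo_partition[OF top_partition(1)] top_partition(1)])
    (auto simp: same_block_lo[OF top_partition(1)] top_partition(2))

lemma hi_top: "hi n (top_partition (n + m)) = top_partition m"
  by (rule partition_eqI[OF hi_partition[OF top_partition(1)] top_partition(1)])
    (auto simp: same_block_hi[OF top_partition(1)] top_partition(2))

lemma meet_assoc:
  assumes "A \<in> set_partitions n" "B \<in> set_partitions n" "C \<in> set_partitions n"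
  shows "meet_n (meet_n A n B) n C = meet_n A n (meet_n B n C)"
  using assms by (intro partition_eqI[of _ n]) (auto simp: partition_meet)

lemma meet_top:
  assumes "A \<in> set_partitions n"
  shows "meet_n (top_partition n) n A = A" and "meet_n A n (top_partition n) = A"
proof -
  have "same_block A a b \<Longrightarrow> a \<in> {1..n} \<and> b \<in> {1..n}" for a b
    using same_block_in[OF assms] .
  then show "meet_n (top_partition n) n A = A" "meet_n A n (top_partition n) = A"
    using assms by (intro partition_eqI[of _ n]; auto simp: partition_meet top_partition)+
qed

lemma set_partitions_0: "set_partitions 0 = {{}}"
  by (auto simp: set_partitions_def partition_on_empty)

lemma top_partition_0: "top_partition 0 = {}"
  by (simp add: top_partition_def)


section \<open>Algebras with the product of monomial functions\<close>

definition meet_pairs :: "nat \<Rightarrow> nat set set \<Rightarrow> (nat set set \<times> nat set set) set" where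
  "meet_pairs n A = {p \<in> set_partitions n \<times> set_partitions n. meet_n (fst p) n (snd p) = A}"

definition glued :: "nat \<Rightarrow> nat \<Rightarrow> nat set set \<Rightarrow> nat set set \<Rightarrow> nat set set set" where
  "glued n m A B = {C \<in> set_partitions (n + m). lo n C = A \<and> hi n C = B}"

lemma finite_meet_pairs [simp]: "finite (meet_pairs n A)"
  by (simp add: meet_pairs_def finite_set_partitions)

lemma finite_glued [simp]: "finite (glued n m A B)"
  by (simp add: glued_def finite_set_partitions)

lemma glued_eq:
  assumes "A \<in> set_partitions n" "B \<in> set_partitions m"
  shows "{C \<in> set_partitions (n + m). meet_n C (n + m) (concat_partition n (top_partition n) (top_partition m)) =
    concat_partition n A B} = glued n m A B"
  unfolding glued_def using meet_concat_top_iff[OF assms] by blast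

text \<open>Both \<open>NCSym\<close> and \<open>K0\<close> are instances; each receives the
  bialgebra axioms, and the two receive their isomorphism, from the multiplication table of the
  basis alone.\<close>

locale partition_algebra = assoc_algebra "kk :: 'k ring" V
  for V :: "('k::field_char_0, 'v, 'x) module_scheme" +
  fixes b :: "nat \<times> nat set set \<Rightarrow> 'v"
  assumes is_basis: "is_basis V graded_partitions b"
    and one_eq: "\<one>\<^bsub>V\<^esub> = b (0, {})"
    and mult_base: "\<lbrakk>A \<in> set_partitions n; B \<in> set_partitions m\<rbrakk> \<Longrightarrow>
      b (n, A) \<otimes>\<^bsub>V\<^esub> b (m, B) = (\<Oplus>\<^bsub>V\<^esub>C\<in>glued n m A B. b (n + m, C))"
begin

sublocale basis_module V graded_partitions b
  by unfold_locales (rule is_basis)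

sublocale TT: tensor_modules kk V T.T
  by unfold_locales

sublocale TT': tensor_modules kk T.T V
  by unfold_locales

abbreviation "\<Delta> \<equiv> internal_coproduct V b"

text \<open>On the dual basis the coproduct becomes the meet, degree by degree. The unit of the meet
  is the top partition, and the counit is that unit.\<close>

definition counit :: "'v \<Rightarrow> 'k" where
  "counit = linear_extension V graded_partitions b (ring_as_module kk) (\<lambda>(n, A). of_bool (A = top_partition n))"

lemma base_closed [simp]: "A \<in> set_partitions n \<Longrightarrow> b (n, A) \<in> carrier V"
  by (simp add: graded_partitions_def)

lemma coproduct_eq: "\<Delta> = linear_extension V graded_partitions b T.T
    (\<lambda>(n, A). \<Oplus>\<^bsub>T.T\<^esub>p\<in>meet_pairs n A. T.pure (b (n, fst p)) (b (n, snd p)))"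
proof -
  have "{(B, C). (B, C) \<in> set_partitions n \<times> set_partitions n \<and> meet_n B n C = A} = meet_pairs n A" for n A
    by (auto simp: meet_pairs_def)
  then show ?thesis
    by (simp add: internal_coproduct_def case_prod_unfold meet_pairs_def conj_commute
        cong: conj_cong)
qed

lemma coproduct_hom: "\<Delta> \<in> mod_hom kk V T.T"
  unfolding coproduct_eq
  by (rule linear_extension_hom) (auto intro!: T.T.finsum_closed T.T.module_axioms simp: graded_partitions_def meet_pairs_def T.module_T)

lemma coproduct_base:
  "A \<in> set_partitions n \<Longrightarrow> \<Delta> (b (n, A)) = (\<Oplus>\<^bsub>T.T\<^esub>p\<in>meet_pairs n A. T.pure (b (n, fst p)) (b (n, snd p)))"
  unfolding coproduct_eq
  by (subst linear_extension_base) (auto intro!: T.T.finsum_closed simp: graded_partitions_def meet_pairs_def T.module_T)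

lemma counit_hom: "counit \<in> mod_hom kk V (ring_as_module kk)"
  unfolding counit_def by (rule linear_extension_hom) (auto simp: module_kk_self)

lemma counit_base: "A \<in> set_partitions n \<Longrightarrow> counit (b (n, A)) = of_bool (A = top_partition n)"
  unfolding counit_def
  by (subst linear_extension_base) (auto simp: module_kk_self graded_partitions_def)

lemma hom_ext:
  assumes "module kk W" "f \<in> mod_hom kk V W" "g \<in> mod_hom kk V W" "x \<in> carrier V"
    and "\<And>n A. A \<in> set_partitions n \<Longrightarrow> f (b (n, A)) = g (b (n, A))"
  shows "f x = g x"
  by (rule mod_hom_ext[OF assms(1-4)]) (auto simp: graded_partitions_def assms(5))

text \<open>Both sides expand into the sum over all triples of partitions of n with meet A.\<close>

lemma coassociative:
  assumes x: "x \<in> carrier V"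
  shows "tensor_assoc kk V V V (tensor_map kk T.T V \<Delta> (\<lambda>a. a) (\<Delta> x)) = tensor_map kk V T.T (\<lambda>a. a) \<Delta> (\<Delta> x)"
proof -
  have id: "(\<lambda>a. a) \<in> mod_hom kk V V" by (rule mod_homI[OF add_homI]) simp_all
  have mV: "module kk V" by unfold_locales
  note ma = tensor_assoc_hom[OF mV mV mV]
  note ml = T.tensor_map_hom[OF T.module_T mV coproduct_hom id]
  note mr = T.tensor_map_hom[OF mV T.module_T id coproduct_hom]
  note ml' = T.tensor_map_pure[OF T.module_T mV coproduct_hom id]
  note mr' = T.tensor_map_pure[OF mV T.module_T id coproduct_hom]
  let ?t = "\<lambda>n z. TT.pure (b (n, fst z)) (T.pure (b (n, fst (snd z))) (b (n, snd (snd z))))"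
  let ?X = "\<lambda>n A. {z \<in> set_partitions n \<times> set_partitions n \<times> set_partitions n. meet_n (fst z) n (meet_n (fst (snd z)) n (snd (snd z))) = A}"
  show ?thesis
  proof (rule hom_ext[OF TT.module_T _ _ x])
    show "(\<lambda>x. tensor_assoc kk V V V (tensor_map kk T.T V \<Delta> (\<lambda>a. a) (\<Delta> x))) \<in> mod_hom kk V TT.T"
      using mod_hom_comp[OF coproduct_hom mod_hom_comp[OF ml ma]] .
    show "(\<lambda>x. tensor_map kk V T.T (\<lambda>a. a) \<Delta> (\<Delta> x)) \<in> mod_hom kk V TT.T"
      using mod_hom_comp[OF coproduct_hom mr] .
    fix n A assume A: "A \<in> set_partitions n"
    have in1: "fst p \<in> set_partitions n" "snd p \<in> set_partitions n" if "p \<in> meet_pairs n B" for p B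
      using that by (auto simp: meet_pairs_def)
    note bc = base_closed[OF in1(1)] base_closed[OF in1(2)]
    \<comment> \<open>A triple determines the intermediate partition of the iterated coproduct: the
      meet of its first two entries here, of its last two in \<open>img2\<close>. That gives the
      witnesses, and also the injectivity of the two reindexings.\<close>
    have img1: "(\<lambda>z. (fst (snd z), snd (snd z), snd (fst z))) ` (SIGMA p:meet_pairs n A. meet_pairs n (fst p)) = ?X n A"
    proof (intro equalityI subsetI)
      fix z assume "z \<in> ?X n A"
      then show "z \<in> (\<lambda>z. (fst (snd z), snd (snd z), snd (fst z))) ` (SIGMA p:meet_pairs n A. meet_pairs n (fst p))"
        by (intro image_eqI[of _ _ "((meet_n (fst z) n (fst (snd z)), snd (snd z)), (fst z, fst (snd z)))"])
          (auto simp: meet_pairs_def meet_assoc partition_meet)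
    qed (auto simp: meet_pairs_def meet_assoc)
    have img2: "?X n A = (\<lambda>z. (fst (fst z), snd z)) ` (SIGMA p:meet_pairs n A. meet_pairs n (snd p))"
    proof (intro equalityI subsetI)
      fix z assume "z \<in> ?X n A"
      then show "z \<in> (\<lambda>z. (fst (fst z), snd z)) ` (SIGMA p:meet_pairs n A. meet_pairs n (snd p))"
        by (intro image_eqI[of _ _ "((fst z, meet_n (fst (snd z)) n (snd (snd z))), snd z)"])
          (auto simp: meet_pairs_def partition_meet)
    qed (auto simp: meet_pairs_def)
    have "tensor_assoc kk V V V (tensor_map kk T.T V \<Delta> (\<lambda>a. a) (\<Delta> (b (n, A)))) =
        (\<Oplus>\<^bsub>TT.T\<^esub>p\<in>meet_pairs n A. tensor_assoc kk V V V (tensor_map kk T.T V \<Delta> (\<lambda>a. a) (T.pure (b (n, fst p)) (b (n, snd p)))))"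
      unfolding coproduct_base[OF A]
      by (rule add_hom_finsum[OF mod_hom_add_hom[OF mod_hom_comp[OF ml ma]] T.abelian_group_T TT.abelian_group_T])
        (simp add: bc)
    also have "\<dots> = (\<Oplus>\<^bsub>TT.T\<^esub>p\<in>meet_pairs n A. \<Oplus>\<^bsub>TT.T\<^esub>q\<in>meet_pairs n (fst p). ?t n (fst q, snd q, snd p))"
    proof (rule TT.T.finsum_cong')
      fix p assume p: "p \<in> meet_pairs n A"
      have *: "tensor_map kk T.T V \<Delta> (\<lambda>a. a) (T.pure (b (n, fst p)) (b (n, snd p))) =
          (\<Oplus>\<^bsub>TT'.T\<^esub>q\<in>meet_pairs n (fst p). TT'.pure (T.pure (b (n, fst q)) (b (n, snd q))) (b (n, snd p)))"
        using p bc by (simp add: ml' coproduct_base[OF in1(1)] TT'.pure_finsum_left)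
      have "tensor_assoc kk V V V (tensor_map kk T.T V \<Delta> (\<lambda>a. a) (T.pure (b (n, fst p)) (b (n, snd p)))) =
          (\<Oplus>\<^bsub>TT.T\<^esub>q\<in>meet_pairs n (fst p). tensor_assoc kk V V V (TT'.pure (T.pure (b (n, fst q)) (b (n, snd q))) (b (n, snd p))))"
        unfolding * using p bc
        by (intro add_hom_finsum[OF mod_hom_add_hom[OF ma] TT'.abelian_group_T TT.abelian_group_T]) simp
      also have "\<dots> = (\<Oplus>\<^bsub>TT.T\<^esub>q\<in>meet_pairs n (fst p). ?t n (fst q, snd q, snd p))"
        using p bc by (intro TT.T.finsum_cong') (auto simp: tensor_assoc_pure[OF mV mV mV])
      finally show "tensor_assoc kk V V V (tensor_map kk T.T V \<Delta> (\<lambda>a. a) (T.pure (b (n, fst p)) (b (n, snd p)))) =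
        (\<Oplus>\<^bsub>TT.T\<^esub>q\<in>meet_pairs n (fst p). ?t n (fst q, snd q, snd p))" .
    qed (auto intro!: TT.T.finsum_closed simp: bc)
    also have "\<dots> = (\<Oplus>\<^bsub>TT.T\<^esub>z\<in>(SIGMA p:meet_pairs n A. meet_pairs n (fst p)). ?t n (fst (snd z), snd (snd z), snd (fst z)))"
      by (subst TT.T.finsum_Sigma) (auto simp: bc)
    also have "\<dots> = finsum TT.T (?t n) ((\<lambda>z. (fst (snd z), snd (snd z), snd (fst z))) ` (SIGMA p:meet_pairs n A. meet_pairs n (fst p)))"
      by (subst TT.T.finsum_reindex) (auto simp: bc inj_on_def meet_pairs_def)
    also have "\<dots> = finsum TT.T (?t n) ((\<lambda>z. (fst (fst z), snd z)) ` (SIGMA p:meet_pairs n A. meet_pairs n (snd p)))"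
      by (simp only: img1 img2)
    also have "\<dots> = (\<Oplus>\<^bsub>TT.T\<^esub>z\<in>(SIGMA p:meet_pairs n A. meet_pairs n (snd p)). ?t n (fst (fst z), snd z))"
      by (subst TT.T.finsum_reindex) (auto simp: bc inj_on_def meet_pairs_def)
    also have "\<dots> = (\<Oplus>\<^bsub>TT.T\<^esub>p\<in>meet_pairs n A. \<Oplus>\<^bsub>TT.T\<^esub>q\<in>meet_pairs n (snd p). ?t n (fst p, q))"
      by (subst TT.T.finsum_Sigma) (auto simp: bc)
    also have "\<dots> = (\<Oplus>\<^bsub>TT.T\<^esub>p\<in>meet_pairs n A. tensor_map kk V T.T (\<lambda>a. a) \<Delta> (T.pure (b (n, fst p)) (b (n, snd p))))"
      by (rule TT.T.finsum_cong')
        (auto simp: bc mr' coproduct_base[OF in1(2)] TT.pure_finsum_right intro!: TT.pure_closed T.T.finsum_closed)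
    also have "\<dots> = tensor_map kk V T.T (\<lambda>a. a) \<Delta> (\<Delta> (b (n, A)))"
      unfolding coproduct_base[OF A]
      by (rule add_hom_finsum[OF mod_hom_add_hom[OF mr] T.abelian_group_T TT.abelian_group_T, symmetric])
        (simp add: bc)
    finally show "tensor_assoc kk V V V (tensor_map kk T.T V \<Delta> (\<lambda>a. a) (\<Delta> (b (n, A)))) =
      tensor_map kk V T.T (\<lambda>a. a) \<Delta> (\<Delta> (b (n, A)))" .
  qed
qed

lemma counit_tensor:
  assumes x: "x \<in> carrier V"
  shows "tensor_lift V (\<lambda>a c. counit a \<odot>\<^bsub>V\<^esub> c) (\<Delta> x) = x" (is ?left)
    and "tensor_lift V (\<lambda>a c. counit c \<odot>\<^bsub>V\<^esub> a) (\<Delta> x) = x" (is ?right)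
proof -
  have mV: "module kk V" by unfold_locales
  have eps: "counit (u \<oplus>\<^bsub>V\<^esub> v) = counit u + counit v" "counit (r \<odot>\<^bsub>V\<^esub> u) = r * counit u"
    if "u \<in> carrier V" "v \<in> carrier V" for u v r
    using counit_hom that by (auto simp: functional_iff)
  have h: "(\<lambda>a. counit a \<odot>\<^bsub>V\<^esub> c) \<in> mod_hom kk V V" "(\<lambda>a. counit c \<odot>\<^bsub>V\<^esub> a) \<in> mod_hom kk V V"
    if "c \<in> carrier V" for c
    using that by (auto intro!: mod_homI add_homI simp: eps kk_smult_add kk_smult_mult smult_r_distr
        simp flip: kk_smult_mult mult.commute)
  note l = T.bilinear_lift_hom[OF mV h] T.bilinear_lift_pure[OF mV h]
  note r = T.bilinear_lift_hom[OF mV h(2,1)] T.bilinear_lift_pure[OF mV h(2,1)]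
  have id: "(\<lambda>a. a) \<in> mod_hom kk V V" by (rule mod_homI[OF add_homI]) simp_all
  have in1: "fst p \<in> set_partitions n" "snd p \<in> set_partitions n" if "p \<in> meet_pairs n B" for p n B
    using that by (auto simp: meet_pairs_def)
  note bc = base_closed[OF in1(1)] base_closed[OF in1(2)]
  show ?left
  proof (rule hom_ext[OF mV mod_hom_comp[OF coproduct_hom l(1)] id x])
    fix n A assume A: "A \<in> set_partitions n"
    have "tensor_lift V (\<lambda>a c. counit a \<odot>\<^bsub>V\<^esub> c) (\<Delta> (b (n, A))) =
        (\<Oplus>\<^bsub>V\<^esub>p\<in>meet_pairs n A. of_bool (fst p = top_partition n) \<odot>\<^bsub>V\<^esub> b (n, snd p))"
      unfolding coproduct_base[OF A]
      using bc in1 by (subst add_hom_finsum[OF mod_hom_add_hom[OF l(1)]])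
        (auto simp: l(2) counit_base M.abelian_group_axioms intro!: M.finsum_cong')
    \<comment> \<open>Only pairs that start with the top partition have a nonzero coefficient, and
      their second entry is then the meet itself, that is A.\<close>
    also have "\<dots> = (\<Oplus>\<^bsub>V\<^esub>p\<in>{(top_partition n, A)}. of_bool (fst p = top_partition n) \<odot>\<^bsub>V\<^esub> b (n, snd p))"
    proof (rule M.add.finprod_mono_neutral_cong_right)
      fix p assume p: "p \<in> meet_pairs n A - {(top_partition n, A)}"
      then have "fst p \<noteq> top_partition n" using meet_top(1) by (auto simp: meet_pairs_def)
      then show "of_bool (fst p = top_partition n) \<odot>\<^bsub>V\<^esub> b (n, snd p) = \<zero>\<^bsub>V\<^esub>"
        using p in1[of p n A] by simp
    qed (use A bc in \<open>auto simp: meet_pairs_def top_partition(1) meet_top(1) finite_set_partitions\<close>)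
    also have "\<dots> = b (n, A)" using A by simp
    finally show "tensor_lift V (\<lambda>a c. counit a \<odot>\<^bsub>V\<^esub> c) (\<Delta> (b (n, A))) = b (n, A)" .
  qed
  show ?right
  proof (rule hom_ext[OF mV mod_hom_comp[OF coproduct_hom r(1)] id x])
    fix n A assume A: "A \<in> set_partitions n"
    have "tensor_lift V (\<lambda>a c. counit c \<odot>\<^bsub>V\<^esub> a) (\<Delta> (b (n, A))) =
        (\<Oplus>\<^bsub>V\<^esub>p\<in>meet_pairs n A. of_bool (snd p = top_partition n) \<odot>\<^bsub>V\<^esub> b (n, fst p))"
      unfolding coproduct_base[OF A]
      using bc in1 by (subst add_hom_finsum[OF mod_hom_add_hom[OF r(1)]])
        (auto simp: r(2) counit_base M.abelian_group_axioms intro!: M.finsum_cong')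
    also have "\<dots> = (\<Oplus>\<^bsub>V\<^esub>p\<in>{(A, top_partition n)}. of_bool (snd p = top_partition n) \<odot>\<^bsub>V\<^esub> b (n, fst p))"
    proof (rule M.add.finprod_mono_neutral_cong_right)
      fix p assume p: "p \<in> meet_pairs n A - {(A, top_partition n)}"
      then have "snd p \<noteq> top_partition n" using meet_top(2) by (auto simp: meet_pairs_def)
      then show "of_bool (snd p = top_partition n) \<odot>\<^bsub>V\<^esub> b (n, fst p) = \<zero>\<^bsub>V\<^esub>"
        using p in1[of p n A] by simp
    qed (use A bc in \<open>auto simp: meet_pairs_def top_partition(1) meet_top(2) finite_set_partitions\<close>)
    also have "\<dots> = b (n, A)" using A by simp
    finally show "tensor_lift V (\<lambda>a c. counit c \<odot>\<^bsub>V\<^esub> a) (\<Delta> (b (n, A))) = b (n, A)" .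
  qed
qed

lemma counit_multiplicative:
  assumes x: "x \<in> carrier V" and y: "y \<in> carrier V"
  shows "counit (x \<otimes>\<^bsub>V\<^esub> y) = counit x * counit y"
proof -
  have eps: "counit (u \<oplus>\<^bsub>V\<^esub> v) = counit u + counit v" "counit (r \<odot>\<^bsub>V\<^esub> u) = r * counit u"
    if "u \<in> carrier V" "v \<in> carrier V" for u v r
    using counit_hom that by (auto simp: functional_iff)
  have base: "counit (b (n, A) \<otimes>\<^bsub>V\<^esub> b (m, B)) = counit (b (n, A)) * counit (b (m, B))"
    if A: "A \<in> set_partitions n" and B: "B \<in> set_partitions m" for n A m B
  proof -
    have "counit (b (n, A) \<otimes>\<^bsub>V\<^esub> b (m, B)) = (\<Sum>C\<in>glued n m A B. counit (b (n + m, C)))"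
      unfolding mult_base[OF that]
      by (subst add_hom_finsum[OF mod_hom_add_hom[OF counit_hom]])
        (auto simp: M.abelian_group_axioms module.axioms(2)[OF module_kk_self] glued_def finite_set_partitions)
    also have "\<dots> = (\<Sum>C\<in>glued n m A B. of_bool (C = top_partition (n + m)))"
      by (intro sum.cong) (auto simp: counit_base glued_def)
    also have "\<dots> = of_bool (top_partition (n + m) \<in> glued n m A B)"
      by (simp add: of_bool_def if_distrib sum.delta cong: if_cong)
    \<comment> \<open>Both restrictions of the top partition are top, so it lies in exactly one
      fibre.\<close>
    also have "\<dots> = of_bool (A = top_partition n) * of_bool (B = top_partition m)"
      by (auto simp: glued_def lo_top hi_top top_partition)
    finally show ?thesis using that by (simp add: counit_base)
  qed
  have 1: "counit (x \<otimes>\<^bsub>V\<^esub> b (m, B)) = counit x * counit (b (m, B))" if B: "B \<in> set_partitions m" for m B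
    by (rule hom_ext[OF module_kk_self _ _ x])
      (use B in \<open>auto simp: functional_iff eps base l_distr smult_mult_left algebra_simps\<close>)
  show ?thesis
    by (rule hom_ext[OF module_kk_self _ _ y])
      (use x in \<open>auto simp: functional_iff eps 1 r_distr smult_mult_right algebra_simps\<close>)
qed

text \<open>On the left stand the pairs (C, D) whose meet is glued from A and B. On the right stand
  a meet pair for A, one for B, a gluing of their first entries and a gluing of their second
  entries. Sorting the former by the restrictions of C and D gives the latter.\<close>

lemma coproduct_multiplicative:
  assumes x: "x \<in> carrier V" and y: "y \<in> carrier V"
  shows "\<Delta> (x \<otimes>\<^bsub>V\<^esub> y) = \<Delta> x \<otimes>\<^bsub>T.T\<^esub> \<Delta> y"
proof -
  note cl = add_hom_closed[OF mod_hom_add_hom[OF coproduct_hom]]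
  have in1: "fst p \<in> set_partitions n" "snd p \<in> set_partitions n" if "p \<in> meet_pairs n B" for p n B
    using that by (auto simp: meet_pairs_def)
  note bc = base_closed[OF in1(1)] base_closed[OF in1(2)]
  have gl: "C \<in> set_partitions (n + m)" if "C \<in> glued n m A B" for n m A B C
    using that by (simp add: glued_def)
  have base: "\<Delta> (b (n, A) \<otimes>\<^bsub>V\<^esub> b (m, B)) = \<Delta> (b (n, A)) \<otimes>\<^bsub>T.T\<^esub> \<Delta> (b (m, B))"
    if A: "A \<in> set_partitions n" and B: "B \<in> set_partitions m" for n A m B
  proof -
    let ?N = "n + m"
    let ?g = "\<lambda>p. T.pure (b (?N, fst p)) (b (?N, snd p))"
    \<comment> \<open>All pairs that occur in the coproducts of the terms of the product.\<close>
    let ?X = "{p \<in> set_partitions ?N \<times> set_partitions ?N. meet_n (fst p) ?N (snd p) \<in> glued n m A B}"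
    let ?G = "\<lambda>w. glued n m (fst (fst w)) (fst (snd w)) \<times> glued n m (snd (fst w)) (snd (snd w))"
    have gX: "?g p \<in> carrier T.T" if "p \<in> ?X" for p using that by auto
    have finX: "finite ?X" by (simp add: finite_set_partitions)
    have "\<Delta> (b (n, A) \<otimes>\<^bsub>V\<^esub> b (m, B)) = (\<Oplus>\<^bsub>T.T\<^esub>C\<in>glued n m A B. \<Delta> (b (?N, C)))"
      unfolding mult_base[OF that]
      by (rule add_hom_finsum[OF mod_hom_add_hom[OF coproduct_hom]]) (auto simp: M.abelian_group_axioms gl)
    also have "\<dots> = (\<Oplus>\<^bsub>T.T\<^esub>C\<in>glued n m A B. \<Oplus>\<^bsub>T.T\<^esub>p\<in>{p \<in> ?X. meet_n (fst p) ?N (snd p) = C}. ?g p)"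
    proof (rule T.T.finsum_cong')
      fix C assume C: "C \<in> glued n m A B"
      then have "{p \<in> ?X. meet_n (fst p) ?N (snd p) = C} = meet_pairs ?N C" by (auto simp: meet_pairs_def)
      then show "\<Delta> (b (?N, C)) = (\<Oplus>\<^bsub>T.T\<^esub>p\<in>{p \<in> ?X. meet_n (fst p) ?N (snd p) = C}. ?g p)"
        using coproduct_base[OF gl[OF C]] by simp
    qed (use gX in \<open>auto intro!: T.T.finsum_closed\<close>)
    also have "\<dots> = finsum T.T ?g ?X"
      by (rule T.T.finsum_fibres) (use gX finX in auto)
    also have "\<dots> = (\<Oplus>\<^bsub>T.T\<^esub>w\<in>meet_pairs n A \<times> meet_pairs m B. \<Oplus>\<^bsub>T.T\<^esub>p\<in>{p \<in> ?X.
        ((lo n (fst p), lo n (snd p)), (hi n (fst p), hi n (snd p))) = w}. ?g p)"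
    proof (rule T.T.finsum_fibres[symmetric])
      show "(\<lambda>p. ((lo n (fst p), lo n (snd p)), (hi n (fst p), hi n (snd p)))) ` ?X \<subseteq> meet_pairs n A \<times> meet_pairs m B"
        by (auto simp: glued_def meet_pairs_def lo_meet hi_meet lo_partition[of _ n m] hi_partition[of _ n m])
    qed (use gX finX in simp_all)
    also have "\<dots> = (\<Oplus>\<^bsub>T.T\<^esub>w\<in>meet_pairs n A \<times> meet_pairs m B. finsum T.T ?g (?G w))"
    proof (rule T.T.finsum_cong')
      fix w assume w: "w \<in> meet_pairs n A \<times> meet_pairs m B"
      \<comment> \<open>Membership in \<open>?X\<close> comes for free from the right: the meet of
        two gluings restricts to the meets of their parts, which are A and B.\<close>
      have "{p \<in> ?X. ((lo n (fst p), lo n (snd p)), (hi n (fst p), hi n (snd p))) = w} = ?G w"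
        using w by (auto simp: glued_def meet_pairs_def lo_meet hi_meet partition_meet)
      then show "(\<Oplus>\<^bsub>T.T\<^esub>p\<in>{p \<in> ?X. ((lo n (fst p), lo n (snd p)), (hi n (fst p), hi n (snd p))) = w}. ?g p) = finsum T.T ?g (?G w)"
        by simp
    qed (auto intro!: T.T.finsum_closed simp: gl)
    also have "\<dots> = (\<Oplus>\<^bsub>T.T\<^esub>w\<in>meet_pairs n A \<times> meet_pairs m B.
        T.pure (b (n, fst (fst w))) (b (n, snd (fst w))) \<otimes>\<^bsub>T.T\<^esub> T.pure (b (m, fst (snd w))) (b (m, snd (snd w))))"
    proof (rule T.T.finsum_cong')
      fix w assume w: "w \<in> meet_pairs n A \<times> meet_pairs m B"
      then have p: "fst (fst w) \<in> set_partitions n" "snd (fst w) \<in> set_partitions n"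
        "fst (snd w) \<in> set_partitions m" "snd (snd w) \<in> set_partitions m" by (auto simp: meet_pairs_def)
      have "T.pure (b (n, fst (fst w))) (b (n, snd (fst w))) \<otimes>\<^bsub>T.T\<^esub> T.pure (b (m, fst (snd w))) (b (m, snd (snd w)))
          = T.pure (\<Oplus>\<^bsub>V\<^esub>C\<in>glued n m (fst (fst w)) (fst (snd w)). b (?N, C)) (\<Oplus>\<^bsub>V\<^esub>D\<in>glued n m (snd (fst w)) (snd (snd w)). b (?N, D))"
        using p by (simp add: tensor_mult_pure mult_base)
      also have "\<dots> = (\<Oplus>\<^bsub>T.T\<^esub>C\<in>glued n m (fst (fst w)) (fst (snd w)). \<Oplus>\<^bsub>T.T\<^esub>D\<in>glued n m (snd (fst w)) (snd (snd w)). T.pure (b (?N, C)) (b (?N, D)))"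
        by (subst T.pure_finsum_left, (auto simp: gl intro!: M.finsum_closed)[2], rule T.T.finsum_cong')
          (auto simp: gl T.pure_finsum_right intro!: T.T.finsum_closed)
      also have "\<dots> = finsum T.T ?g (?G w)"
        by (subst T.T.finsum_Sigma) (auto simp: gl)
      finally show "finsum T.T ?g (?G w) =
        T.pure (b (n, fst (fst w))) (b (n, snd (fst w))) \<otimes>\<^bsub>T.T\<^esub> T.pure (b (m, fst (snd w))) (b (m, snd (snd w)))" ..
    qed (auto intro!: tensor_mult_closed T.pure_closed base_closed simp: meet_pairs_def)
    also have "\<dots> = (\<Oplus>\<^bsub>T.T\<^esub>p\<in>meet_pairs n A. \<Oplus>\<^bsub>T.T\<^esub>q\<in>meet_pairs m B.
        T.pure (b (n, fst p)) (b (n, snd p)) \<otimes>\<^bsub>T.T\<^esub> T.pure (b (m, fst q)) (b (m, snd q)))"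
      by (subst T.T.finsum_Sigma) (auto simp: tensor_mult_pure bc)
    also have "\<dots> = (\<Oplus>\<^bsub>T.T\<^esub>p\<in>meet_pairs n A. T.pure (b (n, fst p)) (b (n, snd p)) \<otimes>\<^bsub>T.T\<^esub> \<Delta> (b (m, B)))"
      unfolding coproduct_base[OF B]
      by (rule T.T.finsum_cong', simp)
        (auto simp: bc add_hom_finsum[OF tensor_mult_hom_right] add_hom_closed[OF tensor_mult_hom_right] intro!: T.T.finsum_closed)
    also have "\<dots> = \<Delta> (b (n, A)) \<otimes>\<^bsub>T.T\<^esub> \<Delta> (b (m, B))"
      unfolding coproduct_base[OF A]
      using B by (subst add_hom_finsum[OF tensor_mult_hom_left]) (auto simp: bc cl)
    finally show ?thesis .
  qed
  \<comment> \<open>From basis elements to all elements, one argument at a time, since both sides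
    are linear in each.\<close>
  have 1: "\<Delta> (x \<otimes>\<^bsub>V\<^esub> b (m, B)) = \<Delta> x \<otimes>\<^bsub>T.T\<^esub> \<Delta> (b (m, B))" if B: "B \<in> set_partitions m" for m B
  proof (rule hom_ext[OF T.module_T _ _ x])
    show "(\<lambda>x. \<Delta> (x \<otimes>\<^bsub>V\<^esub> b (m, B))) \<in> mod_hom kk V T.T"
      using B by (intro mod_hom_comp[OF mult_mod_hom_left coproduct_hom]) simp
    show "(\<lambda>x. \<Delta> x \<otimes>\<^bsub>T.T\<^esub> \<Delta> (b (m, B))) \<in> mod_hom kk V T.T"
      using B cl by (intro mod_hom_comp[OF coproduct_hom] mod_homI tensor_mult_hom_left) (simp_all add: tensor_mult_smult)
  qed (use B base in auto)
  show ?thesis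
  proof (rule hom_ext[OF T.module_T _ _ y])
    show "(\<lambda>y. \<Delta> (x \<otimes>\<^bsub>V\<^esub> y)) \<in> mod_hom kk V T.T"
      using x by (intro mod_hom_comp[OF mult_mod_hom_right coproduct_hom])
    show "(\<lambda>y. \<Delta> x \<otimes>\<^bsub>T.T\<^esub> \<Delta> y) \<in> mod_hom kk V T.T"
      using x cl by (intro mod_hom_comp[OF coproduct_hom] mod_homI tensor_mult_hom_right) (simp_all add: tensor_mult_smult)
  qed (use 1 in auto)
qed

lemma empty_in_set_partitions_0 [simp]: "{} \<in> set_partitions 0"
  by (simp add: set_partitions_0)

lemma bialgebra: "bialgebra kk V \<Delta> counit"
proof (intro bialgebra.intro bialgebra_axioms.intro)
  show "module kk V" "ring V" by unfold_locales
  show "\<Delta> \<one>\<^bsub>V\<^esub> = \<one>\<^bsub>T.T\<^esub>"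
  proof -
    \<comment> \<open>The only partition of the empty set is its own top, so the unit is
      grouplike.\<close>
    have "meet_pairs 0 {} = {({}, {})}"
      using meet_top(1)[of "{}" 0] by (auto simp: meet_pairs_def set_partitions_0 top_partition_0)
    then have "\<Delta> \<one>\<^bsub>V\<^esub> = T.pure (b (0, {})) (b (0, {}))"
      by (simp add: one_eq coproduct_base Pi_def)
    then show ?thesis by (simp add: tensor_def one_eq)
  qed
  show "counit \<one>\<^bsub>V\<^esub> = \<one>\<^bsub>kk\<^esub>" by (simp add: one_eq counit_base top_partition_0)
qed (simp_all add: smult_mult_left smult_mult_right coproduct_hom counit_hom coassociative counit_tensor
    coproduct_multiplicative counit_multiplicative)

end

text \<open>F matches two bases with the same multiplication table, the same coproduct and the same
  counit. Its inverse is the linear extension \<open>G\<close> in the opposite direction.\<close>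

lemma partition_algebra_iso:
  assumes V: "partition_algebra (V :: ('k::field_char_0, 'v, 'x) module_scheme) b"
    and W: "partition_algebra (W :: ('k, 'w, 'y) module_scheme) c"
  defines "F \<equiv> linear_extension V graded_partitions b W c"
  shows "bialgebra_iso kk V (internal_coproduct V b) (partition_algebra.counit V b)
     W (internal_coproduct W c) (partition_algebra.counit W c) F"
proof -
  interpret V: partition_algebra V b by fact
  interpret W: partition_algebra W c by fact
  have mV: "module kk V" and mW: "module kk W" by unfold_locales
  define G where "G = linear_extension W graded_partitions c V b"
  have F: "F \<in> mod_hom kk V W" and Fb: "\<And>n A. A \<in> set_partitions n \<Longrightarrow> F (b (n, A)) = c (n, A)"
    unfolding F_def using V.linear_extension_hom[OF mW, of c] V.linear_extension_base[OF mW, of c]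
    by (auto simp: graded_partitions_def)
  have G: "G \<in> mod_hom kk W V" and Gb: "\<And>n A. A \<in> set_partitions n \<Longrightarrow> G (c (n, A)) = b (n, A)"
    unfolding G_def using W.linear_extension_hom[OF mV, of b] W.linear_extension_base[OF mV, of b]
    by (auto simp: graded_partitions_def)
  have idV: "(\<lambda>a. a) \<in> mod_hom kk V V" and idW: "(\<lambda>a. a) \<in> mod_hom kk W W"
    by (rule mod_homI[OF add_homI]; simp)+
  note Fc = add_hom_closed[OF mod_hom_add_hom[OF F]] and Gc = add_hom_closed[OF mod_hom_add_hom[OF G]]
  have GF: "G (F x) = x" if "x \<in> carrier V" for x
    using that by (rule V.hom_ext[OF mV mod_hom_comp[OF F G] idV]) (simp add: Fb Gb)
  have FG: "F (G x) = x" if "x \<in> carrier W" for x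
    using that by (rule W.hom_ext[OF mW mod_hom_comp[OF G F] idW]) (simp add: Fb Gb)
  have bij: "bij_betw F (carrier V) (carrier W)"
    by (rule bij_betw_byWitness[of _ G]) (use GF FG Fc Gc in auto)
  have mult1: "F (x \<otimes>\<^bsub>V\<^esub> b (m, B)) = F x \<otimes>\<^bsub>W\<^esub> F (b (m, B))"
    if x: "x \<in> carrier V" and B: "B \<in> set_partitions m" for x m B
  proof (rule V.hom_ext[OF mW _ _ x])
    show "(\<lambda>x. F (x \<otimes>\<^bsub>V\<^esub> b (m, B))) \<in> mod_hom kk V W"
      using B by (intro mod_hom_comp[OF V.mult_mod_hom_left F]) simp
    show "(\<lambda>x. F x \<otimes>\<^bsub>W\<^esub> F (b (m, B))) \<in> mod_hom kk V W"
      using B by (intro mod_hom_comp[OF F W.mult_mod_hom_left]) (simp add: Fc)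
    fix n A assume A: "A \<in> set_partitions n"
    show "F (b (n, A) \<otimes>\<^bsub>V\<^esub> b (m, B)) = F (b (n, A)) \<otimes>\<^bsub>W\<^esub> F (b (m, B))"
      unfolding V.mult_base[OF A B] using A B
      by (subst add_hom_finsum[OF mod_hom_add_hom[OF F]])
        (auto simp: Fb W.mult_base V.M.abelian_group_axioms W.M.abelian_group_axioms glued_def intro!: W.M.finsum_cong')
  qed
  have mult: "F (x \<otimes>\<^bsub>V\<^esub> y) = F x \<otimes>\<^bsub>W\<^esub> F y" if x: "x \<in> carrier V" and y: "y \<in> carrier V" for x y
  proof (rule V.hom_ext[OF mW _ _ y])
    show "(\<lambda>y. F (x \<otimes>\<^bsub>V\<^esub> y)) \<in> mod_hom kk V W"
      using x by (intro mod_hom_comp[OF V.mult_mod_hom_right F])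
    show "(\<lambda>y. F x \<otimes>\<^bsub>W\<^esub> F y) \<in> mod_hom kk V W"
      using x by (intro mod_hom_comp[OF F W.mult_mod_hom_right]) (simp add: Fc)
  qed (use mult1 x in auto)
  note tm = V.T.tensor_map_hom[OF mW mW F F] and tp = V.T.tensor_map_pure[OF mW mW F F]
  have comult: "internal_coproduct W c (F x) = tensor_map kk W W F F (internal_coproduct V b x)"
    if "x \<in> carrier V" for x
    using that
  proof (rule V.hom_ext[OF W.T.module_T mod_hom_comp[OF F W.coproduct_hom] mod_hom_comp[OF V.coproduct_hom tm]])
    fix n A assume A: "A \<in> set_partitions n"
    show "internal_coproduct W c (F (b (n, A))) = tensor_map kk W W F F (internal_coproduct V b (b (n, A)))"
    proof -
      have "tensor_map kk W W F F (internal_coproduct V b (b (n, A))) =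
          (\<Oplus>\<^bsub>W.T.T\<^esub>p\<in>meet_pairs n A. tensor_map kk W W F F (V.T.pure (b (n, fst p)) (b (n, snd p))))"
        unfolding V.coproduct_base[OF A]
        by (rule add_hom_finsum[OF mod_hom_add_hom[OF tm] V.T.abelian_group_T W.T.abelian_group_T])
          (auto simp: meet_pairs_def)
      also have "\<dots> = internal_coproduct W c (c (n, A))"
        unfolding W.coproduct_base[OF A]
        by (rule W.T.T.finsum_cong') (auto simp: tp Fb meet_pairs_def)
      finally show ?thesis by (simp add: Fb A)
    qed
  qed
  have counit: "W.counit (F x) = V.counit x" if "x \<in> carrier V" for x
    using that by (rule V.hom_ext[OF module_kk_self mod_hom_comp[OF F W.counit_hom] V.counit_hom])
      (simp add: Fb V.counit_base W.counit_base)
  show ?thesis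
    unfolding bialgebra_iso_def using V.bialgebra W.bialgebra F bij mult comult counit
    by (simp add: V.one_eq W.one_eq Fb)
qed

section \<open>The join algebra\<close>

lemma
  assumes "C \<in> set_partitions n"
  shows same_block_refl: "a \<in> {1..n} \<Longrightarrow> same_block C a a"
    and same_block_sym: "same_block C a b \<Longrightarrow> same_block C b a"
    and same_block_trans: "same_block C a b \<Longrightarrow> same_block C b c \<Longrightarrow> same_block C a c"
proof -
  have C: "partition_on {1..n} C" using assms by (simp add: set_partitions_def)
  show "same_block C a a" if "a \<in> {1..n}"
    using that partition_onD1[OF C] by (auto simp: same_block_def)
  show "same_block C b a" if "same_block C a b" using that by (auto simp: same_block_def)
  show "same_block C a c" if ab: "same_block C a b" and bc: "same_block C b c"
  proof -
    obtain p q where "p \<in> C" "a \<in> p" "b \<in> p" "q \<in> C" "b \<in> q" "c \<in> q"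
      using ab bc unfolding same_block_def by blast
    moreover from this have "p = q" using partition_onD2[OF C] unfolding disjoint_def by blast
    ultimately show ?thesis unfolding same_block_def by blast
  qed
qed

lemma partition_of_equivalence:
  assumes dom: "\<And>a b. r a b \<Longrightarrow> a \<in> {1..n} \<and> b \<in> {1..n}"
    and refl: "\<And>a. a \<in> {1..n} \<Longrightarrow> r a a" and sym: "\<And>a b. r a b \<Longrightarrow> r b a"
    and trans: "\<And>a b c. r a b \<Longrightarrow> r b c \<Longrightarrow> r a c"
  obtains D where "D \<in> set_partitions n" "\<And>a b. same_block D a b \<longleftrightarrow> r a b"
proof
  let ?r = "{(a, b). r a b}"
  let ?D = "{1..n} // ?r"
  have "equiv {1..n} ?r"
  proof (rule equivI)
    show "?r \<subseteq> {1..n} \<times> {1..n}" using dom by blast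
    show "refl_on {1..n} ?r" using refl by (simp add: refl_on_def)
    show "Relation.sym ?r" using sym by (intro symI) blast
    show "Relation.trans ?r" using trans by (intro transI) blast
  qed
  then show D: "?D \<in> set_partitions n"
    by (simp add: set_partitions_def partition_on_quotient)
  show "same_block ?D a b \<longleftrightarrow> r a b" for a b
  proof
    assume "same_block ?D a b"
    then obtain c where "r c a" "r c b" unfolding same_block_def by (auto elim!: quotientE)
    then show "r a b" using sym trans by blast
  next
    assume r: "r a b"
    then have "?r `` {a} \<in> ?D" using dom by (intro quotientI) blast
    moreover have "a \<in> ?r `` {a}" "b \<in> ?r `` {a}" using r dom refl by blast+
    ultimately show "same_block ?D a b" unfolding same_block_def by (intro bexI conjI)
  qed
qed

section \<open>The refinement order and joins\<close>

definition ple :: "nat \<Rightarrow> nat set set \<Rightarrow> nat set set \<Rightarrow> bool" where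
  "ple n A B \<longleftrightarrow> refines {1..n} A B"

lemma ple_in: "ple n A B \<Longrightarrow> A \<in> set_partitions n" "ple n A B \<Longrightarrow> B \<in> set_partitions n"
  by (simp_all add: ple_def refines_def set_partitions_def)

lemma ple_iff_same_block:
  assumes "A \<in> set_partitions n" "B \<in> set_partitions n"
  shows "ple n A B \<longleftrightarrow> (\<forall>a b. same_block A a b \<longrightarrow> same_block B a b)"
  unfolding ple_def by (rule refines_iff_same_block[OF assms])

lemma ple_refl: "A \<in> set_partitions n \<Longrightarrow> ple n A A"
  by (simp add: ple_iff_same_block)

lemma ple_trans: "ple n A B \<Longrightarrow> ple n B C \<Longrightarrow> ple n A C"
  unfolding ple_def by (rule refines_trans)

lemma ple_asym: "ple n A B \<Longrightarrow> ple n B A \<Longrightarrow> A = B"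
  unfolding ple_def by (rule refines_asym)

lemma le_partition_lattice [simp]:
  "carrier (partition_lattice n) = set_partitions n" "A \<sqsubseteq>\<^bsub>partition_lattice n\<^esub> B \<longleftrightarrow> ple n A B"
  by (simp_all add: partition_lattice_def ple_def)

text \<open>The join is built from above, as the intersection of all common upper bounds viewed as
  equivalence relations. This yields its universal property directly, where a description by chains
  of overlapping blocks would need an induction.\<close>

lemma partition_join:
  assumes A: "A \<in> set_partitions n" and B: "B \<in> set_partitions n"
  shows "A \<squnion>\<^bsub>partition_lattice n\<^esub> B \<in> set_partitions n"
    and "ple n (A \<squnion>\<^bsub>partition_lattice n\<^esub> B) C \<longleftrightarrow> ple n A C \<and> ple n B C"
proof -
  let ?L = "partition_lattice n"
  let ?r = "\<lambda>a b. a \<in> {1..n} \<and> b \<in> {1..n} \<and>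
    (\<forall>C\<in>set_partitions n. ple n A C \<and> ple n B C \<longrightarrow> same_block C a b)"
  obtain D where D: "D \<in> set_partitions n" and sD: "\<And>a b. same_block D a b \<longleftrightarrow> ?r a b"
  proof (rule partition_of_equivalence[of ?r n])
    show "?r a b \<Longrightarrow> ?r b a" for a b using same_block_sym by blast
    show "?r a b \<Longrightarrow> ?r b c \<Longrightarrow> ?r a c" for a b c using same_block_trans by blast
  qed (use same_block_refl in blast)+
  have in_sp: "C \<in> set_partitions n" if "ple n E C" for E C
    using that ple_in by blast
  have AD: "ple n A D"
    unfolding ple_iff_same_block[OF A D] sD
    using same_block_in[OF A] ple_iff_same_block[OF A] by blast
  have BD: "ple n B D"
    unfolding ple_iff_same_block[OF B D] sD
    using same_block_in[OF B] ple_iff_same_block[OF B] by blast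
  have min: "ple n D C" if "ple n A C" "ple n B C" for C
    using that sD in_sp by (subst ple_iff_same_block[OF D]) blast+
  have up: "Upper ?L {A, B} = {C. ple n A C \<and> ple n B C}"
    using A B in_sp by (auto simp: Upper_def)
  have "least ?L E (Upper ?L {A, B}) \<longleftrightarrow> E = D" for E
  proof
    assume "least ?L E (Upper ?L {A, B})"
    then have "ple n A E" "ple n B E" "ple n E D"
      using AD BD unfolding least_def up by auto
    then show "E = D" using min ple_asym by blast
  next
    assume "E = D"
    then show "least ?L E (Upper ?L {A, B})"
      unfolding least_def up using AD BD min in_sp by auto
  qed
  then have eq: "A \<squnion>\<^bsub>?L\<^esub> B = D" by (simp add: join_def sup_def)
  show "A \<squnion>\<^bsub>?L\<^esub> B \<in> set_partitions n" using D eq by simp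
  show "ple n (A \<squnion>\<^bsub>?L\<^esub> B) C \<longleftrightarrow> ple n A C \<and> ple n B C"
    unfolding eq using min AD BD ple_trans by blast
qed

lemma bot_partition:
  shows bot_in: "bot_partition n \<in> set_partitions n"
    and bot_ple: "C \<in> set_partitions n \<Longrightarrow> ple n (bot_partition n) C"
proof -
  show b: "bot_partition n \<in> set_partitions n"
    using partition_on_singletons[of "{1..n}"] by (simp add: set_partitions_def bot_partition_def)
  show "ple n (bot_partition n) C" if C: "C \<in> set_partitions n"
    unfolding ple_iff_same_block[OF b C]
  proof (intro allI impI)
    fix i j assume "same_block (bot_partition n) i j"
    then have "i \<in> {1..n}" "j = i" unfolding same_block_def bot_partition_def by blast+
    then show "same_block C i j" using same_block_refl[OF C] by blast
  qed
qed

lemma finite_ple [simp]: "finite {B. ple n B A}" "finite {B. ple n A B}"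
  by (rule finite_subset[OF _ finite_set_partitions[of n]]; use ple_in in blast)+

section \<open>Characters of the join algebra\<close>

definition chi :: "nat \<Rightarrow> nat set set \<Rightarrow> 'k::field_char_0 part_vec \<Rightarrow> 'k" where
  "chi n A x = (\<Sum>B | ple n B A. Poly_Mapping.lookup x B)"

abbreviation "J \<equiv> join_algebra"

lemma carrier_J: "(x :: 'k::field_char_0 part_vec) \<in> carrier (J n) \<longleftrightarrow> Poly_Mapping.keys x \<subseteq> set_partitions n"
  and add_J [simp]: "x \<oplus>\<^bsub>J n\<^esub> y = x + y" and zero_J [simp]: "\<zero>\<^bsub>J n\<^esub> = 0"
  by (simp_all add: join_algebra_def)

lemma chi_add: "chi n A (x + y) = chi n A x + chi n A y"
  by (simp add: chi_def lookup_add sum.distrib)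

lemma chi_zero [simp]: "chi n A 0 = 0"
  by (simp add: chi_def)

lemma chi_diff: "chi n A (x - y) = chi n A x - chi n A y"
  by (simp add: chi_def lookup_minus sum_subtractf)

lemma chi_sum: "chi n A (sum f S) = (\<Sum>s\<in>S. chi n A (f s))"
  by (induction S rule: infinite_finite_induct) (simp_all add: chi_add)

lemma chi_single: "chi n A (Poly_Mapping.single B c) = (if ple n B A then c else 0)"
  by (simp add: chi_def lookup_single when_def)

lemma chi_keys: "chi n A x = (\<Sum>B\<in>Poly_Mapping.keys x. if ple n B A then Poly_Mapping.lookup x B else 0)"
proof -
  have "chi n A x = (\<Sum>B\<in>{B. ple n B A} \<inter> Poly_Mapping.keys x. Poly_Mapping.lookup x B)"
    unfolding chi_def by (rule sum.mono_neutral_right) (auto simp: in_keys_iff)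
  also have "\<dots> = (\<Sum>B\<in>Poly_Mapping.keys x. if ple n B A then Poly_Mapping.lookup x B else 0)"
    by (subst sum.inter_filter[symmetric]) (auto intro!: sum.cong)
  finally show ?thesis .
qed

lemma keys_single_subset: "Poly_Mapping.keys (Poly_Mapping.single a c) \<subseteq> {a}"
  by simp

lemma keys_sum_subset: "(\<And>s. s \<in> S \<Longrightarrow> Poly_Mapping.keys (f s) \<subseteq> K) \<Longrightarrow> Poly_Mapping.keys (sum f S) \<subseteq> K"
  using keys_sum[of f S] by blast

lemma mult_J: "x \<otimes>\<^bsub>J n\<^esub> y = (\<Sum>A\<in>Poly_Mapping.keys x. \<Sum>B\<in>Poly_Mapping.keys y.
    Poly_Mapping.single (A \<squnion>\<^bsub>partition_lattice n\<^esub> B) (Poly_Mapping.lookup x A * Poly_Mapping.lookup y B))"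
  by (simp add: join_algebra_def)

lemma mult_J_closed: "\<lbrakk>x \<in> carrier (J n); y \<in> carrier (J n)\<rbrakk> \<Longrightarrow> x \<otimes>\<^bsub>J n\<^esub> y \<in> carrier (J n)"
  unfolding carrier_J mult_J
  by (intro keys_sum_subset order_trans[OF keys_single_subset]) (auto simp: partition_join(1) subset_iff)

text \<open>Multiplicativity is the universal property of the join: it lies below A iff both of its
  arguments do.\<close>

lemma chi_mult:
  assumes "x \<in> carrier (J n)" "y \<in> carrier (J n)"
  shows "chi n A (x \<otimes>\<^bsub>J n\<^esub> y) = chi n A x * chi n A y"
proof -
  have "chi n A (x \<otimes>\<^bsub>J n\<^esub> y) = (\<Sum>B\<in>Poly_Mapping.keys x. \<Sum>C\<in>Poly_Mapping.keys y.
      (if ple n B A then Poly_Mapping.lookup x B else 0) * (if ple n C A then Poly_Mapping.lookup y C else 0))"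
    unfolding mult_J chi_sum chi_single
  proof (intro sum.cong refl)
    fix B C assume "B \<in> Poly_Mapping.keys x" "C \<in> Poly_Mapping.keys y"
    then have "B \<in> set_partitions n" "C \<in> set_partitions n" using assms by (auto simp: carrier_J)
    then show "(if ple n (B \<squnion>\<^bsub>partition_lattice n\<^esub> C) A then Poly_Mapping.lookup x B * Poly_Mapping.lookup y C else 0) =
        (if ple n B A then Poly_Mapping.lookup x B else 0) * (if ple n C A then Poly_Mapping.lookup y C else 0)"
      by (simp add: partition_join(2))
  qed
  also have "\<dots> = chi n A x * chi n A y"
    by (simp add: chi_keys sum_product)
  finally show ?thesis .
qed

lemma one_J: "\<one>\<^bsub>J n\<^esub> = scalar n 1"
  by (simp add: join_algebra_def scalar_def)

lemma scalar_closed [simp]: "scalar n c \<in> carrier (J n)"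
  by (simp add: carrier_J scalar_def bot_in)

lemma chi_scalar [simp]: "A \<in> set_partitions n \<Longrightarrow> chi n A (scalar n c) = c"
  by (simp add: scalar_def chi_single bot_ple)

text \<open>The characters are unitriangular in the basis: once the coefficients of x - y strictly
  below A vanish, \<chi>_A(x - y) is the coefficient at A. Elements are compared through characters
  from here on, which turns the laws of the join algebra, associativity included, into laws of the
  field.\<close>

lemma chi_eqI:
  assumes x: "x \<in> carrier (J n)" and y: "y \<in> carrier (J n)"
    and eq: "\<And>A. A \<in> set_partitions n \<Longrightarrow> chi n A x = chi n A y"
  shows "x = y"
proof (rule poly_mapping_eqI)
  fix A
  have "Poly_Mapping.lookup (x - y) A = 0" if "A \<in> set_partitions n"
    using that
  proof (induction "card {B. ple n B A}" arbitrary: A rule: less_induct)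
    case less
    have "Poly_Mapping.lookup (x - y) B = 0" if B: "ple n B A" "B \<noteq> A" for B
    proof (rule less(1))
      show "B \<in> set_partitions n" using B ple_in by blast
      have "\<not> ple n A B" using B ple_asym by blast
      then have "{C. ple n C B} \<subset> {C. ple n C A}"
        using B ple_refl[OF less(2)] by (auto intro: ple_trans)
      then show "card {C. ple n C B} < card {C. ple n C A}"
        by (intro psubset_card_mono) auto
    qed
    then have "chi n A (x - y) = (\<Sum>B\<in>{A}. Poly_Mapping.lookup (x - y) B)"
      unfolding chi_def using ple_refl[OF less(2)] by (intro sum.mono_neutral_right) auto
    then show ?case using eq[OF less(2)] by (simp add: chi_diff)
  qed
  moreover have "Poly_Mapping.lookup (x - y) A = 0" if "A \<notin> set_partitions n"
    using that x y unfolding carrier_J lookup_minus by (metis diff_self in_keys_iff subsetD)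
  ultimately show "Poly_Mapping.lookup x A = Poly_Mapping.lookup y A"
    by (cases "A \<in> set_partitions n") (auto simp: lookup_minus)
qed

lemma add_J_closed: "\<lbrakk>x \<in> carrier (J n); y \<in> carrier (J n)\<rbrakk> \<Longrightarrow> x + y \<in> carrier (J n)"
  unfolding carrier_J using keys_add[of x y] by blast

lemma sum_J_closed: "(\<And>s. s \<in> S \<Longrightarrow> f s \<in> carrier (J n)) \<Longrightarrow> sum f S \<in> carrier (J n)"
  unfolding carrier_J by (rule keys_sum_subset)

lemma cring_J [simp, intro]: "cring (J n :: 'k::field_char_0 part_vec ring)"
proof (rule cringI)
  show "abelian_group (J n :: 'k part_vec ring)"
  proof (rule abelian_groupI)
    fix x :: "'k part_vec" assume "x \<in> carrier (J n)"
    then show "\<exists>y\<in>carrier (J n). y \<oplus>\<^bsub>J n\<^esub> x = \<zero>\<^bsub>J n\<^esub>"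
      by (intro bexI[of _ "- x"]) (auto simp: carrier_J in_keys_iff)
  qed (auto simp: add_J_closed algebra_simps carrier_J[of 0])
  show "Group.comm_monoid (J n :: 'k part_vec ring)"
    by (rule comm_monoidI) (auto intro!: chi_eqI[of _ n] mult_J_closed simp: chi_mult mult_J_closed one_J)
qed (auto intro!: chi_eqI[of _ n] mult_J_closed add_J_closed simp: chi_mult chi_add algebra_simps mult_J_closed add_J_closed)

lemma abelian_group_J [simp, intro]: "abelian_group (J n :: 'k::field_char_0 part_vec ring)"
  using cring.axioms(1)[OF cring_J] ring.axioms(1) by blast

lemma finsum_J [simp]: "finite S \<Longrightarrow> (\<And>s. s \<in> S \<Longrightarrow> f s \<in> carrier (J n)) \<Longrightarrow> finsum (J n) f S = sum f S"
proof (induction S rule: finite_induct)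
  case empty
  interpret abelian_group "J n" ..
  show ?case by simp
next
  case (insert s S)
  interpret abelian_group "J n" ..
  show ?case using insert by (simp add: Pi_def)
qed

section \<open>Primitive idempotents\<close>

abbreviation "idem \<equiv> primitive_idem"

lemma lookup_idem: "Poly_Mapping.lookup (idem n A) B = (if ple n A B then of_int (mobius n A B) else 0)"
  unfolding primitive_idem_def ple_def[symmetric] by (simp add: lookup_sum lookup_single when_def)

lemma idem_closed [simp]: "A \<in> set_partitions n \<Longrightarrow> idem n A \<in> carrier (J n)"
  by (auto simp: carrier_J in_keys_iff lookup_idem split: if_splits dest: ple_in)

text \<open>For A strictly below C the values \<mu>(A, B) sum to zero over the interval from A to C,
  which is the recursion defining \<open>mobius\<close>. Idempotents and characters are thus dual to
  each other.\<close>

lemma chi_idem [simp]: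
  assumes "A \<in> set_partitions n" "C \<in> set_partitions n"
  shows "chi n C (idem n A) = of_bool (A = C)"
proof -
  have "chi n C (idem n A) = (\<Sum>B | ple n A B \<and> ple n B C. of_int (mobius n A B))"
    unfolding chi_def lookup_idem by (subst sum.inter_filter[symmetric]) (auto intro!: sum.cong)
  also have "\<dots> = of_bool (A = C)"
  proof (cases "A = C")
    case True
    then have "{B. ple n A B \<and> ple n B C} = {A}"
      using ple_asym ple_refl[OF assms(1)] by blast
    then show ?thesis using True by (simp add: mobius.simps)
  next
    case False
    show ?thesis
    proof (cases "ple n A C")
      case AC: True
      let ?X = "{B. ple n A B \<and> ple n B C \<and> B \<noteq> C}"
      have "{B. ple n A B \<and> ple n B C} = insert C ?X"
        using AC ple_refl[OF assms(2)] by blast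
      moreover have "finite ?X" by (rule finite_subset[OF _ finite_ple(2)[of n A]]) auto
      moreover have "mobius n A C = - (\<Sum>B\<in>?X. mobius n A B)"
        using False AC by (subst mobius.simps) (simp only: ple_def if_False if_True)
      ultimately show ?thesis using False by simp
    next
      case False
      then have *: "{B. ple n A B \<and> ple n B C} = {}"
        using ple_trans by blast
      show ?thesis unfolding * using \<open>A \<noteq> C\<close> by simp
    qed
  qed
  finally show ?thesis .
qed

lemma sum_idem: "(\<Sum>A\<in>set_partitions n. idem n A) = \<one>\<^bsub>J n\<^esub>"
  by (rule chi_eqI[of _ n]) (auto intro!: sum_J_closed simp: chi_sum one_J finite_set_partitions)

lemma mult_idem:
  assumes "x \<in> carrier (J n)" "A \<in> set_partitions n"
  shows "x \<otimes>\<^bsub>J n\<^esub> idem n A = scalar n (chi n A x) \<otimes>\<^bsub>J n\<^esub> idem n A"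
  using assms by (intro chi_eqI[of _ n]) (auto simp: chi_mult mult_J_closed)

lemma idem_expand:
  assumes "x \<in> carrier (J n)"
  shows "x = (\<Sum>A\<in>set_partitions n. scalar n (chi n A x) \<otimes>\<^bsub>J n\<^esub> idem n A)"
  using assms by (intro chi_eqI[of _ n]) (auto intro!: sum_J_closed mult_J_closed simp: chi_sum chi_mult finite_set_partitions)

lemma scalar_add: "scalar n (c + d) = scalar n c + scalar n d"
  by (simp add: scalar_def single_add)

lemma scalar_mult: "scalar n (c * d) = scalar n c \<otimes>\<^bsub>J n\<^esub> scalar n d"
  by (rule chi_eqI[of _ n]) (auto simp: chi_mult mult_J_closed)


section \<open>Modules with a basis of simultaneous eigenvectors\<close>

lemma restrict_scalars_simps [simp]:
  "carrier (restrict_scalars \<phi> M) = carrier M" "x \<oplus>\<^bsub>restrict_scalars \<phi> M\<^esub> y = x \<oplus>\<^bsub>M\<^esub> y"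
  "\<zero>\<^bsub>restrict_scalars \<phi> M\<^esub> = \<zero>\<^bsub>M\<^esub>" "s \<odot>\<^bsub>restrict_scalars \<phi> M\<^esub> x = \<phi> s \<odot>\<^bsub>M\<^esub> x"
  by (simp_all add: restrict_scalars_def with_smult_def)

lemma abelian_group_same:
  assumes "abelian_group M" "carrier N = carrier M" "\<zero>\<^bsub>N\<^esub> = \<zero>\<^bsub>M\<^esub>"
    "\<And>x y. x \<oplus>\<^bsub>N\<^esub> y = x \<oplus>\<^bsub>M\<^esub> y"
  shows "abelian_group N"
proof -
  interpret abelian_group M by fact
  show ?thesis
    by (rule abelian_groupI) (auto simp: assms(2-) a_ac intro: add.l_inv_ex)
qed

lemma module_over_field:
  assumes "module (J n) (M :: ('k::field_char_0 part_vec, 'a, 'x) module_scheme)"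
  shows "module kk (over_field n M)"
proof -
  interpret M: module "J n" M by fact
  show ?thesis
  proof (rule moduleI)
    show "abelian_group (over_field n M)"
      by (rule abelian_group_same[OF M.abelian_group_axioms]) simp_all
  qed (simp_all add: scalar_add scalar_mult M.smult_assoc1 M.smult_r_distr M.smult_l_distr[simplified] flip: one_J)
qed

locale J_module = module "J n" M for n and M :: "('k::field_char_0 part_vec, 'a, 'x) module_scheme"
begin

abbreviation "V \<equiv> over_field n M"

sublocale V: kk_space V
  by (simp add: kk_space_def module_over_field[OF module_axioms])

lemma smult_add_J: "\<lbrakk>x \<in> carrier (J n); y \<in> carrier (J n); p \<in> carrier M\<rbrakk> \<Longrightarrow> (x + y) \<odot>\<^bsub>M\<^esub> p = x \<odot>\<^bsub>M\<^esub> p \<oplus>\<^bsub>M\<^esub> y \<odot>\<^bsub>M\<^esub> p"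
  using smult_l_distr by simp

lemma smult_commute:
  assumes "x \<in> carrier (J n)" "y \<in> carrier (J n)" "p \<in> carrier M"
  shows "x \<odot>\<^bsub>M\<^esub> (y \<odot>\<^bsub>M\<^esub> p) = y \<odot>\<^bsub>M\<^esub> (x \<odot>\<^bsub>M\<^esub> p)"
  using assms by (simp add: m_comm flip: smult_assoc1)

lemma act_hom: "x \<in> carrier (J n) \<Longrightarrow> (\<lambda>p. x \<odot>\<^bsub>M\<^esub> p) \<in> mod_hom kk V V"
  by (rule mod_homI[OF add_homI]) (simp_all add: smult_r_distr smult_commute)

lemma orbit_hom: "p \<in> carrier M \<Longrightarrow> (\<lambda>x. x \<odot>\<^bsub>M\<^esub> p) \<in> add_hom (J n) M"
  by (rule add_homI) (simp_all add: smult_add_J)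

definition eigenvector :: "nat set set \<Rightarrow> 'a \<Rightarrow> bool" where
  "eigenvector A v \<longleftrightarrow> v \<in> carrier M \<and> (\<forall>x\<in>carrier (J n). x \<odot>\<^bsub>M\<^esub> v = scalar n (chi n A x) \<odot>\<^bsub>M\<^esub> v)"

lemma eigenvector_idem:
  assumes "p \<in> carrier M" "A \<in> set_partitions n"
  shows "eigenvector A (idem n A \<odot>\<^bsub>M\<^esub> p)"
  unfolding eigenvector_def
proof (intro conjI ballI)
  fix x :: "'k part_vec" assume x: "x \<in> carrier (J n)"
  have "x \<odot>\<^bsub>M\<^esub> (idem n A \<odot>\<^bsub>M\<^esub> p) = (x \<otimes>\<^bsub>J n\<^esub> idem n A) \<odot>\<^bsub>M\<^esub> p"
    using assms x by (simp add: smult_assoc1)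
  also have "\<dots> = scalar n (chi n A x) \<odot>\<^bsub>M\<^esub> (idem n A \<odot>\<^bsub>M\<^esub> p)"
    unfolding mult_idem[OF x assms(2)] using assms by (simp add: smult_assoc1)
  finally show "x \<odot>\<^bsub>M\<^esub> (idem n A \<odot>\<^bsub>M\<^esub> p) = scalar n (chi n A x) \<odot>\<^bsub>M\<^esub> (idem n A \<odot>\<^bsub>M\<^esub> p)" .
qed (use assms in simp)

lemma decompose: "p \<in> carrier M \<Longrightarrow> p = (\<Oplus>\<^bsub>V\<^esub>A\<in>set_partitions n. idem n A \<odot>\<^bsub>M\<^esub> p)"
proof -
  assume p: "p \<in> carrier M"
  have "(\<Oplus>\<^bsub>J n\<^esub>A\<in>set_partitions n. idem n A) \<odot>\<^bsub>M\<^esub> p = (\<Oplus>\<^bsub>V\<^esub>A\<in>set_partitions n. idem n A \<odot>\<^bsub>M\<^esub> p)"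
    using orbit_hom[OF p]
    by (intro add_hom_finsum) (auto simp: add_hom_def V.M.abelian_group_axioms)
  then show ?thesis using p by (simp add: finite_set_partitions sum_idem)
qed

end

text \<open>The index type is free, since extensions are indexed by disjoint sums and induced
  modules by pairs together with a partition. Labels may repeat.\<close>

locale eigenbasis = J_module n M
  for n and M :: "('k::field_char_0 part_vec, 'a, 'x) module_scheme" +
  fixes I :: "'i set" and a :: "'i \<Rightarrow> nat set set" and v :: "'i \<Rightarrow> 'a"
  assumes finite_I [simp]: "finite I" and a_in [simp]: "i \<in> I \<Longrightarrow> a i \<in> set_partitions n"
    and eigen_basis: "is_basis (over_field n M) I v"
    and eigen: "\<lbrakk>i \<in> I; x \<in> carrier (J n)\<rbrakk> \<Longrightarrow> x \<odot>\<^bsub>M\<^esub> v i = scalar n (chi n (a i) x) \<odot>\<^bsub>M\<^esub> v i"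
begin

sublocale V: basis_module V I v
  by unfold_locales (rule eigen_basis)

lemma v_closed [simp]: "i \<in> I \<Longrightarrow> v i \<in> carrier M"
  using V.b_closed by simp

lemma coord_act:
  assumes x: "x \<in> carrier (J n)" and p: "p \<in> carrier M" and i: "i \<in> I"
  shows "Poly_Mapping.lookup (V.coord (x \<odot>\<^bsub>M\<^esub> p)) i = chi n (a i) x * Poly_Mapping.lookup (V.coord p) i"
proof (rule V.mod_hom_ext[OF module_kk_self])
  show "(\<lambda>p. Poly_Mapping.lookup (V.coord (x \<odot>\<^bsub>M\<^esub> p)) i) \<in> mod_hom kk V (ring_as_module kk)"
    by (rule mod_hom_comp[OF act_hom[OF x] V.coord_functional])
  show "(\<lambda>p. chi n (a i) x * Poly_Mapping.lookup (V.coord p) i) \<in> mod_hom kk V (ring_as_module kk)"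
    using V.coord_functional[of i] by (simp add: functional_iff algebra_simps)
  fix j assume j: "j \<in> I"
  then have "V.coord (x \<odot>\<^bsub>M\<^esub> v j) = Poly_Mapping.map ((*) (chi n (a j) x)) (V.coord (v j))"
    unfolding eigen[OF j x] using V.coord_smult[of "v j" "chi n (a j) x"] by simp
  then show "Poly_Mapping.lookup (V.coord (x \<odot>\<^bsub>M\<^esub> v j)) i = chi n (a i) x * Poly_Mapping.lookup (V.coord (v j)) i"
    by (simp add: V.coord_base[OF j] lookup_single when_def)
qed (use p in simp)

lemma coord_sum:
  assumes "p \<in> carrier M"
  shows "p = (\<Oplus>\<^bsub>V\<^esub>i\<in>I. scalar n (Poly_Mapping.lookup (V.coord p) i) \<odot>\<^bsub>M\<^esub> v i)"
  using V.lincomb_superset[OF finite_I V.keys_coord order_refl, of p] V.lincomb_coord[of p] assms by simp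

end

lemma (in J_module) eigenbasisI:
  assumes "finite I" "\<And>i. i \<in> I \<Longrightarrow> a i \<in> set_partitions n" "is_basis V I v"
    "\<And>i. i \<in> I \<Longrightarrow> eigenvector (a i) (v i)"
  shows "eigenbasis n M I a v"
proof unfold_locales
  show "x \<odot>\<^bsub>M\<^esub> v i = scalar n (chi n (a i) x) \<odot>\<^bsub>M\<^esub> v i" if "i \<in> I" "x \<in> carrier (J n)" for i x
    using assms(4)[OF that(1)] that(2) unfolding eigenvector_def by blast
qed (use assms(1-3) in simp_all)

text \<open>The components f_A s of finitely many generators s are eigenvectors and still span,
  because the idempotents sum to the unit. A spanning set of eigenvectors of least size is
  independent.\<close>

lemma (in J_module) exists_eigenbasis:
  assumes "fin_gen kk V"
  obtains I a where "eigenbasis n M I a (\<lambda>v. v)"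
proof -
  \<comment> \<open>Spanning sets are indexed by their own elements, so that the cardinality of the
    set itself can be minimised.\<close>
  define spans where "spans E \<longleftrightarrow> finite E \<and> (\<forall>e\<in>E. \<exists>A\<in>set_partitions n. eigenvector A e) \<and>
    carrier V \<subseteq> vspan V E (\<lambda>v. v)" for E
  have fam: "vector_family V E (\<lambda>v. v)" if "\<forall>e\<in>E. \<exists>A\<in>set_partitions n. eigenvector A e" for E
    using that by unfold_locales (auto simp: eigenvector_def)
  obtain S where S: "finite S" "S \<subseteq> carrier M"
    "\<And>x. x \<in> carrier M \<Longrightarrow> \<exists>c. x = (\<Oplus>\<^bsub>V\<^esub>s\<in>S. c s \<odot>\<^bsub>V\<^esub> s)"
  proof -
    from assms obtain S where S: "finite S" "S \<subseteq> carrier V"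
      "\<forall>x\<in>carrier V. \<exists>c\<in>S \<rightarrow> carrier (kk :: 'k ring). x = (\<Oplus>\<^bsub>V\<^esub>s\<in>S. c s \<odot>\<^bsub>V\<^esub> s)"
      unfolding fin_gen_def by blast
    show thesis
    proof (rule that[of S])
      show "S \<subseteq> carrier M" using S(2) by simp
      show "\<exists>c. x = (\<Oplus>\<^bsub>V\<^esub>s\<in>S. c s \<odot>\<^bsub>V\<^esub> s)" if "x \<in> carrier M" for x
        using S(3) that unfolding restrict_scalars_simps(1) by blast
    qed (fact S(1))
  qed
  let ?E = "(\<lambda>(A, s). idem n A \<odot>\<^bsub>M\<^esub> s) ` (set_partitions n \<times> S)"
  have E: "\<forall>e\<in>?E. \<exists>A\<in>set_partitions n. eigenvector A e"
  proof
    fix e assume "e \<in> ?E"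
    then obtain A s where "e = idem n A \<odot>\<^bsub>M\<^esub> s" "A \<in> set_partitions n" "s \<in> S" by auto
    then show "\<exists>A\<in>set_partitions n. eigenvector A e"
      using S(2) eigenvector_idem[of s A] by auto
  qed
  interpret E: vector_family V ?E "\<lambda>v. v" by (rule fam[OF E])
  have "s \<in> vspan V ?E (\<lambda>v. v)" if s: "s \<in> S" for s
  proof -
    have "(\<Oplus>\<^bsub>V\<^esub>A\<in>set_partitions n. idem n A \<odot>\<^bsub>M\<^esub> s) \<in> vspan V ?E (\<lambda>v. v)"
      using s by (intro E.vspan_finsum E.vspan_base) auto
    then show ?thesis using decompose[of s] s S(2) by auto
  qed
  moreover have "x \<in> vspan V ?E (\<lambda>v. v)" if x: "x \<in> carrier M" and S': "\<And>s. s \<in> S \<Longrightarrow> s \<in> vspan V ?E (\<lambda>v. v)" for x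
  proof -
    obtain c where "x = (\<Oplus>\<^bsub>V\<^esub>s\<in>S. c s \<odot>\<^bsub>V\<^esub> s)" using S(3)[OF x] by blast
    then show ?thesis by (simp only:) (intro E.vspan_finsum E.vspan_smult S')
  qed
  ultimately have "carrier V \<subseteq> vspan V ?E (\<lambda>v. v)" by (simp add: subsetI)
  then have "spans ?E"
    using E S(1) finite_set_partitions unfolding spans_def by blast
  then obtain E where sp: "spans E" and min: "\<And>E'. spans E' \<Longrightarrow> card E \<le> card E'"
    using ex_has_least_nat[of spans ?E card] by blast
  interpret E: vector_family V E "\<lambda>v. v" using sp by (intro fam) (simp add: spans_def)
  have "is_basis V E (\<lambda>v. v)"
  proof (rule E.is_basisI)
    show "carrier V \<subseteq> vspan V E (\<lambda>v. v)" using sp by (simp add: spans_def)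
    fix c assume c: "Poly_Mapping.keys c \<subseteq> E" "lincomb V (\<lambda>v. v) c = \<zero>\<^bsub>V\<^esub>"
    show "c = 0"
    proof (rule ccontr)
      assume "c \<noteq> 0"
      \<comment> \<open>A vector with nonzero coefficient in a relation is a combination of the
        others; dropping it from E contradicts minimality.\<close>
      then obtain e where e: "e \<in> Poly_Mapping.keys c" by (metis ex_in_conv keys_eq_empty)
      let ?E = "E - {e}"
      interpret E': vector_family V ?E "\<lambda>v. v" using sp by (intro fam) (auto simp: spans_def)
      have eE: "e \<in> E" "finite E" and eM: "\<And>e. e \<in> E \<Longrightarrow> e \<in> carrier M"
        using e c sp E.b_closed by (auto simp: spans_def)
      let ?r = "Poly_Mapping.lookup c e"
      have r: "?r \<noteq> 0" using e by (simp add: in_keys_iff)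
      let ?s = "\<Oplus>\<^bsub>V\<^esub>u\<in>?E. Poly_Mapping.lookup c u \<odot>\<^bsub>V\<^esub> u"
      have s: "?s \<in> vspan V ?E (\<lambda>v. v)"
        by (intro E'.vspan_finsum E'.vspan_smult E'.vspan_base)
      have sM: "?s \<in> carrier V" using eM by (intro V.M.finsum_closed) auto
      have "\<zero>\<^bsub>V\<^esub> = (\<Oplus>\<^bsub>V\<^esub>u\<in>insert e ?E. Poly_Mapping.lookup c u \<odot>\<^bsub>V\<^esub> u)"
        using E.lincomb_superset[of E c] c eE by (simp add: insert_absorb del: restrict_scalars_simps(4))
      also have "\<dots> = ?r \<odot>\<^bsub>V\<^esub> e \<oplus>\<^bsub>V\<^esub> ?s"
        using eE eM by (intro V.M.finsum_insert) auto
      finally have "?r \<odot>\<^bsub>V\<^esub> e = \<ominus>\<^bsub>V\<^esub> ?s"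
        using V.M.minus_equality[OF _ sM V.kk_smult_closed[of e ?r]] eM eE by simp
      then have "(1 / ?r) \<odot>\<^bsub>V\<^esub> (?r \<odot>\<^bsub>V\<^esub> e) = (- (1 / ?r)) \<odot>\<^bsub>V\<^esub> ?s"
        using sM by (simp add: V.kk_smult_minus V.smult_r_minus del: restrict_scalars_simps(4))
      then have "e = (- (1 / ?r)) \<odot>\<^bsub>V\<^esub> ?s"
        using r eM eE by (simp add: V.kk_smult_mult[symmetric] del: restrict_scalars_simps(4))
      then have e_in: "e \<in> vspan V ?E (\<lambda>v. v)" using E'.vspan_smult[OF s, of "- (1 / ?r)"] by (rule ssubst)
      have "x \<in> vspan V ?E (\<lambda>v. v)" if "x \<in> carrier V" for x
      proof -
        have "x \<in> vspan V E (\<lambda>v. v)" using that sp unfolding spans_def by (meson subsetD)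
        then obtain d where d: "Poly_Mapping.keys d \<subseteq> E" "x = lincomb V (\<lambda>v. v) d"
          unfolding vspan_def by (elim imageE CollectE)
        have "u \<in> vspan V ?E (\<lambda>v. v)" if "u \<in> E" for u
          using that e_in E'.vspan_base[of u] by (cases "u = e") auto
        then show ?thesis
          unfolding d(2) lincomb_def using d(1) by (intro E'.vspan_finsum E'.vspan_smult) auto
      qed
      then have "spans ?E" using sp by (auto simp: spans_def)
      from min[OF this] show False using eE by (metis card_Diff1_less leD)
    qed
  qed
  moreover obtain a where "\<And>e. e \<in> E \<Longrightarrow> a e \<in> set_partitions n \<and> eigenvector (a e) e"
    using sp unfolding spans_def by metis
  ultimately have "eigenbasis n M E a (\<lambda>v. v)"
    using sp by (intro eigenbasisI) (auto simp: spans_def)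
  then show thesis by (rule that)
qed

text \<open>A diagonal entry of the product of the two transition matrices, which are inverse to
  each other.\<close>

lemma eigenbasis_trace:
  assumes "eigenbasis n M I a v" "eigenbasis n M K b w" "i \<in> I"
  shows "(\<Sum>k\<in>K. Poly_Mapping.lookup (basis_module.coord (over_field n M) K w (v i)) k *
    Poly_Mapping.lookup (basis_module.coord (over_field n M) I v (w k)) i) = 1"
proof -
  interpret v: eigenbasis n M I a v by fact
  interpret w: eigenbasis n M K b w by fact
  let ?f = "\<lambda>p. Poly_Mapping.lookup (v.V.coord p) i"
  let ?x = "\<lambda>k. Poly_Mapping.lookup (w.V.coord (v i)) k"
  have "?f (\<Oplus>\<^bsub>v.V\<^esub>k\<in>K. scalar n (?x k) \<odot>\<^bsub>M\<^esub> w k) = (\<Oplus>\<^bsub>ring_as_module kk\<^esub>k\<in>K. ?f (scalar n (?x k) \<odot>\<^bsub>M\<^esub> w k))"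
    by (rule add_hom_finsum[OF mod_hom_add_hom[OF v.V.coord_functional]])
      (auto simp: v.V.M.abelian_group_axioms module.axioms(2)[OF module_kk_self])
  also have "\<dots> = (\<Sum>k\<in>K. ?x k * ?f (w k))"
    using v.V.coord_functional[of i] by (auto simp: functional_iff intro!: sum.cong)
  also have "(\<Oplus>\<^bsub>v.V\<^esub>k\<in>K. scalar n (?x k) \<odot>\<^bsub>M\<^esub> w k) = v i"
    using w.coord_sum[of "v i"] \<open>i \<in> I\<close> by simp
  finally show ?thesis using \<open>i \<in> I\<close> by (simp add: v.V.coord_base)
qed

text \<open>The transition matrices between two eigenbases are supported on pairs of equal eigenvalues, so
  \<open>\<Sum>\<^sub>i g (a i) = tr (g X Y) = tr (Y g X) = \<Sum>\<^sub>k g (b k)\<close> for every function \<open>g\<close>.\<close>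

lemma eigenbasis_unique:
  fixes M :: "('k::field_char_0 part_vec, 'a, 'x) module_scheme" and g :: "nat set set \<Rightarrow> 'k"
  assumes "eigenbasis n M I a v" "eigenbasis n M K b w"
  shows "(\<Sum>i\<in>I. g (a i)) = (\<Sum>k\<in>K. g (b k))"
proof -
  interpret v: eigenbasis n M I a v by fact
  interpret w: eigenbasis n M K b w by fact
  define tx where "tx i k = Poly_Mapping.lookup (w.V.coord (v i)) k" for i k
  define ty where "ty k i = Poly_Mapping.lookup (v.V.coord (w k)) i" for k i
  \<comment> \<open>The idempotent of the label \<open>a i\<close> fixes \<open>v i\<close> but
    multiplies the coordinate at k by its character at \<open>b k\<close>, which is zero when the
    labels differ.\<close>
  have supp: "tx i k = 0" if ik: "i \<in> I" "k \<in> K" and "a i \<noteq> b k" for i k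
  proof -
    let ?e = "idem n (a i) :: 'k part_vec"
    have "?e \<odot>\<^bsub>M\<^esub> v i = v i" using ik v.V.kk_smult_one[of "v i"] by (subst v.eigen) simp_all
    then have "tx i k = chi n (b k) ?e * tx i k"
      using w.coord_act[of ?e "v i" k] ik by (simp add: tx_def)
    then show ?thesis using that by simp
  qed
  have "(\<Sum>i\<in>I. g (a i)) = (\<Sum>i\<in>I. g (a i) * (\<Sum>k\<in>K. tx i k * ty k i))"
    unfolding tx_def ty_def using eigenbasis_trace[OF assms] by (intro sum.cong) simp_all
  also have "\<dots> = (\<Sum>i\<in>I. \<Sum>k\<in>K. g (a i) * (tx i k * ty k i))"
    by (simp add: sum_distrib_left)
  also have "\<dots> = (\<Sum>i\<in>I. \<Sum>k\<in>K. g (b k) * (ty k i * tx i k))"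
    using supp by (intro sum.cong refl) force
  also have "\<dots> = (\<Sum>k\<in>K. g (b k) * (\<Sum>i\<in>I. ty k i * tx i k))"
    by (subst sum.swap) (simp add: sum_distrib_left)
  also have "\<dots> = (\<Sum>k\<in>K. g (b k))"
    unfolding tx_def ty_def using eigenbasis_trace[OF assms(2,1)] by (intro sum.cong) simp_all
  finally show ?thesis .
qed

section \<open>Homomorphisms between modules with eigenbases\<close>

lemma (in J_module) eigenvectorD:
  "\<lbrakk>eigenvector A v; x \<in> carrier (J n)\<rbrakk> \<Longrightarrow> x \<odot>\<^bsub>M\<^esub> v = scalar n (chi n A x) \<odot>\<^bsub>M\<^esub> v"
  by (simp only: eigenvector_def)

lemma (in J_module) finsum_over_field:
  "(\<And>i. i \<in> S \<Longrightarrow> f i \<in> carrier M) \<Longrightarrow> finsum V f S = finsum M f S"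
proof (induction S rule: infinite_finite_induct)
  case (insert i S)
  then show ?case by (simp add: V.M.finsum_insert Pi_def)
qed simp_all

lemma over_field_hom: "f \<in> mod_hom (J n) M N \<Longrightarrow> f \<in> mod_hom kk (over_field n M) (over_field n N)"
  by (auto simp: mod_hom_def)

text \<open>An element of the join algebra acts on \<open>v i\<close> and on its image by the same
  scalar, so the linear extension commutes with it on a basis and hence everywhere.\<close>

lemma (in eigenbasis) extension_J_hom:
  fixes N :: "('k part_vec, 'b, 'y) module_scheme"
  assumes N: "J_module n N" and w: "\<And>i. i \<in> I \<Longrightarrow> J_module.eigenvector n N (a i) (w i)"
  defines "L \<equiv> linear_extension V I v (over_field n N) w"
  shows "L \<in> mod_hom (J n) M N" and "\<And>i. i \<in> I \<Longrightarrow> L (v i) = w i"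
proof -
  interpret N: J_module n N by fact
  have mN: "module kk N.V" by (rule module_over_field[OF N.module_axioms])
  have wc: "w i \<in> carrier N.V" if "i \<in> I" for i using w[OF that] by (simp add: N.eigenvector_def)
  have L: "L \<in> mod_hom kk V N.V" and Lv: "\<And>i. i \<in> I \<Longrightarrow> L (v i) = w i"
    unfolding L_def using V.linear_extension_hom[OF mN wc] V.linear_extension_base[OF mN wc] by auto
  show "L (v i) = w i" if "i \<in> I" for i using Lv that .
  show "L \<in> mod_hom (J n) M N"
  proof (rule mod_homI)
    show "L \<in> add_hom M N" using mod_hom_add_hom[OF L] by (simp add: add_hom_def)
    fix x :: "'k part_vec" and p assume x: "x \<in> carrier (J n)" and p: "p \<in> carrier M"
    show "L (x \<odot>\<^bsub>M\<^esub> p) = x \<odot>\<^bsub>N\<^esub> L p"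
    proof (rule V.mod_hom_ext[OF mN mod_hom_comp[OF act_hom[OF x] L] mod_hom_comp[OF L N.act_hom[OF x]]])
      fix i assume i: "i \<in> I"
      have "L (x \<odot>\<^bsub>M\<^esub> v i) = scalar n (chi n (a i) x) \<odot>\<^bsub>N\<^esub> L (v i)"
        unfolding eigen[OF i x] using mod_hom_smult[OF L, of "chi n (a i) x" "v i"] i by simp
      also have "\<dots> = x \<odot>\<^bsub>N\<^esub> L (v i)"
        unfolding Lv[OF i] by (rule N.eigenvectorD[OF w[OF i] x, symmetric])
      finally show "L (x \<odot>\<^bsub>M\<^esub> v i) = x \<odot>\<^bsub>N\<^esub> L (v i)" .
    qed (use p in simp)
  qed
qed

lemma (in eigenbasis) eigenvector_v: "i \<in> I \<Longrightarrow> eigenvector (a i) (v i)"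
  unfolding eigenvector_def by (intro conjI ballI v_closed eigen)

lemma eigenbasis_mod_iso:
  assumes M: "eigenbasis n M I a v" and N: "eigenbasis n N K b w"
    and h: "bij_betw h I K" and ab: "\<And>i. i \<in> I \<Longrightarrow> b (h i) = a i"
  shows "mod_iso (J n) M N"
proof -
  interpret M: eigenbasis n M I a v by fact
  interpret N: eigenbasis n N K b w by fact
  have JM: "J_module n M" and JN: "J_module n N" by unfold_locales
  define h' where "h' = inv_into I h"
  have h1: "h i \<in> K" "h' (h i) = i" if "i \<in> I" for i
    using h that by (auto simp: h'_def bij_betw_def)
  have h2: "h' k \<in> I" "h (h' k) = k" if "k \<in> K" for k
    using h that by (auto simp: h'_def bij_betw_def f_inv_into_f inv_into_into)
  define f where "f = linear_extension M.V I v N.V (\<lambda>i. w (h i))"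
  define g where "g = linear_extension N.V K w M.V (\<lambda>k. v (h' k))"
  have f: "f \<in> mod_hom (J n) M N" and fv: "\<And>i. i \<in> I \<Longrightarrow> f (v i) = w (h i)"
    unfolding f_def using M.extension_J_hom[OF JN, of "\<lambda>i. w (h i)"] N.eigenvector_v[OF h1(1)] ab by auto
  have ba: "a (h' k) = b k" if "k \<in> K" for k using ab[OF h2(1)[OF that]] h2(2)[OF that] by simp
  have g: "g \<in> mod_hom (J n) N M" and gw: "\<And>k. k \<in> K \<Longrightarrow> g (w k) = v (h' k)"
    unfolding g_def using N.extension_J_hom[OF JM, of "\<lambda>k. v (h' k)"] M.eigenvector_v[OF h2(1)] ba by auto
  note mM = module_over_field[OF M.module_axioms] and mN = module_over_field[OF N.module_axioms]
  have id: "(\<lambda>x. x) \<in> mod_hom kk M.V M.V" "(\<lambda>x. x) \<in> mod_hom kk N.V N.V"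
    by (rule mod_homI[OF add_homI]; simp)+
  have gf: "g (f x) = x" if "x \<in> carrier M.V" for x
    using that by (rule M.V.mod_hom_ext[OF mM mod_hom_comp[OF over_field_hom[OF f] over_field_hom[OF g]] id(1)])
      (simp add: fv gw h1)
  have fg: "f (g x) = x" if "x \<in> carrier N.V" for x
    using that by (rule N.V.mod_hom_ext[OF mN mod_hom_comp[OF over_field_hom[OF g] over_field_hom[OF f]] id(2)])
      (simp add: fv gw h2)
  have "bij_betw f (carrier M) (carrier N)"
    by (rule bij_betw_byWitness[of _ g])
      (use gf fg add_hom_closed[OF mod_hom_add_hom[OF f]] add_hom_closed[OF mod_hom_add_hom[OF g]] in auto)
  then show ?thesis using f unfolding mod_iso_def by blast
qed

lemma eigenbasis_transport:
  fixes M :: "('k::field_char_0 part_vec, 'a, 'x) module_scheme" and N :: "('k part_vec, 'b, 'y) module_scheme"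
  assumes M: "eigenbasis n M I a v" and N: "J_module n N"
    and f: "f \<in> mod_hom (J n) M N" and bij: "bij_betw f (carrier M) (carrier N)"
  shows "eigenbasis n N I a (\<lambda>i. f (v i))"
proof -
  interpret M: eigenbasis n M I a v by fact
  interpret N: J_module n N by fact
  note fh = over_field_hom[OF f]
  note mN = module_over_field[OF N.module_axioms]
  have fc: "f (v i) \<in> carrier N" if "i \<in> I" for i using add_hom_closed[OF mod_hom_add_hom[OF f]] that by simp
  interpret V: vector_family N.V I "\<lambda>i. f (v i)" by unfold_locales (use fc in simp)
  show ?thesis
  proof (rule N.eigenbasisI)
    show "N.eigenvector (a i) (f (v i))" if i: "i \<in> I" for i
      unfolding N.eigenvector_def
    proof (intro conjI ballI)
      fix x :: "'k part_vec" assume x: "x \<in> carrier (J n)"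
      show "x \<odot>\<^bsub>N\<^esub> f (v i) = scalar n (chi n (a i) x) \<odot>\<^bsub>N\<^esub> f (v i)"
        using mod_hom_smult[OF f x M.v_closed[OF i]] mod_hom_smult[OF f scalar_closed M.v_closed[OF i]] M.eigen[OF i x]
        by simp
    qed (rule fc[OF i])
    show "is_basis N.V I (\<lambda>i. f (v i))"
    proof (rule V.is_basisI)
      show "carrier N.V \<subseteq> vspan N.V I (\<lambda>i. f (v i))"
      proof
        fix y assume "y \<in> carrier N.V"
        then obtain x where x: "x \<in> carrier M.V" "y = f x" using bij by (auto simp: bij_betw_def)
        have "y = lincomb N.V (\<lambda>i. f (v i)) (M.V.coord x)"
          using M.V.lincomb_hom[OF mN fh M.V.keys_coord[OF x(1)]] M.V.lincomb_coord[OF x(1)] x(2) by simp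
        then show "y \<in> vspan N.V I (\<lambda>i. f (v i))"
          using M.V.keys_coord[OF x(1)] unfolding vspan_def by blast
      qed
      fix c assume c: "Poly_Mapping.keys c \<subseteq> I" "lincomb N.V (\<lambda>i. f (v i)) c = \<zero>\<^bsub>N.V\<^esub>"
      have "f (lincomb M.V v c) = f \<zero>\<^bsub>M\<^esub>"
        using M.V.lincomb_hom[OF mN fh c(1)] c(2) add_hom_zero[OF mod_hom_add_hom[OF f] M.M.abelian_group_axioms N.M.abelian_group_axioms]
        by simp
      then have "lincomb M.V v c = lincomb M.V v 0"
        using bij M.V.lincomb_closed[OF c(1)] unfolding bij_betw_def inj_on_def by simp
      then show "c = 0" using M.V.coord_lincomb[OF c(1)] M.V.coord_lincomb[of 0] by simp
    qed
  qed simp_all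
qed

subsection \<open>Eigenbases and projectivity\<close>

lemma (in eigenbasis) fin_gen: "fin_gen kk V"
proof -
  \<comment> \<open>\<open>fin_gen\<close> speaks of a generating set, so the family has to be
    reindexed by its image. Equal vectors would have equal coordinates.\<close>
  have inj: "inj_on v I"
  proof (rule inj_onI)
    fix i j assume "i \<in> I" "j \<in> I" "v i = v j"
    then have "Poly_Mapping.single i (1 :: 'k) = Poly_Mapping.single j 1"
      by (simp flip: V.coord_base)
    then show "i = j" by (metis lookup_single_eq lookup_single_not_eq zero_neq_one)
  qed
  show ?thesis unfolding fin_gen_def
  proof (intro exI[of _ "v ` I"] conjI ballI)
    fix x assume x: "x \<in> carrier V"
    let ?c = "\<lambda>s. Poly_Mapping.lookup (V.coord x) (inv_into I v s)"
    have "(\<Oplus>\<^bsub>V\<^esub>s\<in>v ` I. ?c s \<odot>\<^bsub>V\<^esub> s) = (\<Oplus>\<^bsub>V\<^esub>i\<in>I. ?c (v i) \<odot>\<^bsub>V\<^esub> v i)"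
      by (rule V.M.finsum_reindex[OF _ inj]) auto
    also have "\<dots> = (\<Oplus>\<^bsub>V\<^esub>i\<in>I. Poly_Mapping.lookup (V.coord x) i \<odot>\<^bsub>V\<^esub> v i)"
      by (rule V.M.finsum_cong') (auto simp: inv_into_f_f[OF inj])
    also have "\<dots> = x" using coord_sum[of x] x by simp
    finally show "\<exists>c\<in>v ` I \<rightarrow> carrier kk. x = (\<Oplus>\<^bsub>V\<^esub>s\<in>v ` I. c s \<odot>\<^bsub>V\<^esub> s)"
      by (intro bexI[of _ ?c]) auto
  qed auto
qed

lemma free_module_simps:
  "carrier (free_module R d) = {..<d} \<rightarrow>\<^sub>E carrier R"
  "f \<oplus>\<^bsub>free_module R d\<^esub> g = (\<lambda>i\<in>{..<d}. f i \<oplus>\<^bsub>R\<^esub> g i)"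
  "r \<odot>\<^bsub>free_module R d\<^esub> f = (\<lambda>i\<in>{..<d}. r \<otimes>\<^bsub>R\<^esub> f i)"
  by (simp_all add: free_module_def)

text \<open>Each basis vector spans a copy of the ideal generated by the idempotent of its label, a
  summand of the join algebra. \<open>?i\<close> turns a coordinate into a multiple of that
  idempotent and \<open>?p\<close> sends the k-th unit vector to \<open>v (h k)\<close>; the
  composite is the identity because the idempotent fixes this vector.\<close>

lemma (in eigenbasis) fg_projective: "fg_projective (J n) M"
proof -
  obtain h where h: "bij_betw h {..<card I} I"
    using ex_bij_betw_nat_finite[OF finite_I] by (auto simp: atLeast0LessThan)
  let ?d = "card I"
  have hI: "h k \<in> I" if "k < ?d" for k using h that by (auto simp: bij_betw_def)
  let ?F = "free_module (J n :: 'k part_vec ring) ?d"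
  let ?i = "\<lambda>p. \<lambda>k\<in>{..<?d}. scalar n (Poly_Mapping.lookup (V.coord p) (h k)) \<otimes>\<^bsub>J n\<^esub> idem n (a (h k))"
  let ?p = "\<lambda>g. \<Oplus>\<^bsub>M\<^esub>k\<in>{..<?d}. g k \<odot>\<^bsub>M\<^esub> v (h k)"
  interpret Jn: cring "J n" by (rule cring_J)
  have i_hom: "?i \<in> mod_hom (J n) M ?F"
  proof (rule mod_homI[OF add_homI])
    fix x :: "'k part_vec" and p assume "x \<in> carrier (J n)" "p \<in> carrier M"
    then show "?i (x \<odot>\<^bsub>M\<^esub> p) = x \<odot>\<^bsub>?F\<^esub> ?i p"
      unfolding free_module_simps
      by (intro restrict_ext) (auto simp: hI coord_act chi_mult mult_J_closed intro!: chi_eqI[of _ n])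
  next
    fix p q assume "p \<in> carrier M" "q \<in> carrier M"
    then show "?i (p \<oplus>\<^bsub>M\<^esub> q) = ?i p \<oplus>\<^bsub>?F\<^esub> ?i q"
      unfolding free_module_simps using V.coord_add[of p q]
      by (intro restrict_ext) (auto simp: hI lookup_add chi_mult chi_add mult_J_closed add_J_closed algebra_simps intro!: chi_eqI[of _ n])
  qed (simp add: free_module_simps hI)
  have p_hom: "?p \<in> mod_hom (J n) ?F M"
  proof (rule mod_homI[OF add_homI])
    fix x :: "'k part_vec" and g assume "x \<in> carrier (J n)" and g: "g \<in> carrier ?F"
    then show "?p (x \<odot>\<^bsub>?F\<^esub> g) = x \<odot>\<^bsub>M\<^esub> ?p g"
      by (subst finsum_smult_ldistr) (auto simp: free_module_simps PiE_iff hI smult_assoc1 intro!: M.finsum_cong')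
  next
    fix f g assume "f \<in> carrier ?F" "g \<in> carrier ?F"
    then have fg: "f k \<in> carrier (J n)" "g k \<in> carrier (J n)" if "k < ?d" for k
      using that by (auto simp: free_module_simps)
    have "?p (f \<oplus>\<^bsub>?F\<^esub> g) = (\<Oplus>\<^bsub>M\<^esub>k\<in>{..<?d}. f k \<odot>\<^bsub>M\<^esub> v (h k) \<oplus>\<^bsub>M\<^esub> g k \<odot>\<^bsub>M\<^esub> v (h k))"
      by (rule M.finsum_cong') (auto simp: free_module_simps fg hI smult_add_J)
    also have "\<dots> = ?p f \<oplus>\<^bsub>M\<^esub> ?p g"
      by (rule M.finsum_addf) (auto simp: fg hI)
    finally show "?p (f \<oplus>\<^bsub>?F\<^esub> g) = ?p f \<oplus>\<^bsub>M\<^esub> ?p g" .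
  qed (auto simp: free_module_simps PiE_iff hI intro!: M.finsum_closed)
  have retract: "?p (?i p) = p" if p: "p \<in> carrier M" for p
  proof -
    have "?p (?i p) = (\<Oplus>\<^bsub>M\<^esub>k\<in>{..<?d}. scalar n (Poly_Mapping.lookup (V.coord p) (h k)) \<odot>\<^bsub>M\<^esub> v (h k))"
    proof (rule M.finsum_cong')
      fix k assume "k \<in> {..<?d}"
      then have k: "h k \<in> I" using hI by simp
      have "idem n (a (h k)) \<odot>\<^bsub>M\<^esub> v (h k) = v (h k)"
        using V.kk_smult_one[of "v (h k)"] k by (subst eigen) simp_all
      then show "?i p k \<odot>\<^bsub>M\<^esub> v (h k) = scalar n (Poly_Mapping.lookup (V.coord p) (h k)) \<odot>\<^bsub>M\<^esub> v (h k)"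
        using k \<open>k \<in> {..<?d}\<close> by (simp add: smult_assoc1)
    qed (use hI in auto)
    also have "\<dots> = (\<Oplus>\<^bsub>M\<^esub>i\<in>h ` {..<?d}. scalar n (Poly_Mapping.lookup (V.coord p) i) \<odot>\<^bsub>M\<^esub> v i)"
      using h by (subst M.finsum_reindex) (auto simp: bij_betw_def)
    also have "\<dots> = (\<Oplus>\<^bsub>V\<^esub>i\<in>I. scalar n (Poly_Mapping.lookup (V.coord p) i) \<odot>\<^bsub>M\<^esub> v i)"
      using h by (simp add: bij_betw_def finsum_over_field)
    also have "\<dots> = p" by (rule coord_sum[OF p, symmetric])
    finally show ?thesis .
  qed
  show ?thesis
    unfolding fg_projective_def
    by (intro conjI exI[of _ ?d] bexI[of _ ?i] bexI[of _ ?p] ballI retract i_hom p_hom module_axioms)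
qed

lemma (in eigenbasis) fd_projective: "fd_projective n M"
  unfolding fd_projective_def using fg_projective fin_gen by simp

lemma fd_projective_eigenbasis:
  assumes "fd_projective n M"
  obtains I a where "eigenbasis n M I a (\<lambda>v. v)"
proof -
  interpret J_module n M using assms by (simp add: fd_projective_def fg_projective_def J_module_def)
  show thesis using exists_eigenbasis that assms unfolding fd_projective_def by blast
qed

text \<open>A model with prescribed labels on the type of the generators of \<open>K0\<close>. It
  witnesses the choice in \<open>std_copy\<close> and stands in for the submodule when a basis
  vector is split off.\<close>

definition diag_module :: "nat \<Rightarrow> nat \<Rightarrow> (nat \<Rightarrow> nat set set) \<Rightarrow> 'k::field_char_0 std_module" where
  "diag_module n d a = \<lparr>carrier = {..<d} \<rightarrow>\<^sub>E UNIV, monoid.mult = undefined, monoid.one = undefined,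
     ring.zero = (\<lambda>i\<in>{..<d}. 0), ring.add = (\<lambda>f g. \<lambda>i\<in>{..<d}. f i + g i),
     module.smult = (\<lambda>x f. \<lambda>i\<in>{..<d}. chi n (a i) x * f i)\<rparr>"

lemma diag_module_eigenbasis:
  assumes a: "\<And>i. i < d \<Longrightarrow> a i \<in> set_partitions n"
  shows "eigenbasis n (diag_module n d a :: 'k::field_char_0 std_module) {..<d} a (\<lambda>i. \<lambda>j\<in>{..<d}. of_bool (i = j))"
proof -
  let ?M = "diag_module n d a :: 'k std_module"
  let ?v = "\<lambda>i. \<lambda>j\<in>{..<d}. of_bool (i = j) :: 'k"
  have simps: "carrier ?M = {..<d} \<rightarrow>\<^sub>E UNIV" "\<zero>\<^bsub>?M\<^esub> = (\<lambda>i\<in>{..<d}. 0)" "f \<oplus>\<^bsub>?M\<^esub> g = (\<lambda>i\<in>{..<d}. f i + g i)"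
    "x \<odot>\<^bsub>?M\<^esub> f = (\<lambda>i\<in>{..<d}. chi n (a i) x * f i)" for f g x
    by (simp_all add: diag_module_def)
  have ext: "f = g" if "f \<in> {..<d} \<rightarrow>\<^sub>E UNIV" "g \<in> {..<d} \<rightarrow>\<^sub>E UNIV" "\<And>i. i < d \<Longrightarrow> f i = g i" for f g :: "nat \<Rightarrow> 'k"
    using that by (intro PiE_ext[of f "{..<d}" "\<lambda>_. UNIV" g]) auto
  interpret M: J_module n ?M
    unfolding J_module_def
  proof (rule moduleI)
    show "abelian_group ?M"
    proof (rule abelian_groupI)
      fix f assume "f \<in> carrier ?M"
      then show "\<exists>g\<in>carrier ?M. g \<oplus>\<^bsub>?M\<^esub> f = \<zero>\<^bsub>?M\<^esub>"
        by (intro bexI[of _ "\<lambda>i\<in>{..<d}. - f i"]) (simp_all add: simps fun_eq_iff restrict_PiE_iff)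
    qed (simp_all add: simps algebra_simps fun_eq_iff restrict_PiE_iff PiE_iff extensional_def)
  qed (simp_all add: simps algebra_simps chi_add chi_mult one_J a fun_eq_iff restrict_PiE_iff PiE_iff extensional_def)
  interpret V: vector_family M.V "{..<d}" ?v
    by unfold_locales (auto simp: simps)
  have finsum: "finsum M.V g S = (\<lambda>j\<in>{..<d}. \<Sum>i\<in>S. g i j)" if "finite S" "\<And>i. i \<in> S \<Longrightarrow> g i \<in> carrier M.V" for g and S :: "nat set"
    using that
  proof (induction S rule: finite_induct)
    case (insert i S)
    then show ?case by (subst M.V.M.finsum_insert) (simp_all add: simps fun_eq_iff)
  qed (simp add: simps)
  show ?thesis
  proof (rule M.eigenbasisI)
    show "M.eigenvector (a i) (?v i)" if "i \<in> {..<d}" for i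
      using that a by (simp add: M.eigenvector_def simps fun_eq_iff)
    show "is_basis M.V {..<d} ?v"
    proof (rule V.is_basis_dualI)
      show "carrier M.V \<subseteq> vspan M.V {..<d} ?v"
      proof
        fix f assume f: "f \<in> carrier M.V"
        have "f = (\<Oplus>\<^bsub>M.V\<^esub>i\<in>{..<d}. f i \<odot>\<^bsub>M.V\<^esub> ?v i)"
        proof (rule ext)
          show "f j = (\<Oplus>\<^bsub>M.V\<^esub>i\<in>{..<d}. f i \<odot>\<^bsub>M.V\<^esub> ?v i) j" if j: "j < d" for j
          proof -
            have "(\<Oplus>\<^bsub>M.V\<^esub>i\<in>{..<d}. f i \<odot>\<^bsub>M.V\<^esub> ?v i) = (\<lambda>j\<in>{..<d}. \<Sum>i\<in>{..<d}. (f i \<odot>\<^bsub>M.V\<^esub> ?v i) j)"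
              by (rule finsum) (auto simp: simps)
            moreover have "(\<lambda>j\<in>{..<d}. \<Sum>i\<in>{..<d}. (f i \<odot>\<^bsub>M.V\<^esub> ?v i) j) j = (\<Sum>i\<in>{..<d}. if i = j then f i else 0)"
              using j a by (auto simp: simps intro!: sum.cong)
            ultimately show ?thesis using j by simp
          qed
          show "f \<in> {..<d} \<rightarrow>\<^sub>E UNIV" using f by (simp add: simps)
          have "(\<Oplus>\<^bsub>M.V\<^esub>i\<in>{..<d}. f i \<odot>\<^bsub>M.V\<^esub> ?v i) \<in> carrier M.V"
            by (rule M.V.M.finsum_closed) (auto simp: simps)
          then show "(\<Oplus>\<^bsub>M.V\<^esub>i\<in>{..<d}. f i \<odot>\<^bsub>M.V\<^esub> ?v i) \<in> {..<d} \<rightarrow>\<^sub>E UNIV" by (simp add: simps)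
        qed
        also have "\<dots> \<in> vspan M.V {..<d} ?v" by (intro V.vspan_finsum V.vspan_smult V.vspan_base)
        finally show "f \<in> vspan M.V {..<d} ?v" .
      qed
      show "(\<lambda>f. f i) \<in> mod_hom kk M.V (ring_as_module kk)" if "i \<in> {..<d}" for i
        using that a by (auto simp: functional_iff simps)
    qed auto
  qed (use a in auto)
qed

lemma std_copy:
  assumes "eigenbasis n M I a v"
  shows "(n, std_copy n M) \<in> K0_gens" and "mod_iso (J n) (std_copy n M) M"
proof -
  interpret M: eigenbasis n M I a v by fact
  obtain h where h: "bij_betw h {..<card I} I"
    using ex_bij_betw_nat_finite[OF M.finite_I] by (auto simp: atLeast0LessThan)
  have ah: "a (h i) \<in> set_partitions n" if "i < card I" for i
    using M.a_in[of "h i"] bij_betwE[OF h] that by simp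
  let ?D = "diag_module n (card I) (\<lambda>i. a (h i))"
  note D = diag_module_eigenbasis[of "card I" "\<lambda>i. a (h i)" n, OF ah]
  have "(n, ?D) \<in> K0_gens" using eigenbasis.fd_projective[OF D] by (simp add: K0_gens_def)
  moreover have "mod_iso (J n) ?D M" by (rule eigenbasis_mod_iso[OF D assms h refl])
  ultimately have "\<exists>P. (n, P) \<in> K0_gens \<and> mod_iso (J n) P M" by blast
  from someI_ex[OF this] show "(n, std_copy n M) \<in> K0_gens" "mod_iso (J n) (std_copy n M) M"
    by (simp_all add: std_copy_def)
qed

section \<open>Induction\<close>

lemma with_smult_simps [simp]:
  "carrier (with_smult M f) = carrier M" "x \<oplus>\<^bsub>with_smult M f\<^esub> y = x \<oplus>\<^bsub>M\<^esub> y"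
  "\<zero>\<^bsub>with_smult M f\<^esub> = \<zero>\<^bsub>M\<^esub>" "s \<odot>\<^bsub>with_smult M f\<^esub> x = f s x"
  by (simp_all add: with_smult_def)

lemma ring_as_module_simps [simp]:
  "carrier (ring_as_module R) = carrier R" "x \<oplus>\<^bsub>ring_as_module R\<^esub> y = x \<oplus>\<^bsub>R\<^esub> y"
  "\<zero>\<^bsub>ring_as_module R\<^esub> = \<zero>\<^bsub>R\<^esub>" "x \<odot>\<^bsub>ring_as_module R\<^esub> y = x \<otimes>\<^bsub>R\<^esub> y"
  by (simp_all add: ring_as_module_def)

lemma module_ring_as_module:
  assumes "cring R"
  shows "module R (ring_as_module R)"
proof -
  interpret cring R by fact
  show ?thesis
    by (rule moduleI) (auto simp: l_distr r_distr m_assoc assms intro: abelian_group_same[OF is_abelian_group])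
qed

abbreviation "RJ n \<equiv> ring_as_module (join_algebra n)"

lemma J_module_RJ: "J_module n (RJ n :: ('k::field_char_0 part_vec, 'k part_vec) module)"
  unfolding J_module_def by (rule module_ring_as_module) simp

lemma lincomb_in_vspan:
  assumes "vector_family W I b" "\<And>i. i \<in> Poly_Mapping.keys c \<Longrightarrow> f i \<in> vspan W I b"
  shows "lincomb W f c \<in> vspan W I b"
proof -
  interpret vector_family W I b by fact
  show ?thesis unfolding lincomb_def using assms(2) by (intro vspan_finsum vspan_smult)
qed

text \<open>Allows a tensor argument to be expanded in its basis; \<open>spanning\<close> applies it
  to each of the three arguments of an induced tensor.\<close>

lemma (in basis_module) hom_into_vspan:
  assumes W: "vector_family W K c" and f: "f \<in> mod_hom kk V W" and b: "\<And>i. i \<in> I \<Longrightarrow> f (b i) \<in> vspan W K c"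
    and x: "x \<in> carrier V"
  shows "f x \<in> vspan W K c"
proof -
  interpret W: vector_family W K c by fact
  have "f x = lincomb W (\<lambda>i. f (b i)) (coord x)"
    using lincomb_hom[OF W.module_axioms f keys_coord[OF x]] by (simp add: lincomb_coord[OF x])
  also have "\<dots> \<in> vspan W K c"
    using keys_coord[OF x] b by (intro lincomb_in_vspan[OF W]) blast
  finally show ?thesis .
qed

text \<open>The coordinates of x with respect to the idempotents are its characters, by
  \<open>idem_expand\<close> and duality.\<close>

lemma eigenbasis_RJ: "eigenbasis n (RJ n :: ('k::field_char_0 part_vec, 'k part_vec) module) (set_partitions n) (\<lambda>A. A) (idem n)"
proof -
  interpret J_module n "RJ n :: ('k part_vec, 'k part_vec) module" by (rule J_module_RJ)
  interpret F: vector_family V "set_partitions n" "idem n :: _ \<Rightarrow> 'k part_vec" by unfold_locales auto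
  show ?thesis
  proof (rule eigenbasisI)
    show "eigenvector A (idem n A)" if "A \<in> set_partitions n" for A
      unfolding eigenvector_def using that by (auto intro: mult_idem)
    show "is_basis V (set_partitions n) (idem n)"
    proof (rule F.is_basis_dualI)
      show "carrier V \<subseteq> vspan V (set_partitions n) (idem n)"
      proof
        fix x assume x: "x \<in> carrier V"
        have "(\<Oplus>\<^bsub>V\<^esub>A\<in>set_partitions n. chi n A x \<odot>\<^bsub>V\<^esub> idem n A) = (\<Oplus>\<^bsub>RJ n\<^esub>A\<in>set_partitions n. scalar n (chi n A x) \<otimes>\<^bsub>J n\<^esub> idem n A)"
          by (subst finsum_over_field) (auto intro!: mult_J_closed)
        also have "\<dots> = (\<Oplus>\<^bsub>J n\<^esub>A\<in>set_partitions n. scalar n (chi n A x) \<otimes>\<^bsub>J n\<^esub> idem n A)"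
        proof -
          have "(\<lambda>x. x) \<in> add_hom (RJ n) (J n)" by (rule add_homI) simp_all
          from add_hom_finsum[OF this M.abelian_group_axioms abelian_group_J, of "set_partitions n" "\<lambda>A. scalar n (chi n A x) \<otimes>\<^bsub>J n\<^esub> idem n A"]
          show ?thesis by (simp add: mult_J_closed)
        qed
        also have "\<dots> = x" using x by (subst finsum_J) (auto intro!: mult_J_closed idem_expand[symmetric] simp: finite_set_partitions)
        finally have "x = (\<Oplus>\<^bsub>V\<^esub>A\<in>set_partitions n. chi n A x \<odot>\<^bsub>V\<^esub> idem n A)" ..
        also have "\<dots> \<in> vspan V (set_partitions n) (idem n)"
          by (intro F.vspan_finsum F.vspan_smult F.vspan_base)
        finally show "x \<in> vspan V (set_partitions n) (idem n)" .
      qed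
      show "chi n A \<in> mod_hom kk V (ring_as_module kk)" if "A \<in> set_partitions n" for A
        using that by (simp add: functional_iff chi_add chi_mult)
    qed auto
  qed (simp_all add: finite_set_partitions)
qed

text \<open>Concatenation is left adjoint to the pair of restrictions: every block of C|D lies on
  one side, so only the traces of E on the two sides matter.\<close>

lemma ple_concat_iff:
  assumes C: "C \<in> set_partitions n" and D: "D \<in> set_partitions m" and E: "E \<in> set_partitions (n + m)"
  shows "ple (n + m) (concat_partition n C D) E \<longleftrightarrow> ple n C (lo n E) \<and> ple m D (hi n E)"
proof -
  note cp = concat_partition[OF C D]
  have "ple (n + m) (concat_partition n C D) E \<longleftrightarrow>
      (\<forall>a b. same_block C a b \<longrightarrow> same_block E a b) \<and>
      (\<forall>a b. n < a \<and> n < b \<and> same_block D (a - n) (b - n) \<longrightarrow> same_block E a b)"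
    unfolding ple_iff_same_block[OF cp(1) E] cp(2) by blast
  also have "(\<forall>a b. same_block C a b \<longrightarrow> same_block E a b) \<longleftrightarrow> ple n C (lo n E)"
    unfolding ple_iff_same_block[OF C lo_partition[OF E]] same_block_lo[OF E]
    using same_block_in[OF C] by blast
  also have "(\<forall>a b. n < a \<and> n < b \<and> same_block D (a - n) (b - n) \<longrightarrow> same_block E a b) \<longleftrightarrow> ple m D (hi n E)"
    unfolding ple_iff_same_block[OF D hi_partition[OF E]] same_block_hi[OF E]
  proof (intro iffI allI impI)
    fix a b assume *: "\<forall>a b. n < a \<and> n < b \<and> same_block D (a - n) (b - n) \<longrightarrow> same_block E a b" and "same_block D a b"
    then show "0 < a \<and> 0 < b \<and> same_block E (n + a) (n + b)"
      using same_block_in[OF D, of a b] *[rule_format, of "n + a" "n + b"] by simp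
  next
    fix a b assume "\<forall>a b. same_block D a b \<longrightarrow> 0 < a \<and> 0 < b \<and> same_block E (n + a) (n + b)"
      and "n < a \<and> n < b \<and> same_block D (a - n) (b - n)"
    then show "same_block E a b" by (metis le_add_diff_inverse less_imp_le)
  qed
  finally show ?thesis .
qed

definition concat_vec :: "nat \<Rightarrow> 'k::field_char_0 part_vec \<Rightarrow> 'k part_vec \<Rightarrow> 'k part_vec" where
  "concat_vec n x y = (\<Sum>C\<in>Poly_Mapping.keys x. \<Sum>D\<in>Poly_Mapping.keys y.
     Poly_Mapping.single (concat_partition n C D) (Poly_Mapping.lookup x C * Poly_Mapping.lookup y D))"

lemma concat_vec_closed:
  "\<lbrakk>x \<in> carrier (J n); y \<in> carrier (J m)\<rbrakk> \<Longrightarrow> concat_vec n x y \<in> carrier (J (n + m))"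
  unfolding carrier_J concat_vec_def
  by (intro keys_sum_subset order_trans[OF keys_single_subset]) (auto simp: concat_partition(1) subset_iff)

text \<open>The adjunction \<open>ple_concat_iff\<close>, read through characters: pulled back along
  \<open>rho\<close>, the character of E splits into those of its two restrictions. This decides
  which E occur in an induced module.\<close>

lemma chi_concat_vec:
  assumes x: "x \<in> carrier (J n)" and y: "y \<in> carrier (J m)" and E: "E \<in> set_partitions (n + m)"
  shows "chi (n + m) E (concat_vec n x y) = chi n (lo n E) x * chi m (hi n E) y"
proof -
  have "chi (n + m) E (concat_vec n x y) = (\<Sum>C\<in>Poly_Mapping.keys x. \<Sum>D\<in>Poly_Mapping.keys y.
      (if ple n C (lo n E) then Poly_Mapping.lookup x C else 0) * (if ple m D (hi n E) then Poly_Mapping.lookup y D else 0))"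
    unfolding concat_vec_def chi_sum chi_single
  proof (intro sum.cong refl)
    fix C D assume "C \<in> Poly_Mapping.keys x" "D \<in> Poly_Mapping.keys y"
    then have "C \<in> set_partitions n" "D \<in> set_partitions m" using x y by (auto simp: carrier_J)
    then show "(if ple (n + m) (concat_partition n C D) E then Poly_Mapping.lookup x C * Poly_Mapping.lookup y D else 0) =
        (if ple n C (lo n E) then Poly_Mapping.lookup x C else 0) * (if ple m D (hi n E) then Poly_Mapping.lookup y D else 0)"
      by (simp add: ple_concat_iff E)
  qed
  also have "\<dots> = chi n (lo n E) x * chi m (hi n E) y"
    by (simp add: chi_keys sum_product)
  finally show ?thesis .
qed

section \<open>The induced module\<close>

locale induction_pair = M: J_module n M + N: J_module m N
  for n m and M :: "('k::field_char_0 part_vec, 'a, 'x) module_scheme" and N :: "('k part_vec, 'b, 'y) module_scheme"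
begin

abbreviation "S \<equiv> join_algebra2 n m :: ('k, ('k part_vec, 'k part_vec) tensor) module"
abbreviation "JN \<equiv> J (n + m) :: 'k part_vec ring"

sublocale A: J_module n "RJ n :: ('k part_vec, 'k part_vec) module" by (rule J_module_RJ)
sublocale B: J_module m "RJ m :: ('k part_vec, 'k part_vec) module" by (rule J_module_RJ)
sublocale C: J_module "n + m" "RJ (n + m) :: ('k part_vec, 'k part_vec) module" by (rule J_module_RJ)

sublocale AB: tensor_modules kk A.V B.V
  by (simp add: tensor_modules_def A.V.module_axioms B.V.module_axioms)

sublocale MN: tensor_modules kk M.V N.V
  by (simp add: tensor_modules_def M.V.module_axioms N.V.module_axioms)

lemma S_eq: "S = AB.T"
  by (simp add: join_algebra2_def)

lemma rho_balanced: "balanced_map kk A.V B.V JN (concat_vec n)"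
  by (rule balanced_mapI)
    (auto intro!: chi_eqI[of _ "n + m"] concat_vec_closed mult_J_closed add_J_closed
      simp: chi_concat_vec chi_add chi_mult lo_partition hi_partition[of _ n m] mult_J_closed add_J_closed ring_distribs mult.assoc mult.left_commute)

lemma
  shows rho_hom: "rho n m \<in> add_hom S JN"
    and rho_pure: "\<lbrakk>x \<in> carrier (J n); y \<in> carrier (J m)\<rbrakk> \<Longrightarrow> rho n m (AB.pure x y) = concat_vec n x y"
  unfolding rho_def S_eq concat_vec_def[symmetric, abs_def]
  using AB.tensor_lift_hom[OF _ rho_balanced] AB.tensor_lift_pure[OF _ rho_balanced] by simp_all

text \<open>The action of the pure element x \<otimes> y of \<open>S\<close>; that of a general
  element is obtained by lifting in (x, y).\<close>

abbreviation act :: "'k part_vec \<Rightarrow> 'k part_vec \<Rightarrow> ('a, 'b) tensor \<Rightarrow> ('a, 'b) tensor" where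
  "act x y \<equiv> tensor_map kk M.V N.V (\<lambda>p. x \<odot>\<^bsub>M\<^esub> p) (\<lambda>q. y \<odot>\<^bsub>N\<^esub> q)"

lemma act:
  assumes "x \<in> carrier (J n)" "y \<in> carrier (J m)"
  shows act_hom: "act x y \<in> mod_hom kk MN.T MN.T"
    and act_pure: "\<And>p q. p \<in> carrier M \<Longrightarrow> q \<in> carrier N \<Longrightarrow> act x y (MN.pure p q) = MN.pure (x \<odot>\<^bsub>M\<^esub> p) (y \<odot>\<^bsub>N\<^esub> q)"
  using MN.tensor_map_hom[OF M.V.module_axioms N.V.module_axioms M.act_hom N.act_hom, OF assms]
    MN.tensor_map_pure[OF M.V.module_axioms N.V.module_axioms M.act_hom N.act_hom, OF assms] by simp_all

lemma act_closed: "\<lbrakk>x \<in> carrier (J n); y \<in> carrier (J m); t \<in> carrier MN.T\<rbrakk> \<Longrightarrow> act x y t \<in> carrier MN.T"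
  using add_hom_closed[OF mod_hom_add_hom[OF act_hom]] by blast

lemma act_add: "\<lbrakk>x \<in> carrier (J n); y \<in> carrier (J m); t \<in> carrier MN.T; t' \<in> carrier MN.T\<rbrakk> \<Longrightarrow>
    act x y (t \<oplus>\<^bsub>MN.T\<^esub> t') = act x y t \<oplus>\<^bsub>MN.T\<^esub> act x y t'"
  using add_hom_add[OF mod_hom_add_hom[OF act_hom]] by blast

text \<open>Linearity in the algebra argument is what lifting the action to \<open>S\<close>
  requires. As t is an arbitrary tensor, it is reduced to pure t by
  \<open>tensor_ext\<close>.\<close>

lemma act_left_hom:
  assumes y: "y \<in> carrier (J m)" and t: "t \<in> carrier MN.T"
  shows "(\<lambda>x. act x y t) \<in> mod_hom kk A.V MN.T"
proof (rule mod_homI[OF add_homI])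
  fix x x' assume x: "x \<in> carrier A.V" and x': "x' \<in> carrier A.V"
  show "act (x \<oplus>\<^bsub>A.V\<^esub> x') y t = act x y t \<oplus>\<^bsub>MN.T\<^esub> act x' y t"
    using t
  proof (rule MN.tensor_ext[of _ MN.T, rotated -2])
    show "act (x \<oplus>\<^bsub>A.V\<^esub> x') y \<in> add_hom MN.T MN.T"
      using x x' y by (intro mod_hom_add_hom[OF act_hom]) (simp_all add: add_J_closed)
    show "(\<lambda>t. act x y t \<oplus>\<^bsub>MN.T\<^esub> act x' y t) \<in> add_hom MN.T MN.T"
      using x x' y by (intro add_homI) (simp_all add: act_closed act_add MN.T.a_ac)
  qed (use x x' y in \<open>simp_all add: act_pure add_J_closed M.smult_add_J MN.pure_add_left[simplified]\<close>)
next
  fix c x assume "c \<in> carrier (kk :: 'k ring)" and x: "x \<in> carrier A.V"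
  show "act (c \<odot>\<^bsub>A.V\<^esub> x) y t = c \<odot>\<^bsub>MN.T\<^esub> act x y t"
    using t
  proof (rule MN.tensor_ext[of _ MN.T, rotated -2])
    show "act (c \<odot>\<^bsub>A.V\<^esub> x) y \<in> add_hom MN.T MN.T"
      using x y by (intro mod_hom_add_hom[OF act_hom]) (simp_all add: mult_J_closed)
    show "(\<lambda>t. c \<odot>\<^bsub>MN.T\<^esub> act x y t) \<in> add_hom MN.T MN.T"
      using x y add_hom_comp[OF mod_hom_add_hom[OF act_hom] MN.smult_T_hom] by simp
  qed (use x y MN.smult_pure[of c] in \<open>simp_all add: act_pure mult_J_closed M.smult_assoc1\<close>)
qed (use y t act_closed in simp)

lemma act_right_hom:
  assumes x: "x \<in> carrier (J n)" and t: "t \<in> carrier MN.T"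
  shows "(\<lambda>y. act x y t) \<in> mod_hom kk B.V MN.T"
proof (rule mod_homI[OF add_homI])
  fix y y' assume y: "y \<in> carrier B.V" and y': "y' \<in> carrier B.V"
  show "act x (y \<oplus>\<^bsub>B.V\<^esub> y') t = act x y t \<oplus>\<^bsub>MN.T\<^esub> act x y' t"
    using t
  proof (rule MN.tensor_ext[of _ MN.T, rotated -2])
    show "act x (y \<oplus>\<^bsub>B.V\<^esub> y') \<in> add_hom MN.T MN.T"
      using x y y' by (intro mod_hom_add_hom[OF act_hom]) (simp_all add: add_J_closed)
    show "(\<lambda>t. act x y t \<oplus>\<^bsub>MN.T\<^esub> act x y' t) \<in> add_hom MN.T MN.T"
      using x y y' by (intro add_homI) (simp_all add: act_closed act_add MN.T.a_ac)
  qed (use x y y' in \<open>simp_all add: act_pure add_J_closed N.smult_add_J MN.pure_add_right[simplified]\<close>)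
next
  fix c y assume "c \<in> carrier (kk :: 'k ring)" and y: "y \<in> carrier B.V"
  show "act x (c \<odot>\<^bsub>B.V\<^esub> y) t = c \<odot>\<^bsub>MN.T\<^esub> act x y t"
    using t
  proof (rule MN.tensor_ext[of _ MN.T, rotated -2])
    show "act x (c \<odot>\<^bsub>B.V\<^esub> y) \<in> add_hom MN.T MN.T"
      using x y by (intro mod_hom_add_hom[OF act_hom]) (simp_all add: mult_J_closed)
    show "(\<lambda>t. c \<odot>\<^bsub>MN.T\<^esub> act x y t) \<in> add_hom MN.T MN.T"
      using x y add_hom_comp[OF mod_hom_add_hom[OF act_hom] MN.smult_T_hom] by simp
  qed (use x y MN.smult_pure_right[of c] in \<open>simp_all add: act_pure mult_J_closed N.smult_assoc1\<close>)
qed (use x t act_closed in simp)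

abbreviation "Q \<equiv> restrict_scalars (rho n m) (RJ (n + m))"
abbreviation "Y \<equiv> outer_tensor n m M N"

lemma Y_eq: "Y = with_smult MN.T (\<lambda>s t. tensor_lift MN.T (\<lambda>x y. act x y t) s)"
  by (simp add: outer_tensor_def tensor_map_def Let_def)

lemma Y_simps [simp]: "carrier Y = carrier MN.T" "x \<oplus>\<^bsub>Y\<^esub> y = x \<oplus>\<^bsub>MN.T\<^esub> y" "\<zero>\<^bsub>Y\<^esub> = \<zero>\<^bsub>MN.T\<^esub>"
  by (simp_all add: Y_eq)

lemma smult_Y: "s \<odot>\<^bsub>Y\<^esub> t = tensor_lift MN.T (\<lambda>x y. act x y t) s"
  by (simp add: Y_eq)

lemma
  assumes t: "t \<in> carrier MN.T"
  shows smult_Y_hom: "(\<lambda>s. s \<odot>\<^bsub>Y\<^esub> t) \<in> mod_hom kk S MN.T"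
    and smult_Y_pure: "\<lbrakk>x \<in> carrier (J n); y \<in> carrier (J m)\<rbrakk> \<Longrightarrow> AB.pure x y \<odot>\<^bsub>Y\<^esub> t = act x y t"
proof -
  have "(\<lambda>x. act x y t) \<in> mod_hom kk A.V MN.T" if "y \<in> carrier B.V" for y
    using that t by (intro act_left_hom) simp_all
  moreover have r: "(\<lambda>y. act x y t) \<in> mod_hom kk B.V MN.T" if "x \<in> carrier A.V" for x
    using that t by (intro act_right_hom) simp_all
  ultimately show "(\<lambda>s. s \<odot>\<^bsub>Y\<^esub> t) \<in> mod_hom kk S MN.T"
    and "\<lbrakk>x \<in> carrier (J n); y \<in> carrier (J m)\<rbrakk> \<Longrightarrow> AB.pure x y \<odot>\<^bsub>Y\<^esub> t = act x y t"
    unfolding smult_Y S_eq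
    using AB.bilinear_lift_hom[OF MN.module_T, of "\<lambda>x y. act x y t"] AB.bilinear_lift_pure[OF MN.module_T, of "\<lambda>x y. act x y t"]
    by simp_all
qed

sublocale I: tensor_pair S Q Y
proof (intro tensor_pair.intro tensor_pair_axioms.intro)
  show "abelian_group Q" by (rule abelian_group_same[OF abelian_group_J[of "n + m"]]) simp_all
  show "abelian_group Y" by (rule abelian_group_same[OF MN.abelian_group_T]) simp_all
  show "s \<odot>\<^bsub>Q\<^esub> q \<in> carrier Q" if "s \<in> carrier S" "q \<in> carrier Q" for s q
    using that add_hom_closed[OF rho_hom that(1)] by (simp add: mult_J_closed)
  show "s \<odot>\<^bsub>Y\<^esub> t \<in> carrier Y" if "s \<in> carrier S" "t \<in> carrier Y" for s t
    using add_hom_closed[OF mod_hom_add_hom[OF smult_Y_hom]] that by simp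
qed

abbreviation "IM \<equiv> Ind n m M N"

lemma Ind_eq: "IM = with_smult I.T (\<lambda>r. tensor_lift I.T (\<lambda>q x. I.pure (r \<otimes>\<^bsub>JN\<^esub> q) x))"
  by (simp add: Ind_def Let_def)

lemma Ind_simps [simp]: "carrier IM = carrier I.T" "x \<oplus>\<^bsub>IM\<^esub> y = x \<oplus>\<^bsub>I.T\<^esub> y" "\<zero>\<^bsub>IM\<^esub> = \<zero>\<^bsub>I.T\<^esub>"
  by (simp_all add: Ind_eq)

lemma
  assumes r: "r \<in> carrier JN"
  shows smult_Ind_hom: "(\<lambda>t. r \<odot>\<^bsub>IM\<^esub> t) \<in> add_hom I.T I.T"
    and smult_Ind_pure: "\<lbrakk>q \<in> carrier JN; t \<in> carrier MN.T\<rbrakk> \<Longrightarrow> r \<odot>\<^bsub>IM\<^esub> I.pure q t = I.pure (r \<otimes>\<^bsub>JN\<^esub> q) t"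
proof -
  have bal: "balanced_map S Q Y I.T (\<lambda>q x. I.pure (r \<otimes>\<^bsub>JN\<^esub> q) x)"
  proof (rule balanced_mapI)
    fix s t and q :: "'k part_vec" assume s: "s \<in> carrier S" and q: "q \<in> carrier Q" and t: "t \<in> carrier Y"
    note rs = add_hom_closed[OF rho_hom s]
    \<comment> \<open>Multiplication by r respects the relations over \<open>S\<close> because the
      join algebra is commutative, so that r commutes with the image of s.\<close>
    have "r \<otimes>\<^bsub>JN\<^esub> (s \<odot>\<^bsub>Q\<^esub> q) = s \<odot>\<^bsub>Q\<^esub> (r \<otimes>\<^bsub>JN\<^esub> q)"
      using r q rs by (simp add: C.R.m_lcomm)
    then show "I.pure (r \<otimes>\<^bsub>JN\<^esub> (s \<odot>\<^bsub>Q\<^esub> q)) t = I.pure (r \<otimes>\<^bsub>JN\<^esub> q) (s \<odot>\<^bsub>Y\<^esub> t)"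
      using I.pure_balanced[OF s, of "r \<otimes>\<^bsub>JN\<^esub> q" t] r q t by simp
  next
    fix t and q q' :: "'k part_vec" assume q: "q \<in> carrier Q" "q' \<in> carrier Q" and t: "t \<in> carrier Y"
    then show "I.pure (r \<otimes>\<^bsub>JN\<^esub> (q \<oplus>\<^bsub>Q\<^esub> q')) t = I.pure (r \<otimes>\<^bsub>JN\<^esub> q) t \<oplus>\<^bsub>I.T\<^esub> I.pure (r \<otimes>\<^bsub>JN\<^esub> q') t"
      using C.R.r_distr[of q q' r] I.pure_add_left[of "r \<otimes>\<^bsub>JN\<^esub> q" "r \<otimes>\<^bsub>JN\<^esub> q'" t] r by simp
  next
    fix t t' and q :: "'k part_vec" assume q: "q \<in> carrier Q" and t: "t \<in> carrier Y" "t' \<in> carrier Y"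
    then show "I.pure (r \<otimes>\<^bsub>JN\<^esub> q) (t \<oplus>\<^bsub>Y\<^esub> t') = I.pure (r \<otimes>\<^bsub>JN\<^esub> q) t \<oplus>\<^bsub>I.T\<^esub> I.pure (r \<otimes>\<^bsub>JN\<^esub> q) t'"
      using r by (intro I.pure_add_right) simp_all
  qed (use r in \<open>simp add: I.pure_closed\<close>)
  show "(\<lambda>t. r \<odot>\<^bsub>IM\<^esub> t) \<in> add_hom I.T I.T"
    using I.tensor_lift_hom[OF I.abelian_group_T bal] by (simp add: Ind_eq)
  show "r \<odot>\<^bsub>IM\<^esub> I.pure q t = I.pure (r \<otimes>\<^bsub>JN\<^esub> q) t" if "q \<in> carrier JN" "t \<in> carrier MN.T"
    using I.tensor_lift_pure[OF I.abelian_group_T bal, of q t] that by (simp add: Ind_eq)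
qed

lemma module_Ind: "J_module (n + m) IM"
  unfolding J_module_def
proof (rule moduleI)
  note hom = smult_Ind_hom
  show "abelian_group IM" by (rule abelian_group_same[OF I.abelian_group_T]) simp_all
  show "r \<odot>\<^bsub>IM\<^esub> t \<in> carrier IM" if "r \<in> carrier JN" "t \<in> carrier IM" for r t
    using add_hom_closed[OF hom] that by simp
  show "r \<odot>\<^bsub>IM\<^esub> (t \<oplus>\<^bsub>IM\<^esub> t') = r \<odot>\<^bsub>IM\<^esub> t \<oplus>\<^bsub>IM\<^esub> r \<odot>\<^bsub>IM\<^esub> t'"
    if "r \<in> carrier JN" "t \<in> carrier IM" "t' \<in> carrier IM" for r t t'
    using add_hom_add[OF hom] that by simp
  show "(r \<oplus>\<^bsub>JN\<^esub> r') \<odot>\<^bsub>IM\<^esub> t = r \<odot>\<^bsub>IM\<^esub> t \<oplus>\<^bsub>IM\<^esub> r' \<odot>\<^bsub>IM\<^esub> t"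
    if r: "r \<in> carrier JN" "r' \<in> carrier JN" and "t \<in> carrier IM" for r r' t
    using that(3) unfolding Ind_simps
  proof (rule I.tensor_ext[of _ I.T, rotated -2])
    show "(\<lambda>t. (r \<oplus>\<^bsub>JN\<^esub> r') \<odot>\<^bsub>IM\<^esub> t) \<in> add_hom I.T I.T"
      using r by (intro hom) (simp add: add_J_closed)
    show "(\<lambda>t. r \<odot>\<^bsub>IM\<^esub> t \<oplus>\<^bsub>I.T\<^esub> r' \<odot>\<^bsub>IM\<^esub> t) \<in> add_hom I.T I.T"
      using r by (intro add_homI) (simp_all add: add_hom_closed[OF hom] add_hom_add[OF hom] I.T.a_ac)
    show "(r \<oplus>\<^bsub>JN\<^esub> r') \<odot>\<^bsub>IM\<^esub> I.pure q t = r \<odot>\<^bsub>IM\<^esub> I.pure q t \<oplus>\<^bsub>I.T\<^esub> r' \<odot>\<^bsub>IM\<^esub> I.pure q t"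
      if "q \<in> carrier Q" "t \<in> carrier Y" for q t
      using that r C.R.l_distr[of r r' q] I.pure_add_left[of "r \<otimes>\<^bsub>JN\<^esub> q" "r' \<otimes>\<^bsub>JN\<^esub> q" t]
      by (simp add: smult_Ind_pure add_J_closed)
  qed auto
  show "(r \<otimes>\<^bsub>JN\<^esub> r') \<odot>\<^bsub>IM\<^esub> t = r \<odot>\<^bsub>IM\<^esub> (r' \<odot>\<^bsub>IM\<^esub> t)"
    if r: "r \<in> carrier JN" "r' \<in> carrier JN" and "t \<in> carrier IM" for r r' t
    using that(3) unfolding Ind_simps
  proof (rule I.tensor_ext[of _ I.T, rotated -2])
    show "(\<lambda>t. (r \<otimes>\<^bsub>JN\<^esub> r') \<odot>\<^bsub>IM\<^esub> t) \<in> add_hom I.T I.T"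
      using r by (intro hom) simp
    show "(\<lambda>t. r \<odot>\<^bsub>IM\<^esub> (r' \<odot>\<^bsub>IM\<^esub> t)) \<in> add_hom I.T I.T"
      using r add_hom_comp[OF hom hom] by blast
    show "(r \<otimes>\<^bsub>JN\<^esub> r') \<odot>\<^bsub>IM\<^esub> I.pure q t = r \<odot>\<^bsub>IM\<^esub> (r' \<odot>\<^bsub>IM\<^esub> I.pure q t)"
      if "q \<in> carrier Q" "t \<in> carrier Y" for q t
      using that r by (simp add: smult_Ind_pure C.R.m_assoc)
  qed auto
  show "\<one>\<^bsub>JN\<^esub> \<odot>\<^bsub>IM\<^esub> t = t" if "t \<in> carrier IM" for t
    using that unfolding Ind_simps
  proof (rule I.tensor_ext[of _ I.T, rotated -2])
    show "(\<lambda>t. \<one>\<^bsub>JN\<^esub> \<odot>\<^bsub>IM\<^esub> t) \<in> add_hom I.T I.T" by (intro hom) simp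
    show "(\<lambda>t. t) \<in> add_hom I.T I.T" by (rule add_homI) simp_all
    show "\<one>\<^bsub>JN\<^esub> \<odot>\<^bsub>IM\<^esub> I.pure q t = I.pure q t" if "q \<in> carrier Q" "t \<in> carrier Y" for q t
      using that by (simp add: smult_Ind_pure)
  qed auto
qed simp

sublocale IM: J_module "n + m" IM by (rule module_Ind)

text \<open>A scalar c of the field acts on M \<otimes> N as the element c \<otimes> 1 of
  \<open>S\<close>, and \<open>rho\<close> maps this element to the scalar c of the larger join
  algebra. So c passes through a tensor sign that is taken over \<open>S\<close>.\<close>

lemma pure_scalar:
  assumes q: "q \<in> carrier JN" and t: "t \<in> carrier MN.T"
  shows "I.pure q (c \<odot>\<^bsub>MN.T\<^esub> t) = scalar (n + m) c \<odot>\<^bsub>IM\<^esub> I.pure q t"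
proof -
  let ?s = "AB.pure (scalar n c) \<one>\<^bsub>J m\<^esub>"
  have s: "?s \<in> carrier S" unfolding S_eq by (rule AB.pure_closed) (simp_all add: one_J)
  have "rho n m ?s = scalar (n + m) c"
    by (simp add: rho_pure one_J) (auto intro!: chi_eqI[of _ "n + m"] concat_vec_closed
        simp: chi_concat_vec lo_partition hi_partition[of _ n m])
  then have "scalar (n + m) c \<odot>\<^bsub>IM\<^esub> I.pure q t = I.pure (?s \<odot>\<^bsub>Q\<^esub> q) t"
    using q t by (simp add: smult_Ind_pure)
  also have "\<dots> = I.pure q (?s \<odot>\<^bsub>Y\<^esub> t)"
    using s q t by (intro I.pure_balanced) simp_all
  also have "?s \<odot>\<^bsub>Y\<^esub> t = act (scalar n c) \<one>\<^bsub>J m\<^esub> t"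
    using t by (simp add: smult_Y_pure one_J)
  also have "\<dots> = c \<odot>\<^bsub>MN.T\<^esub> t"
    using t
  proof (rule MN.tensor_ext[of _ MN.T, rotated -2])
    show "act (scalar n c) \<one>\<^bsub>J m\<^esub> \<in> add_hom MN.T MN.T" by (intro mod_hom_add_hom[OF act_hom]) (simp_all add: one_J)
    show "(\<lambda>t. c \<odot>\<^bsub>MN.T\<^esub> t) \<in> add_hom MN.T MN.T" by (rule MN.smult_T_hom) simp
  qed (use MN.smult_pure[of c] N.smult_one in \<open>simp_all add: act_pure one_J\<close>)
  finally show ?thesis ..
qed

end

section \<open>An eigenbasis of the induced module\<close>

locale induction_eigen = M: eigenbasis n M I a v + N: eigenbasis m N K b w
  for n m and M :: "('k::field_char_0 part_vec, 'a, 'x) module_scheme" and N :: "('k part_vec, 'b, 'y) module_scheme"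
    and I :: "'i set" and a v and K :: "'j set" and b w
begin

sublocale induction_pair n m M N by unfold_locales

definition ind_index :: "(('i \<times> 'j) \<times> nat set set) set" where
  "ind_index = (SIGMA p:I \<times> K. glued n m (a (fst p)) (b (snd p)))"

definition ind_vec :: "('i \<times> 'j) \<times> nat set set \<Rightarrow> ('k part_vec, ('a, 'b) tensor) tensor" where
  "ind_vec z = I.pure (idem (n + m) (snd z)) (MN.pure (v (fst (fst z))) (w (snd (fst z))))"

lemma ind_indexD:
  assumes "z \<in> ind_index"
  shows "fst (fst z) \<in> I" "snd (fst z) \<in> K" "snd z \<in> set_partitions (n + m)"
    "lo n (snd z) = a (fst (fst z))" "hi n (snd z) = b (snd (fst z))"
  using assms by (auto simp: ind_index_def glued_def)

lemma ind_vec_closed: "z \<in> ind_index \<Longrightarrow> ind_vec z \<in> carrier IM"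
  unfolding ind_vec_def by (simp add: ind_indexD)

lemma vector_family_ind: "vector_family IM.V ind_index ind_vec"
proof (intro vector_family.intro vector_family_axioms.intro)
  show "kk_space IM.V" by (rule IM.V.kk_space_axioms)
  show "ind_vec \<in> ind_index \<rightarrow> carrier IM.V"
  proof (rule funcsetI)
    fix z assume "z \<in> ind_index"
    from ind_vec_closed[OF this] show "ind_vec z \<in> carrier IM.V" by (simp only: restrict_scalars_simps(1))
  qed
qed

sublocale F: vector_family IM.V ind_index ind_vec
  by (rule vector_family_ind)

lemma pure_hom_q:
  "t \<in> carrier MN.T \<Longrightarrow> (\<lambda>q. I.pure q t) \<in> mod_hom kk C.V IM.V"
  by (rule mod_homI[OF add_homI]) (use I.pure_add_left[of _ _ t] in \<open>simp_all add: smult_Ind_pure\<close>)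

lemma pure_hom_t:
  "q \<in> carrier JN \<Longrightarrow> (\<lambda>t. I.pure q t) \<in> mod_hom kk MN.T IM.V"
  by (rule mod_homI[OF add_homI]) (use I.pure_add_right[of q] in \<open>simp_all add: pure_scalar\<close>)

text \<open>The idempotent of \<open>S\<close> formed from the labels \<open>a i\<close> and
  \<open>b j\<close> fixes the right factor. Moved to the left factor it multiplies f_E by the value
  of the character of E on its image under \<open>rho\<close>, which is zero unless E restricts to
  these two labels.\<close>

lemma pure_vanish:
  assumes i: "i \<in> I" and j: "j \<in> K" and E: "E \<in> set_partitions (n + m)" and ne: "E \<notin> glued n m (a i) (b j)"
  shows "I.pure (idem (n + m) E) (MN.pure (v i) (w j)) = \<zero>\<^bsub>IM\<^esub>"
proof -
  let ?s = "AB.pure (idem n (a i)) (idem m (b j))"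
  let ?t = "MN.pure (v i) (w j)"
  have s: "?s \<in> carrier S" unfolding S_eq using i j by (intro AB.pure_closed) simp_all
  have "idem n (a i) \<odot>\<^bsub>M\<^esub> v i = v i" "idem m (b j) \<odot>\<^bsub>N\<^esub> w j = w j"
    using M.V.kk_smult_one[of "v i"] N.V.kk_smult_one[of "w j"] i j
    by (subst M.eigen, simp_all, subst N.eigen, simp_all)
  then have "?s \<odot>\<^bsub>Y\<^esub> ?t = ?t"
    using i j by (simp add: smult_Y_pure act_pure)
  then have "I.pure (idem (n + m) E) ?t = I.pure (?s \<odot>\<^bsub>Q\<^esub> idem (n + m) E) ?t"
    using I.pure_balanced[OF s, of "idem (n + m) E" ?t] i j E by simp
  also have "?s \<odot>\<^bsub>Q\<^esub> idem (n + m) E = 0"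
  proof -
    have "lo n E \<noteq> a i \<or> hi n E \<noteq> b j" using ne E by (simp add: glued_def)
    then show ?thesis
      using i j E by (auto intro!: chi_eqI[of _ "n + m"] mult_J_closed concat_vec_closed
          simp: rho_pure chi_mult concat_vec_closed chi_concat_vec lo_partition hi_partition[of _ n m] carrier_J[of 0])
  qed
  finally show ?thesis using I.pure_zero_left[of ?t] i j by simp
qed

text \<open>The tensor q \<otimes> (p \<otimes> p') is linear in each of its three arguments, so
  each can be expanded in its own basis: the idempotents for q, the given eigenbases for p and p'.
  What does not vanish then is an \<open>ind_vec\<close>.\<close>

lemma spanning: "carrier IM.V \<subseteq> vspan IM.V ind_index ind_vec"
proof
  interpret E: eigenbasis "n + m" "RJ (n + m) :: ('k part_vec, 'k part_vec) module" "set_partitions (n + m)" "\<lambda>A. A" "idem (n + m)"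
    by (rule eigenbasis_RJ)
  note fam = F.vector_family_axioms
  have 1: "I.pure q (MN.pure (v i) (w j)) \<in> vspan IM.V ind_index ind_vec"
    if ij: "i \<in> I" "j \<in> K" and q: "q \<in> carrier JN" for i j q
  proof (rule E.V.hom_into_vspan[OF fam pure_hom_q])
    fix E assume E: "E \<in> set_partitions (n + m)"
    show "I.pure (idem (n + m) E) (MN.pure (v i) (w j)) \<in> vspan IM.V ind_index ind_vec"
    proof (cases "E \<in> glued n m (a i) (b j)")
      case True
      then have "((i, j), E) \<in> ind_index" using ij by (simp add: ind_index_def)
      from F.vspan_base[OF this] show ?thesis by (simp add: ind_vec_def)
    next
      case False
      then show ?thesis using pure_vanish[OF ij E] F.vspan_zero by simp
    qed
  qed (use ij q in simp_all)
  have 2: "I.pure q (MN.pure (v i) p') \<in> vspan IM.V ind_index ind_vec"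
    if i: "i \<in> I" and p': "p' \<in> carrier N" and q: "q \<in> carrier JN" for i p' q
  proof (rule N.V.hom_into_vspan[OF fam, where f = "\<lambda>p'. I.pure q (MN.pure (v i) p')"])
    have "v i \<in> carrier M.V" using i by simp
    from mod_hom_comp[OF MN.pure_mod_hom_right[OF this] pure_hom_t[OF q]]
    show "(\<lambda>p'. I.pure q (MN.pure (v i) p')) \<in> mod_hom kk N.V IM.V" .
  qed (use 1 i p' q in simp_all)
  have 3: "I.pure q (MN.pure p p') \<in> vspan IM.V ind_index ind_vec"
    if p: "p \<in> carrier M" and p': "p' \<in> carrier N" and q: "q \<in> carrier JN" for p p' q
  proof (rule M.V.hom_into_vspan[OF fam, where f = "\<lambda>p. I.pure q (MN.pure p p')"])
    have "p' \<in> carrier N.V" using p' by simp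
    from mod_hom_comp[OF MN.pure_mod_hom_left[OF this] pure_hom_t[OF q]]
    show "(\<lambda>p. I.pure q (MN.pure p p')) \<in> mod_hom kk M.V IM.V" .
  qed (use 2 p p' q in simp_all)
  have 4: "I.pure q t \<in> vspan IM.V ind_index ind_vec" if q: "q \<in> carrier JN" and t: "t \<in> carrier MN.T" for q t
    using t
  proof (induction t rule: MN.tensor_induct)
    case zero
    then show ?case using F.vspan_zero I.pure_zero_right[of q] q by simp
  next
    case (add s t)
    then show ?case using F.vspan_add I.pure_add_right[of q s t] q by simp
  qed (use 3 q in simp)
  fix t assume "t \<in> carrier IM.V"
  then have "t \<in> carrier I.T" by simp
  then show "t \<in> vspan IM.V ind_index ind_vec"
  proof (induction t rule: I.tensor_induct)
    case zero
    then show ?case using F.vspan_zero by simp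
  next
    case (add s t)
    then show ?case using F.vspan_add[of s t] by simp
  qed (use 4 in simp)
qed

definition ind_dual1 :: "'i \<Rightarrow> 'j \<Rightarrow> ('a, 'b) tensor \<Rightarrow> 'k" where
  "ind_dual1 i j = tensor_lift (ring_as_module kk) (\<lambda>p q. Poly_Mapping.lookup (M.V.coord p) i * Poly_Mapping.lookup (N.V.coord q) j)"

lemma
  shows ind_dual1_hom: "ind_dual1 i j \<in> mod_hom kk MN.T (ring_as_module kk)"
    and ind_dual1_pure: "\<lbrakk>p \<in> carrier M; q \<in> carrier N\<rbrakk> \<Longrightarrow>
      ind_dual1 i j (MN.pure p q) = Poly_Mapping.lookup (M.V.coord p) i * Poly_Mapping.lookup (N.V.coord q) j"
proof -
  have l: "(\<lambda>p. Poly_Mapping.lookup (M.V.coord p) i * Poly_Mapping.lookup (N.V.coord q) j) \<in> mod_hom kk M.V (ring_as_module kk)" for q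
    using M.V.coord_functional[of i] by (simp add: functional_iff ring_distribs mult.assoc mult.left_commute)
  have r: "(\<lambda>q. Poly_Mapping.lookup (M.V.coord p) i * Poly_Mapping.lookup (N.V.coord q) j) \<in> mod_hom kk N.V (ring_as_module kk)" for p
    using N.V.coord_functional[of j] by (simp add: functional_iff ring_distribs mult.assoc mult.left_commute)
  show "ind_dual1 i j \<in> mod_hom kk MN.T (ring_as_module kk)"
    unfolding ind_dual1_def by (rule MN.bilinear_lift_hom[OF module_kk_self l r])
  show "ind_dual1 i j (MN.pure p q) = Poly_Mapping.lookup (M.V.coord p) i * Poly_Mapping.lookup (N.V.coord q) j"
    if "p \<in> carrier M" "q \<in> carrier N"
    unfolding ind_dual1_def using that by (intro MN.bilinear_lift_pure[OF module_kk_self l r]) simp_all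
qed

lemma ind_dual1_add: "\<lbrakk>s \<in> carrier MN.T; t \<in> carrier MN.T\<rbrakk> \<Longrightarrow> ind_dual1 i j (s \<oplus>\<^bsub>MN.T\<^esub> t) = ind_dual1 i j s + ind_dual1 i j t"
  using ind_dual1_hom[of i j] by (simp add: functional_iff)

abbreviation "kkm \<equiv> ring_as_module (kk :: 'k ring)"

lemma abelian_group_kkm: "abelian_group kkm"
  by (rule module.axioms(2)[OF module_kk_self])

text \<open>The coordinate at (i, j) transforms under x \<otimes> y by the product of the characters
  of \<open>a i\<close> and \<open>b j\<close>. When E glues these two labels, this product is the
  character of E after \<open>rho\<close>, and that makes \<open>ind_dual\<close> balanced over
  \<open>S\<close>.\<close>

lemma ind_dual1_act:
  assumes z: "((i, j), E) \<in> ind_index" and s: "s \<in> carrier S" and t: "t \<in> carrier MN.T"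
  shows "ind_dual1 i j (s \<odot>\<^bsub>Y\<^esub> t) = chi (n + m) E (rho n m s) * ind_dual1 i j t"
proof -
  note zD = ind_indexD[OF z, simplified]
  have 1: "ind_dual1 i j (act x y t) = chi n (a i) x * chi m (b j) y * ind_dual1 i j t"
    if x: "x \<in> carrier (J n)" and y: "y \<in> carrier (J m)" for x y
    using t
  proof (rule MN.tensor_ext[of _ kkm, rotated -2])
    show "(\<lambda>t. ind_dual1 i j (act x y t)) \<in> add_hom MN.T kkm"
      using add_hom_comp[OF mod_hom_add_hom[OF act_hom[OF x y]] mod_hom_add_hom[OF ind_dual1_hom]] .
    show "(\<lambda>t. chi n (a i) x * chi m (b j) y * ind_dual1 i j t) \<in> add_hom MN.T kkm"
      by (rule add_homI) (simp_all add: ind_dual1_add ring_distribs mult.assoc mult.left_commute)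
  qed (use x y zD in \<open>simp_all add: act_pure ind_dual1_pure M.coord_act N.coord_act abelian_group_kkm\<close>)
  show ?thesis
    using s unfolding S_eq
  proof (rule AB.tensor_ext[of _ kkm, rotated -2])
    show "(\<lambda>s. ind_dual1 i j (s \<odot>\<^bsub>Y\<^esub> t)) \<in> add_hom AB.T kkm"
      using add_hom_comp[OF mod_hom_add_hom[OF smult_Y_hom[OF t]] mod_hom_add_hom[OF ind_dual1_hom]] by (simp add: S_eq)
    show "(\<lambda>s. chi (n + m) E (rho n m s) * ind_dual1 i j t) \<in> add_hom AB.T kkm"
      using add_hom_add[OF rho_hom] by (intro add_homI) (simp_all add: S_eq chi_add ring_distribs mult.assoc mult.left_commute)
  qed (use t zD in \<open>simp_all add: smult_Y_pure 1 rho_pure chi_concat_vec abelian_group_kkm\<close>)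
qed

text \<open>The future coordinate at z: a product of coordinate functionals on the join algebra, on
  M and on N.\<close>

definition ind_dual :: "('i \<times> 'j) \<times> nat set set \<Rightarrow> ('k part_vec, ('a, 'b) tensor) tensor \<Rightarrow> 'k" where
  "ind_dual z = tensor_lift kkm (\<lambda>q t. chi (n + m) (snd z) q * ind_dual1 (fst (fst z)) (snd (fst z)) t)"

lemma
  assumes z: "z \<in> ind_index"
  shows ind_dual_hom: "ind_dual z \<in> mod_hom kk IM.V kkm"
    and ind_dual_pure: "\<lbrakk>q \<in> carrier JN; t \<in> carrier MN.T\<rbrakk> \<Longrightarrow>
      ind_dual z (I.pure q t) = chi (n + m) (snd z) q * ind_dual1 (fst (fst z)) (snd (fst z)) t"
proof -
  obtain i j E where zE: "z = ((i, j), E)" by (metis prod.exhaust)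
  note zD = ind_indexD[OF z, unfolded zE, simplified]
  have bal: "balanced_map S Q Y kkm (\<lambda>q t. chi (n + m) E q * ind_dual1 i j t)"
  proof (rule balanced_mapI)
    fix s t and q :: "'k part_vec" assume "s \<in> carrier S" "q \<in> carrier Q" "t \<in> carrier Y"
    then show "chi (n + m) E (s \<odot>\<^bsub>Q\<^esub> q) * ind_dual1 i j t = chi (n + m) E q * ind_dual1 i j (s \<odot>\<^bsub>Y\<^esub> t)"
      using ind_dual1_act[OF z[unfolded zE]] add_hom_closed[OF rho_hom] by (simp add: chi_mult)
  qed (simp_all add: chi_add ind_dual1_add ring_distribs mult.assoc mult.left_commute)
  note lift = I.tensor_lift_hom[OF abelian_group_kkm bal]
  have pure: "ind_dual z (I.pure q t) = chi (n + m) E q * ind_dual1 i j t"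
    if "q \<in> carrier JN" "t \<in> carrier MN.T" for q t
    unfolding ind_dual_def zE using I.tensor_lift_pure[OF abelian_group_kkm bal, of q t] that by simp
  then show "\<lbrakk>q \<in> carrier JN; t \<in> carrier MN.T\<rbrakk> \<Longrightarrow>
      ind_dual z (I.pure q t) = chi (n + m) (snd z) q * ind_dual1 (fst (fst z)) (snd (fst z)) t"
    by (simp add: zE)
  have add: "ind_dual z \<in> add_hom I.T kkm" using lift by (simp add: ind_dual_def zE)
  show "ind_dual z \<in> mod_hom kk IM.V kkm"
  proof (rule mod_homI)
    show "ind_dual z \<in> add_hom IM.V kkm" using add by (simp add: add_hom_def)
    fix c t assume "t \<in> carrier IM.V"
    then have "t \<in> carrier I.T" by simp
    then show "ind_dual z (c \<odot>\<^bsub>IM.V\<^esub> t) = c \<odot>\<^bsub>kkm\<^esub> ind_dual z t"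
    proof (rule I.tensor_ext[of _ kkm, rotated -2])
      show "(\<lambda>t. ind_dual z (c \<odot>\<^bsub>IM.V\<^esub> t)) \<in> add_hom I.T kkm"
        using add_hom_comp[OF smult_Ind_hom[OF scalar_closed] add] by simp
      show "(\<lambda>t. c \<odot>\<^bsub>kkm\<^esub> ind_dual z t) \<in> add_hom I.T kkm"
        using add_hom_add[OF add] by (intro add_homI) (simp_all add: ring_distribs mult.assoc mult.left_commute)
    qed (use zD in \<open>simp_all add: smult_Ind_pure pure mult_J_closed chi_mult abelian_group_kkm\<close>)
  qed
qed

text \<open>Each pair of basis vectors contributes one line for every gluing of their labels, which
  is the count needed for multiplicativity. The label is read off the left factor, where the larger
  join algebra acts on f_C by \<chi>_C.\<close>

theorem ind_eigenbasis: "eigenbasis (n + m) IM ind_index snd ind_vec"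
proof (rule IM.eigenbasisI)
  show "finite ind_index" by (auto simp: ind_index_def)
  show "snd z \<in> set_partitions (n + m)" if "z \<in> ind_index" for z using ind_indexD[OF that] by simp
  show "is_basis IM.V ind_index ind_vec"
  proof (rule F.is_basis_dualI[OF spanning ind_dual_hom])
    fix z z' assume z: "z \<in> ind_index" "z' \<in> ind_index"
    note zD = ind_indexD[OF z(1)] ind_indexD[OF z(2)]
    have "ind_dual z (ind_vec z') = chi (n + m) (snd z) (idem (n + m) (snd z')) *
        ind_dual1 (fst (fst z)) (snd (fst z)) (MN.pure (v (fst (fst z'))) (w (snd (fst z'))))"
      unfolding ind_vec_def using zD by (intro ind_dual_pure[OF z(1)]) simp_all
    \<comment> \<open>The character compares the partitions and the coordinates compare the basis
      vectors, so together they compare the indices.\<close>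
    also have "\<dots> = of_bool (z = z')"
      using zD by (auto simp: ind_dual1_pure M.V.coord_base N.V.coord_base lookup_single when_def prod_eq_iff)
    finally show "ind_dual z (ind_vec z') = of_bool (z = z')" .
  qed
  show "IM.eigenvector (snd z) (ind_vec z)" if z: "z \<in> ind_index" for z
    unfolding IM.eigenvector_def
  proof (intro conjI ballI)
    fix r assume r: "r \<in> carrier JN"
    show "r \<odot>\<^bsub>IM\<^esub> ind_vec z = scalar (n + m) (chi (n + m) (snd z) r) \<odot>\<^bsub>IM\<^esub> ind_vec z"
      unfolding ind_vec_def using ind_indexD[OF z] r mult_idem[of r "n + m" "snd z"] by (simp add: smult_Ind_pure)
  qed (rule ind_vec_closed[OF z])
qed

end

section \<open>The characteristic of a projective module\<close>

text \<open>A definition cannot quantify over index types, so the index set is taken among sets of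
  module elements; a basis indexed by itself is always available there. By
  \<open>eigenbasis_unique\<close> the value is independent of the choice.\<close>

definition ch :: "nat \<Rightarrow> ('k::field_char_0 part_vec, 'a, 'x) module_scheme \<Rightarrow> 'k nc_series" where
  "ch n P = (SOME s. \<exists>(I :: 'a set) a v. eigenbasis n P I a v \<and> s = (\<lambda>u. \<Sum>i\<in>I. monomial_fun (n, a i) u))"

lemma ch_eq:
  fixes P :: "('k::field_char_0 part_vec, 'a, 'x) module_scheme"
  assumes "eigenbasis n P I a v"
  shows "ch n P = (\<lambda>u. \<Sum>i\<in>I. monomial_fun (n, a i) u)"
proof -
  obtain I' :: "'a set" and a' where e: "eigenbasis n P I' a' (\<lambda>v. v)"
    using fd_projective_eigenbasis[OF eigenbasis.fd_projective[OF assms]] by blast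
  then have "\<exists>s. \<exists>(I :: 'a set) a v. eigenbasis n P I a v \<and> s = (\<lambda>u. \<Sum>i\<in>I. monomial_fun (n, a i) u :: 'k)"
    by blast
  from someI_ex[OF this] obtain I2 :: "'a set" and a2 v2 where
    "eigenbasis n P I2 a2 v2" and ch: "ch n P = (\<lambda>u. \<Sum>i\<in>I2. monomial_fun (n, a2 i) u)"
    unfolding ch_def by blast
  then show ?thesis
    using eigenbasis_unique[OF _ assms, of I2 a2 v2 "\<lambda>A. monomial_fun (n, A) u" for u] by auto
qed

section \<open>Passing to standard copies\<close>

lemma mod_iso_sym:
  assumes "module R M" "module R N" "mod_iso R M N"
  shows "mod_iso R N M"
proof -
  interpret M: module R M by fact
  interpret N: module R N by fact
  obtain f where f: "f \<in> mod_hom R M N" and bij: "bij_betw f (carrier M) (carrier N)"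
    using assms(3) unfolding mod_iso_def by blast
  let ?g = "inv_into (carrier M) f"
  have g: "?g y \<in> carrier M" "f (?g y) = y" if "y \<in> carrier N" for y
    using bij that by (auto simp: bij_betw_def inv_into_into f_inv_into_f)
  have gI: "?g y = x" if "x \<in> carrier M" "f x = y" for x y
    using bij that by (auto simp: bij_betw_def)
  have "?g \<in> mod_hom R N M"
  proof (rule mod_homI[OF add_homI])
    show "?g y \<in> carrier M" if "y \<in> carrier N" for y using g that by blast
    show "?g (x \<oplus>\<^bsub>N\<^esub> y) = ?g x \<oplus>\<^bsub>M\<^esub> ?g y" if "x \<in> carrier N" "y \<in> carrier N" for x y
      using that g add_hom_add[OF mod_hom_add_hom[OF f]] by (intro gI) simp_all
    show "?g (r \<odot>\<^bsub>N\<^esub> x) = r \<odot>\<^bsub>M\<^esub> ?g x" if "r \<in> carrier R" "x \<in> carrier N" for r x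
      using that g mod_hom_smult[OF f] by (intro gI) simp_all
  qed
  then show ?thesis
    unfolding mod_iso_def using bij_betw_inv_into[OF bij] by blast
qed

lemma K0_gens_J_module: "(n, P) \<in> K0_gens \<Longrightarrow> J_module n P"
  by (simp add: K0_gens_def fd_projective_def fg_projective_def J_module_def)

lemma std_copy_eigenbasis:
  assumes M: "eigenbasis n M I a v"
  obtains u where "eigenbasis n (std_copy n M) I a u"
proof -
  interpret M: eigenbasis n M I a v by fact
  note sc = std_copy[OF M]
  have JC: "J_module n (std_copy n M)" by (rule K0_gens_J_module[OF sc(1)])
  then have "mod_iso (J n) M (std_copy n M)"
    using mod_iso_sym[OF _ M.module_axioms sc(2)] by (simp add: J_module_def)
  then show thesis
    using that eigenbasis_transport[OF M JC] unfolding mod_iso_def by blast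
qed

lemma ch_std_copy:
  assumes "eigenbasis n M I a v"
  shows "ch n (std_copy n M) = ch n M"
proof -
  obtain u where "eigenbasis n (std_copy n M) I a u" using std_copy_eigenbasis[OF assms] .
  then show ?thesis by (simp add: ch_eq ch_eq[OF assms])
qed

text \<open>Idempotents produce the lift: an arbitrary preimage \<open>y k\<close> of
  \<open>w k\<close>, multiplied by the idempotent of \<open>b k\<close>, becomes an eigenvector and
  still maps to \<open>w k\<close>. These vectors and the images of the \<open>v i\<close> form the
  basis, with the coordinates of \<open>r x\<close> and \<open>g x\<close> as dual
  functionals.\<close>

lemma short_exact_eigenbasis:
  assumes M': "eigenbasis n M' I a v" and M'': "eigenbasis n M'' K b w" and M: "J_module n M"
    and ses: "short_exact (J n) M' M M''"
  obtains u where "eigenbasis n M (I <+> K) (case_sum a b) u"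
proof -
  interpret M': eigenbasis n M' I a v by fact
  interpret M'': eigenbasis n M'' K b w by fact
  interpret M: J_module n M by fact
  obtain f g where f: "f \<in> mod_hom (J n) M' M" and g: "g \<in> mod_hom (J n) M M''"
    and inj: "inj_on f (carrier M')" and surj: "g ` carrier M = carrier M''"
    and exact: "f ` carrier M' = {x \<in> carrier M. g x = \<zero>\<^bsub>M''\<^esub>}"
    using ses unfolding short_exact_def by blast
  note fk = over_field_hom[OF f] and gk = over_field_hom[OF g]
  note fc = add_hom_closed[OF mod_hom_add_hom[OF f]] and gc = add_hom_closed[OF mod_hom_add_hom[OF g]]
  note fa = add_hom_add[OF mod_hom_add_hom[OF f]] and ga = add_hom_add[OF mod_hom_add_hom[OF g]]
  note mM = module_over_field[OF M.module_axioms] and mM'' = module_over_field[OF M''.module_axioms]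
  define y where "y k = inv_into (carrier M) g (w k)" for k
  have y: "y k \<in> carrier M" "g (y k) = w k" if "k \<in> K" for k
    using that surj by (auto simp: y_def inv_into_into f_inv_into_f)
  define z where "z k = idem n (b k) \<odot>\<^bsub>M\<^esub> y k" for k
  have z: "z k \<in> carrier M" "g (z k) = w k" if k: "k \<in> K" for k
  proof -
    have "idem n (b k) \<odot>\<^bsub>M''\<^esub> w k = w k"
      using M''.V.kk_smult_one[of "w k"] k by (subst M''.eigen) simp_all
    then show "z k \<in> carrier M" "g (z k) = w k"
      using k y mod_hom_smult[OF g, of "idem n (b k)" "y k"] by (simp_all add: z_def)
  qed
  \<comment> \<open>A section over the field. It serves to find coordinates; the action of the join
    algebra is accounted for by the eigenvectors \<open>z k\<close>.\<close>
  define s where "s = linear_extension M''.V K w M.V z"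
  have s: "s \<in> mod_hom kk M''.V M.V" and sw: "\<And>k. k \<in> K \<Longrightarrow> s (w k) = z k"
    unfolding s_def using M''.V.linear_extension_hom[OF mM, of z] M''.V.linear_extension_base[OF mM, of z] z by auto
  note sc = add_hom_closed[OF mod_hom_add_hom[OF s]] and sa = add_hom_add[OF mod_hom_add_hom[OF s]]
  have id: "(\<lambda>x. x) \<in> mod_hom kk M''.V M''.V" by (rule mod_homI[OF add_homI]) simp_all
  have gs: "g (s x) = x" if "x \<in> carrier M''.V" for x
    using that by (rule M''.V.mod_hom_ext[OF mM'' mod_hom_comp[OF s gk] id]) (simp add: sw z)
  \<comment> \<open>The component of x along M'. Applying g shows that x - s (g x) is in the kernel
    of g, which by exactness is the image of f.\<close>
  define r where "r x = inv_into (carrier M') f (x \<ominus>\<^bsub>M\<^esub> s (g x))" for x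
  have gneg: "g (\<ominus>\<^bsub>M\<^esub> x) = \<ominus>\<^bsub>M''\<^esub> g x" if "x \<in> carrier M" for x
    using add_hom_neg[OF mod_hom_add_hom[OF g] M.M.abelian_group_axioms M''.M.abelian_group_axioms that] .
  have r: "r x \<in> carrier M'" "f (r x) \<oplus>\<^bsub>M\<^esub> s (g x) = x" if x: "x \<in> carrier M" for x
  proof -
    have sx: "s (g x) \<in> carrier M" using sc[of "g x"] gc[OF x] by simp
    have "g (x \<ominus>\<^bsub>M\<^esub> s (g x)) = \<zero>\<^bsub>M''\<^esub>"
      using x sx gs[of "g x"] gc[OF x] by (simp add: a_minus_def ga gneg M''.M.r_neg)
    then have "x \<ominus>\<^bsub>M\<^esub> s (g x) \<in> f ` carrier M'" using exact x sx by simp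
    then show "r x \<in> carrier M'" "f (r x) \<oplus>\<^bsub>M\<^esub> s (g x) = x"
      using x sx by (simp_all add: r_def inv_into_into f_inv_into_f a_minus_def M.M.a_assoc M.M.l_neg)
  qed
  \<comment> \<open>Linearity of r, defined by \<open>inv_into\<close>, is deduced from this
    characterisation.\<close>
  have r_unique: "r x = p" if "p \<in> carrier M'" "x \<in> carrier M" "f p \<oplus>\<^bsub>M\<^esub> s (g x) = x" for p x
  proof -
    have "s (g x) \<in> carrier M" using sc[of "g x"] gc[OF that(2)] by simp
    then have "f p = f (r x)"
      using that r[OF that(2)] fc by (metis M.M.add.right_cancel)
    then show ?thesis using inj that r by (simp add: inj_on_def)
  qed
  have r_hom: "r \<in> mod_hom kk M.V M'.V"
  proof (rule mod_homI[OF add_homI])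
    show "r x \<in> carrier M'.V" if "x \<in> carrier M.V" for x using r that by simp
    show "r (x \<oplus>\<^bsub>M.V\<^esub> x') = r x \<oplus>\<^bsub>M'.V\<^esub> r x'" if "x \<in> carrier M.V" "x' \<in> carrier M.V" for x x'
    proof -
      have x: "x \<in> carrier M" "x' \<in> carrier M" using that by simp_all
      have sx: "s (g x) \<in> carrier M" "s (g x') \<in> carrier M" using x gc sc by simp_all
      have "f (r x \<oplus>\<^bsub>M'\<^esub> r x') \<oplus>\<^bsub>M\<^esub> s (g (x \<oplus>\<^bsub>M\<^esub> x')) = (f (r x) \<oplus>\<^bsub>M\<^esub> f (r x')) \<oplus>\<^bsub>M\<^esub> (s (g x) \<oplus>\<^bsub>M\<^esub> s (g x'))"
        using x r gc by (simp add: fa ga sa[simplified])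
      also have "\<dots> = (f (r x) \<oplus>\<^bsub>M\<^esub> s (g x)) \<oplus>\<^bsub>M\<^esub> (f (r x') \<oplus>\<^bsub>M\<^esub> s (g x'))"
        using x r sx fc by (simp only: M.M.a_ac M.M.a_closed)
      also have "\<dots> = x \<oplus>\<^bsub>M\<^esub> x'" using x r by simp
      finally show ?thesis using x r by (simp add: r_unique)
    qed
    show "r (c \<odot>\<^bsub>M.V\<^esub> x) = c \<odot>\<^bsub>M'.V\<^esub> r x" if "x \<in> carrier M.V" for c x
    proof -
      have x: "x \<in> carrier M" using that by simp
      have sx: "s (g x) \<in> carrier M" using x gc sc by simp
      have "f (scalar n c \<odot>\<^bsub>M'\<^esub> r x) \<oplus>\<^bsub>M\<^esub> s (g (scalar n c \<odot>\<^bsub>M\<^esub> x)) = scalar n c \<odot>\<^bsub>M\<^esub> f (r x) \<oplus>\<^bsub>M\<^esub> scalar n c \<odot>\<^bsub>M\<^esub> s (g x)"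
        using x r gc mod_hom_smult[OF f scalar_closed] mod_hom_smult[OF g scalar_closed] mod_hom_smult[OF s, of c "g x"] by simp
      also have "\<dots> = scalar n c \<odot>\<^bsub>M\<^esub> (f (r x) \<oplus>\<^bsub>M\<^esub> s (g x))"
        using M.smult_r_distr[OF scalar_closed, of "f (r x)" "s (g x)"] fc[OF r(1)[OF x]] sx by simp
      also have "\<dots> = scalar n c \<odot>\<^bsub>M\<^esub> x" using x r by simp
      finally show ?thesis using x r by (simp add: r_unique)
    qed
  qed
  have s0: "s \<zero>\<^bsub>M''\<^esub> = \<zero>\<^bsub>M\<^esub>"
    using add_hom_zero[OF mod_hom_add_hom[OF s] M''.V.M.abelian_group_axioms M.V.M.abelian_group_axioms] by simp
  have f0: "f \<zero>\<^bsub>M'\<^esub> = \<zero>\<^bsub>M\<^esub>"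
    using add_hom_zero[OF mod_hom_add_hom[OF f] M'.M.abelian_group_axioms M.M.abelian_group_axioms] .
  have gf: "g (f p) = \<zero>\<^bsub>M''\<^esub>" if "p \<in> carrier M'" for p using exact that by blast
  have rf: "r (f p) = p" if "p \<in> carrier M'" for p
    using that by (intro r_unique) (simp_all add: fc gf s0)
  have rz: "r (z k) = \<zero>\<^bsub>M'\<^esub>" if "k \<in> K" for k
    using that z by (intro r_unique) (simp_all add: f0 sw)
  define u where "u = case_sum (\<lambda>i. f (v i)) z"
  have fam: "vector_family M.V (I <+> K) u"
    by (intro vector_family.intro vector_family_axioms.intro M.V.kk_space_axioms) (auto simp: u_def fc z)
  interpret F: vector_family M.V "I <+> K" u by (rule fam)
  have "eigenbasis n M (I <+> K) (case_sum a b) u"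
  proof (rule M.eigenbasisI)
    show "finite (I <+> K)" by simp
    show "case_sum a b i \<in> set_partitions n" if "i \<in> I <+> K" for i using that by auto
    show "is_basis M.V (I <+> K) u"
    proof (rule F.is_basis_dualI)
      show "carrier M.V \<subseteq> vspan M.V (I <+> K) u"
      proof
        fix x assume "x \<in> carrier M.V"
        then have x: "x \<in> carrier M" by simp
        have "f (r x) \<in> vspan M.V (I <+> K) u"
        proof (rule M'.V.hom_into_vspan[OF fam fk])
          show "f (v i) \<in> vspan M.V (I <+> K) u" if "i \<in> I" for i
            using F.vspan_base[OF InlI[OF that]] by (simp add: u_def)
        qed (use r x in simp)
        moreover have "s (g x) \<in> vspan M.V (I <+> K) u"
        proof (rule M''.V.hom_into_vspan[OF fam s])
          show "s (w k) \<in> vspan M.V (I <+> K) u" if "k \<in> K" for k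
            using F.vspan_base[OF InrI[OF that]] that by (simp add: u_def sw)
        qed (use gc x in simp)
        ultimately show "x \<in> vspan M.V (I <+> K) u"
          using F.vspan_add r(2)[OF x] by fastforce
      qed
      let ?d = "case_sum (\<lambda>i x. Poly_Mapping.lookup (M'.V.coord (r x)) i) (\<lambda>k x. Poly_Mapping.lookup (M''.V.coord (g x)) k)"
      show "?d i \<in> mod_hom kk M.V (ring_as_module kk)" for i
        using mod_hom_comp[OF r_hom M'.V.coord_functional] mod_hom_comp[OF gk M''.V.coord_functional]
        by (cases i) simp_all
      have c0: "M'.V.coord \<zero>\<^bsub>M'\<^esub> = 0" "M''.V.coord \<zero>\<^bsub>M''\<^esub> = 0"
        using M'.V.coord_lincomb[of 0] M''.V.coord_lincomb[of 0] by simp_all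
      show "?d i (u j) = of_bool (i = j)" if "i \<in> I <+> K" "j \<in> I <+> K" for i j
        using that by (auto simp: u_def rf rz gf z c0 M'.V.coord_base M''.V.coord_base lookup_single when_def split: if_splits)
    qed
    show "M.eigenvector (case_sum a b i) (u i)" if i: "i \<in> I <+> K" for i
    proof (cases i)
      case (Inl j)
      then have j: "j \<in> I" using i by auto
      have eig: "x \<odot>\<^bsub>M\<^esub> f (v j) = scalar n (chi n (a j) x) \<odot>\<^bsub>M\<^esub> f (v j)" if x: "x \<in> carrier (J n)" for x
        using mod_hom_smult[OF f x M'.v_closed[OF j]] mod_hom_smult[OF f scalar_closed M'.v_closed[OF j]] M'.eigen[OF j x]
        by simp
      have "M.eigenvector (a j) (f (v j))"
        unfolding M.eigenvector_def by (intro conjI ballI eig fc M'.v_closed j)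
      then show ?thesis using Inl by (simp add: u_def)
    next
      case (Inr k)
      then show ?thesis using M.eigenvector_idem[of "y k" "b k"] y i by (auto simp: u_def z_def)
    qed
  qed
  then show thesis by (rule that)
qed

lemma ch_short_exact:
  assumes "fd_projective n M'" "fd_projective n M" "fd_projective n M''" "short_exact (J n) M' M M''"
  shows "ch n M u = ch n M' u + ch n M'' u"
proof -
  obtain I a where e': "eigenbasis n M' I a (\<lambda>v. v)" using fd_projective_eigenbasis[OF assms(1)] .
  obtain K b where e'': "eigenbasis n M'' K b (\<lambda>v. v)" using fd_projective_eigenbasis[OF assms(3)] .
  have "J_module n M" using assms(2) by (simp add: fd_projective_def fg_projective_def J_module_def)
  then obtain v where e: "eigenbasis n M (I <+> K) (case_sum a b) v"
    using short_exact_eigenbasis[OF e' e'' _ assms(4)] by blast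
  interpret I: eigenbasis n M' I a "\<lambda>v. v" by fact
  interpret K: eigenbasis n M'' K b "\<lambda>v. v" by fact
  show ?thesis unfolding ch_eq[OF e] ch_eq[OF e'] ch_eq[OF e''] by (simp add: sum.Plus)
qed

text \<open>The maps f and s include the two halves of the basis, g and r project onto them, and f
  (r x) + s (g x) = x. This is the source of the relations by which a module is broken into
  lines.\<close>

lemma eigenbasis_short_exact:
  assumes M: "eigenbasis n M (I \<union> K) a u" and M': "eigenbasis n M' I a v" and M'': "eigenbasis n M'' K a w"
    and disj: "I \<inter> K = {}"
  shows "short_exact (J n) M' M M''"
proof -
  interpret M: eigenbasis n M "I \<union> K" a u by fact
  interpret M': eigenbasis n M' I a v by fact
  interpret M'': eigenbasis n M'' K a w by fact
  have JM: "J_module n M" "J_module n M'" "J_module n M''" by unfold_locales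
  \<comment> \<open>The projections g and r send half of the basis to zero, which must therefore
    count as an eigenvector for the labels occurring there.\<close>
  have zero: "M'.eigenvector A \<zero>\<^bsub>M'\<^esub>" "M''.eigenvector A \<zero>\<^bsub>M''\<^esub>" for A
    by (auto simp: M'.eigenvector_def M''.eigenvector_def)
  define f where "f = linear_extension M'.V I v M.V u"
  define g where "g = linear_extension M.V (I \<union> K) u M''.V (\<lambda>i. if i \<in> K then w i else \<zero>\<^bsub>M''\<^esub>)"
  define r where "r = linear_extension M.V (I \<union> K) u M'.V (\<lambda>i. if i \<in> I then v i else \<zero>\<^bsub>M'\<^esub>)"
  define s where "s = linear_extension M''.V K w M.V u"
  have f: "f \<in> mod_hom (J n) M' M" "\<And>i. i \<in> I \<Longrightarrow> f (v i) = u i"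
    unfolding f_def using M'.extension_J_hom[OF JM(1), of u] M.eigenvector_v by auto
  have s: "s \<in> mod_hom (J n) M'' M" "\<And>i. i \<in> K \<Longrightarrow> s (w i) = u i"
    unfolding s_def using M''.extension_J_hom[OF JM(1), of u] M.eigenvector_v by auto
  have g: "g \<in> mod_hom (J n) M M''" "\<And>i. i \<in> I \<union> K \<Longrightarrow> g (u i) = (if i \<in> K then w i else \<zero>\<^bsub>M''\<^esub>)"
    unfolding g_def using M.extension_J_hom[OF JM(3), of "\<lambda>i. if i \<in> K then w i else \<zero>\<^bsub>M''\<^esub>"] M''.eigenvector_v zero by auto
  have r: "r \<in> mod_hom (J n) M M'" "\<And>i. i \<in> I \<union> K \<Longrightarrow> r (u i) = (if i \<in> I then v i else \<zero>\<^bsub>M'\<^esub>)"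
    unfolding r_def using M.extension_J_hom[OF JM(2), of "\<lambda>i. if i \<in> I then v i else \<zero>\<^bsub>M'\<^esub>"] M'.eigenvector_v zero by auto
  note fk = over_field_hom[OF f(1)] and gk = over_field_hom[OF g(1)] and rk = over_field_hom[OF r(1)] and sk = over_field_hom[OF s(1)]
  note mM = module_over_field[OF M.module_axioms] and mM' = module_over_field[OF M'.module_axioms]
    and mM'' = module_over_field[OF M''.module_axioms]
  have id: "(\<lambda>x. x) \<in> mod_hom kk M.V M.V" "(\<lambda>x. x) \<in> mod_hom kk M'.V M'.V" "(\<lambda>x. x) \<in> mod_hom kk M''.V M''.V"
    by (rule mod_homI[OF add_homI]; simp)+
  note fc = add_hom_closed[OF mod_hom_add_hom[OF f(1)]] and gc = add_hom_closed[OF mod_hom_add_hom[OF g(1)]]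
    and rc = add_hom_closed[OF mod_hom_add_hom[OF r(1)]] and sc = add_hom_closed[OF mod_hom_add_hom[OF s(1)]]
  have f0: "f \<zero>\<^bsub>M'\<^esub> = \<zero>\<^bsub>M\<^esub>" and s0: "s \<zero>\<^bsub>M''\<^esub> = \<zero>\<^bsub>M\<^esub>"
    using add_hom_zero[OF mod_hom_add_hom[OF f(1)]] add_hom_zero[OF mod_hom_add_hom[OF s(1)]]
      M.M.abelian_group_axioms M'.M.abelian_group_axioms M''.M.abelian_group_axioms by blast+
  have rf: "r (f x) = x" if "x \<in> carrier M'.V" for x
    using that by (rule M'.V.mod_hom_ext[OF mM' mod_hom_comp[OF fk rk] id(2)]) (simp add: f r)
  have gs: "g (s x) = x" if "x \<in> carrier M''.V" for x
    using that by (rule M''.V.mod_hom_ext[OF mM'' mod_hom_comp[OF sk gk] id(3)]) (simp add: s g)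
  have zh: "(\<lambda>x. \<zero>\<^bsub>M''\<^esub>) \<in> mod_hom kk M'.V M''.V"
    by (rule mod_homI[OF add_homI]) simp_all
  have gf: "g (f x) = \<zero>\<^bsub>M''\<^esub>" if "x \<in> carrier M'.V" for x
    using that by (rule M'.V.mod_hom_ext[OF mM'' mod_hom_comp[OF fk gk] zh]) (use disj in \<open>auto simp: f g\<close>)
  have dec: "f (r x) \<oplus>\<^bsub>M\<^esub> s (g x) = x" if "x \<in> carrier M.V" for x
  proof (rule M.V.mod_hom_ext[OF mM _ id(1) that, where f = "\<lambda>x. f (r x) \<oplus>\<^bsub>M\<^esub> s (g x)"])
    show "(\<lambda>x. f (r x) \<oplus>\<^bsub>M\<^esub> s (g x)) \<in> mod_hom kk M.V M.V"
    proof (rule mod_homI[OF add_homI])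
      fix x y assume "x \<in> carrier M.V" "y \<in> carrier M.V"
      then show "f (r (x \<oplus>\<^bsub>M.V\<^esub> y)) \<oplus>\<^bsub>M\<^esub> s (g (x \<oplus>\<^bsub>M.V\<^esub> y)) = f (r x) \<oplus>\<^bsub>M\<^esub> s (g x) \<oplus>\<^bsub>M.V\<^esub> (f (r y) \<oplus>\<^bsub>M\<^esub> s (g y))"
        using add_hom_add[OF mod_hom_add_hom[OF f(1)]] add_hom_add[OF mod_hom_add_hom[OF g(1)]]
          add_hom_add[OF mod_hom_add_hom[OF r(1)]] add_hom_add[OF mod_hom_add_hom[OF s(1)]] fc gc rc sc
        by (simp add: M.M.a_ac)
    next
      fix c x assume "x \<in> carrier M.V"
      then show "f (r (c \<odot>\<^bsub>M.V\<^esub> x)) \<oplus>\<^bsub>M\<^esub> s (g (c \<odot>\<^bsub>M.V\<^esub> x)) = c \<odot>\<^bsub>M.V\<^esub> (f (r x) \<oplus>\<^bsub>M\<^esub> s (g x))"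
        using mod_hom_smult[OF f(1)] mod_hom_smult[OF g(1)] mod_hom_smult[OF r(1)] mod_hom_smult[OF s(1)] fc gc rc sc
        by (simp add: M.smult_r_distr)
    qed (use fc gc rc sc in simp)
    show "f (r (u i)) \<oplus>\<^bsub>M\<^esub> s (g (u i)) = u i" if "i \<in> I \<union> K" for i
      using that disj by (auto simp: f g r s f0 s0)
  qed
  show ?thesis
    unfolding short_exact_def
  proof (intro bexI[OF _ f(1)] bexI[OF _ g(1)] conjI)
    show "inj_on f (carrier M')" using rf by (auto intro: inj_on_inverseI[of _ r])
    show "g ` carrier M = carrier M''"
    proof
      show "carrier M'' \<subseteq> g ` carrier M" using gs sc by (metis image_eqI restrict_scalars_simps(1) subsetI)
    qed (use gc in auto)
    show "f ` carrier M' = {x \<in> carrier M. g x = \<zero>\<^bsub>M''\<^esub>}"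
    proof
      show "{x \<in> carrier M. g x = \<zero>\<^bsub>M''\<^esub>} \<subseteq> f ` carrier M'"
      proof clarify
        fix x assume x: "x \<in> carrier M" "g x = \<zero>\<^bsub>M''\<^esub>"
        then have "x = f (r x)" using dec[of x] fc rc by (simp add: s0)
        then show "x \<in> f ` carrier M'" using rc[OF x(1)] by (rule image_eqI)
      qed
    qed (use fc gf in auto)
  qed
qed

text \<open>The index i is arbitrary, so that the line can be considered alone, indexed by
  \<open>()\<close>, or be the part of a numbered basis at position d.\<close>

lemma W_module_eigenbasis:
  assumes A: "A \<in> set_partitions n"
  shows "eigenbasis n (W_module n A :: ('k::field_char_0 part_vec, 'k part_vec) module) {i} (\<lambda>_. A) (\<lambda>_. idem n A)"
proof -
  let ?W = "W_module n A :: ('k part_vec, 'k part_vec) module"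
  let ?f = "idem n A :: 'k part_vec"
  interpret R: cring "J n :: 'k part_vec ring" by (rule cring_J)
  have f: "?f \<in> carrier (J n)" using A by simp
  have simps: "carrier ?W = (\<lambda>x. x \<otimes>\<^bsub>J n\<^esub> ?f) ` carrier (J n)" "x \<oplus>\<^bsub>?W\<^esub> y = x + y" "\<zero>\<^bsub>?W\<^esub> = 0" "x \<odot>\<^bsub>?W\<^esub> y = x \<otimes>\<^bsub>J n\<^esub> y" for x y
    by (simp_all add: W_module_def ring_as_module_def)
  have sub: "carrier ?W \<subseteq> carrier (J n)" using f by (auto simp: simps mult_J_closed)
  have ac: "x + y \<in> carrier ?W" if xy: "x \<in> carrier ?W" "y \<in> carrier ?W" for x y
  proof -
    obtain x' y' where "x = x' \<otimes>\<^bsub>J n\<^esub> ?f" "y = y' \<otimes>\<^bsub>J n\<^esub> ?f" and c: "x' \<in> carrier (J n)" "y' \<in> carrier (J n)"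
      using xy unfolding simps by blast
    then have "x + y = (x' + y') \<otimes>\<^bsub>J n\<^esub> ?f" using R.l_distr[of x' y' ?f] f by simp
    then show ?thesis unfolding simps using add_J_closed[OF c] by (rule image_eqI)
  qed
  have sc: "x \<otimes>\<^bsub>J n\<^esub> y \<in> carrier ?W" if x: "x \<in> carrier (J n)" and y: "y \<in> carrier ?W" for x y
  proof -
    obtain y' where "y = y' \<otimes>\<^bsub>J n\<^esub> ?f" and c: "y' \<in> carrier (J n)"
      using y unfolding simps by blast
    then have "x \<otimes>\<^bsub>J n\<^esub> y = (x \<otimes>\<^bsub>J n\<^esub> y') \<otimes>\<^bsub>J n\<^esub> ?f" using R.m_assoc[of x y' ?f] f x by simp
    then show ?thesis unfolding simps using mult_J_closed[OF x c] by (rule image_eqI)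
  qed
  interpret W: J_module n ?W
    unfolding J_module_def
  proof (rule moduleI)
    have zc: "0 \<in> carrier ?W"
      unfolding simps using R.l_null[OF f] R.zero_closed by (intro image_eqI[of _ _ 0]) simp_all
    show "abelian_group ?W"
    proof (rule abelian_groupI)
      fix x assume x: "x \<in> carrier ?W"
      then have xJ: "x \<in> carrier (J n)" using sub by blast
      \<comment> \<open>The negative is taken as a multiple by -1, for which membership in the ideal
        is already known.\<close>
      have "scalar n (-1) \<otimes>\<^bsub>J n\<^esub> x + x = 0"
        using xJ by (intro chi_eqI[of _ n]) (auto intro!: add_J_closed mult_J_closed simp: carrier_J[of 0] chi_add chi_mult)
      then show "\<exists>y\<in>carrier ?W. y \<oplus>\<^bsub>?W\<^esub> x = \<zero>\<^bsub>?W\<^esub>"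
        using sc[OF scalar_closed x, of "-1"] by (auto simp: simps(2,3))
    qed (use zc ac in \<open>simp_all add: simps(2,3) algebra_simps\<close>)
    fix x y z :: "'k part_vec" assume "x \<in> carrier (J n)" and y: "y \<in> carrier (J n)" and z: "z \<in> carrier ?W"
    have "z \<in> carrier (J n)" using sub z by blast
    then show "(x \<oplus>\<^bsub>J n\<^esub> y) \<odot>\<^bsub>?W\<^esub> z = x \<odot>\<^bsub>?W\<^esub> z \<oplus>\<^bsub>?W\<^esub> y \<odot>\<^bsub>?W\<^esub> z"
      "(x \<otimes>\<^bsub>J n\<^esub> y) \<odot>\<^bsub>?W\<^esub> z = x \<odot>\<^bsub>?W\<^esub> (y \<odot>\<^bsub>?W\<^esub> z)"
      using \<open>x \<in> _\<close> y R.l_distr[of x y z] R.m_assoc[of x y z] by (simp_all add: simps(2,4))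
  next
    fix x y z :: "'k part_vec" assume "x \<in> carrier (J n)" and yz: "y \<in> carrier ?W" "z \<in> carrier ?W"
    then show "x \<odot>\<^bsub>?W\<^esub> (y \<oplus>\<^bsub>?W\<^esub> z) = x \<odot>\<^bsub>?W\<^esub> y \<oplus>\<^bsub>?W\<^esub> x \<odot>\<^bsub>?W\<^esub> z"
      using R.r_distr[of y z x] sub by (simp add: simps(2,4) subset_iff)
  next
    fix x y :: "'k part_vec" assume "x \<in> carrier (J n)" "y \<in> carrier ?W"
    then show "x \<odot>\<^bsub>?W\<^esub> y \<in> carrier ?W"
      using sc by (simp add: simps(4))
  next
    fix y assume "y \<in> carrier ?W"
    then show "\<one>\<^bsub>J n\<^esub> \<odot>\<^bsub>?W\<^esub> y = y" using sub by (auto simp: simps(4))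
  qed simp
  have fW: "?f \<in> carrier ?W"
    unfolding simps using f by (intro image_eqI[of _ _ "\<one>\<^bsub>J n\<^esub>"]) simp_all
  have fam: "vector_family W.V {i} (\<lambda>_. ?f)"
    by (intro vector_family.intro vector_family_axioms.intro W.V.kk_space_axioms) (simp add: fW)
  interpret F: vector_family W.V "{i}" "\<lambda>_. ?f" by (rule fam)
  show ?thesis
  proof (rule W.eigenbasisI)
    show "W.eigenvector A ?f"
      unfolding W.eigenvector_def simps(4) using fW mult_idem[OF _ A] by blast
    show "is_basis W.V {i} (\<lambda>_. ?f)"
    proof (rule F.is_basis_dualI)
      show "carrier W.V \<subseteq> vspan W.V {i} (\<lambda>_. ?f)"
      proof
        fix y assume "y \<in> carrier W.V"
        then obtain x where "x \<in> carrier (J n)" "y = x \<otimes>\<^bsub>J n\<^esub> ?f" by (auto simp: simps(1))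
        then have "y = chi n A x \<odot>\<^bsub>W.V\<^esub> ?f" using mult_idem[OF _ A] by (simp add: simps(4))
        then show "y \<in> vspan W.V {i} (\<lambda>_. ?f)" using F.vspan_smult[OF F.vspan_base[of i]] by simp
      qed
      show "chi n A \<in> mod_hom kk W.V (ring_as_module kk)"
        using sub A by (auto simp: functional_iff simps(2,4) chi_add chi_mult subset_iff)
    qed (use A in simp)
  qed (use A in simp_all)
qed

section \<open>Symmetric functions in noncommuting variables\<close>

text \<open>The value at c of the linear functional with values h on the basis. Coefficients of
  series, characteristics and coefficients of \<open>free_W\<close> all have this form.\<close>

definition dot :: "('i \<Rightarrow> 'k::field_char_0) \<Rightarrow> ('i \<Rightarrow>\<^sub>0 'k) \<Rightarrow> 'k" where
  "dot h c = (\<Sum>i\<in>Poly_Mapping.keys c. Poly_Mapping.lookup c i * h i)"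

lemma dot_superset: "finite L \<Longrightarrow> Poly_Mapping.keys c \<subseteq> L \<Longrightarrow> dot h c = (\<Sum>i\<in>L. Poly_Mapping.lookup c i * h i)"
  unfolding dot_def by (rule sum.mono_neutral_left) (auto simp: in_keys_iff)

lemma dot_add: "dot h (c + d) = dot h c + dot h d"
proof -
  let ?L = "Poly_Mapping.keys c \<union> Poly_Mapping.keys d"
  have L: "finite ?L" by simp
  show ?thesis
    unfolding dot_superset[OF L keys_add] dot_superset[OF L Un_upper1] dot_superset[OF L Un_upper2]
    by (simp add: lookup_add ring_distribs sum.distrib)
qed

lemma dot_zero [simp]: "dot h 0 = 0"
  by (simp add: dot_def)

lemma dot_scale: "dot h (Poly_Mapping.map ((*) r) c) = r * dot h c"
  unfolding dot_superset[OF finite_keys keys_scale] by (simp add: dot_def sum_distrib_left mult.assoc)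

lemma dot_single [simp]: "dot h (Poly_Mapping.single i r) = r * h i"
  by (cases "r = 0") (simp_all add: dot_def)

lemma dot_diff: "dot h (c - d) = dot h c - dot h d"
  using dot_add[of h "c - d" d] by simp

lemma NCSym_simps [simp]:
  "x \<oplus>\<^bsub>NCSym\<^esub> y = (\<lambda>u. x u + y u)" "\<zero>\<^bsub>NCSym\<^esub> = (\<lambda>u. 0)" "c \<odot>\<^bsub>NCSym\<^esub> x = (\<lambda>u. c * x u)"
  "\<one>\<^bsub>NCSym\<^esub> = monomial_fun (0, {})"
  by (simp_all add: NCSym_def)

lemma mult_NCSym: "f \<otimes>\<^bsub>NCSym\<^esub> g = (\<lambda>u. \<Sum>i\<le>length u. f (take i u) * g (drop i u))"
  by (simp add: NCSym_def)

lemma carrier_NCSym: "carrier NCSym = (\<lambda>c u. dot (\<lambda>i. monomial_fun i u) c) ` {c. Poly_Mapping.keys c \<subseteq> graded_partitions}"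
  unfolding NCSym_def dot_def by auto

lemma NCSym_I: "Poly_Mapping.keys c \<subseteq> graded_partitions \<Longrightarrow> (\<lambda>u. dot (\<lambda>i. monomial_fun i u) c) \<in> carrier NCSym"
  unfolding carrier_NCSym by blast

lemma NCSym_add: "\<lbrakk>f \<in> carrier NCSym; g \<in> carrier NCSym\<rbrakk> \<Longrightarrow> (\<lambda>u. f u + g u) \<in> carrier NCSym"
proof -
  assume "f \<in> carrier NCSym" "g \<in> carrier NCSym"
  then obtain c d where cd: "f = (\<lambda>u. dot (\<lambda>i. monomial_fun i u) c)" "g = (\<lambda>u. dot (\<lambda>i. monomial_fun i u) d)"
    and "Poly_Mapping.keys c \<subseteq> graded_partitions" "Poly_Mapping.keys d \<subseteq> graded_partitions"
    unfolding carrier_NCSym by blast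
  then have "Poly_Mapping.keys (c + d) \<subseteq> graded_partitions" using keys_add[of c d] by blast
  from NCSym_I[OF this] show ?thesis by (simp add: cd dot_add)
qed

lemma NCSym_scale: "f \<in> carrier NCSym \<Longrightarrow> (\<lambda>u. r * f u) \<in> carrier NCSym"
proof -
  assume "f \<in> carrier NCSym"
  then obtain c where c: "f = (\<lambda>u. dot (\<lambda>i. monomial_fun i u) c)" and "Poly_Mapping.keys c \<subseteq> graded_partitions"
    unfolding carrier_NCSym by blast
  then have "Poly_Mapping.keys (Poly_Mapping.map ((*) r) c) \<subseteq> graded_partitions" using keys_scale[of r c] by blast
  from NCSym_I[OF this] show ?thesis by (simp add: c dot_scale)
qed

lemma NCSym_zero: "(\<lambda>u. 0) \<in> carrier NCSym"
  using NCSym_I[of 0] by simp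

lemma NCSym_sum: "(\<And>s. s \<in> S \<Longrightarrow> f s \<in> carrier NCSym) \<Longrightarrow> (\<lambda>u. \<Sum>s\<in>S. f s u) \<in> carrier NCSym"
  by (induction S rule: infinite_finite_induct) (simp_all add: NCSym_zero NCSym_add)

lemma monomial_fun_closed: "i \<in> graded_partitions \<Longrightarrow> monomial_fun i \<in> carrier NCSym"
  using NCSym_I[of "Poly_Mapping.single i 1"] by simp

lemma monomial_fun_mult':
  assumes "A \<in> set_partitions n" "B \<in> set_partitions m"
  shows "monomial_fun (n, A) \<otimes>\<^bsub>NCSym\<^esub> monomial_fun (m, B) = (\<lambda>u. \<Sum>C\<in>glued n m A B. monomial_fun (n + m, C) u)"
  unfolding monomial_fun_mult[OF assms] glued_eq[OF assms] ..

lemma NCSym_mult_sum: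
  "(\<lambda>u. \<Sum>i\<in>I. c i * f i u) \<otimes>\<^bsub>NCSym\<^esub> (\<lambda>u. \<Sum>j\<in>K. d j * g j u) =
    (\<lambda>u. \<Sum>i\<in>I. \<Sum>j\<in>K. (c i * d j) * (f i \<otimes>\<^bsub>NCSym\<^esub> g j) u)"
proof
  fix u
  have "((\<lambda>u. \<Sum>i\<in>I. c i * f i u) \<otimes>\<^bsub>NCSym\<^esub> (\<lambda>u. \<Sum>j\<in>K. d j * g j u)) u =
      (\<Sum>l\<le>length u. \<Sum>i\<in>I. \<Sum>j\<in>K. (c i * d j) * (f i (take l u) * g j (drop l u)))"
    by (simp add: mult_NCSym sum_product algebra_simps)
  also have "\<dots> = (\<Sum>i\<in>I. \<Sum>l\<le>length u. \<Sum>j\<in>K. (c i * d j) * (f i (take l u) * g j (drop l u)))"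
    by (rule sum.swap)
  also have "\<dots> = (\<Sum>i\<in>I. \<Sum>j\<in>K. \<Sum>l\<le>length u. (c i * d j) * (f i (take l u) * g j (drop l u)))"
    by (intro sum.cong refl sum.swap)
  also have "\<dots> = (\<Sum>i\<in>I. \<Sum>j\<in>K. (c i * d j) * (f i \<otimes>\<^bsub>NCSym\<^esub> g j) u)"
    by (simp add: mult_NCSym sum_distrib_left)
  finally show "((\<lambda>u. \<Sum>i\<in>I. c i * f i u) \<otimes>\<^bsub>NCSym\<^esub> (\<lambda>u. \<Sum>j\<in>K. d j * g j u)) u =
    (\<Sum>i\<in>I. \<Sum>j\<in>K. (c i * d j) * (f i \<otimes>\<^bsub>NCSym\<^esub> g j) u)" .
qed

lemma NCSym_mult_closed:
  assumes "f \<in> carrier NCSym" "g \<in> carrier NCSym"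
  shows "f \<otimes>\<^bsub>NCSym\<^esub> g \<in> carrier NCSym"
proof -
  obtain c d where cd: "f = (\<lambda>u. dot (\<lambda>i. monomial_fun i u) c)" "g = (\<lambda>u. dot (\<lambda>i. monomial_fun i u) d)"
    and k: "Poly_Mapping.keys c \<subseteq> graded_partitions" "Poly_Mapping.keys d \<subseteq> graded_partitions"
    using assms unfolding carrier_NCSym by blast
  have "monomial_fun i \<otimes>\<^bsub>NCSym\<^esub> monomial_fun j \<in> carrier NCSym"
    if ij: "i \<in> graded_partitions" "j \<in> graded_partitions" for i j
  proof -
    obtain n A m B where "i = (n, A)" "j = (m, B)" "A \<in> set_partitions n" "B \<in> set_partitions m"
      using ij by (auto simp: graded_partitions_def)
    then show ?thesis
      by (auto simp: monomial_fun_mult' glued_def graded_partitions_def intro!: NCSym_sum monomial_fun_closed)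
  qed
  then show ?thesis
    unfolding cd dot_def NCSym_mult_sum using k by (intro NCSym_sum NCSym_scale) blast
qed

lemma NCSym_mult_assoc: "(f \<otimes>\<^bsub>NCSym\<^esub> g) \<otimes>\<^bsub>NCSym\<^esub> h = f \<otimes>\<^bsub>NCSym\<^esub> (g \<otimes>\<^bsub>NCSym\<^esub> h)"
proof
  fix u :: "nat list"
  let ?n = "length u"
  have "((f \<otimes>\<^bsub>NCSym\<^esub> g) \<otimes>\<^bsub>NCSym\<^esub> h) u =
      (\<Sum>j\<le>?n. \<Sum>i\<le>j. f (take i u) * g (drop i (take j u)) * h (drop j u))"
    by (simp add: mult_NCSym sum_distrib_right min_absorb1 min_absorb2)
  also have "\<dots> = (\<Sum>p\<in>(SIGMA j:{..?n}. {..j}). f (take (snd p) u) * g (drop (snd p) (take (fst p) u)) * h (drop (fst p) u))"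
    by (simp add: sum.Sigma case_prod_unfold)
  \<comment> \<open>Both sides cut u into three words. On the left j and i are the positions of the
    two cuts; on the right k = j - i is the length of the middle word.\<close>
  also have "\<dots> = (\<Sum>p\<in>(SIGMA i:{..?n}. {..?n - i}). f (take (fst p) u) * (g (take (snd p) (drop (fst p) u)) * h (drop (snd p) (drop (fst p) u))))"
    by (rule sum.reindex_bij_witness[of _ "\<lambda>p. (fst p + snd p, fst p)" "\<lambda>p. (snd p, fst p - snd p)"])
      (auto simp: drop_take mult.assoc)
  also have "\<dots> = (\<Sum>i\<le>?n. \<Sum>k\<le>?n - i. f (take i u) * (g (take k (drop i u)) * h (drop k (drop i u))))"
    by (simp add: sum.Sigma case_prod_unfold)
  also have "\<dots> = (f \<otimes>\<^bsub>NCSym\<^esub> (g \<otimes>\<^bsub>NCSym\<^esub> h)) u"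
    by (simp add: mult_NCSym sum_distrib_left)
  finally show "((f \<otimes>\<^bsub>NCSym\<^esub> g) \<otimes>\<^bsub>NCSym\<^esub> h) u = (f \<otimes>\<^bsub>NCSym\<^esub> (g \<otimes>\<^bsub>NCSym\<^esub> h)) u" .
qed

lemma monomial_fun_one: "monomial_fun (0, {}) u = of_bool (u = [])"
  by (auto simp: monomial_fun_def)

lemma NCSym_one_mult: "monomial_fun (0, {}) \<otimes>\<^bsub>NCSym\<^esub> f = f" "f \<otimes>\<^bsub>NCSym\<^esub> monomial_fun (0, {}) = f"
proof -
  show "monomial_fun (0, {}) \<otimes>\<^bsub>NCSym\<^esub> f = f"
  proof
    fix u
    have "(monomial_fun (0, {}) \<otimes>\<^bsub>NCSym\<^esub> f) u = (\<Sum>i\<le>length u. if i = 0 then f (drop i u) else 0)"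
      unfolding mult_NCSym monomial_fun_one by (intro sum.cong) auto
    then show "(monomial_fun (0, {}) \<otimes>\<^bsub>NCSym\<^esub> f) u = f u" by simp
  qed
  show "f \<otimes>\<^bsub>NCSym\<^esub> monomial_fun (0, {}) = f"
  proof
    fix u
    have "(f \<otimes>\<^bsub>NCSym\<^esub> monomial_fun (0, {})) u = (\<Sum>i\<le>length u. if i = length u then f (take i u) else 0)"
      unfolding mult_NCSym monomial_fun_one by (intro sum.cong) auto
    then show "(f \<otimes>\<^bsub>NCSym\<^esub> monomial_fun (0, {})) u = f u" by simp
  qed
qed

lemma unit_index: "(0, {}) \<in> graded_partitions"
  by (simp add: graded_partitions_def set_partitions_0)

lemma abelian_group_NCSym: "abelian_group (NCSym :: ('k::field_char_0, 'k nc_series) module)"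
proof (rule abelian_groupI)
  fix f :: "'k nc_series" assume "f \<in> carrier NCSym"
  then show "\<exists>g\<in>carrier NCSym. g \<oplus>\<^bsub>NCSym\<^esub> f = \<zero>\<^bsub>NCSym\<^esub>"
    using NCSym_scale[of f "-1"] by (intro bexI[of _ "\<lambda>u. - f u"]) auto
qed (auto simp: NCSym_add NCSym_zero algebra_simps)

lemma assoc_algebra_NCSym: "assoc_algebra kk (NCSym :: ('k::field_char_0, 'k nc_series) module)"
proof (intro assoc_algebra.intro assoc_algebra_axioms.intro)
  show "module kk (NCSym :: ('k, 'k nc_series) module)"
    by (rule moduleI) (auto simp: abelian_group_NCSym NCSym_scale algebra_simps)
  show "ring (NCSym :: ('k, 'k nc_series) module)"
  proof (rule ringI)
    show "Group.monoid (NCSym :: ('k, 'k nc_series) module)"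
      using monomial_fun_closed[OF unit_index]
      by (intro monoidI) (auto simp: NCSym_mult_closed NCSym_mult_assoc NCSym_one_mult)
  qed (auto simp: abelian_group_NCSym mult_NCSym sum.distrib algebra_simps)
qed (auto simp: mult_NCSym sum_distrib_left algebra_simps)

lemma finsum_NCSym:
  "(\<And>i. i \<in> S \<Longrightarrow> f i \<in> carrier NCSym) \<Longrightarrow> finite S \<Longrightarrow> finsum NCSym f S = (\<lambda>u. \<Sum>i\<in>S. f i u)"
proof (induction S rule: infinite_finite_induct)
  case empty
  interpret abelian_group NCSym by (rule abelian_group_NCSym)
  show ?case by simp
next
  case (insert i S)
  interpret abelian_group NCSym by (rule abelian_group_NCSym)
  show ?case using insert by (subst finsum_insert) auto
qed simp

text \<open>Each position carries the least element of its block as its letter; it is positive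
  because positions start at 1.\<close>

lemma ex_kernel_partition:
  assumes A: "A \<in> set_partitions n"
  obtains u where "length u = n" "0 \<notin> set u" "kernel_partition u = A"
proof -
  define l where "l a = (LEAST b. same_block A a b)" for a
  have lA: "same_block A a (l a)" if "a \<in> {1..n}" for a
    unfolding l_def using same_block_refl[OF A that] by (rule LeastI)
  have eq: "l a = l b \<longleftrightarrow> same_block A a b" if a: "a \<in> {1..n}" and b: "b \<in> {1..n}" for a b
  proof
    assume "l a = l b"
    then show "same_block A a b"
      using lA[OF a] lA[OF b] same_block_sym[OF A] same_block_trans[OF A] by metis
  next
    assume "same_block A a b"
    then have "same_block A a = same_block A b"
      using same_block_sym[OF A] same_block_trans[OF A] by blast
    then show "l a = l b" by (simp add: l_def)
  qed
  let ?u = "map l [1..<Suc n]"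
  have nth: "?u ! (a - 1) = l a" if "a \<in> {1..n}" for a
    using that by (auto simp: nth_append simp del: upt_Suc)
  show thesis
  proof (rule that[of ?u])
    show "0 \<notin> set ?u"
    proof
      assume "0 \<in> set ?u"
      moreover have "set ?u = l ` {1..n}"
        by (simp add: atLeastLessThanSuc_atLeastAtMost del: upt_Suc)
      ultimately obtain a where "a \<in> {1..n}" "l a = 0" by (metis imageE)
      then show False using same_block_in[OF A lA[of a]] by simp
    qed
    show "kernel_partition ?u = A"
    proof (rule partition_eqI[of _ n])
      show "kernel_partition ?u \<in> set_partitions n" using kernel_partition(1)[of ?u] by (simp del: upt_Suc)
      show "same_block (kernel_partition ?u) a b \<longleftrightarrow> same_block A a b" for a b
      proof (cases "a \<in> {1..n} \<and> b \<in> {1..n}")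
        case True
        then show ?thesis unfolding kernel_partition(2) using nth eq by (simp del: upt_Suc)
      next
        case False
        then show ?thesis unfolding kernel_partition(2) using same_block_in[OF A] by (auto simp del: upt_Suc)
      qed
    qed (rule A)
  qed simp
qed

text \<open>A word with kernel A and without the letter 0 has coefficient 1 in the monomial function
  of A and 0 in all others, so evaluation at it isolates one coefficient of c.\<close>

lemma monomial_fun_independent:
  assumes c: "Poly_Mapping.keys c \<subseteq> graded_partitions" and 0: "\<And>u. dot (\<lambda>i. monomial_fun i u) c = (0 :: 'k::field_char_0)"
  shows "c = 0"
proof (rule poly_mapping_eqI)
  fix i :: "nat \<times> nat set set"
  obtain n A where i: "i = (n, A)" by (cases i)
  show "Poly_Mapping.lookup c i = Poly_Mapping.lookup 0 i"
  proof (cases "A \<in> set_partitions n")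
    case True
    then obtain u where u: "length u = n" "0 \<notin> set u" "kernel_partition u = A" by (rule ex_kernel_partition)
    have "monomial_fun j u = (of_bool (j = i) :: 'k)" if "j \<in> Poly_Mapping.keys c" for j
    proof -
      have "j \<in> graded_partitions" using that c by blast
      then obtain m B where j: "j = (m, B)" "B \<in> set_partitions m" by (auto simp: graded_partitions_def)
      then show ?thesis using u by (auto simp: i monomial_fun_eq)
    qed
    then have "dot (\<lambda>i. monomial_fun i u) c = (\<Sum>j\<in>Poly_Mapping.keys c. if j = i then Poly_Mapping.lookup c j else 0)"
      unfolding dot_def by (intro sum.cong) auto
    then show ?thesis using 0[of u] by (auto simp: in_keys_iff split: if_splits)
  next
    case False
    then show ?thesis using c by (auto simp: i in_keys_iff graded_partitions_def)
  qed
qed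

lemma partition_algebra_NCSym: "partition_algebra (NCSym :: ('k::field_char_0, 'k nc_series) module) monomial_fun"
proof (intro partition_algebra.intro partition_algebra_axioms.intro)
  show alg: "assoc_algebra kk (NCSym :: ('k, 'k nc_series) module)" by (rule assoc_algebra_NCSym)
  interpret assoc_algebra kk "NCSym :: ('k, 'k nc_series) module" by (rule alg)
  interpret vector_family "NCSym :: ('k, 'k nc_series) module" graded_partitions monomial_fun
    by unfold_locales (auto simp: monomial_fun_closed)
  have lin: "lincomb NCSym monomial_fun c = (\<lambda>u. dot (\<lambda>i. monomial_fun i u) c)" if "Poly_Mapping.keys c \<subseteq> graded_partitions"
    for c :: "nat \<times> nat set set \<Rightarrow>\<^sub>0 'k"
    unfolding lincomb_def dot_def using that by (subst finsum_NCSym) (auto intro!: NCSym_scale monomial_fun_closed)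
  show "is_basis (NCSym :: ('k, 'k nc_series) module) graded_partitions monomial_fun"
  proof (rule is_basisI)
    show "carrier (NCSym :: ('k, 'k nc_series) module) \<subseteq> vspan NCSym graded_partitions monomial_fun"
      unfolding carrier_NCSym vspan_def using lin by (auto intro!: image_eqI)
    show "c = 0" if "Poly_Mapping.keys c \<subseteq> graded_partitions" "lincomb NCSym monomial_fun c = \<zero>\<^bsub>NCSym :: ('k, 'k nc_series) module\<^esub>" for c :: "nat \<times> nat set set \<Rightarrow>\<^sub>0 'k"
      using that lin[OF that(1)] by (intro monomial_fun_independent) (auto dest: fun_cong)
  qed
  show "monomial_fun (n, A) \<otimes>\<^bsub>NCSym\<^esub> monomial_fun (m, B) =
      (\<Oplus>\<^bsub>NCSym :: ('k, 'k nc_series) module\<^esub>C\<in>glued n m A B. monomial_fun (n + m, C))"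
    if "A \<in> set_partitions n" "B \<in> set_partitions m" for n m A B
    by (subst finsum_NCSym) (auto simp: monomial_fun_mult'[OF that] glued_def graded_partitions_def finite_set_partitions intro!: monomial_fun_closed)
qed simp


section \<open>The Grothendieck group\<close>

abbreviation scale :: "'k::field_char_0 \<Rightarrow> ('i \<Rightarrow>\<^sub>0 'k) \<Rightarrow> 'i \<Rightarrow>\<^sub>0 'k" where
  "scale c \<equiv> Poly_Mapping.map ((*) c)"

interpretation pm: Modules.module "scale :: 'k::field_char_0 \<Rightarrow> ('i \<Rightarrow>\<^sub>0 'k) \<Rightarrow> 'i \<Rightarrow>\<^sub>0 'k"
  by unfold_locales (auto intro!: poly_mapping_eqI simp: lookup_add algebra_simps)

section \<open>The characteristic on formal combinations of modules\<close>

definition ch_free :: "'k::field_char_0 K0_free \<Rightarrow> 'k nc_series" where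
  "ch_free x = (\<lambda>u. dot (\<lambda>p. ch (fst p) (snd p) u) x)"

lemma ch_free_simps: "ch_free (x + y) = (\<lambda>u. ch_free x u + ch_free y u)" "ch_free (x - y) = (\<lambda>u. ch_free x u - ch_free y u)"
  "ch_free (scale c x) = (\<lambda>u. c * ch_free x u)" "ch_free (Poly_Mapping.single (n, P) c) = (\<lambda>u. c * ch n P u)" "ch_free 0 = (\<lambda>u. 0)"
  by (simp_all add: ch_free_def dot_add dot_diff dot_scale)

text \<open>Vanishing on the generating relations is additivity of the characteristic on short exact
  sequences, and both properties pass to the span.\<close>

lemma K0_rel_props:
  assumes "x \<in> K0_rel"
  shows "Poly_Mapping.keys x \<subseteq> K0_gens" "ch_free x = (\<lambda>u. 0)"
proof -
  have "Poly_Mapping.keys x \<subseteq> K0_gens \<and> ch_free x = (\<lambda>u. 0)"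
    using assms unfolding K0_rel_def
  proof (induction rule: pm.span_induct)
    case base
    show ?case
    proof (rule pm.subspaceI)
      fix x y :: "'a K0_free" and c :: 'a
      assume x: "x \<in> {x. Poly_Mapping.keys x \<subseteq> K0_gens \<and> ch_free x = (\<lambda>u. 0)}"
      then show "scale c x \<in> {x. Poly_Mapping.keys x \<subseteq> K0_gens \<and> ch_free x = (\<lambda>u. 0)}"
        using keys_scale[of c x] by (auto simp: ch_free_simps)
      assume "y \<in> {x. Poly_Mapping.keys x \<subseteq> K0_gens \<and> ch_free x = (\<lambda>u. 0)}"
      with x show "x + y \<in> {x. Poly_Mapping.keys x \<subseteq> K0_gens \<and> ch_free x = (\<lambda>u. 0)}"
        using keys_add[of x y] by (auto simp: ch_free_simps)
    qed (simp add: ch_free_simps)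
  next
    case (step y)
    then obtain n P P' P'' where y: "y = Poly_Mapping.single (n, P) 1 - Poly_Mapping.single (n, P') 1 - Poly_Mapping.single (n, P'') 1"
      and g: "(n, P) \<in> K0_gens" "(n, P') \<in> K0_gens" "(n, P'') \<in> K0_gens" and ses: "short_exact (J n) P' P P''"
      by blast
    have "Poly_Mapping.keys y \<subseteq> K0_gens"
      unfolding y using g by (auto simp: in_keys_iff lookup_minus lookup_single when_def split: if_splits)
    moreover have "ch_free y = (\<lambda>u. 0)"
      unfolding y using g ch_short_exact[OF _ _ _ ses] by (auto simp: ch_free_simps K0_gens_def)
    ultimately show ?case by blast
  qed
  then show "Poly_Mapping.keys x \<subseteq> K0_gens" "ch_free x = (\<lambda>u. 0)" by auto
qed

lemma
  shows K0_rel_add: "\<lbrakk>x \<in> K0_rel; y \<in> K0_rel\<rbrakk> \<Longrightarrow> x + y \<in> K0_rel"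
    and K0_rel_scale: "x \<in> K0_rel \<Longrightarrow> scale c x \<in> K0_rel" and K0_rel_neg: "x \<in> K0_rel \<Longrightarrow> - x \<in> K0_rel"
  unfolding K0_rel_def by (auto intro: pm.span_add pm.span_scale pm.span_neg)

lemma K0_rel_sum: "(\<And>s. s \<in> S \<Longrightarrow> f s \<in> K0_rel) \<Longrightarrow> sum f S \<in> K0_rel"
  unfolding K0_rel_def by (rule pm.span_sum)

lemma K0_rel_short_exact:
  "\<lbrakk>(n, P) \<in> K0_gens; (n, P') \<in> K0_gens; (n, P'') \<in> K0_gens; short_exact (J n) P' P P''\<rbrakk> \<Longrightarrow>
    Poly_Mapping.single (n, P) 1 - Poly_Mapping.single (n, P') 1 - Poly_Mapping.single (n, P'') 1 \<in> K0_rel"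
  unfolding K0_rel_def by (rule pm.span_base) blast

section \<open>Generation by the modules W\<close>

abbreviation std_W :: "nat \<Rightarrow> nat set set \<Rightarrow> 'k::field_char_0 std_module" where
  "std_W n A \<equiv> std_copy n (W_module n A :: ('k part_vec, 'k part_vec) module)"

lemma std_W_gens: "A \<in> set_partitions n \<Longrightarrow> (n, std_W n A) \<in> K0_gens"
  using std_copy(1)[OF W_module_eigenbasis] .

lemma ch_std_W:
  assumes "A \<in> set_partitions n"
  shows "ch n (std_W n A :: 'k std_module) = (monomial_fun (n, A) :: 'k::field_char_0 nc_series)"
proof -
  have e: "eigenbasis n (W_module n A :: ('k part_vec, 'k part_vec) module) {()} (\<lambda>_. A) (\<lambda>_. idem n A)"
    by (rule W_module_eigenbasis[OF assms])
  show ?thesis by (simp add: ch_std_copy[OF e] ch_eq[OF e])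
qed

text \<open>The line of the last basis vector is split off as a quotient. The kernel is represented
  by a diagonal module with the remaining labels, which already lives on the type of generators and
  carries an eigenbasis for the induction.\<close>

lemma K0_decompose:
  fixes P :: "'k::field_char_0 std_module"
  assumes "(n, P) \<in> K0_gens" "eigenbasis n P {..<d::nat} a v"
  shows "Poly_Mapping.single (n, P) 1 - (\<Sum>i<d. Poly_Mapping.single (n, std_W n (a i)) 1) \<in> K0_rel"
  using assms
proof (induction d arbitrary: P v)
  case 0
  then have e: "eigenbasis n P {} a v" by simp
  \<comment> \<open>P is zero here, so the sequence with all three terms P is exact; its relation is
    [P] - [P] - [P], the negative of what is claimed.\<close>
  have "short_exact (J n) P P P"
    by (rule eigenbasis_short_exact[of n P "{}" "{}" a v P v P v]) (use e in simp_all)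
  from K0_rel_neg[OF K0_rel_short_exact[OF 0(1) 0(1) 0(1) this]] show ?case by simp
next
  case (Suc d)
  interpret P: eigenbasis n P "{..<Suc d}" a v by (rule Suc.prems)
  have a: "a i \<in> set_partitions n" if "i < Suc d" for i using P.a_in that by blast
  let ?D = "diag_module n d a :: 'k std_module"
  have D: "eigenbasis n ?D {..<d} a (\<lambda>i. \<lambda>j\<in>{..<d}. of_bool (i = j))" using a by (intro diag_module_eigenbasis) simp
  have Dg: "(n, ?D) \<in> K0_gens" using eigenbasis.fd_projective[OF D] by (simp add: K0_gens_def)
  have W: "eigenbasis n (W_module n (a d) :: ('k part_vec, 'k part_vec) module) {d} (\<lambda>_. a d) (\<lambda>_. idem n (a d))"
    using a by (intro W_module_eigenbasis) simp
  obtain u where u: "eigenbasis n (std_W n (a d) :: 'k std_module) {d} (\<lambda>_. a d) u" using std_copy_eigenbasis[OF W] .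
  interpret U: eigenbasis n "std_W n (a d) :: 'k std_module" "{d}" "\<lambda>_. a d" u by (rule u)
  \<comment> \<open>\<open>eigenbasis_short_exact\<close> wants one label function for all three
    bases; on the single index d the constant function agrees with a.\<close>
  have u': "eigenbasis n (std_W n (a d) :: 'k std_module) {d} a u"
    by (intro U.eigenbasisI) (use U.eigen_basis U.eigenvector_v U.a_in in auto)
  have un: "{..<Suc d} = {..<d} \<union> {d}" by auto
  have "short_exact (J n) ?D P (std_W n (a d))"
    by (rule eigenbasis_short_exact[OF _ D u']) (use Suc.prems(2) un in auto)
  note r = K0_rel_short_exact[OF Suc.prems(1) Dg std_W_gens this]
  show ?case using K0_rel_add[OF r Suc.IH[OF Dg D]] a by (simp add: algebra_simps)
qed

definition free_W :: "(nat \<times> nat set set \<Rightarrow>\<^sub>0 'k::field_char_0) \<Rightarrow> 'k K0_free" where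
  "free_W c = (\<Sum>i\<in>Poly_Mapping.keys c. Poly_Mapping.single (fst i, std_W (fst i) (snd i)) (Poly_Mapping.lookup c i))"

text \<open>Written as a \<open>dot\<close>, the coefficient at q is visibly linear in c; the sum
  collects every i whose copy is q.\<close>

lemma lookup_free_W: "Poly_Mapping.lookup (free_W c) q = dot (\<lambda>i. of_bool ((fst i, std_W (fst i) (snd i)) = q)) c"
  unfolding free_W_def dot_def lookup_sum by (intro sum.cong refl) (simp add: lookup_single when_def)

lemma free_W_simps: "free_W (c + d) = free_W c + free_W d" "free_W (scale r c) = scale r (free_W c)"
  "free_W (Poly_Mapping.single (n, A) r) = Poly_Mapping.single (n, std_W n A) r" "free_W 0 = 0"
  by (auto intro!: poly_mapping_eqI simp: lookup_free_W lookup_add dot_add dot_scale lookup_single when_def)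

lemma free_W_sum: "free_W (sum f S) = (\<Sum>s\<in>S. free_W (f s))"
  by (induction S rule: infinite_finite_induct) (simp_all add: free_W_simps)

lemma ch_free_free_W:
  fixes c :: "nat \<times> nat set set \<Rightarrow>\<^sub>0 'k::field_char_0"
  assumes "Poly_Mapping.keys c \<subseteq> graded_partitions"
  shows "ch_free (free_W c) = (\<lambda>u. dot (\<lambda>i. monomial_fun i u) c)"
proof -
  have "ch_free (sum f S) = (\<lambda>u. \<Sum>s\<in>S. ch_free (f s) u)" for f :: "_ \<Rightarrow> 'k K0_free" and S :: "(nat \<times> nat set set) set"
    by (induction S rule: infinite_finite_induct) (simp_all add: ch_free_simps)
  then have "ch_free (free_W c) = (\<lambda>u. \<Sum>i\<in>Poly_Mapping.keys c. Poly_Mapping.lookup c i * ch (fst i) (std_W (fst i) (snd i)) u)"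
    by (simp add: free_W_def ch_free_simps)
  also have "\<dots> = (\<lambda>u. dot (\<lambda>i. monomial_fun i u) c)"
    unfolding dot_def using assms by (intro ext sum.cong) (auto simp: graded_partitions_def ch_std_W)
  finally show ?thesis .
qed

text \<open>By linearity one generator is enough. An eigenbasis of it, renumbered by an initial
  segment, feeds \<open>K0_decompose\<close>.\<close>

lemma ex_free_W:
  fixes x :: "'k::field_char_0 K0_free"
  assumes x: "Poly_Mapping.keys x \<subseteq> K0_gens"
  obtains c where "Poly_Mapping.keys c \<subseteq> graded_partitions" "x - free_W c \<in> K0_rel"
proof -
  have ex: "\<exists>c. Poly_Mapping.keys c \<subseteq> graded_partitions \<and> Poly_Mapping.single p 1 - free_W c \<in> K0_rel"
    if p: "p \<in> K0_gens" for p :: "nat \<times> 'k std_module"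
  proof -
    obtain n P where nP: "p = (n, P)" by (cases p)
    then have "fd_projective n P" using p by (simp add: K0_gens_def)
    then obtain I a where e: "eigenbasis n P I a (\<lambda>v. v)" using fd_projective_eigenbasis by blast
    interpret P: eigenbasis n P I a "\<lambda>v. v" by (rule e)
    obtain h where h: "bij_betw h {..<card I} I"
      using ex_bij_betw_nat_finite[OF P.finite_I] by (auto simp: atLeast0LessThan)
    have a: "a (h i) \<in> set_partitions n" if "i < card I" for i
      using P.a_in[of "h i"] bij_betwE[OF h] that by simp
    let ?a = "\<lambda>i. a (h i)"
    have D: "eigenbasis n (diag_module n (card I) ?a :: 'k std_module) {..<card I} ?a (\<lambda>i. \<lambda>j\<in>{..<card I}. of_bool (i = j))"
      using a by (intro diag_module_eigenbasis)
    \<comment> \<open>Transporting the standard basis of the diagonal module along this isomorphism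
      renumbers the eigenbasis of P.\<close>
    have "mod_iso (J n) (diag_module n (card I) ?a) P" by (rule eigenbasis_mod_iso[OF D e h refl])
    then obtain f where "f \<in> mod_hom (J n) (diag_module n (card I) ?a) P" "bij_betw f (carrier (diag_module n (card I) ?a)) (carrier P)"
      unfolding mod_iso_def by blast
    from eigenbasis_transport[OF D P.J_module_axioms this]
    have "Poly_Mapping.single p 1 - (\<Sum>i<card I. Poly_Mapping.single (n, std_W n (?a i)) 1) \<in> K0_rel"
      using p unfolding nP by (intro K0_decompose)
    moreover have "free_W (\<Sum>i<card I. Poly_Mapping.single (n, ?a i) 1) = (\<Sum>i<card I. Poly_Mapping.single (n, std_W n (?a i)) (1 :: 'k))"
      by (simp add: free_W_sum free_W_simps)
    moreover have "Poly_Mapping.keys (\<Sum>i<card I. Poly_Mapping.single (n, ?a i) (1 :: 'k)) \<subseteq> graded_partitions"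
      using a by (intro keys_sum_subset) (auto simp: graded_partitions_def)
    ultimately show ?thesis by metis
  qed
  define C where "C p = (SOME c. Poly_Mapping.keys c \<subseteq> graded_partitions \<and> Poly_Mapping.single p 1 - free_W c \<in> K0_rel)" for p :: "nat \<times> 'k std_module"
  have C: "Poly_Mapping.keys (C p) \<subseteq> graded_partitions \<and> Poly_Mapping.single p 1 - free_W (C p) \<in> K0_rel" if "p \<in> K0_gens" for p
    using someI_ex[OF ex[OF that]] unfolding C_def .
  let ?c = "\<Sum>p\<in>Poly_Mapping.keys x. scale (Poly_Mapping.lookup x p) (C p)"
  have "x = (\<Sum>p\<in>Poly_Mapping.keys x. scale (Poly_Mapping.lookup x p) (Poly_Mapping.single p 1))"
    by (rule poly_mapping_eqI) (simp add: lookup_sum lookup_single when_def in_keys_iff)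
  moreover have "free_W ?c = (\<Sum>p\<in>Poly_Mapping.keys x. scale (Poly_Mapping.lookup x p) (free_W (C p)))"
    by (simp only: free_W_sum free_W_simps)
  ultimately have "x - free_W ?c = (\<Sum>p\<in>Poly_Mapping.keys x. scale (Poly_Mapping.lookup x p) (Poly_Mapping.single p 1)) -
      (\<Sum>p\<in>Poly_Mapping.keys x. scale (Poly_Mapping.lookup x p) (free_W (C p)))"
    by (rule arg_cong2[of _ _ _ _ "(-)"])
  also have "\<dots> = (\<Sum>p\<in>Poly_Mapping.keys x. scale (Poly_Mapping.lookup x p) (Poly_Mapping.single p 1 - free_W (C p)))"
    by (simp only: pm.scale_right_diff_distrib sum_subtractf)
  also have "\<dots> \<in> K0_rel" using C x by (intro K0_rel_sum K0_rel_scale) blast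
  finally have "x - free_W ?c \<in> K0_rel" .
  moreover have "Poly_Mapping.keys ?c \<subseteq> graded_partitions"
  proof (rule keys_sum_subset)
    fix p assume "p \<in> Poly_Mapping.keys x"
    then have "p \<in> K0_gens" using x by blast
    then show "Poly_Mapping.keys (scale (Poly_Mapping.lookup x p) (C p)) \<subseteq> graded_partitions"
      using C by (intro order_trans[OF keys_scale]) blast
  qed
  ultimately show thesis using that by blast
qed

text \<open>Modulo the relations x is a combination of the modules W, and its characteristic is the
  same combination of independent monomial functions. The relations from exact sequences are thus
  exactly what the characteristic forgets, and cosets become its fibres.\<close>

lemma ch_free_kernel:
  assumes x: "Poly_Mapping.keys x \<subseteq> K0_gens" and 0: "ch_free x = (\<lambda>u. 0)"
  shows "x \<in> K0_rel"
proof -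
  obtain c where c: "Poly_Mapping.keys c \<subseteq> graded_partitions" "x - free_W c \<in> K0_rel" using ex_free_W[OF x] .
  have "dot (\<lambda>i. monomial_fun i u) c = 0" for u
    using K0_rel_props(2)[OF c(2)] 0 ch_free_free_W[OF c(1)] by (simp add: ch_free_simps fun_eq_iff)
  then have "c = 0" by (rule monomial_fun_independent[OF c(1)])
  then show ?thesis using c(2) by (simp add: free_W_simps)
qed

lemma ch_free_in_NCSym:
  assumes "Poly_Mapping.keys x \<subseteq> K0_gens"
  shows "ch_free x \<in> carrier NCSym"
proof -
  obtain c where c: "Poly_Mapping.keys c \<subseteq> graded_partitions" "x - free_W c \<in> K0_rel" using ex_free_W[OF assms] .
  have "ch_free x = ch_free (free_W c)" using K0_rel_props(2)[OF c(2)] by (simp add: ch_free_simps fun_eq_iff)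
  then show ?thesis using NCSym_I[OF c(1)] ch_free_free_W[OF c(1)] by simp
qed

text \<open>The labels of the induced eigenbasis, grouped by pairs of basis vectors, run over the
  index sets of the products of the corresponding monomial functions.\<close>

lemma
  fixes M :: "('k::field_char_0 part_vec, 'a, 'x) module_scheme" and N :: "('k part_vec, 'b, 'y) module_scheme"
  assumes M: "fd_projective n M" and N: "fd_projective m N"
  shows ch_Ind: "ch (n + m) (Ind n m M N) = ch n M \<otimes>\<^bsub>NCSym\<^esub> ch m N"
    and ch_Ind_copy: "ch (n + m) (std_copy (n + m) (Ind n m M N)) = ch n M \<otimes>\<^bsub>NCSym\<^esub> ch m N"
    and Ind_copy_gens: "(n + m, std_copy (n + m) (Ind n m M N)) \<in> K0_gens"
proof -
  obtain I a where e: "eigenbasis n M I a (\<lambda>v. v)" using fd_projective_eigenbasis[OF M] .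
  obtain K b where e': "eigenbasis m N K b (\<lambda>v. v)" using fd_projective_eigenbasis[OF N] .
  interpret induction_eigen n m M N I a "\<lambda>v. v" K b "\<lambda>v. v"
    using e e' by (simp add: induction_eigen_def)
  have mono: "monomial_fun (n, a i) \<otimes>\<^bsub>NCSym\<^esub> monomial_fun (m, b j) = (\<lambda>u. \<Sum>C\<in>glued n m (a i) (b j). monomial_fun (n + m, C) u)"
    if "i \<in> I" "j \<in> K" for i j using that by (intro monomial_fun_mult') simp_all
  show ch: "ch (n + m) (Ind n m M N) = ch n M \<otimes>\<^bsub>NCSym\<^esub> ch m N"
  proof
    fix u
    have "ch (n + m) (Ind n m M N) u = (\<Sum>p\<in>I \<times> K. \<Sum>C\<in>glued n m (a (fst p)) (b (snd p)). monomial_fun (n + m, C) u)"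
      unfolding ch_eq[OF ind_eigenbasis] ind_index_def by (subst sum.Sigma) (auto simp: case_prod_unfold)
    also have "\<dots> = (\<Sum>i\<in>I. \<Sum>j\<in>K. \<Sum>C\<in>glued n m (a i) (b j). monomial_fun (n + m, C) u)"
      by (subst sum.Sigma) (auto simp: case_prod_unfold)
    \<comment> \<open>The coefficient \<open>1 * 1\<close> brings the sum into the shape of
      \<open>NCSym_mult_sum\<close>.\<close>
    also have "\<dots> = (\<Sum>i\<in>I. \<Sum>j\<in>K. (1 * 1) * (monomial_fun (n, a i) \<otimes>\<^bsub>NCSym\<^esub> monomial_fun (m, b j)) u)"
      by (intro sum.cong refl) (simp add: mono)
    also have "\<dots> = (ch n M \<otimes>\<^bsub>NCSym\<^esub> ch m N) u"
      using fun_cong[OF NCSym_mult_sum[where c = "\<lambda>_. 1" and d = "\<lambda>_. 1" and I = I and K = K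
          and f = "\<lambda>i. monomial_fun (n, a i) :: 'k nc_series" and g = "\<lambda>j. monomial_fun (m, b j)"], of u]
      by (simp add: ch_eq[OF e] ch_eq[OF e'])
    finally show "ch (n + m) (Ind n m M N) u = (ch n M \<otimes>\<^bsub>NCSym\<^esub> ch m N) u" .
  qed
  show "ch (n + m) (std_copy (n + m) (Ind n m M N)) = ch n M \<otimes>\<^bsub>NCSym\<^esub> ch m N"
    using ch_std_copy[OF ind_eigenbasis] ch by simp
  show "(n + m, std_copy (n + m) (Ind n m M N)) \<in> K0_gens" by (rule std_copy(1)[OF ind_eigenbasis])
qed

lemma ch_free_sum: "ch_free (sum f S) = (\<lambda>u. \<Sum>s\<in>S. ch_free (f s) u)"
  by (induction S rule: infinite_finite_induct) (simp_all add: ch_free_simps)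

lemma K0_free_mult:
  assumes x: "Poly_Mapping.keys x \<subseteq> K0_gens" and y: "Poly_Mapping.keys y \<subseteq> K0_gens"
  shows K0_free_mult_keys: "Poly_Mapping.keys (K0_free_mult x y) \<subseteq> K0_gens"
    and ch_free_mult: "ch_free (K0_free_mult x y) = ch_free x \<otimes>\<^bsub>NCSym\<^esub> ch_free y"
proof -
  let ?s = "\<lambda>p q. Poly_Mapping.single (fst p + fst q, std_copy (fst p + fst q) (Ind (fst p) (fst q) (snd p) (snd q)))
       (Poly_Mapping.lookup x p * Poly_Mapping.lookup y q)"
  have eq: "K0_free_mult x y = (\<Sum>p\<in>Poly_Mapping.keys x. \<Sum>q\<in>Poly_Mapping.keys y. ?s p q)"
    by (simp add: K0_free_mult_def case_prod_unfold)
  have fd: "fd_projective (fst p) (snd p)" if "p \<in> K0_gens" for p :: "nat \<times> 'a std_module"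
    using that by (auto simp: K0_gens_def)
  show "Poly_Mapping.keys (K0_free_mult x y) \<subseteq> K0_gens"
    unfolding eq using x y fd by (intro keys_sum_subset order_trans[OF keys_single_subset]) (auto intro!: Ind_copy_gens)
  have "ch_free (K0_free_mult x y) = (\<lambda>u. \<Sum>p\<in>Poly_Mapping.keys x. \<Sum>q\<in>Poly_Mapping.keys y.
      (Poly_Mapping.lookup x p * Poly_Mapping.lookup y q) * (ch (fst p) (snd p) \<otimes>\<^bsub>NCSym\<^esub> ch (fst q) (snd q)) u)"
    unfolding eq ch_free_sum ch_free_simps
  proof (intro ext sum.cong refl)
    fix u p q assume "p \<in> Poly_Mapping.keys x" "q \<in> Poly_Mapping.keys y"
    then have "fd_projective (fst p) (snd p)" "fd_projective (fst q) (snd q)" using fd x y by blast+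
    then show "Poly_Mapping.lookup x p * Poly_Mapping.lookup y q * ch (fst p + fst q) (std_copy (fst p + fst q) (Ind (fst p) (fst q) (snd p) (snd q))) u =
        Poly_Mapping.lookup x p * Poly_Mapping.lookup y q * (ch (fst p) (snd p) \<otimes>\<^bsub>NCSym\<^esub> ch (fst q) (snd q)) u"
      by (simp add: ch_Ind_copy)
  qed
  also have "\<dots> = ch_free x \<otimes>\<^bsub>NCSym\<^esub> ch_free y"
    unfolding ch_free_def dot_def NCSym_mult_sum ..
  finally show "ch_free (K0_free_mult x y) = ch_free x \<otimes>\<^bsub>NCSym\<^esub> ch_free y" .
qed

section \<open>Cosets as fibres of the characteristic\<close>

lemma K0_coset:
  assumes x: "Poly_Mapping.keys x \<subseteq> K0_gens"
  shows K0_coset_self: "x \<in> K0_coset x"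
    and K0_coset_mem: "y \<in> K0_coset x \<longleftrightarrow> Poly_Mapping.keys y \<subseteq> K0_gens \<and> ch_free y = ch_free x"
proof -
  show mem: "y \<in> K0_coset x \<longleftrightarrow> Poly_Mapping.keys y \<subseteq> K0_gens \<and> ch_free y = ch_free x" for y
  proof
    assume "y \<in> K0_coset x"
    then obtain r where r: "r \<in> K0_rel" "y = r + x" by (auto simp: K0_coset_def)
    then show "Poly_Mapping.keys y \<subseteq> K0_gens \<and> ch_free y = ch_free x"
      using K0_rel_props[OF r(1)] keys_add[of r x] x by (auto simp: ch_free_simps)
  next
    assume y: "Poly_Mapping.keys y \<subseteq> K0_gens \<and> ch_free y = ch_free x"
    have "Poly_Mapping.keys (y - x) \<subseteq> K0_gens"
    proof -
      have "Poly_Mapping.keys (y - x) \<subseteq> Poly_Mapping.keys y \<union> Poly_Mapping.keys x"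
        by (auto simp: in_keys_iff lookup_minus)
      then show ?thesis using x y by blast
    qed
    then have "y - x \<in> K0_rel" using y by (intro ch_free_kernel) (simp_all add: ch_free_simps)
    then have "(y - x) + x \<in> K0_coset x" unfolding K0_coset_def by (rule imageI)
    then show "y \<in> K0_coset x" by simp
  qed
  show "x \<in> K0_coset x" by (simp add: mem x)
qed

lemma K0_coset_eq_iff:
  assumes "Poly_Mapping.keys x \<subseteq> K0_gens" "Poly_Mapping.keys y \<subseteq> K0_gens"
  shows "K0_coset x = K0_coset y \<longleftrightarrow> ch_free x = ch_free y"
proof
  assume "K0_coset x = K0_coset y"
  then have "x \<in> K0_coset y" using K0_coset_self[OF assms(1)] by simp
  then show "ch_free x = ch_free y" unfolding K0_coset_mem[OF assms(2)] by simp
next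
  assume "ch_free x = ch_free y"
  then show "K0_coset x = K0_coset y"
    unfolding set_eq_iff K0_coset_mem[OF assms(1)] K0_coset_mem[OF assms(2)] by simp
qed

lemma the_elem_image:
  assumes "a \<in> A" "\<And>x. x \<in> A \<Longrightarrow> f x = f a"
  shows "the_elem (f ` A) = f a"
proof -
  have "f ` A = {f a}" using assms by blast
  then show ?thesis by simp
qed

text \<open>Since cosets are fibres, independence of representatives amounts to this: the
  characteristic of the result is determined by those of the arguments.\<close>

lemma K0_ops:
  assumes x: "Poly_Mapping.keys x \<subseteq> K0_gens" and y: "Poly_Mapping.keys y \<subseteq> K0_gens"
  shows K0_mult_coset: "K0_coset x \<otimes>\<^bsub>K0\<^esub> K0_coset y = K0_coset (K0_free_mult x y)"
    and K0_add_coset: "K0_coset x \<oplus>\<^bsub>K0\<^esub> K0_coset y = K0_coset (x + y)"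
    and K0_smult_coset: "c \<odot>\<^bsub>K0\<^esub> K0_coset x = K0_coset (scale c x)"
proof -
  have k: "Poly_Mapping.keys (x + y) \<subseteq> K0_gens" if "Poly_Mapping.keys x \<subseteq> K0_gens" "Poly_Mapping.keys y \<subseteq> K0_gens" for x y :: "'a K0_free"
    using keys_add[of x y] that by blast
  have s: "Poly_Mapping.keys (scale c x) \<subseteq> K0_gens" if "Poly_Mapping.keys x \<subseteq> K0_gens" for x :: "'a K0_free"
    using keys_scale[of c x] that by blast
  have mem: "Poly_Mapping.keys x' \<subseteq> K0_gens \<and> ch_free x' = ch_free x" if "x' \<in> K0_coset x" "Poly_Mapping.keys x \<subseteq> K0_gens" for x x' :: "'a K0_free"
    using K0_coset_mem[OF that(2)] that(1) by blast
  \<comment> \<open>Treats sum and product at once; h is evaluated on combinations of generators,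
    where membership in a coset is decided by the characteristic.\<close>
  have pair: "the_elem ((\<lambda>(x, y). K0_coset (h x y)) ` (K0_coset x \<times> K0_coset y)) = K0_coset (h x y)"
    if h: "\<And>x y. Poly_Mapping.keys x \<subseteq> K0_gens \<Longrightarrow> Poly_Mapping.keys y \<subseteq> K0_gens \<Longrightarrow> Poly_Mapping.keys (h x y) \<subseteq> K0_gens"
      and Ph: "\<And>x' y'. \<lbrakk>Poly_Mapping.keys x' \<subseteq> K0_gens; Poly_Mapping.keys y' \<subseteq> K0_gens; ch_free x' = ch_free x; ch_free y' = ch_free y\<rbrakk> \<Longrightarrow> ch_free (h x' y') = ch_free (h x y)"
    for h :: "'a K0_free \<Rightarrow> 'a K0_free \<Rightarrow> 'a K0_free"
  proof -
    have "the_elem ((\<lambda>(x, y). K0_coset (h x y)) ` (K0_coset x \<times> K0_coset y)) = (\<lambda>(x, y). K0_coset (h x y)) (x, y)"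
    proof (rule the_elem_image)
      show "(x, y) \<in> K0_coset x \<times> K0_coset y" using K0_coset_self x y by blast
      fix z assume "z \<in> K0_coset x \<times> K0_coset y"
      then obtain x' y' where z: "z = (x', y')" and x': "x' \<in> K0_coset x" and y': "y' \<in> K0_coset y" by blast
      have "K0_coset (h x' y') = K0_coset (h x y)"
      proof (subst K0_coset_eq_iff)
        show "Poly_Mapping.keys (h x' y') \<subseteq> K0_gens" using h mem[OF x' x] mem[OF y' y] by simp
        show "Poly_Mapping.keys (h x y) \<subseteq> K0_gens" using h x y by simp
        show "ch_free (h x' y') = ch_free (h x y)" using Ph mem[OF x' x] mem[OF y' y] by simp
      qed
      then show "(\<lambda>(x, y). K0_coset (h x y)) z = (\<lambda>(x, y). K0_coset (h x y)) (x, y)" by (simp add: z)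
    qed
    then show ?thesis by simp
  qed
  show "K0_coset x \<otimes>\<^bsub>K0\<^esub> K0_coset y = K0_coset (K0_free_mult x y)"
    using pair[of K0_free_mult] x y by (simp add: K0_def K0_free_mult_keys ch_free_mult)
  show "K0_coset x \<oplus>\<^bsub>K0\<^esub> K0_coset y = K0_coset (x + y)"
    using pair[of "(+)"] k by (simp add: K0_def ch_free_simps)
  have "the_elem ((\<lambda>x. K0_coset (scale c x)) ` K0_coset x) = K0_coset (scale c x)"
  proof (rule the_elem_image[OF K0_coset_self[OF x]])
    fix x' assume "x' \<in> K0_coset x"
    from mem[OF this x] show "K0_coset (scale c x') = K0_coset (scale c x)"
      using x s by (simp add: K0_coset_eq_iff ch_free_simps)
  qed
  then show "c \<odot>\<^bsub>K0\<^esub> K0_coset x = K0_coset (scale c x)"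
    by (simp add: K0_def)
qed

section \<open>Transport of structure from symmetric functions\<close>

definition ch_K0 :: "'k::field_char_0 K0_free set \<Rightarrow> 'k nc_series" where
  "ch_K0 U = the_elem (ch_free ` U)"

lemma ch_K0_coset:
  assumes "Poly_Mapping.keys x \<subseteq> K0_gens"
  shows "ch_K0 (K0_coset x) = ch_free x"
  unfolding ch_K0_def using assms K0_coset_mem[OF assms] by (intro the_elem_image) simp_all

lemma carrier_K0: "carrier K0 = K0_coset ` {x. Poly_Mapping.keys x \<subseteq> K0_gens}"
  and zero_K0: "\<zero>\<^bsub>K0\<^esub> = K0_coset 0" and one_K0: "\<one>\<^bsub>K0\<^esub> = K0_W (0, {})"
  by (simp_all add: K0_def K0_W_def)

lemma K0_class_ch_K0:
  assumes "eigenbasis n M I a v"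
  shows "K0_class n M \<in> carrier K0" "ch_K0 (K0_class n M) = ch n M"
proof -
  have k: "Poly_Mapping.keys (Poly_Mapping.single (n, std_copy n M) 1) \<subseteq> K0_gens"
    using std_copy(1)[OF assms] by simp
  show "K0_class n M \<in> carrier K0" unfolding K0_class_def carrier_K0 using k by blast
  show "ch_K0 (K0_class n M) = ch n M"
    unfolding K0_class_def ch_K0_coset[OF k] by (simp add: ch_free_simps ch_std_copy[OF assms])
qed

lemma K0_W_ch_K0:
  assumes "A \<in> set_partitions n"
  shows "K0_W (n, A) \<in> carrier (K0 :: ('k::field_char_0, 'k K0_free set) module)"
    and "ch_K0 (K0_W (n, A)) = (monomial_fun (n, A) :: 'k nc_series)"
proof -
  have e: "eigenbasis n (W_module n A :: ('k part_vec, 'k part_vec) module) {()} (\<lambda>_. A) (\<lambda>_. idem n A)"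
    by (rule W_module_eigenbasis[OF assms])
  show "K0_W (n, A) \<in> carrier (K0 :: ('k, 'k K0_free set) module)" "ch_K0 (K0_W (n, A)) = (monomial_fun (n, A) :: 'k nc_series)"
    using K0_class_ch_K0[OF e] by (simp_all add: K0_W_def ch_eq[OF e])
qed

lemma ch_K0_hom:
  fixes U V :: "'k::field_char_0 K0_free set"
  assumes U: "U \<in> carrier K0" and V: "V \<in> carrier K0"
  shows "U \<oplus>\<^bsub>K0\<^esub> V \<in> carrier K0" "ch_K0 (U \<oplus>\<^bsub>K0\<^esub> V) = ch_K0 U \<oplus>\<^bsub>NCSym\<^esub> ch_K0 V"
    and "U \<otimes>\<^bsub>K0\<^esub> V \<in> carrier K0" "ch_K0 (U \<otimes>\<^bsub>K0\<^esub> V) = ch_K0 U \<otimes>\<^bsub>NCSym\<^esub> ch_K0 V"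
    and "c \<odot>\<^bsub>K0\<^esub> U \<in> carrier K0" "ch_K0 (c \<odot>\<^bsub>K0\<^esub> U) = c \<odot>\<^bsub>NCSym\<^esub> ch_K0 U"
proof -
  obtain x y where xy: "U = K0_coset x" "V = K0_coset y" and x: "Poly_Mapping.keys x \<subseteq> K0_gens" and y: "Poly_Mapping.keys y \<subseteq> K0_gens"
    using U V unfolding carrier_K0 by blast
  have k: "Poly_Mapping.keys (x + y) \<subseteq> K0_gens" using keys_add[of x y] x y by blast
  have s: "Poly_Mapping.keys (scale c x) \<subseteq> K0_gens" using keys_scale[of c x] x by blast
  note m = K0_free_mult_keys[OF x y]
  show "U \<oplus>\<^bsub>K0\<^esub> V \<in> carrier K0" "U \<otimes>\<^bsub>K0\<^esub> V \<in> carrier K0" "c \<odot>\<^bsub>K0\<^esub> U \<in> carrier K0"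
    unfolding xy K0_ops[OF x y] carrier_K0 using k s m by blast+
  show "ch_K0 (U \<oplus>\<^bsub>K0\<^esub> V) = ch_K0 U \<oplus>\<^bsub>NCSym\<^esub> ch_K0 V" "ch_K0 (U \<otimes>\<^bsub>K0\<^esub> V) = ch_K0 U \<otimes>\<^bsub>NCSym\<^esub> ch_K0 V"
    "ch_K0 (c \<odot>\<^bsub>K0\<^esub> U) = c \<odot>\<^bsub>NCSym\<^esub> ch_K0 U"
    unfolding xy K0_ops[OF x y] by (simp_all add: ch_K0_coset k s m x y ch_free_simps ch_free_mult)
qed

lemma ch_K0_zero: "\<zero>\<^bsub>K0\<^esub> \<in> carrier K0" "ch_K0 \<zero>\<^bsub>K0\<^esub> = \<zero>\<^bsub>NCSym\<^esub>"
  by (simp_all add: zero_K0 carrier_K0 ch_K0_coset ch_free_simps)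

lemma ch_K0_one: "\<one>\<^bsub>K0\<^esub> \<in> carrier K0" "ch_K0 \<one>\<^bsub>K0\<^esub> = \<one>\<^bsub>NCSym\<^esub>"
  using K0_W_ch_K0[of "{}" 0] by (simp_all add: one_K0 set_partitions_0)

lemma ch_K0_bij: "bij_betw ch_K0 (carrier K0) (carrier (NCSym :: ('k::field_char_0, 'k nc_series) module))"
  unfolding bij_betw_def
proof
  show "inj_on ch_K0 (carrier K0 :: 'k K0_free set set)"
    unfolding carrier_K0 by (auto simp: inj_on_def ch_K0_coset K0_coset_eq_iff)
  show "ch_K0 ` carrier K0 = carrier (NCSym :: ('k, 'k nc_series) module)"
  proof
    show "ch_K0 ` carrier K0 \<subseteq> carrier (NCSym :: ('k, 'k nc_series) module)"
      unfolding carrier_K0 by (auto simp: ch_K0_coset ch_free_in_NCSym)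
    show "carrier (NCSym :: ('k, 'k nc_series) module) \<subseteq> ch_K0 ` carrier K0"
    proof
      fix f :: "'k nc_series" assume "f \<in> carrier NCSym"
      then obtain c where c: "Poly_Mapping.keys c \<subseteq> graded_partitions" and f: "f = (\<lambda>u. dot (\<lambda>i. monomial_fun i u) c)"
        unfolding carrier_NCSym by blast
      have k: "Poly_Mapping.keys (free_W c) \<subseteq> K0_gens"
        unfolding free_W_def using c
        by (intro keys_sum_subset order_trans[OF keys_single_subset]) (auto simp: graded_partitions_def intro!: std_W_gens)
      have "f = ch_K0 (K0_coset (free_W c))" by (simp add: ch_K0_coset[OF k] ch_free_free_W[OF c] f)
      moreover have "K0_coset (free_W c) \<in> carrier K0" unfolding carrier_K0 using k by blast
      ultimately show "f \<in> ch_K0 ` carrier K0" by (rule image_eqI)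
    qed
  qed
qed

text \<open>\<open>ch_K0\<close> is injective and respects all operations, so each equation in
  \<open>K0\<close> follows from the same equation in \<open>NCSym\<close>. Negatives are existence
  statements and come from surjectivity; coefficients in the basis W are those of the characteristic
  in the monomial functions.\<close>

lemma partition_algebra_K0: "partition_algebra (K0 :: ('k::field_char_0, 'k K0_free set) module) K0_W"
proof -
  let ?K = "K0 :: ('k, 'k K0_free set) module" and ?N = "NCSym :: ('k, 'k nc_series) module"
  interpret N: partition_algebra ?N monomial_fun by (rule partition_algebra_NCSym)
  note cl = ch_K0_hom(1,3,5) ch_K0_zero(1) ch_K0_one(1)
  note ev = ch_K0_hom(2,4,6) ch_K0_zero(2) ch_K0_one(2)
  have bij: "bij_betw ch_K0 (carrier ?K) (carrier ?N)" by (rule ch_K0_bij)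
  have inj: "U = V" if "U \<in> carrier ?K" "V \<in> carrier ?K" "ch_K0 U = ch_K0 V" for U V
    using bij that by (auto simp: bij_betw_def inj_on_def)
  have chc: "ch_K0 U \<in> carrier ?N" if "U \<in> carrier ?K" for U
    using bij that by (auto simp: bij_betw_def)
  have ex: "\<exists>U\<in>carrier ?K. ch_K0 U = f" if "f \<in> carrier ?N" for f
  proof -
    have "f \<in> ch_K0 ` carrier ?K" unfolding bij_betw_imp_surj_on[OF bij] by (rule that)
    then obtain U where "U \<in> carrier ?K" "f = ch_K0 U" by (rule imageE)
    then show ?thesis by (intro bexI[of _ U]) simp_all
  qed
  have ab: "abelian_group ?K"
  proof (rule abelian_groupI)
    fix U assume U: "U \<in> carrier ?K"
    obtain V where V: "V \<in> carrier ?K" "ch_K0 V = \<ominus>\<^bsub>?N\<^esub> ch_K0 U" using ex[of "\<ominus>\<^bsub>?N\<^esub> ch_K0 U"] chc[OF U] by auto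
    have "ch_K0 (V \<oplus>\<^bsub>?K\<^esub> U) = ch_K0 \<zero>\<^bsub>?K\<^esub>"
      using U V chc[OF U] N.M.l_neg[of "ch_K0 U"] by (simp only: ev)
    then show "\<exists>V\<in>carrier ?K. V \<oplus>\<^bsub>?K\<^esub> U = \<zero>\<^bsub>?K\<^esub>"
      using U V by (intro bexI[of _ V] inj) (simp_all only: cl)
  qed (simp_all add: cl, (rule inj; simp add: cl ev algebra_simps)+)
  have mod: "module kk ?K"
    by (rule moduleI, simp_all add: ab cl, (rule inj; simp add: cl ev algebra_simps)+)
  have rng: "ring ?K"
  proof (rule ringI[OF ab])
    show "Group.monoid ?K"
      by (rule monoidI, simp_all add: cl, (rule inj; simp add: cl ev NCSym_mult_assoc NCSym_one_mult)+)
  qed (rule inj; simp add: cl ev mult_NCSym sum.distrib algebra_simps)+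
  have alg: "assoc_algebra kk ?K"
    by (intro assoc_algebra.intro assoc_algebra_axioms.intro mod rng)
      (rule inj; simp add: cl ev mult_NCSym sum_distrib_left algebra_simps)+
  interpret K: assoc_algebra kk ?K by (rule alg)
  have hom: "ch_K0 \<in> mod_hom kk ?K ?N"
    by (rule mod_homI[OF add_homI]) (simp_all add: chc ev del: NCSym_simps)
  have std_W: "K0_W i \<in> carrier ?K" "ch_K0 (K0_W i :: 'k K0_free set) = monomial_fun i" if "i \<in> graded_partitions" for i
    using that K0_W_ch_K0 by (auto simp: graded_partitions_def)
  have fam: "vector_family ?K graded_partitions K0_W"
    using mod by (auto simp: vector_family_def vector_family_axioms_def kk_space_def std_W)
  interpret K: vector_family ?K graded_partitions K0_W by (rule fam)
  have lin: "ch_K0 (lincomb ?K K0_W c) = lincomb ?N monomial_fun c" if c: "Poly_Mapping.keys c \<subseteq> graded_partitions" for c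
  proof -
    have "lincomb ?N (\<lambda>i. ch_K0 (K0_W i)) c = lincomb ?N monomial_fun c"
      unfolding lincomb_def using c by (intro N.M.finsum_cong') (auto simp: std_W subset_iff simp del: NCSym_simps)
    then show ?thesis using K.lincomb_hom[OF N.module_axioms hom c] by simp
  qed
  have basis: "is_basis ?K graded_partitions K0_W"
  proof (rule K.is_basisI)
    show "carrier ?K \<subseteq> vspan ?K graded_partitions K0_W"
    proof
      fix U assume U: "U \<in> carrier ?K"
      let ?c = "N.coord (ch_K0 U)"
      note k = N.keys_coord[OF chc[OF U]]
      have "U = lincomb ?K K0_W ?c"
        using U k N.lincomb_coord[OF chc[OF U]] by (intro inj) (simp_all add: lin)
      then show "U \<in> vspan ?K graded_partitions K0_W" unfolding vspan_def using k by blast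
    qed
    fix c assume c: "Poly_Mapping.keys c \<subseteq> graded_partitions" "lincomb ?K K0_W c = \<zero>\<^bsub>?K\<^esub>"
    have "lincomb ?N monomial_fun c = lincomb ?N monomial_fun 0"
    proof -
      have "lincomb ?N monomial_fun c = ch_K0 \<zero>\<^bsub>?K\<^esub>" using lin[OF c(1)] c(2) by simp
      also have "\<dots> = \<zero>\<^bsub>?N\<^esub>" by (rule ev(4))
      finally show ?thesis by simp
    qed
    then show "c = 0" using N.coord_lincomb[OF c(1)] N.coord_lincomb[of 0] by simp
  qed
  show ?thesis
  proof (intro partition_algebra.intro partition_algebra_axioms.intro alg basis)
    show "\<one>\<^bsub>?K\<^esub> = K0_W (0, {})" by (rule one_K0)
    fix n m A B assume A: "A \<in> set_partitions n" and B: "B \<in> set_partitions m"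
    have W: "K0_W (n + m, C) \<in> carrier ?K" if "C \<in> glued n m A B" for C
      using that by (intro std_W) (simp add: glued_def graded_partitions_def)
    have "ch_K0 (\<Oplus>\<^bsub>?K\<^esub>C\<in>glued n m A B. K0_W (n + m, C)) = (\<Oplus>\<^bsub>?N\<^esub>C\<in>glued n m A B. ch_K0 (K0_W (n + m, C)))"
      using W by (intro add_hom_finsum[OF mod_hom_add_hom[OF hom] ab abelian_group_NCSym])
    also have "\<dots> = (\<Oplus>\<^bsub>?N\<^esub>C\<in>glued n m A B. monomial_fun (n + m, C))"
      by (intro N.M.finsum_cong') (auto simp: K0_W_ch_K0 glued_def simp del: NCSym_simps)
    also have "\<dots> = ch_K0 (K0_W (n, A) \<otimes>\<^bsub>?K\<^esub> K0_W (m, B))"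
      using A B by (simp add: ev K0_W_ch_K0 N.mult_base)
    finally show "K0_W (n, A) \<otimes>\<^bsub>?K\<^esub> K0_W (m, B) = (\<Oplus>\<^bsub>?K\<^esub>C\<in>glued n m A B. K0_W (n + m, C))"
      using A B W by (intro inj) (auto simp: cl K0_W_ch_K0 intro!: K.M.finsum_closed)
  qed
qed

text \<open>The two basis statements give meaning to \<open>linear_extension\<close>, and with it to
  both coproducts and \<open>F_map\<close>. The statement on \<open>Ind\<close> identifies the
  product, which \<open>K0\<close> evaluates through chosen copies, with the class of the induced
  module. The counits are quantified because they are determined by the coproducts.\<close>

theorem theorem3p5:
  shows "is_basis (K0 :: ('k::field_char_0, 'k K0_free set) module) graded_partitions K0_W \<and>
    is_basis (NCSym :: ('k, 'k nc_series) module) graded_partitions monomial_fun \<and>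
    (\<forall>n m. \<forall>(M :: 'k std_module) (N :: 'k std_module). fd_projective n M \<longrightarrow> fd_projective m N \<longrightarrow>
       K0_class n M \<otimes>\<^bsub>K0\<^esub> K0_class m N = K0_class (n + m) (Ind n m M N)) \<and>
    (\<exists>\<epsilon> \<epsilon>'. bialgebra kk (K0 :: ('k, 'k K0_free set) module) (internal_coproduct K0 K0_W) \<epsilon> \<and>
       bialgebra_iso kk
         (K0 :: ('k, 'k K0_free set) module) (internal_coproduct K0 K0_W) \<epsilon>
         (NCSym :: ('k, 'k nc_series) module) (internal_coproduct NCSym monomial_fun) \<epsilon>' F_map)"
proof (intro conjI allI impI exI)
  show "is_basis (K0 :: ('k, 'k K0_free set) module) graded_partitions K0_W"
    by (rule partition_algebra.is_basis[OF partition_algebra_K0])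
  show "is_basis (NCSym :: ('k, 'k nc_series) module) graded_partitions monomial_fun"
    by (rule partition_algebra.is_basis[OF partition_algebra_NCSym])
  show "bialgebra kk (K0 :: ('k, 'k K0_free set) module) (internal_coproduct K0 K0_W) (partition_algebra.counit K0 K0_W)"
    by (rule partition_algebra.bialgebra[OF partition_algebra_K0])
  show "bialgebra_iso kk
      (K0 :: ('k, 'k K0_free set) module) (internal_coproduct K0 K0_W) (partition_algebra.counit K0 K0_W)
      (NCSym :: ('k, 'k nc_series) module) (internal_coproduct NCSym monomial_fun) (partition_algebra.counit NCSym monomial_fun) F_map"
    unfolding F_map_def by (rule partition_algebra_iso[OF partition_algebra_K0 partition_algebra_NCSym])
  fix n m and M N :: "'k std_module"
  assume M: "fd_projective n M" and N: "fd_projective m N"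
  obtain I a where e: "eigenbasis n M I a (\<lambda>v. v)" using fd_projective_eigenbasis[OF M] .
  obtain K b where e': "eigenbasis m N K b (\<lambda>v. v)" using fd_projective_eigenbasis[OF N] .
  interpret induction_eigen n m M N I a "\<lambda>v. v" K b "\<lambda>v. v"
    using e e' by (simp add: induction_eigen_def)
  \<comment> \<open>The product of classes is induced from the chosen copies of M and N, the
    right-hand side from M and N themselves. Both have the same characteristic, and this decides
    equality in \<open>K0\<close>.\<close>
  note c = K0_class_ch_K0[OF e] K0_class_ch_K0[OF e'] K0_class_ch_K0[OF ind_eigenbasis]
  have "ch_K0 (K0_class n M \<otimes>\<^bsub>K0\<^esub> K0_class m N) = ch_K0 (K0_class (n + m) (Ind n m M N))"
    using ch_K0_hom(4)[OF c(1,3)] by (simp add: c ch_Ind[OF M N])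
  then show "K0_class n M \<otimes>\<^bsub>K0\<^esub> K0_class m N = K0_class (n + m) (Ind n m M N)"
    using ch_K0_bij ch_K0_hom(3)[OF c(1,3)] c(5) unfolding bij_betw_def inj_on_def by blast
qed

end
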